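(* Let $T>0$ and let $\Omega\subset\mathbb{R}^d$ be open and bounded with $C^2$ boundary. Let $f\in W^{1,\infty}_{\mathrm{loc}}(\mathbb{R};\mathbb{R}^d)$; let $b\in W^{1,\infty}_{\mathrm{loc}}(\mathbb{R};\mathbb{R})$ be non-decreasing with weak derivative $b'\in BV_{\mathrm{loc}}(\mathbb{R})$; let $u^c\in (C^2\cap L^\infty)(Q^c)$ have an extension $\overline{u}^c\in (C^2\cap L^\infty)([0,T]\times\mathbb{R}^d)$; let $u_0\in L^\infty(\Omega)$; and let $\alpha\in(0,2)$. For $n\in\mathbb{N}$ let $u_n$ be the entropy solution of $$\begin{cases}\partial_t u_n+\mathrm{div}\big(f(u_n)\big)=-\frac1n(-\Delta)^{\frac{\alpha}{2}}[b(u_n)] & \text{in } Q,\\ u_n=u^c & \text{in } Q^c,\\ u_n(0,\cdot)=u_0 & \text{on }\Omega,\end{cases}$$ and let $u$ be the entropy solution of the scalar conservation law $$\begin{cases}\partial_t u+\mathrm{div}\big(f(u)\big)=0 & \text{in } Q,\\ u=u^c & \text{on } \Gamma,\\ u(0,\cdot)=u_0 & \text{on }\Omega.\end{cases}$$ Then $u_n\to u$ in $L^p(Q)$ as $n\to\infty$ for all $p\in[1,\infty)$.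
   Context: Sets: $\Omega^c=\mathbb{R}^d\setminus\Omega$, $Q=(0,T)\times\Omega$, $Q^c=(0,T)\times\Omega^c$, $\Gamma=(0,T)\times\partial\Omega$, $M=(0,T)\times\mathbb{R}^d$; $\mathrm{d}\sigma$ is the $(d-1)$-dimensional Hausdorff measure on $\partial\Omega$. Write $(a)^+=\max\{a,0\}$, $(a)^-=(-a)^+$; $\mathrm{sgn}^\pm(a)=\pm1$ if $\pm a>0$ and $0$ otherwise. For $u,k\in\mathbb{R}$ let $F^\pm(u,k)=\mathrm{sgn}^\pm(u-k)(f(u)-f(k))$. The operator $-(-\Delta)^{\alpha/2}$ is given by $\phi\mapsto\lim_{\epsilon\to0}\int_{|z|>\epsilon}(\phi(x+z)-\phi(x))\,\mathrm{d}\mu_\alpha(z)$ with $\mathrm{d}\mu_\alpha(z)=c_{d,\alpha}|z|^{-(d+\alpha)}\mathrm{d}z$, where $c_{d,\alpha}>0$ is the usual normalization constant. Entropy solution of a problem with nonlocal operator $\mathcal{L}[\phi](x)=\lim_{\epsilon\to0}\int_{|z|>\epsilon}(\phi(x+z)-\phi(x))\,\mathrm{d}\mu(z)$ (here $\mu=\frac1n\mu_\alpha$): for $r>0$, let $\mathcal{L}^{\ge r}$ and $\mathcal{L}^{<r}$ be defined with the integration restricted to $\{|z|\ge r\}$ and $\{|z|<r\}$; they act in the $x$-variable, and $\mathcal{L}^{\ge r}$ extends to a bounded operator on $L^\infty(\mathbb{R}^d)$. A function $u\in L^\infty(M)$ is an entropy solution of $\partial_tu+\mathrm{div}(f(u))=\mathcal{L}[b(u)]$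 in $Q$, $u=u^c$ in $Q^c$, $u(0,\cdot)=u_0$ on $\Omega$, if (a) for both choices of sign $\pm$, for all $r>0$, and for all $k\in\mathbb{R}$ and $0\le\varphi\in C_c^\infty([0,T)\times\mathbb{R}^d)$ satisfying $(b(u^c)-b(k))^\pm\varphi=0$ in $Q^c$, $$-\int_Q\Big((u-k)^\pm\partial_t\varphi+F^\pm(u,k)\cdot\nabla\varphi\Big)\mathrm{d}x\,\mathrm{d}t-\int_Q\mathcal{L}^{\ge r}[b(u)]\,\mathrm{sgn}^\pm(u-k)\varphi\,\mathrm{d}x\,\mathrm{d}t-\int_M(b(u)-b(k))^\pm\mathcal{L}^{<r}[\varphi]\,\mathrm{d}x\,\mathrm{d}t$$ $$\le\int_\Omega(u_0-k)^\pm\varphi(0,\cdot)\,\mathrm{d}x+L_f\int_\Gamma(\overline{u}^c-k)^\pm\varphi\,\mathrm{d}\sigma(x)\,\mathrm{d}t,$$ and (b) $u=u^c$ a.e. in $Q^c$. Entropy solution of the scalar conservation law: $u\in L^\infty(Q)$ such that for both signs, all $k\in\mathbb{R}$ and all $0\le\varphi\in C_c^\infty([0,T)\times\mathbb{R}^d)$, $$-\int_Q\Big((u-k)^\pm\partial_t\varphi+F^\pm(u,k)\cdot\nabla\varphi\Big)\mathrm{d}x\,\mathrm{d}t\le\int_\Omega(u_0-k)^\pm\varphi(0,\cdot)\,\mathrm{d}x+L_f\int_\Gamma(\overline{u}^c-k)^\pm\varphi\,\mathrm{d}\sigma(x)\,\mathrm{d}t.$$ In both definitions $L_f$ is the Lipschitz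 constant of $f$ on the smallest compact interval containing $k$ and the essential ranges of $u$, $u_0$, $u^c$. Entropy solutions of both problems are unique. *)

theory Defs
  imports "HOL-Analysis.Analysis"
begin

section \<open>Function spaces\<close>

text \<open>
  Derivatives are taken within \<open>S\<close>, so that on \<open>{0..T} \<times> UNIV\<close> or \<open>{0..<T} \<times> UNIV\<close> they are
  one-sided in time at the end points; on an open \<open>S\<close> this is the usual class \<open>C\<^sup>k(S)\<close>.
\<close>

primrec Ck_on :: "nat \<Rightarrow> 'a::real_normed_vector set \<Rightarrow> ('a \<Rightarrow> 'b::real_normed_vector) \<Rightarrow> bool" where
  "Ck_on 0 S g \<longleftrightarrow> continuous_on S g"
| "Ck_on (Suc k) S g \<longleftrightarrow>
     (\<exists>g'. (\<forall>x\<in>S. (g has_derivative g' x) (at x within S)) \<and> (\<forall>v. Ck_on k S (\<lambda>x. g' x v)))"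

text \<open>
  \<open>C\<^sub>c\<^sup>\<infinity>(S)\<close>; the support is a compact subset of \<open>S\<close> itself. In particular, on
  \<open>{0..<T} \<times> UNIV\<close> the test functions vanish near \<open>t = T\<close> but not necessarily at \<open>t = 0\<close>.
  The values outside \<open>S\<close> are irrelevant.
\<close>

definition Cc_infty :: "'a::real_normed_vector set \<Rightarrow> ('a \<Rightarrow> real) \<Rightarrow> bool" where
  "Cc_infty S \<phi> \<longleftrightarrow> (\<forall>k. Ck_on k S \<phi>) \<and> (\<exists>K. compact K \<and> K \<subseteq> S \<and> (\<forall>x\<in>S - K. \<phi> x = 0))"

definition Linf_on :: "'a::euclidean_space set \<Rightarrow> ('a \<Rightarrow> 'b::euclidean_space) \<Rightarrow> bool" where
  "Linf_on S g \<longleftrightarrow> g \<in> borel_measurable (lebesgue_on S) \<and> (\<exists>C. AE x in lebesgue_on S. norm (g x) \<le> C)"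

definition Lp_space :: "real \<Rightarrow> 'a::euclidean_space set \<Rightarrow> ('a \<Rightarrow> real) set" where
  "Lp_space p S = {g \<in> borel_measurable (lebesgue_on S). integrable (lebesgue_on S) (\<lambda>x. \<bar>g x\<bar> powr p)}"

definition Lp_norm :: "real \<Rightarrow> 'a::euclidean_space set \<Rightarrow> ('a \<Rightarrow> real) \<Rightarrow> real" where
  "Lp_norm p S g = (LINT x|lebesgue_on S. \<bar>g x\<bar> powr p) powr (1 / p)"

definition L1_loc :: "(real \<Rightarrow> 'b::euclidean_space) \<Rightarrow> bool" where
  "L1_loc g \<longleftrightarrow> (\<forall>K. compact K \<longrightarrow> g absolutely_integrable_on K)"

definition Linf_loc :: "(real \<Rightarrow> 'b::euclidean_space) \<Rightarrow> bool" where
  "Linf_loc g \<longleftrightarrow> (\<forall>K. compact K \<longrightarrow> Linf_on K g)"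

definition weak_deriv :: "(real \<Rightarrow> 'b::euclidean_space) \<Rightarrow> (real \<Rightarrow> 'b) \<Rightarrow> bool" where
  "weak_deriv g g' \<longleftrightarrow> L1_loc g \<and> L1_loc g' \<and>
     (\<forall>\<phi>. Cc_infty UNIV \<phi> \<longrightarrow>
       (LINT x|lebesgue. deriv \<phi> x *\<^sub>R g x) = - (LINT x|lebesgue. \<phi> x *\<^sub>R g' x))"

text \<open>
  Elements of \<open>W\<^sup>1\<^sup>,\<^sup>\<infinity>\<^sub>l\<^sub>o\<^sub>c(\<real>)\<close> are evaluated pointwise below (as in \<open>f(u)\<close> and \<open>b(k)\<close>),
  which refers to their continuous representative.
\<close>

definition W1inf_loc :: "(real \<Rightarrow> 'b::euclidean_space) \<Rightarrow> bool" where
  "W1inf_loc g \<longleftrightarrow> continuous_on UNIV g \<and> Linf_loc g \<and> (\<exists>g'. weak_deriv g g' \<and> Linf_loc g')"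

definition BV_loc :: "(real \<Rightarrow> real) \<Rightarrow> bool" where
  "BV_loc g \<longleftrightarrow> L1_loc g \<and>
     (\<forall>U. open U \<and> bounded U \<longrightarrow>
       (\<exists>C. \<forall>\<phi>. Cc_infty U \<phi> \<and> (\<forall>x\<in>U. \<bar>\<phi> x\<bar> \<le> 1) \<longrightarrow>
         (LINT x|lebesgue_on U. g x * deriv \<phi> x) \<le> C))"

definition ess_range :: "'a::euclidean_space set \<Rightarrow> ('a \<Rightarrow> real) \<Rightarrow> real set" where
  "ess_range S g = {y. \<forall>\<epsilon>>0. \<not> (AE x in lebesgue_on S. \<epsilon> \<le> \<bar>g x - y\<bar>)}"


section \<open>Geometry of the domain\<close>

text \<open>
  Near each boundary point \<open>\<Omega>\<close> is the strict epigraph of a \<open>C\<^sup>2\<close> function over the hyperplane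
  orthogonal to some unit vector \<open>\<nu>\<close>. The function \<open>\<gamma>\<close> is evaluated on that hyperplane only;
  it is taken on the whole space to avoid a type for the hyperplane.
\<close>

definition C2_boundary :: "'a::euclidean_space set \<Rightarrow> bool" where
  "C2_boundary \<Omega> \<longleftrightarrow>
     (\<forall>x0\<in>frontier \<Omega>. \<exists>r>0. \<exists>\<nu>. \<exists>\<gamma>::'a \<Rightarrow> real.
        norm \<nu> = 1 \<and> Ck_on 2 UNIV \<gamma> \<and>
        \<Omega> \<inter> ball x0 r = {x \<in> ball x0 r. \<gamma> (x - (x \<bullet> \<nu>) *\<^sub>R \<nu>) < x \<bullet> \<nu>})"

text \<open>
  The \<open>m\<close>-dimensional Hausdorff measure, normalised to agree with Lebesgue measure on
  \<open>m\<close>-dimensional subspaces. A nonempty set of diameter 0 has weight 1 if \<open>m = 0\<close>, so that this is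
  the counting measure then. Boundedness is required because \<^const>\<open>diameter\<close> is
  unspecified on unbounded sets.
\<close>

definition hausdorff_content :: "nat \<Rightarrow> real \<Rightarrow> 'a::metric_space set \<Rightarrow> ennreal" where
  "hausdorff_content m \<delta> A =
     (INF C\<in>{C::nat \<Rightarrow> 'a set. A \<subseteq> (\<Union>i. C i) \<and> (\<forall>i. bounded (C i) \<and> diameter (C i) \<le> \<delta>)}.
        \<Sum>i. if C i = {} then 0 else ennreal (unit_ball_vol (real m) * (diameter (C i) / 2) ^ m))"

definition hausdorff_outer :: "nat \<Rightarrow> 'a::metric_space set \<Rightarrow> ennreal" where
  "hausdorff_outer m A = (SUP \<delta>\<in>{0<..}. hausdorff_content m \<delta> A)"

text \<open>A metric outer measure is countably additive on the Borel sets, so \<^const>\<open>measure_of\<close> applies.\<close>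

definition hausdorff_measure :: "nat \<Rightarrow> 'a::metric_space measure" where
  "hausdorff_measure m = measure_of UNIV (sets borel) (hausdorff_outer m)"

definition surface_measure :: "'a::euclidean_space measure" where
  "surface_measure = hausdorff_measure (DIM('a) - 1)"


section \<open>Nonlocal operators\<close>

definition nonlocal_ge :: "'a::euclidean_space measure \<Rightarrow> real \<Rightarrow> ('a \<Rightarrow> real) \<Rightarrow> 'a \<Rightarrow> real" where
  "nonlocal_ge \<mu> r v x = (LINT z:{z. r \<le> norm z}|\<mu>. v (x + z) - v x)"

definition nonlocal_lt :: "'a::euclidean_space measure \<Rightarrow> real \<Rightarrow> ('a \<Rightarrow> real) \<Rightarrow> 'a \<Rightarrow> real" where
  "nonlocal_lt \<mu> r v x =
     Lim (at_right 0) (\<lambda>\<epsilon>. LINT z:{z. \<epsilon> < norm z \<and> norm z < r}|\<mu>. v (x + z) - v x)"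

text \<open>The constant for which \<open>(-\<Delta>)\<^bsup>\<alpha>/2\<^esup>\<close> has the Fourier symbol \<open>|\<xi>|\<^bsup>\<alpha>\<^esup>\<close>.\<close>

definition frac_const :: "nat \<Rightarrow> real \<Rightarrow> real" where
  "frac_const d \<alpha> =
     2 powr \<alpha> * Gamma ((real d + \<alpha>) / 2) / (pi powr (real d / 2) * \<bar>Gamma (- \<alpha> / 2)\<bar>)"

definition frac_measure :: "real \<Rightarrow> 'a::euclidean_space measure" where
  "frac_measure \<alpha> =
     density lebesgue (\<lambda>z. ennreal (frac_const DIM('a) \<alpha> * norm z powr (- (real DIM('a) + \<alpha>))))"


section \<open>Entropy solutions\<close>

text \<open>The sign \<open>\<plusminus>\<close> is represented by a real number \<open>s \<in> {1, -1}\<close>.\<close>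

definition part :: "real \<Rightarrow> real \<Rightarrow> real" where
  "part s a = max (s * a) 0"

definition sgn_part :: "real \<Rightarrow> real \<Rightarrow> real" where
  "sgn_part s a = (if s * a > 0 then s else 0)"

definition entropy_flux :: "(real \<Rightarrow> 'a::real_vector) \<Rightarrow> real \<Rightarrow> real \<Rightarrow> real \<Rightarrow> 'a" where
  "entropy_flux f s v k = sgn_part s (v - k) *\<^sub>R (f v - f k)"

definition partial_t :: "(real \<times> 'a \<Rightarrow> real) \<Rightarrow> real \<Rightarrow> 'a \<Rightarrow> real" where
  "partial_t \<phi> t x = deriv (\<lambda>\<tau>. \<phi> (\<tau>, x)) t"

definition grad_x :: "(real \<times> 'a::euclidean_space \<Rightarrow> real) \<Rightarrow> real \<Rightarrow> 'a \<Rightarrow> 'a" where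
  "grad_x \<phi> t x = (\<Sum>i\<in>Basis. deriv (\<lambda>h. \<phi> (t, x + h *\<^sub>R i)) 0 *\<^sub>R i)"

definition lip_const :: "(real \<Rightarrow> 'a::metric_space) \<Rightarrow> real set \<Rightarrow> real" where
  "lip_const f I = Inf {C. C-lipschitz_on I f}"

definition smallest_interval :: "real set \<Rightarrow> real set" where
  "smallest_interval A = \<Inter>{{a..b} |a b. A \<subseteq> {a..b}}"

text \<open>
  The following two quantities occur in both notions of solution. In \<open>entropy_rhs\<close>, \<open>I\<close> is the
  interval on which the Lipschitz constant of \<open>f\<close> is taken and \<open>ubar\<close> is the extension of \<open>u\<^sup>c\<close>.
\<close>

definition entropy_lhs_local ::
  "real \<Rightarrow> 'a::euclidean_space set \<Rightarrow> (real \<Rightarrow> 'a) \<Rightarrow> (real \<times> 'a \<Rightarrow> real) \<Rightarrow>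
   real \<Rightarrow> real \<Rightarrow> (real \<times> 'a \<Rightarrow> real) \<Rightarrow> real" where
  "entropy_lhs_local T \<Omega> f u s k \<phi> =
     - (LINT (t, x)|lebesgue_on ({0<..<T} \<times> \<Omega>).
          part s (u (t, x) - k) * partial_t \<phi> t x + entropy_flux f s (u (t, x)) k \<bullet> grad_x \<phi> t x)"

definition entropy_rhs ::
  "real \<Rightarrow> 'a::euclidean_space set \<Rightarrow> (real \<Rightarrow> 'a) \<Rightarrow> real set \<Rightarrow> (real \<times> 'a \<Rightarrow> real) \<Rightarrow> ('a \<Rightarrow> real) \<Rightarrow>
   real \<Rightarrow> real \<Rightarrow> (real \<times> 'a \<Rightarrow> real) \<Rightarrow> real" where
  "entropy_rhs T \<Omega> f I ubar u0 s k \<phi> =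
     (LINT x|lebesgue_on \<Omega>. part s (u0 x - k) * \<phi> (0, x)) +
     lip_const f I *
       (LINT t|lebesgue_on {0<..<T}.
          (LINT x:frontier \<Omega>|surface_measure. part s (ubar (t, x) - k) * \<phi> (t, x)))"

definition nonlocal_entropy_solution ::
  "real \<Rightarrow> 'a::euclidean_space set \<Rightarrow> (real \<Rightarrow> 'a) \<Rightarrow> (real \<Rightarrow> real) \<Rightarrow> 'a measure \<Rightarrow>
   (real \<times> 'a \<Rightarrow> real) \<Rightarrow> (real \<times> 'a \<Rightarrow> real) \<Rightarrow> ('a \<Rightarrow> real) \<Rightarrow> (real \<times> 'a \<Rightarrow> real) \<Rightarrow> bool" where
  "nonlocal_entropy_solution T \<Omega> f b \<mu> uc ubar u0 u \<longleftrightarrow>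
     Linf_on ({0<..<T} \<times> UNIV) u \<and>
     (\<forall>s\<in>{1, -1}. \<forall>r>0. \<forall>k \<phi>.
        Cc_infty ({0..<T} \<times> UNIV) \<phi> \<and> (\<forall>p\<in>{0..<T} \<times> UNIV. 0 \<le> \<phi> p) \<and>
        (\<forall>p\<in>{0<..<T} \<times> (- \<Omega>). part s (b (uc p) - b k) * \<phi> p = 0) \<longrightarrow>
        entropy_lhs_local T \<Omega> f u s k \<phi>
        - (LINT (t, x)|lebesgue_on ({0<..<T} \<times> \<Omega>).
             nonlocal_ge \<mu> r (\<lambda>y. b (u (t, y))) x * sgn_part s (u (t, x) - k) * \<phi> (t, x))
        - (LINT (t, x)|lebesgue_on ({0<..<T} \<times> UNIV).
             part s (b (u (t, x)) - b k) * nonlocal_lt \<mu> r (\<lambda>y. \<phi> (t, y)) x)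
        \<le> entropy_rhs T \<Omega> f
             (smallest_interval (insert k (ess_range ({0<..<T} \<times> UNIV) u \<union> ess_range \<Omega> u0 \<union>
                ess_range ({0<..<T} \<times> (- \<Omega>)) uc)))
             ubar u0 s k \<phi>) \<and>
     (AE p in lebesgue_on ({0<..<T} \<times> (- \<Omega>)). u p = uc p)"

definition local_entropy_solution ::
  "real \<Rightarrow> 'a::euclidean_space set \<Rightarrow> (real \<Rightarrow> 'a) \<Rightarrow>
   (real \<times> 'a \<Rightarrow> real) \<Rightarrow> (real \<times> 'a \<Rightarrow> real) \<Rightarrow> ('a \<Rightarrow> real) \<Rightarrow> (real \<times> 'a \<Rightarrow> real) \<Rightarrow> bool" where
  "local_entropy_solution T \<Omega> f uc ubar u0 u \<longleftrightarrow>
     Linf_on ({0<..<T} \<times> \<Omega>) u \<and>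
     (\<forall>s\<in>{1, -1}. \<forall>k \<phi>.
        Cc_infty ({0..<T} \<times> UNIV) \<phi> \<and> (\<forall>p\<in>{0..<T} \<times> UNIV. 0 \<le> \<phi> p) \<longrightarrow>
        entropy_lhs_local T \<Omega> f u s k \<phi>
        \<le> entropy_rhs T \<Omega> f
             (smallest_interval (insert k (ess_range ({0<..<T} \<times> \<Omega>) u \<union> ess_range \<Omega> u0 \<union>
                ess_range ({0<..<T} \<times> (- \<Omega>)) uc)))
             ubar u0 s k \<phi>)"

end

theory Submission
  imports Defs
begin

text \<open>
  Extended by the initial datum to negative times, with the flux switched off there, the \<open>u\<^sub>n\<close> satisfy the
  entropy inequalities of the conservation law up to \<open>O(1/n)\<close>: the operator \<open>\<L>\<^bsup><r\<^esup>\<close> acts on test functions and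
  \<open>\<L>\<^bsup>\<ge>r\<^esup>\<close> is bounded on the \<open>u\<^sub>n\<close>, which obey a maximum principle. Only test functions that vanish where the
  boundary datum is on the wrong side of \<open>k\<close> are used, so no boundary integral occurs.
  Doubling the variables against \<open>u\<close> gives a Kato inequality, in the limit along an ultrafilter, for interior test
  functions. To reach the boundary one splits the Kruzhkov flux at levels slightly above and below the local boundary
  value. The outer parts are treated by a doubling that is shifted into the domain, where the entropy flux of a
  constant against the solution has a finite limit on the boundary; the middle part is small as its range is.
  Hence every ultrafilter limit of the \<open>L\<^sup>1\<close> distances vanishes, and boundedness upgrades this to \<open>L\<^sup>p\<close>.
\<close>

section \<open>Smooth functions\<close>

text \<open>There is no strong compactness for the \<open>un\<close>, and weak limits do not commute
  with \<open>f\<close>. Limits along an ultrafilter are therefore taken of the nonlinear flux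
  integrals and not of the functions: they exist for every bounded sequence, are linear in the test
  function and replace a Young measure. Doubling is uniform in n because one of the two functions
  compared does not depend on n. At the boundary there are no traces, and a constant may be used
  only on one side of the boundary values. Truncation at a level \<open>c\<close> above the datum
  makes \<open>max v c\<close> a legal constant for the first function. For the second one the
  constant is not restricted from that side, so its test function has to vanish at the boundary;
  this forces the inward shift of the kernel. The price is the flux of \<open>c\<close> against
  \<open>v\<close> in a thin layer, which is small since these quantities are monotone and bounded
  in the layer index. Levels close to the datum cannot be treated in this way. Their flux is small
  by continuity of \<open>f\<close>, while the layer gradients stay bounded in L^1. An error of
  order 1/n also needs a bound of the \<open>un\<close> independent of n, which the entropy
  inequality itself supplies.\<close>

definition smooth :: "('a::real_normed_vector \<Rightarrow> 'b::real_normed_vector) \<Rightarrow> bool" where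
  "smooth f \<longleftrightarrow> (\<forall>k. Ck_on k UNIV f)"

lemma Ck_on_Suc_UNIV:
  "Ck_on (Suc k) UNIV f \<longleftrightarrow>
    (\<exists>f'. (\<forall>x. (f has_derivative f' x) (at x)) \<and> (\<forall>v. Ck_on k UNIV (\<lambda>x. f' x v)))"
  by simp

lemma Ck_on_continuous: "Ck_on k S f \<Longrightarrow> continuous_on S f"
  by (cases k) (auto simp: continuous_on_eq_continuous_within intro: has_derivative_continuous)

lemma Ck_on_SucD: "Ck_on (Suc k) S f \<Longrightarrow> Ck_on k S f"
proof (induction k arbitrary: f)
  case 0
  then show ?case using Ck_on_continuous[of "Suc 0" S f] by simp
next
  case (Suc k)
  from Suc.prems obtain f' where f': "\<forall>x\<in>S. (f has_derivative f' x) (at x within S)"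
    and "\<forall>v. Ck_on (Suc k) S (\<lambda>x. f' x v)" unfolding Ck_on.simps(2)[of "Suc k"] by blast
  then have "\<forall>v. Ck_on k S (\<lambda>x. f' x v)" using Suc.IH by blast
  with f' show ?case unfolding Ck_on.simps(2)[of k] by blast
qed

lemma Ck_on_subset: "Ck_on k S f \<Longrightarrow> A \<subseteq> S \<Longrightarrow> Ck_on k A f"
proof (induction k arbitrary: f)
  case 0
  then show ?case by (auto intro: continuous_on_subset)
next
  case (Suc k)
  then obtain f' where f': "\<forall>x\<in>S. (f has_derivative f' x) (at x within S)"
    "\<forall>v. Ck_on k S (\<lambda>x. f' x v)" by auto
  have "\<forall>x\<in>A. (f has_derivative f' x) (at x within A)"
    using f'(1) Suc.prems(2) by (meson has_derivative_subset subsetD)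
  then show ?case using f'(2) Suc by auto
qed

lemma Ck_on_const [simp]: "Ck_on k S (\<lambda>x. c)"
proof (induction k arbitrary: c)
  case (Suc k)
  show ?case by (simp, intro exI[of _ "\<lambda>x v. 0"]) (auto simp: Suc)
qed simp

lemma Ck_on_bounded_linear: "bounded_linear f \<Longrightarrow> Ck_on k S f"
proof (cases k)
  case 0
  assume "bounded_linear f"
  then show ?thesis using 0 by (simp add: linear_continuous_on)
next
  case (Suc m)
  assume "bounded_linear f"
  then show ?thesis using Suc
    by (simp, intro exI[of _ "\<lambda>x. f"]) (auto intro: bounded_linear_imp_has_derivative)
qed

lemma Ck_on_add: "Ck_on k S f \<Longrightarrow> Ck_on k S g \<Longrightarrow> Ck_on k S (\<lambda>x. f x + g x)"
proof (induction k arbitrary: f g)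
  case 0
  then show ?case by (simp add: continuous_on_add)
next
  case (Suc k)
  then obtain f' g' where "\<forall>x\<in>S. (f has_derivative f' x) (at x within S)"
    "\<forall>v. Ck_on k S (\<lambda>x. f' x v)" "\<forall>x\<in>S. (g has_derivative g' x) (at x within S)"
    "\<forall>v. Ck_on k S (\<lambda>x. g' x v)" by auto
  then show ?case using Suc.IH
    by (simp, intro exI[of _ "\<lambda>x v. f' x v + g' x v"]) (auto intro!: derivative_eq_intros)
qed

lemma Ck_on_mult:
  fixes f g :: "'a::real_normed_vector \<Rightarrow> real"
  shows "Ck_on k S f \<Longrightarrow> Ck_on k S g \<Longrightarrow> Ck_on k S (\<lambda>x. f x * g x)"
proof (induction k arbitrary: f g)
  case 0
  then show ?case by (simp add: continuous_on_mult)
next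
  case (Suc k)
  then obtain f' g' where "\<forall>x\<in>S. (f has_derivative f' x) (at x within S)"
    "\<forall>v. Ck_on k S (\<lambda>x. f' x v)" "\<forall>x\<in>S. (g has_derivative g' x) (at x within S)"
    "\<forall>v. Ck_on k S (\<lambda>x. g' x v)" by auto
  moreover have "Ck_on k S f" "Ck_on k S g" using Suc.prems Ck_on_SucD by blast+
  ultimately show ?case using Suc.IH
    by (simp, intro exI[of _ "\<lambda>x v. f x * g' x v + f' x v * g x"])
      (auto intro!: derivative_eq_intros Ck_on_add)
qed

text \<open>Chain rules are proved for scalar outer functions and, in
  \<open>Ck_on_comp_affine\<close>, for affine inner maps. In both cases the derivative is built
  from compositions of the same kind, so a plain induction on \<open>k\<close> closes.\<close>

lemma Ck_on_comp_real:
  fixes f :: "'a::real_normed_vector \<Rightarrow> real" and g :: "real \<Rightarrow> real"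
  shows "Ck_on k UNIV g \<Longrightarrow> Ck_on k UNIV f \<Longrightarrow> Ck_on k UNIV (\<lambda>x. g (f x))"
proof (induction k arbitrary: f g)
  case 0
  then show ?case by (auto intro: continuous_on_compose2[of UNIV g])
next
  case (Suc k)
  then obtain f' g' where f': "\<forall>x. (f has_derivative f' x) (at x)"
    "\<forall>v. Ck_on k UNIV (\<lambda>x. f' x v)" and g': "\<forall>x. (g has_derivative g' x) (at x)"
    "\<forall>v. Ck_on k UNIV (\<lambda>x. g' x v)" by auto
  have fk: "Ck_on k UNIV f" using Suc.prems Ck_on_SucD by blast
  have eq: "g' y v = g' y 1 * v" for y v
  proof -
    have "linear (g' y)" using g'(1) has_derivative_bounded_linear bounded_linear.linear by blast
    from linear_scale[OF this, of v 1] show ?thesis by (simp add: mult.commute)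
  qed
  have "((\<lambda>x. g (f x)) has_derivative (\<lambda>v. g' (f x) 1 * f' x v)) (at x)" for x
  proof -
    have "((\<lambda>x. g (f x)) has_derivative (\<lambda>v. g' (f x) (f' x v))) (at x)"
      using has_derivative_compose[of f "f' x" x UNIV g "g' (f x)"] f' g' by blast
    moreover have "(\<lambda>v. g' (f x) (f' x v)) = (\<lambda>v. g' (f x) 1 * f' x v)"
      by (rule ext) (rule eq)
    ultimately show ?thesis by simp
  qed
  moreover have "Ck_on k UNIV (\<lambda>x. g' (f x) 1 * f' x v)" for v
    by (rule Ck_on_mult) (use Suc.IH[of "\<lambda>y. g' y 1" f] g' f' fk in blast)+
  ultimately show ?case
    by (simp, intro exI[of _ "\<lambda>x v. g' (f x) 1 * f' x v"]) auto
qed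

lemma Ck_on_comp_affine:
  fixes f :: "'b::real_normed_vector \<Rightarrow> 'c::real_normed_vector"
  assumes "bounded_linear L"
  shows "Ck_on k UNIV f \<Longrightarrow> Ck_on k UNIV (\<lambda>x. f (L x + c))"
proof (induction k arbitrary: f)
  case 0
  then show ?case using assms
    by (auto intro!: continuous_on_compose2[of UNIV f] continuous_on_add[OF linear_continuous_on])
next
  case (Suc k)
  then obtain f' where f': "\<forall>x. (f has_derivative f' x) (at x)"
    "\<forall>v. Ck_on k UNIV (\<lambda>x. f' x v)" by auto
  have "((\<lambda>x. L x + c) has_derivative L) (at x)" for x
    using bounded_linear_imp_has_derivative[OF assms] by (auto intro!: derivative_eq_intros)
  then have "((\<lambda>x. f (L x + c)) has_derivative (\<lambda>v. f' (L x + c) (L v))) (at x)" for x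
    using has_derivative_compose[of "\<lambda>x. L x + c" L x UNIV f] f' by auto
  then show ?case using Suc.IH f'(2)
    by (simp, intro exI[of _ "\<lambda>x v. f' (L x + c) (L v)"]) auto
qed

lemma smooth_const [simp]: "smooth (\<lambda>x. c)" by (simp add: smooth_def)

lemma smooth_linear: "bounded_linear f \<Longrightarrow> smooth f"
  by (simp add: smooth_def Ck_on_bounded_linear)

lemma smooth_add: "smooth f \<Longrightarrow> smooth g \<Longrightarrow> smooth (\<lambda>x. f x + g x)"
  by (simp add: smooth_def Ck_on_add)

lemma smooth_mult:
  fixes f g :: "'a::real_normed_vector \<Rightarrow> real"
  shows "smooth f \<Longrightarrow> smooth g \<Longrightarrow> smooth (\<lambda>x. f x * g x)"
  by (simp add: smooth_def Ck_on_mult)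

lemma smooth_minus:
  fixes f :: "'a::real_normed_vector \<Rightarrow> real"
  shows "smooth f \<Longrightarrow> smooth (\<lambda>x. - f x)"
  using smooth_mult[OF smooth_const[of "-1"], of f] by simp

lemma smooth_diff:
  fixes f g :: "'a::real_normed_vector \<Rightarrow> real"
  shows "smooth f \<Longrightarrow> smooth g \<Longrightarrow> smooth (\<lambda>x. f x - g x)"
  using smooth_add[OF _ smooth_minus, of f g] by simp

lemma smooth_sum:
  fixes f :: "'i \<Rightarrow> 'a::real_normed_vector \<Rightarrow> 'b::real_normed_vector"
  shows "(\<And>i. i \<in> I \<Longrightarrow> smooth (f i)) \<Longrightarrow> smooth (\<lambda>x. \<Sum>i\<in>I. f i x)"
  by (induction I rule: infinite_finite_induct) (auto intro: smooth_add)

lemma smooth_prod: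
  fixes f :: "'i \<Rightarrow> 'a::real_normed_vector \<Rightarrow> real"
  shows "(\<And>i. i \<in> I \<Longrightarrow> smooth (f i)) \<Longrightarrow> smooth (\<lambda>x. \<Prod>i\<in>I. f i x)"
  by (induction I rule: infinite_finite_induct) (auto intro: smooth_mult)

lemma smooth_comp_real:
  fixes f :: "'a::real_normed_vector \<Rightarrow> real" and g :: "real \<Rightarrow> real"
  shows "smooth g \<Longrightarrow> smooth f \<Longrightarrow> smooth (\<lambda>x. g (f x))"
  by (simp add: smooth_def Ck_on_comp_real)

lemma smooth_comp_affine: "bounded_linear L \<Longrightarrow> smooth f \<Longrightarrow> smooth (\<lambda>x. f (L x + c))"
  by (simp add: smooth_def Ck_on_comp_affine)

lemma smooth_comp_linear: "bounded_linear L \<Longrightarrow> smooth f \<Longrightarrow> smooth (\<lambda>x. f (L x))"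
  using smooth_comp_affine[of L f 0] by simp

lemma smooth_continuous_on: "smooth f \<Longrightarrow> continuous_on S f"
  unfolding smooth_def using Ck_on_continuous[of 0 UNIV f] continuous_on_subset[of UNIV f S] by simp

text \<open>For each \<open>k\<close> the definition yields a derivative of its own. Uniqueness of
  the Frechet derivative identifies all of them, and so a single derivative is smooth.\<close>

lemma smooth_has_derivative:
  assumes "smooth f"
  shows "(f has_derivative frechet_derivative f (at x)) (at x)"
    and "smooth (\<lambda>x. frechet_derivative f (at x) v)"
proof -
  have *: "\<exists>f'. (\<forall>x. (f has_derivative f' x) (at x)) \<and> (\<forall>v. Ck_on k UNIV (\<lambda>x. f' x v))" for k
    using assms[unfolded smooth_def, rule_format, of "Suc k"] unfolding Ck_on_Suc_UNIV .
  have eq: "f' x = frechet_derivative f (at x)"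
    if "\<forall>x. (f has_derivative f' x) (at x)" for f' x
    by (rule frechet_derivative_at) (use that in simp)
  obtain f' where f': "\<forall>x. (f has_derivative f' x) (at x)" using *[of 0] by (elim exE conjE)
  show "(f has_derivative frechet_derivative f (at x)) (at x)"
    unfolding eq[OF f', symmetric] by (simp add: f')
  show "smooth (\<lambda>x. frechet_derivative f (at x) v)" unfolding smooth_def
  proof
    fix k
    obtain f' where f': "\<forall>x. (f has_derivative f' x) (at x)" "\<forall>v. Ck_on k UNIV (\<lambda>x. f' x v)"
      using *[of k] by (elim exE conjE)
    show "Ck_on k UNIV (\<lambda>x. frechet_derivative f (at x) v)"
      unfolding eq[OF f'(1), symmetric] by (simp add: f'(2))
  qed
qed

lemma smooth_inner: "smooth (\<lambda>x::'a::euclidean_space. x \<bullet> x)"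
proof -
  have "smooth (\<lambda>x::'a. \<Sum>i\<in>Basis. (x \<bullet> i) * (x \<bullet> i))"
    by (intro smooth_sum smooth_mult smooth_linear bounded_linear_inner_left)
  then show ?thesis by (simp add: euclidean_inner[symmetric])
qed

text \<open>The powers of 1/t make the family stable under differentiation: each derivative combines
  the members \<open>m + 1\<close> and \<open>m + 2\<close>. Smoothness of the standard function
  exp(-1/t) at 0 thus follows by one induction. The members 0 and 2 return later as weights in
  time.\<close>

definition flat_exp :: "nat \<Rightarrow> real \<Rightarrow> real" where
  "flat_exp m t = (if t > 0 then (1 / t) ^ m * exp (- (1 / t)) else 0)"

lemma flat_exp_tendsto_0: "(flat_exp m \<longlongrightarrow> 0) (at_right 0)"
proof -
  have "((\<lambda>t. (1 / t) ^ m * exp (- (1 / t))) \<longlongrightarrow> 0) (at_right (0::real))"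
    using filterlim_compose[OF tendsto_power_div_exp_0[of m] filterlim_inverse_at_top_right]
    by (simp add: field_simps exp_minus)
  then show ?thesis
    by (rule Lim_transform_eventually)
      (auto simp: flat_exp_def eventually_at_right_field intro: exI[of _ 1])
qed

lemma flat_exp_has_derivative:
  "(flat_exp m has_real_derivative (flat_exp (m + 2) t - real m * flat_exp (m + 1) t)) (at t)"
proof -
  consider "t > 0" | "t < 0" | "t = 0" by linarith
  then show ?thesis
  proof cases
    case 1
    have "((\<lambda>t. inverse t ^ m * exp (- inverse t)) has_real_derivative
        (inverse t ^ (m + 2) - real m * inverse t ^ (m + 1)) * exp (- inverse t)) (at t)"
    proof (cases m)
      case 0
      show ?thesis unfolding 0 using 1
        by (auto intro!: derivative_eq_intros simp: field_simps power2_eq_square)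
    next
      case (Suc l)
      have A: "((\<lambda>t. inverse t ^ Suc l) has_real_derivative
          real (Suc l) * (inverse t ^ l * (- (inverse t ^ 2)))) (at t)"
        using DERIV_power_Suc[OF DERIV_inverse[of t UNIV], of l] 1
        by (simp add: algebra_simps power2_eq_square numeral_2_eq_2)
      have B: "((\<lambda>t. exp (- inverse t)) has_real_derivative exp (- inverse t) * inverse t ^ 2) (at t)"
        using 1 by (auto intro!: derivative_eq_intros simp: power2_eq_square)
      show ?thesis unfolding Suc
        by (rule DERIV_cong[OF DERIV_mult[OF A B]]) (simp add: algebra_simps power2_eq_square)
    qed
    then have "((\<lambda>t. (1 / t) ^ m * exp (- (1 / t))) has_real_derivative
        (flat_exp (m + 2) t - real m * flat_exp (m + 1) t)) (at t)"
      using 1 by (simp add: flat_exp_def inverse_eq_divide algebra_simps)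
    then show ?thesis
      by (rule has_field_derivative_transform_within_open[where S="{0<..}"])
        (use 1 in \<open>auto simp: flat_exp_def\<close>)
  next
    case 2
    have "((\<lambda>t. 0) has_real_derivative 0) (at t)" by simp
    then have "(flat_exp m has_real_derivative 0) (at t)"
      by (rule has_field_derivative_transform_within_open[where S="{..<0}"])
        (use 2 in \<open>auto simp: flat_exp_def\<close>)
    then show ?thesis using 2 by (simp add: flat_exp_def)
  next
    case 3
    \<comment> \<open>For positive \<open>h\<close> the difference quotient at 0 is
      \<open>flat_exp (Suc m) h\<close>, which tends to 0 as well.\<close>
    have "((\<lambda>h. flat_exp m h / h) \<longlongrightarrow> 0) (at_right 0)"
      by (rule Lim_transform_eventually[OF flat_exp_tendsto_0[of "Suc m"]])
        (auto simp: flat_exp_def eventually_at_right_field intro: exI[of _ 1])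
    moreover have "((\<lambda>h. flat_exp m h / h) \<longlongrightarrow> 0) (at_left 0)"
      by (rule Lim_transform_eventually[OF tendsto_const])
        (auto simp: flat_exp_def eventually_at_left_field intro: exI[of _ "-1"])
    ultimately have "((\<lambda>h. flat_exp m h / h) \<longlongrightarrow> 0) (at 0)"
      by (simp add: filterlim_split_at)
    then show ?thesis using 3 by (simp add: DERIV_def flat_exp_def)
  qed
qed

lemma smooth_flat_exp: "smooth (flat_exp m)"
proof -
  have "Ck_on k UNIV (flat_exp m)" for k
  proof (induction k arbitrary: m)
    case 0
    have "isCont (flat_exp m) t" for t using flat_exp_has_derivative DERIV_isCont by blast
    then show ?case by (simp add: continuous_at_imp_continuous_on)
  next
    case (Suc k)
    define D where "D x v = (flat_exp (m + 2) x + (- real m) * flat_exp (m + 1) x) * v" for x v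
    have "(flat_exp m has_derivative D x) (at x)" for x
      using flat_exp_has_derivative[of m x] unfolding has_field_derivative_def D_def
      by (simp add: algebra_simps)
    moreover have "Ck_on k UNIV (\<lambda>x. D x v)" for v
      unfolding D_def by (intro Ck_on_mult Ck_on_add Suc Ck_on_const)
    ultimately show ?case by (simp, intro exI[of _ D]) auto
  qed
  then show ?thesis by (simp add: smooth_def)
qed

text \<open>On \<open>real \<times> 'a\<close> this vector holds the time derivative and the spatial
  gradient together, to be paired with the space-time flux.\<close>

definition nabla :: "('e::euclidean_space \<Rightarrow> real) \<Rightarrow> 'e \<Rightarrow> 'e" where
  "nabla \<phi> z = (\<Sum>i\<in>Basis. frechet_derivative \<phi> (at z) i *\<^sub>R i)"

lemma nablaI: "(\<phi> has_derivative (\<lambda>h. g \<bullet> h)) (at z) \<Longrightarrow> nabla \<phi> z = g"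
  unfolding nabla_def by (simp add: frechet_derivative_at[symmetric] euclidean_representation)

lemma has_derivative_inner_nabla:
  assumes "(\<phi> has_derivative D) (at z)"
  shows "(\<phi> has_derivative (\<lambda>h. nabla \<phi> z \<bullet> h)) (at z)" and "nabla \<phi> z \<bullet> h = D h"
proof -
  have D: "frechet_derivative \<phi> (at z) = D" using frechet_derivative_at[OF assms] by simp
  have lin: "linear D" using assms has_derivative_bounded_linear bounded_linear.linear by blast
  have eq: "nabla \<phi> z \<bullet> h = D h" for h
  proof -
    have "D h = D (\<Sum>i\<in>Basis. (h \<bullet> i) *\<^sub>R i)" by (simp add: euclidean_representation)
    also have "\<dots> = (\<Sum>i\<in>Basis. (h \<bullet> i) * D i)"
      by (simp add: linear_sum[OF lin] linear_scale[OF lin])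
    also have "\<dots> = nabla \<phi> z \<bullet> h"
      unfolding nabla_def D inner_sum_left inner_scaleR_left
      by (simp add: inner_commute mult.commute)
    finally show ?thesis by simp
  qed
  then show "nabla \<phi> z \<bullet> h = D h" .
  show "(\<phi> has_derivative (\<lambda>h. nabla \<phi> z \<bullet> h)) (at z)" unfolding eq using assms by simp
qed

lemma smooth_has_nabla:
  "smooth \<phi> \<Longrightarrow> (\<phi> has_derivative (\<lambda>h. nabla \<phi> z \<bullet> h)) (at z)"
  by (rule has_derivative_inner_nabla(1)[OF smooth_has_derivative(1)])

lemma smooth_nabla_inner:
  fixes \<phi> :: "'e::euclidean_space \<Rightarrow> real"
  assumes "smooth \<phi>" shows "smooth (\<lambda>z. nabla \<phi> z \<bullet> h)"
proof -
  have "nabla \<phi> z \<bullet> h = frechet_derivative \<phi> (at z) h" for z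
    by (rule has_derivative_inner_nabla(2)[OF smooth_has_derivative(1)[OF assms]])
  then show ?thesis using smooth_has_derivative(2)[OF assms] by simp
qed

lemma continuous_on_nabla:
  fixes \<phi> :: "'e::euclidean_space \<Rightarrow> real"
  assumes "smooth \<phi>" shows "continuous_on S (nabla \<phi>)"
  using smooth_continuous_on[OF smooth_nabla_inner[OF assms]]
  by (subst continuous_on_componentwise) simp

lemma nabla_add:
  "smooth \<phi> \<Longrightarrow> smooth \<psi> \<Longrightarrow> nabla (\<lambda>z. \<phi> z + \<psi> z) z = nabla \<phi> z + nabla \<psi> z"
  by (rule nablaI) (auto intro!: derivative_eq_intros smooth_has_nabla simp: inner_add_left)

lemma nabla_diff:
  "smooth \<phi> \<Longrightarrow> smooth \<psi> \<Longrightarrow> nabla (\<lambda>z. \<phi> z - \<psi> z) z = nabla \<phi> z - nabla \<psi> z"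
  by (rule nablaI) (auto intro!: derivative_eq_intros smooth_has_nabla simp: inner_diff_left)

lemma nabla_mult:
  assumes "smooth \<phi>" "smooth \<psi>"
  shows "nabla (\<lambda>z. \<phi> z * \<psi> z) z = \<phi> z *\<^sub>R nabla \<psi> z + \<psi> z *\<^sub>R nabla \<phi> z"
proof (rule nablaI)
  show "((\<lambda>z. \<phi> z * \<psi> z) has_derivative (\<lambda>h. (\<phi> z *\<^sub>R nabla \<psi> z + \<psi> z *\<^sub>R nabla \<phi> z) \<bullet> h)) (at z)"
    using has_derivative_mult[OF smooth_has_nabla[OF assms(1)] smooth_has_nabla[OF assms(2)], of z]
    by (simp add: inner_add_left mult.commute)
qed

lemma nabla_const [simp]: "nabla (\<lambda>z. c) z = 0"
  by (rule nablaI) simp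

text \<open>In contrast to \<open>Cc_infty\<close>, such a function is smooth on the whole space and
  vanishes everywhere off the compact set, so it can be translated, convolved and multiplied without
  regard to \<open>S\<close>.\<close>

definition test_on :: "'e::euclidean_space set \<Rightarrow> ('e \<Rightarrow> real) \<Rightarrow> bool" where
  "test_on S \<phi> \<longleftrightarrow> smooth \<phi> \<and> (\<exists>K. compact K \<and> K \<subseteq> S \<and> (\<forall>z. z \<notin> K \<longrightarrow> \<phi> z = 0))"

lemma test_on_smooth: "test_on S \<phi> \<Longrightarrow> smooth \<phi>"
  by (simp add: test_on_def)

lemma test_onE:
  assumes "test_on S \<phi>"
  obtains K where "compact K" "K \<subseteq> S" "\<And>z. z \<notin> K \<Longrightarrow> \<phi> z = 0"
  using assms by (auto simp: test_on_def)

lemma test_on_mono: "test_on S \<phi> \<Longrightarrow> S \<subseteq> S' \<Longrightarrow> test_on S' \<phi>"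
  unfolding test_on_def by blast

lemma test_on_add:
  assumes "test_on S \<phi>" "test_on S \<psi>"
  shows "test_on S (\<lambda>z. \<phi> z + \<psi> z)"
proof -
  obtain K where K: "compact K" "K \<subseteq> S" "\<And>z. z \<notin> K \<Longrightarrow> \<phi> z = 0" using test_onE[OF assms(1)] by blast
  obtain L where L: "compact L" "L \<subseteq> S" "\<And>z. z \<notin> L \<Longrightarrow> \<psi> z = 0" using test_onE[OF assms(2)] by blast
  show ?thesis unfolding test_on_def
    using K L assms by (auto simp: test_on_def intro!: smooth_add exI[of _ "K \<union> L"] compact_Un)
qed

lemma test_on_mult:
  "test_on S \<phi> \<Longrightarrow> smooth \<psi> \<Longrightarrow> test_on S (\<lambda>z. \<psi> z * \<phi> z)"
  "test_on S \<phi> \<Longrightarrow> smooth \<psi> \<Longrightarrow> test_on S (\<lambda>z. \<phi> z * \<psi> z)"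
  unfolding test_on_def by (auto intro: smooth_mult)

lemma test_on_diff:
  assumes "test_on S \<phi>" "test_on S \<psi>"
  shows "test_on S (\<lambda>z. \<phi> z - \<psi> z)"
  using test_on_add[OF assms(1) test_on_mult(1)[OF assms(2) smooth_const[of "-1"]]] by simp

lemma test_on_0 [simp]: "test_on S (\<lambda>z. 0)"
  by (auto simp: test_on_def)

lemma test_on_sum:
  "(\<And>i. i \<in> I \<Longrightarrow> test_on S (\<phi> i)) \<Longrightarrow> test_on S (\<lambda>z. \<Sum>i\<in>I. \<phi> i z)"
  by (induction I rule: infinite_finite_induct) (auto intro: test_on_add)

lemma nabla_eq_0_locally_const:
  fixes \<phi> :: "'e::euclidean_space \<Rightarrow> real"
  assumes "open S" "z \<in> S" "\<And>y. y \<in> S \<Longrightarrow> \<phi> y = c"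
  shows "nabla \<phi> z = 0"
proof (rule nablaI)
  have "((\<lambda>z. c) has_derivative (\<lambda>h. 0 \<bullet> h)) (at z)" by simp
  then show "(\<phi> has_derivative (\<lambda>h. 0 \<bullet> h)) (at z)"
    by (rule has_derivative_transform_within_open[OF _ assms(1,2)]) (use assms(3) in auto)
qed

lemma nabla_eq_0_outside:
  fixes \<phi> :: "'e::euclidean_space \<Rightarrow> real"
  assumes "closed K" "\<And>z. z \<notin> K \<Longrightarrow> \<phi> z = 0" "z \<notin> K"
  shows "nabla \<phi> z = 0"
  by (rule nabla_eq_0_locally_const[of "- K" _ _ 0]) (use assms in auto)

lemma test_on_nabla:
  assumes "test_on S \<phi>" shows "test_on S (\<lambda>z. nabla \<phi> z \<bullet> h)"
proof -
  obtain K where K: "compact K" "K \<subseteq> S" "\<And>z. z \<notin> K \<Longrightarrow> \<phi> z = 0" using test_onE[OF assms] by blast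
  have "nabla \<phi> z \<bullet> h = 0" if "z \<notin> K" for z
    using nabla_eq_0_outside[OF compact_imp_closed[OF K(1)], of \<phi> z] K(3) that by simp
  then show ?thesis unfolding test_on_def
    using K smooth_nabla_inner[OF test_on_smooth[OF assms]] by blast
qed

lemma test_on_bounded:
  fixes \<phi> :: "'e::euclidean_space \<Rightarrow> real"
  assumes "test_on S \<phi>"
  obtains B where "B \<ge> 0" "\<And>z. \<bar>\<phi> z\<bar> \<le> B"
proof -
  obtain K where K: "compact K" "K \<subseteq> S" "\<And>z. z \<notin> K \<Longrightarrow> \<phi> z = 0" using test_onE[OF assms] by blast
  have "compact (\<phi> ` K)"
    by (rule compact_continuous_image[OF smooth_continuous_on[OF test_on_smooth[OF assms]] K(1)])
  then obtain B where B: "\<And>y. y \<in> \<phi> ` K \<Longrightarrow> norm y \<le> B"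
    using compact_imp_bounded[of "\<phi> ` K"] unfolding bounded_iff by blast
  show thesis
  proof (rule that[of "max B 0"])
    fix z show "\<bar>\<phi> z\<bar> \<le> max B 0" using B[of "\<phi> z"] K(3)[of z] by (cases "z \<in> K") auto
  qed simp
qed

lemma nabla_bounded:
  fixes \<phi> :: "'e::euclidean_space \<Rightarrow> real"
  assumes "test_on S \<phi>"
  obtains B where "B \<ge> 0" "\<And>z. norm (nabla \<phi> z) \<le> B"
proof -
  have "\<exists>B\<ge>0. \<forall>z. \<bar>nabla \<phi> z \<bullet> i\<bar> \<le> B" for i
    by (rule test_on_bounded[OF test_on_nabla[OF assms, of i]]) blast
  then have "\<forall>i. \<exists>B\<ge>0. \<forall>z. \<bar>nabla \<phi> z \<bullet> i\<bar> \<le> B" by blast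
  from choice[OF this] obtain B
    where B: "\<And>i. B i \<ge> 0" "\<And>i z. \<bar>nabla \<phi> z \<bullet> i\<bar> \<le> B i" by blast
  have "norm (nabla \<phi> z) \<le> (\<Sum>i\<in>Basis. B i)" for z
    by (rule order_trans[OF norm_le_l1]) (intro sum_mono B)
  then show thesis using that[of "\<Sum>i\<in>Basis. B i"] B(1) by (simp add: sum_nonneg)
qed

lemma onorm_inner_le: "onorm (\<lambda>h. a \<bullet> h) \<le> norm (a :: 'e::euclidean_space)"
  by (rule onorm_le) (simp add: Cauchy_Schwarz_ineq2)

lemma Lipschitz_of_nabla_bound:
  fixes \<phi> :: "'e::euclidean_space \<Rightarrow> real"
  assumes "smooth \<phi>" "\<And>z. norm (nabla \<phi> z) \<le> B"
  shows "\<bar>\<phi> x - \<phi> y\<bar> \<le> B * norm (x - y)"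
  using differentiable_bound[of UNIV \<phi> "\<lambda>z h. nabla \<phi> z \<bullet> h" B x y]
    smooth_has_nabla[OF assms(1)] order_trans[OF onorm_inner_le assms(2)] by simp

lemma test_on_Lipschitz:
  fixes \<phi> :: "'e::euclidean_space \<Rightarrow> real"
  assumes "test_on S \<phi>"
  obtains B where "B \<ge> 0" "\<And>x y. \<bar>\<phi> x - \<phi> y\<bar> \<le> B * norm (x - y)"
proof -
  obtain B where "B \<ge> 0" "\<And>z. norm (nabla \<phi> z) \<le> B" using nabla_bounded[OF assms] by blast
  then show thesis using that Lipschitz_of_nabla_bound[OF test_on_smooth[OF assms]] by blast
qed

lemma nabla_Lipschitz:
  fixes \<phi> :: "'e::euclidean_space \<Rightarrow> real"
  assumes "test_on S \<phi>"
  obtains B where "B \<ge> 0" "\<And>x y. norm (nabla \<phi> x - nabla \<phi> y) \<le> B * norm (x - y)"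
proof -
  have "\<exists>B\<ge>0. \<forall>x y. \<bar>nabla \<phi> x \<bullet> i - nabla \<phi> y \<bullet> i\<bar> \<le> B * norm (x - y)" for i
    by (rule test_on_Lipschitz[OF test_on_nabla[OF assms, of i]]) blast
  then have "\<forall>i. \<exists>B\<ge>0. \<forall>x y. \<bar>nabla \<phi> x \<bullet> i - nabla \<phi> y \<bullet> i\<bar> \<le> B * norm (x - y)" by blast
  from choice[OF this] obtain B where B: "\<And>i. B i \<ge> 0"
    "\<And>i x y. \<bar>nabla \<phi> x \<bullet> i - nabla \<phi> y \<bullet> i\<bar> \<le> B i * norm (x - y)" by blast
  have "norm (nabla \<phi> x - nabla \<phi> y) \<le> (\<Sum>i\<in>Basis. B i) * norm (x - y)" for x y
    by (rule order_trans[OF norm_le_l1])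
      (simp only: sum_distrib_right inner_diff_left, intro sum_mono B)
  then show thesis using that[of "\<Sum>i\<in>Basis. B i"] B(1) by (simp add: sum_nonneg)
qed

text \<open>Mean value inequality for \<open>\<phi>\<close> minus its linearisation, on the ball of
  radius \<open>norm h\<close> around \<open>z\<close>, where the Lipschitz gradient bounds the
  derivative by \<open>B * norm h\<close>. Uniformity in \<open>z\<close> is what convolutions and
  second differences need.\<close>

lemma test_on_Taylor:
  fixes \<phi> :: "'e::euclidean_space \<Rightarrow> real"
  assumes "test_on S \<phi>"
  obtains B where "B \<ge> 0" "\<And>z h. \<bar>\<phi> (z + h) - \<phi> z - nabla \<phi> z \<bullet> h\<bar> \<le> B * (norm h)\<^sup>2"
proof -
  obtain B where B: "B \<ge> 0" "\<And>x y. norm (nabla \<phi> x - nabla \<phi> y) \<le> B * norm (x - y)"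
    using nabla_Lipschitz[OF assms] by blast
  have "\<bar>\<phi> (z + h) - \<phi> z - nabla \<phi> z \<bullet> h\<bar> \<le> B * (norm h)\<^sup>2" for z h
  proof -
    define g where "g y = \<phi> y - nabla \<phi> z \<bullet> y" for y
    have "norm (g (z + h) - g z) \<le> (B * norm h) * norm ((z + h) - z)"
    proof (rule differentiable_bound[of "cball z (norm h)"])
      fix y assume y: "y \<in> cball z (norm h)"
      have "(g has_derivative (\<lambda>k. nabla \<phi> y \<bullet> k - nabla \<phi> z \<bullet> k)) (at y)"
        unfolding g_def
        by (intro derivative_intros smooth_has_nabla test_on_smooth[OF assms])
      then show "(g has_derivative (\<lambda>k. (nabla \<phi> y - nabla \<phi> z) \<bullet> k)) (at y within cball z (norm h))"
        by (simp add: inner_diff_left has_derivative_at_withinI)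
      have "norm (nabla \<phi> y - nabla \<phi> z) \<le> B * norm h"
        by (rule order_trans[OF B(2)])
          (use y B(1) in \<open>auto simp: dist_norm norm_minus_commute intro: mult_left_mono\<close>)
      then show "onorm (\<lambda>k. (nabla \<phi> y - nabla \<phi> z) \<bullet> k) \<le> B * norm h" by (rule order_trans[OF onorm_inner_le])
    qed (auto simp: dist_norm)
    then show ?thesis by (simp add: g_def inner_add_right power2_eq_square algebra_simps)
  qed
  then show thesis using that B(1) by blast
qed

text \<open>The first-order terms of two Taylor expansions cancel. This is the bound that controls
  the singular part of a Levy operator.\<close>

lemma test_on_second_difference:
  fixes \<phi> :: "'e::euclidean_space \<Rightarrow> real"
  assumes "test_on S \<phi>"
  obtains B where "B \<ge> 0" "\<And>z h. \<bar>\<phi> (z + h) + \<phi> (z - h) - 2 * \<phi> z\<bar> \<le> B * (norm h)\<^sup>2"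
proof -
  obtain B where B: "B \<ge> 0" "\<And>z h. \<bar>\<phi> (z + h) - \<phi> z - nabla \<phi> z \<bullet> h\<bar> \<le> B * (norm h)\<^sup>2"
    using test_on_Taylor[OF assms] by blast
  have "\<bar>\<phi> (z + h) + \<phi> (z - h) - 2 * \<phi> z\<bar> \<le> (2 * B) * (norm h)\<^sup>2" for z h
    using B(2)[of z h] B(2)[of z "- h"] by simp
  then show thesis using that[of "2 * B"] B(1) by simp
qed

section \<open>Mollifiers, cut-off functions and partitions of unity\<close>

lemma lborel_distr_reflect:
  fixes z :: "'e::euclidean_space"
  shows "distr lborel borel (\<lambda>x. z - x) = lborel"
  by (subst (2) lborel_affine[of "-1" z]) (simp_all add: density_1)

lemma nn_integral_lborel_reflect:
  fixes z :: "'e::euclidean_space"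
  assumes [measurable]: "f \<in> borel_measurable borel"
  shows "(\<integral>\<^sup>+ y. f (z - y) \<partial>lborel) = (\<integral>\<^sup>+ y. f y \<partial>lborel)"
  by (subst (2) lborel_distr_reflect[of z, symmetric]) (simp add: nn_integral_distr)

lemma integral_lborel_reflect:
  fixes z :: "'e::euclidean_space" and f :: "'e \<Rightarrow> 'b::{banach, second_countable_topology}"
  assumes [measurable]: "f \<in> borel_measurable borel"
  shows "(LINT y|lborel. f (z - y)) = (LINT y|lborel. f y)"
  by (subst (2) lborel_distr_reflect[of z, symmetric]) (simp add: integral_distr)

lemma integrable_lborel_reflect:
  fixes z :: "'e::euclidean_space" and f :: "'e \<Rightarrow> 'b::{banach, second_countable_topology}"
  assumes "integrable lborel f"
  shows "integrable lborel (\<lambda>y. f (z - y))"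
proof -
  have "integrable (distr lborel borel (\<lambda>x. z - x)) f" using assms by (simp add: lborel_distr_reflect)
  then show ?thesis by (rule integrable_distr[rotated]) simp
qed

lemma nn_integral_lborel_translate:
  fixes c :: "'e::euclidean_space"
  assumes [measurable]: "f \<in> borel_measurable borel"
  shows "(\<integral>\<^sup>+ y. f (c + y) \<partial>lborel) = (\<integral>\<^sup>+ y. f y \<partial>lborel)"
  by (subst (2) lborel_distr_plus[of c, symmetric]) (simp add: nn_integral_distr)

lemma integrable_bounded_support:
  fixes f :: "'e::euclidean_space \<Rightarrow> 'b::{banach, second_countable_topology}"
  assumes "f \<in> borel_measurable borel" "bounded K" "\<And>z. z \<notin> K \<Longrightarrow> f z = 0" "\<And>z. norm (f z) \<le> B"
  shows "integrable lborel f"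
proof -
  obtain R x where R: "K \<subseteq> cball x R" using assms(2) bounded_subset_cball by blast
  show ?thesis
    by (rule integrableI_bounded_set[where A="cball x R" and B=B])
      (use assms R emeasure_lborel_cball_finite[of x R] in \<open>auto simp: less_top[symmetric] subset_iff intro!: AE_I2\<close>)
qed

lemma smooth_borel_measurable: "smooth f \<Longrightarrow> f \<in> borel_measurable borel"
  by (intro borel_measurable_continuous_onI smooth_continuous_on)

lemma nabla_borel_measurable:
  fixes \<phi> :: "'e::euclidean_space \<Rightarrow> real"
  shows "smooth \<phi> \<Longrightarrow> nabla \<phi> \<in> borel_measurable borel"
  by (intro borel_measurable_continuous_onI continuous_on_nabla)

lemma test_on_integrable:
  fixes \<phi> :: "'e::euclidean_space \<Rightarrow> real"
  assumes "test_on S \<phi>" shows "integrable lborel \<phi>"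
proof -
  obtain K where K: "compact K" "K \<subseteq> S" "\<And>z. z \<notin> K \<Longrightarrow> \<phi> z = 0" using test_onE[OF assms] by blast
  obtain B where B: "B \<ge> 0" "\<And>z. \<bar>\<phi> z\<bar> \<le> B" using test_on_bounded[OF assms] by blast
  show ?thesis
    by (rule integrable_bounded_support[OF _ compact_imp_bounded[OF K(1)], of _ B])
      (use K B smooth_borel_measurable[OF test_on_smooth[OF assms]] in auto)
qed

lemma norm_nabla_integrable:
  assumes "test_on S \<phi>" shows "integrable lborel (\<lambda>z. norm (nabla \<phi> z))"
proof -
  obtain K where K: "compact K" "K \<subseteq> S" "\<And>z. z \<notin> K \<Longrightarrow> \<phi> z = 0" using test_onE[OF assms] by blast
  obtain B where B: "B \<ge> 0" "\<And>z. norm (nabla \<phi> z) \<le> B" using nabla_bounded[OF assms] by blast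
  show ?thesis
    by (rule integrable_bounded_support[OF _ compact_imp_bounded[OF K(1)], where B=B])
      (use B nabla_borel_measurable[OF test_on_smooth[OF assms]] nabla_eq_0_outside[OF compact_imp_closed[OF K(1)] K(3)] in auto)
qed

text \<open>A quadratic remainder is enough for differentiability. One may then differentiate under
  the integral sign by integrating a uniform Taylor bound, without dominated convergence.\<close>

lemma has_derivative_quadratic:
  fixes f :: "'e::real_normed_vector \<Rightarrow> 'f::real_normed_vector"
  assumes "bounded_linear L" "\<And>h. norm (f (x + h) - f x - L h) \<le> B * (norm h)\<^sup>2"
  shows "(f has_derivative L) (at x)"
  unfolding has_derivative_at
proof
  show "(\<lambda>h. norm (f (x + h) - f x - L h) / norm h) \<midarrow>0\<rightarrow> 0"
  proof (rule Lim_null_comparison)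
    show "((\<lambda>h. B * norm h) \<longlongrightarrow> 0) (at (0::'e))"
      by (rule tendsto_eq_intros refl)+ simp
    show "\<forall>\<^sub>F h in at 0. norm (norm (f (x + h) - f x - L h) / norm h) \<le> B * norm h"
    proof (rule always_eventually, rule allI)
      fix h :: 'e
      show "norm (norm (f (x + h) - f x - L h) / norm h) \<le> B * norm h"
        using assms(2)[of h] by (cases "h = 0") (auto simp: divide_simps power2_eq_square mult.assoc)
    qed
  qed
qed (rule assms)

context
  fixes g \<rho> :: "'e::euclidean_space \<Rightarrow> real"
  assumes g: "integrable lborel g"
begin

lemma convolution_integrable:
  fixes r :: "'e \<Rightarrow> 'b::{banach, second_countable_topology}"
  assumes r: "continuous_on UNIV r" "\<And>x. norm (r x) \<le> B"
  shows "integrable lborel (\<lambda>y. g y *\<^sub>R r (x - y))"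
proof (rule Bochner_Integration.integrable_bound)
  show "integrable lborel (\<lambda>y. B * g y)" using g by simp
  have [measurable]: "r \<in> borel_measurable borel" using r(1) by (rule borel_measurable_continuous_onI)
  have [measurable]: "g \<in> borel_measurable borel" using g by auto
  show "(\<lambda>y. g y *\<^sub>R r (x - y)) \<in> borel_measurable lborel" by measurable
  have "B \<ge> 0" using r(2)[of 0] norm_ge_zero[of "r 0"] by linarith
  then have "norm (g y *\<^sub>R r (x - y)) \<le> norm (B * g y)" for y
    using mult_left_mono[OF r(2)[of "x - y"], of "\<bar>g y\<bar>"] by (simp add: abs_mult mult.commute)
  then show "AE y in lborel. norm (g y *\<^sub>R r (x - y)) \<le> norm (B * g y)" by simp
qed

lemma convolution_has_derivative:
  assumes \<rho>: "test_on S \<rho>"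
  shows "((\<lambda>x. LINT y|lborel. g y * \<rho> (x - y)) has_derivative
           (\<lambda>h. (LINT y|lborel. g y *\<^sub>R nabla \<rho> (x - y)) \<bullet> h)) (at x)"
    and "(LINT y|lborel. g y *\<^sub>R nabla \<rho> (x - y)) \<bullet> h = (LINT y|lborel. g y * (nabla \<rho> (x - y) \<bullet> h))"
proof -
  obtain B where B: "B \<ge> 0" "\<And>z. \<bar>\<rho> z\<bar> \<le> B" using test_on_bounded[OF \<rho>] by blast
  obtain D where D: "D \<ge> 0" "\<And>z. norm (nabla \<rho> z) \<le> D" using nabla_bounded[OF \<rho>] by blast
  obtain C where C: "C \<ge> 0" "\<And>z h. \<bar>\<rho> (z + h) - \<rho> z - nabla \<rho> z \<bullet> h\<bar> \<le> C * (norm h)\<^sup>2"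
    using test_on_Taylor[OF \<rho>] by blast
  have i0: "integrable lborel (\<lambda>y. g y * \<rho> (x - y))" for x
    using convolution_integrable[of \<rho> B x] smooth_continuous_on[OF test_on_smooth[OF \<rho>]] B by simp
  have i1: "integrable lborel (\<lambda>y. g y *\<^sub>R nabla \<rho> (x - y))" for x
    using convolution_integrable[of "nabla \<rho>" D x] continuous_on_nabla[OF test_on_smooth[OF \<rho>]] D by simp
  have i2: "integrable lborel (\<lambda>y. g y * (nabla \<rho> (x - y) \<bullet> h))" for x h
    using integrable_inner_left[of h, OF i1[of x]] by simp
  show eq: "(LINT y|lborel. g y *\<^sub>R nabla \<rho> (x - y)) \<bullet> h = (LINT y|lborel. g y * (nabla \<rho> (x - y) \<bullet> h))" for x h
    using integral_inner_left[of h, OF i1[of x]] by simp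
  show "((\<lambda>x. LINT y|lborel. g y * \<rho> (x - y)) has_derivative
           (\<lambda>h. (LINT y|lborel. g y *\<^sub>R nabla \<rho> (x - y)) \<bullet> h)) (at x)"
  proof (rule has_derivative_quadratic)
    show "bounded_linear (\<lambda>h. (LINT y|lborel. g y *\<^sub>R nabla \<rho> (x - y)) \<bullet> h)"
      by (rule bounded_linear_inner_right)
    fix h
    have fe: "(\<lambda>y. g y * \<rho> (x + h - y) - g y * \<rho> (x - y) - g y * (nabla \<rho> (x - y) \<bullet> h))
      = (\<lambda>y. g y * (\<rho> (x - y + h) - \<rho> (x - y) - nabla \<rho> (x - y) \<bullet> h))"
      by (rule ext) (simp add: right_diff_distrib add.commute add_diff_eq)
    have "(LINT y|lborel. g y * \<rho> (x + h - y)) - (LINT y|lborel. g y * \<rho> (x - y))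
        - (LINT y|lborel. g y *\<^sub>R nabla \<rho> (x - y)) \<bullet> h
      = (LINT y|lborel. g y * \<rho> (x + h - y) - g y * \<rho> (x - y) - g y * (nabla \<rho> (x - y) \<bullet> h))"
      unfolding eq by (simp add: Bochner_Integration.integral_diff i0 i2)
    also have "\<dots> = (LINT y|lborel. g y * (\<rho> (x - y + h) - \<rho> (x - y) - nabla \<rho> (x - y) \<bullet> h))"
      unfolding fe ..
    also have "norm \<dots> \<le> (LINT y|lborel. \<bar>g y\<bar> * (C * (norm h)\<^sup>2))"
    proof (rule Bochner_Integration.integral_norm_bound_integral)
      show "integrable lborel (\<lambda>y. g y * (\<rho> (x - y + h) - \<rho> (x - y) - nabla \<rho> (x - y) \<bullet> h))"
        unfolding fe[symmetric]
        by (intro Bochner_Integration.integrable_diff i0 i2)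
      show "integrable lborel (\<lambda>y. \<bar>g y\<bar> * (C * (norm h)\<^sup>2))" using g by simp
      show "norm (g y * (\<rho> (x - y + h) - \<rho> (x - y) - nabla \<rho> (x - y) \<bullet> h)) \<le> \<bar>g y\<bar> * (C * (norm h)\<^sup>2)" for y
        unfolding real_norm_def abs_mult by (intro mult_left_mono C) simp
    qed
    also have "\<dots> = ((LINT y|lborel. \<bar>g y\<bar>) * C) * (norm h)\<^sup>2" by simp
    finally show "norm ((LINT y|lborel. g y * \<rho> (x + h - y)) - (LINT y|lborel. g y * \<rho> (x - y))
        - (LINT y|lborel. g y *\<^sub>R nabla \<rho> (x - y)) \<bullet> h) \<le> ((LINT y|lborel. \<bar>g y\<bar>) * C) * (norm h)\<^sup>2" .
  qed
qed

lemma nabla_convolution: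
  assumes "test_on S \<rho>"
  shows "nabla (\<lambda>x. LINT y|lborel. g y * \<rho> (x - y)) x = (LINT y|lborel. g y *\<^sub>R nabla \<rho> (x - y))"
  by (rule nablaI[OF convolution_has_derivative(1)[OF assms]])

end

text \<open>The derivative in direction \<open>v\<close> is the convolution of \<open>g\<close> with
  the directional derivative of the kernel, again a test function. Hence the induction runs over all
  kernels at once, and \<open>g\<close> is never differentiated.\<close>

lemma smooth_convolution:
  fixes g \<rho> :: "'e::euclidean_space \<Rightarrow> real"
  assumes g: "integrable lborel g" and "test_on S \<rho>"
  shows "smooth (\<lambda>x. LINT y|lborel. g y * \<rho> (x - y))"
proof -
  have "Ck_on k UNIV (\<lambda>x. LINT y|lborel. g y * \<rho> (x - y))" if "test_on S \<rho>" for k \<rho>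
    using that
  proof (induction k arbitrary: \<rho>)
    case 0
    have "isCont (\<lambda>x. LINT y|lborel. g y * \<rho> (x - y)) x" for x
      by (rule has_derivative_continuous[OF convolution_has_derivative(1)[OF g 0]])
    then show ?case by (simp add: continuous_at_imp_continuous_on)
  next
    case (Suc k)
    show ?case unfolding Ck_on_Suc_UNIV
    proof (intro exI conjI allI)
      fix x
      show "((\<lambda>x. LINT y|lborel. g y * \<rho> (x - y)) has_derivative
           (\<lambda>h. (LINT y|lborel. g y *\<^sub>R nabla \<rho> (x - y)) \<bullet> h)) (at x)"
        by (rule convolution_has_derivative(1)[OF g Suc.prems])
      fix v
      show "Ck_on k UNIV (\<lambda>x. (LINT y|lborel. g y *\<^sub>R nabla \<rho> (x - y)) \<bullet> v)"
        unfolding convolution_has_derivative(2)[OF g Suc.prems]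
        by (rule Suc.IH[OF test_on_nabla[OF Suc.prems]])
    qed
  qed
  then show ?thesis using assms(2) by (simp add: smooth_def)
qed

text \<open>The support set is arbitrary and need not contain the origin: near the boundary, kernels
  are used that are concentrated around a nonzero displacement.\<close>

definition mollifier :: "'e::euclidean_space set \<Rightarrow> ('e \<Rightarrow> real) \<Rightarrow> bool" where
  "mollifier S \<rho> \<longleftrightarrow> test_on S \<rho> \<and> (\<forall>z. 0 \<le> \<rho> z) \<and> (LINT z|lborel. \<rho> z) = 1"

lemma mollifierD:
  assumes "mollifier S \<rho>"
  shows "test_on S \<rho>" "0 \<le> \<rho> z" "(LINT z|lborel. \<rho> z) = 1" "\<rho> z \<noteq> 0 \<Longrightarrow> z \<in> S"
proof -
  show t: "test_on S \<rho>" and "0 \<le> \<rho> z" "(LINT z|lborel. \<rho> z) = 1" using assms by (auto simp: mollifier_def)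
  obtain K where "compact K" "K \<subseteq> S" "\<And>z. z \<notin> K \<Longrightarrow> \<rho> z = 0" using test_onE[OF t] by blast
  then show "\<rho> z \<noteq> 0 \<Longrightarrow> z \<in> S" by auto
qed

lemma mollifier_mono: "mollifier S \<rho> \<Longrightarrow> S \<subseteq> S' \<Longrightarrow> mollifier S' \<rho>"
  unfolding mollifier_def using test_on_mono by blast

lemma ex_mollifier:
  fixes c :: "'e::euclidean_space"
  assumes "r > 0"
  obtains \<rho> where "mollifier (ball c r) \<rho>"
proof -
  \<comment> \<open>The bump lives on the ball of half the radius, which leaves room for a compact
    support inside the open ball.\<close>
  define \<beta> where "\<beta> z = flat_exp 0 ((r / 2)\<^sup>2 - (z - c) \<bullet> (z - c))" for z
  have lin: "bounded_linear (\<lambda>z::'e. z)" by simp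
  have "smooth (\<lambda>z. (z - c) \<bullet> (z - c))"
    using smooth_comp_affine[OF lin smooth_inner, of "- c"] by simp
  then have sm: "smooth \<beta>"
    unfolding \<beta>_def by (intro smooth_comp_real[OF smooth_flat_exp] smooth_diff smooth_const)
  have inner: "(z - c) \<bullet> (z - c) < (r / 2)\<^sup>2 \<longleftrightarrow> norm (z - c) < r / 2" for z
    using assms norm_lt_square[of "z - c" "r / 2"] by simp
  have pos: "\<beta> z > 0 \<longleftrightarrow> z \<in> ball c (r / 2)" for z
    using inner[of z] by (auto simp: \<beta>_def flat_exp_def dist_norm norm_minus_commute)
  have ge: "\<beta> z \<ge> 0" for z by (simp add: \<beta>_def flat_exp_def)
  have t: "test_on (ball c r) \<beta>" unfolding test_on_def
  proof (intro conjI sm exI[of _ "cball c (r/2)"])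
    show "\<forall>z. z \<notin> cball c (r / 2) \<longrightarrow> \<beta> z = 0" 
    proof (intro allI impI)
      fix z assume "z \<notin> cball c (r / 2)"
      then have "\<not> \<beta> z > 0" unfolding pos by auto
      then show "\<beta> z = 0" using ge[of z] by simp
    qed
  qed (use assms in auto)
  have "(LINT z|lborel. \<beta> z) \<noteq> 0"
  proof
    assume "(LINT z|lborel. \<beta> z) = 0"
    then have "AE z in lborel. \<beta> z = 0"
      using integral_nonneg_eq_0_iff_AE[OF test_on_integrable[OF t]] ge by simp
    then have "AE z in lborel. z \<notin> ball c (r / 2)"
      by eventually_elim (use pos in force)
    then have "emeasure lborel (ball c (r / 2)) = 0"
      by (subst (asm) AE_iff_measurable[of "ball c (r/2)"]) auto
    moreover have "0 < unit_ball_vol (real DIM('e)) * (r / 2) ^ DIM('e)"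
      using assms by (intro mult_pos_pos unit_ball_vol_pos zero_less_power) auto
    ultimately show False using assms emeasure_ball[of "r / 2" c] by (simp add: ennreal_eq_0_iff)
  qed
  then have N: "(LINT z|lborel. \<beta> z) > 0" using ge by (simp add: less_le integral_nonneg_AE)
  show thesis
  proof (rule that[of "\<lambda>z. inverse (LINT z|lborel. \<beta> z) * \<beta> z"])
    show "mollifier (ball c r) (\<lambda>z. inverse (LINT z|lborel. \<beta> z) * \<beta> z)"
      unfolding mollifier_def using N ge test_on_mult(1)[OF t smooth_const] by simp
  qed
qed

text \<open>The indicator of the e/2-neighbourhood of \<open>K\<close> is mollified at scale e/4.
  The result is 1 on the e/4-neighbourhood \<open>N\<close> and 0 off the closed 3e/4-neighbourhood.
  Being 1 on an open set around \<open>K\<close>, it still takes the value 1 at slightly displaced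
  points, and its gradient vanishes near \<open>K\<close>.\<close>

lemma ex_cutoff:
  fixes K V :: "'e::euclidean_space set"
  assumes "compact K" "open V" "K \<subseteq> V"
  obtains \<theta> N where "test_on V \<theta>" "\<And>z. 0 \<le> \<theta> z" "\<And>z. \<theta> z \<le> 1"
    "open N" "K \<subseteq> N" "\<And>z. z \<in> N \<Longrightarrow> \<theta> z = 1"
proof -
  obtain e where e: "e > 0" "(\<Union>x\<in>K. ball x e) \<subseteq> V"
    using compact_subset_open_imp_ball_epsilon_subset[OF assms] by blast
  obtain \<rho> where \<rho>: "mollifier (ball (0::'e) (e / 4)) \<rho>" using ex_mollifier[of "e / 4" 0] e by auto
  note \<rho>D = mollifierD[OF \<rho>]
  define A where "A = (\<Union>x\<in>K. ball x (e / 2))"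
  define N where "N = (\<Union>x\<in>K. ball x (e / 4))"
  define K1 where "K1 = {x + y |x y. x \<in> K \<and> y \<in> cball 0 (3 * e / 4)}"
  define \<theta> where "\<theta> z = (LINT y|lborel. indicator A y * \<rho> (z - y))" for z
  have A: "open A" "bounded A"
  proof -
    show "open A" by (auto simp: A_def)
    have "bounded {x + y |x y. x \<in> K \<and> y \<in> cball 0 (e / 2)}"
      by (rule compact_imp_bounded[OF compact_sums[OF assms(1) compact_cball]])
    then show "bounded A"
    proof (rule bounded_subset)
      show "A \<subseteq> {x + y |x y. x \<in> K \<and> y \<in> cball 0 (e / 2)}"
      proof
        fix y assume "y \<in> A"
        then obtain x where "x \<in> K" "dist x y < e / 2" by (auto simp: A_def)
        then show "y \<in> {x + y |x y. x \<in> K \<and> y \<in> cball 0 (e / 2)}"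
          by (intro CollectI exI[of _ x] exI[of _ "y - x"]) (auto simp: dist_norm norm_minus_commute)
      qed
    qed
  qed
  have [measurable]: "A \<in> sets borel" using A(1) by simp
  have iA: "integrable lborel (indicator A :: 'e \<Rightarrow> real)"
    by (rule integrable_bounded_support[OF _ A(2), where B=1]) (auto split: split_indicator)
  have \<rho>z: "(LINT y|lborel. \<rho> (z - y)) = 1" "integrable lborel (\<lambda>y. \<rho> (z - y))" for z
    using integral_lborel_reflect[of \<rho> z] \<rho>D(3) smooth_borel_measurable[OF test_on_smooth[OF \<rho>D(1)]]
      integrable_lborel_reflect[OF test_on_integrable[OF \<rho>D(1)]] by auto
  have i\<theta>: "integrable lborel (\<lambda>y. indicator A y * \<rho> (z - y))" for z
    using integrable_mult_indicator[OF _ \<rho>z(2), of A] by simp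
  have 0: "0 \<le> \<theta> z" for z
    unfolding \<theta>_def by (intro Bochner_Integration.integral_nonneg) (simp add: \<rho>D(2))
  have 1: "\<theta> z \<le> 1" for z
  proof -
    have "\<theta> z \<le> (LINT y|lborel. \<rho> (z - y))"
      unfolding \<theta>_def
      by (rule integral_mono[OF i\<theta> \<rho>z(2)]) (use \<rho>D(2) in \<open>auto split: split_indicator\<close>)
    then show ?thesis using \<rho>z by simp
  qed
  have eq1: "\<theta> z = 1" if z: "z \<in> N" for z
  proof -
    have "indicator A y * \<rho> (z - y) = \<rho> (z - y)" for y
    proof (cases "\<rho> (z - y) = 0")
      case False
      then have "z - y \<in> ball 0 (e / 4)" by (rule \<rho>D(4))
      then have *: "dist z y < e / 4" unfolding mem_ball_0 dist_norm .
      obtain x where x: "x \<in> K" "dist x z < e / 4" using z by (auto simp: N_def)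
      have "dist x y < e / 2" using * x(2) dist_triangle[of x y z] by simp
      then have "y \<in> A" using x(1) by (auto simp: A_def)
      then show ?thesis by simp
    qed simp
    then show ?thesis unfolding \<theta>_def by (simp only: \<rho>z)
  qed
  have supp: "\<theta> z = 0" if "z \<notin> K1" for z
  proof -
    have "indicator A y * \<rho> (z - y) = 0" for y
    proof (rule ccontr)
      assume a: "indicator A y * \<rho> (z - y) \<noteq> 0"
      then have "y \<in> A" by (auto split: split_indicator_asm)
      then obtain x where x: "x \<in> K" "dist x y < e / 2" by (auto simp: A_def)
      have "z - y \<in> ball 0 (e / 4)" using a by (intro \<rho>D(4)) auto
      then have "dist y z < e / 4" by (simp add: dist_norm norm_minus_commute)
      then have "dist x z \<le> 3 * e / 4" using x(2) dist_triangle[of x z y] by simp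
      then have "z \<in> K1" unfolding K1_def using x(1)
        by (intro CollectI exI[of _ x] exI[of _ "z - x"]) (auto simp: dist_norm norm_minus_commute)
      then show False using that by simp
    qed
    then show ?thesis unfolding \<theta>_def by (simp only: integral_zero)
  qed
  show thesis
  proof (rule that[of \<theta> N])
    have "compact K1" unfolding K1_def by (rule compact_sums[OF assms(1) compact_cball])
    moreover have "K1 \<subseteq> V"
    proof
      fix z assume "z \<in> K1"
      then obtain x y where z: "z = x + y" "x \<in> K" "norm y \<le> 3 * e / 4" by (auto simp: K1_def)
      then have "z \<in> ball x e" using e(1) by (auto simp: dist_norm)
      then show "z \<in> V" using e(2) z(2) by blast
    qed
    moreover have "smooth \<theta>" unfolding \<theta>_def by (rule smooth_convolution[OF iA \<rho>D(1)])
    ultimately show "test_on V \<theta>" unfolding test_on_def using supp by blast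
    show "open N" by (auto simp: N_def)
    show "K \<subseteq> N" using e(1) by (auto simp: N_def)
  qed (use 0 1 eq1 in auto)
qed

lemma telescoping_complement_prod:
  fixes b :: "nat \<Rightarrow> real"
  shows "(\<Sum>i<n. b i * (\<Prod>j<i. 1 - b j)) = 1 - (\<Prod>j<n. 1 - b j)"
  by (induction n) (auto simp: algebra_simps)

text \<open>The function \<open>\<phi>\<close> is decomposed, rather than 1. Each piece is
  \<open>\<phi>\<close> times one cut-off times the complements of the earlier ones. The sum
  telescopes to \<open>\<phi>\<close> times (1 minus the product of all complements), and that
  product vanishes on the support. No division is involved, so the pieces are visibly
  smooth.\<close>

lemma ex_partition:
  fixes \<phi> :: "'e::euclidean_space \<Rightarrow> real"
  assumes \<phi>: "test_on V \<phi>" "\<And>z. 0 \<le> \<phi> z" and V: "open V"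
    and W: "\<And>z. z \<in> V \<Longrightarrow> open (W z)" "\<And>z. z \<in> V \<Longrightarrow> z \<in> W z"
  shows "\<exists>(n :: nat) \<psi> p. (\<forall>i<n. p i \<in> V \<and> test_on (V \<inter> W (p i)) (\<psi> i)) \<and>
    (\<forall>i z. 0 \<le> \<psi> i z) \<and> (\<forall>z. \<phi> z = (\<Sum>i<n. \<psi> i z))"
proof -
  obtain K where K: "compact K" "K \<subseteq> V" "\<And>z. z \<notin> K \<Longrightarrow> \<phi> z = 0" using test_onE[OF \<phi>(1)] by blast
  have "\<exists>\<theta> N. test_on (V \<inter> W q) \<theta> \<and> (\<forall>z. 0 \<le> \<theta> z \<and> \<theta> z \<le> 1) \<and> open N \<and> q \<in> N \<and> (\<forall>z\<in>N. \<theta> z = 1)"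
    if "q \<in> V" for q
  proof -
    have pre: "compact {q}" "open (V \<inter> W q)" "{q} \<subseteq> V \<inter> W q" using that W[OF that] V by auto
    obtain \<theta> N where "test_on (V \<inter> W q) \<theta>" "\<And>z. 0 \<le> \<theta> z" "\<And>z. \<theta> z \<le> 1"
      "open N" "{q} \<subseteq> N" "\<And>z. z \<in> N \<Longrightarrow> \<theta> z = 1"
      using ex_cutoff[OF pre] by blast
    then show ?thesis by (intro exI[of _ \<theta>] exI[of _ N]) auto
  qed
  then have "\<forall>q\<in>V. \<exists>\<theta> N. test_on (V \<inter> W q) \<theta> \<and> (\<forall>z. 0 \<le> \<theta> z \<and> \<theta> z \<le> 1) \<and> open N \<and> q \<in> N \<and> (\<forall>z\<in>N. \<theta> z = 1)"
    by blast
  from bchoice[OF this] obtain X where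
    "\<forall>q\<in>V. \<exists>N. test_on (V \<inter> W q) (X q) \<and> (\<forall>z. 0 \<le> X q z \<and> X q z \<le> 1) \<and> open N \<and> q \<in> N \<and> (\<forall>z\<in>N. X q z = 1)"
    by blast
  from bchoice[OF this] obtain M where
    M0: "\<forall>q\<in>V. test_on (V \<inter> W q) (X q) \<and> (\<forall>z. 0 \<le> X q z \<and> X q z \<le> 1) \<and> open (M q) \<and> q \<in> M q \<and> (\<forall>z\<in>M q. X q z = 1)"
    by blast
  have M: "test_on (V \<inter> W q) (X q)" "0 \<le> X q z" "X q z \<le> 1" "open (M q)" "q \<in> M q"
    "y \<in> M q \<Longrightarrow> X q y = 1" if "q \<in> V" for q z y
    using bspec[OF M0 that] by auto
  obtain D where D: "D \<subseteq> K" "finite D" "K \<subseteq> (\<Union>q\<in>D. M q)"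
  proof (rule compactE_image[OF K(1), of K M])
    show "open (M q)" if "q \<in> K" for q using M(4)[of q] K(2) that by blast
    show "K \<subseteq> (\<Union>q\<in>K. M q)" using M(5) K(2) by blast
  qed blast
  obtain h where h: "bij_betw h {0..<card D} D" using ex_bij_betw_nat_finite[OF D(2)] by blast
  have hD: "h i \<in> D" if "i < card D" for i using h that by (auto simp: bij_betw_def)
  have hV: "h i \<in> V" if "i < card D" for i using hD[OF that] D(1) K(2) by blast
  define \<psi> where "\<psi> i z = (if i < card D then \<phi> z * (\<Prod>j<i. 1 - X (h j) z) * X (h i) z else 0)" for i z
  have Xs: "smooth (X (h i))" if "i < card D" for i by (rule test_on_smooth[OF M(1)[OF hV[OF that]]])
  show ?thesis
  proof (rule exI[of _ "card D"], rule exI[of _ \<psi>], rule exI[of _ h], intro conjI allI impI)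
    show "h i \<in> V" if "i < card D" for i by (rule hV[OF that])
    show "test_on (V \<inter> W (h i)) (\<psi> i)" if i: "i < card D" for i
    proof -
      have "smooth (\<lambda>z. \<phi> z * (\<Prod>j<i. 1 - X (h j) z))"
        using i by (intro smooth_mult smooth_prod smooth_diff smooth_const Xs test_on_smooth[OF \<phi>(1)]) auto
      then show ?thesis unfolding \<psi>_def using i by (simp add: test_on_mult(1)[OF M(1)[OF hV[OF i]]])
    qed
    show "0 \<le> \<psi> i z" for i z
      unfolding \<psi>_def using \<phi>(2) M(2,3)[OF hV] by (auto intro!: mult_nonneg_nonneg prod_nonneg)
    fix z
    have "(\<Sum>i<card D. \<psi> i z) = \<phi> z * (\<Sum>i<card D. X (h i) z * (\<Prod>j<i. 1 - X (h j) z))"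
      unfolding sum_distrib_left \<psi>_def by (intro sum.cong) auto
    also have "\<dots> = \<phi> z * (1 - (\<Prod>j<card D. 1 - X (h j) z))"
      using telescoping_complement_prod[of "\<lambda>i. X (h i) z"] by simp
    also have "\<dots> = \<phi> z"
    proof (cases "z \<in> K")
      case True
      then obtain q where q: "q \<in> D" "z \<in> M q" using D(3) by blast
      then obtain j where j: "j < card D" "h j = q" using h by (force simp: bij_betw_def)
      have "X q z = 1" using M(6)[of q z] q D(1) K(2) by blast
      then have "(\<Prod>j<card D. 1 - X (h j) z) = 0" using j by (intro prod_zero) auto
      then show ?thesis by simp
    next
      case False
      then show ?thesis using K(3) by simp
    qed
    finally show "\<phi> z = (\<Sum>i<card D. \<psi> i z)" by simp
  qed
qed

section \<open>Kruzhkov fluxes in space-time\<close>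

text \<open>
  The semi-Kruzhkov entropy pair \<open>((\<alpha> - \<beta>)\<^sup>+, sgn\<^sup>+(\<alpha> - \<beta>)(f(\<alpha>) - f(\<beta>)))\<close> as one space-time vector;
  written with \<open>max\<close> it is visibly continuous and telescoping.
\<close>

definition kflux :: "(real \<Rightarrow> 'a::euclidean_space) \<Rightarrow> real \<Rightarrow> real \<Rightarrow> real \<times> 'a" where
  "kflux f \<alpha> \<beta> = (max \<alpha> \<beta> - \<beta>, f (max \<alpha> \<beta>) - f \<beta>)"

text \<open>
  Solutions are continued by the initial datum to negative times, where the flux is switched off.
  The initial condition then becomes part of the differential inequality.
\<close>

definition switched :: "real \<Rightarrow> real \<times> 'a \<Rightarrow> real \<times> 'a::euclidean_space" where
  "switched t p = (fst p, (if t > 0 then 1 else 0) *\<^sub>R snd p)"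

text \<open>Nonnegativity for all nonnegative \<open>\<phi>\<close> is the weak form of a
  nonpositive space-time divergence of the Kruzhkov flux. An entropy inequality is an upper bound
  for the negative of this quantity.\<close>

definition flux_int ::
  "(real \<times> 'a::euclidean_space) set \<Rightarrow> (real \<Rightarrow> 'a) \<Rightarrow> (real \<times> 'a \<Rightarrow> real) \<Rightarrow> (real \<times> 'a \<Rightarrow> real) \<Rightarrow>
    (real \<times> 'a \<Rightarrow> real) \<Rightarrow> real" where
  "flux_int Q f X Y \<phi> =
    (LINT z|lborel. indicator Q z * (kflux f (X z) (Y z) \<bullet> switched (fst z) (nabla \<phi> z)))"

lemma kflux_self_le: "\<alpha> \<le> \<beta> \<Longrightarrow> kflux f \<alpha> \<beta> = 0"
  by (simp add: kflux_def max_def zero_prod_def)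

text \<open>The substitution of -u for u leads to the flux \<open>\<lambda>s. - f (- s)\<close> and
  exchanges sub- and supersolutions. Supersolutions are therefore expressed throughout as reflected
  subsolutions.\<close>

lemma kflux_reflect: "kflux (\<lambda>s. - f (- s)) (- \<beta>) (- \<alpha>) = kflux f \<alpha> \<beta>"
  by (auto simp: kflux_def max_def)

lemma kflux_max_right: "kflux f \<alpha> (max \<beta> c) = kflux f (max \<alpha> c) (max \<beta> c)"
  by (simp add: kflux_def max.left_commute max.commute)

text \<open>On this side truncation is not free: telescoping through \<open>max \<beta> c\<close>
  leaves the flux of the constant \<open>c\<close> against \<open>\<beta>\<close>. This surplus is
  the term that has to be controlled in the boundary layer.\<close>

lemma kflux_max_left: "kflux f (max \<alpha> c) \<beta> = kflux f (max \<alpha> c) (max \<beta> c) + kflux f c \<beta>"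
  by (simp add: kflux_def max.left_commute max.commute max.assoc)

text \<open>The interval from \<open>\<beta>\<close> to \<open>\<alpha>\<close> is cut at
  \<open>c\<close> and \<open>d\<close>; the identity is additivity of increments over consecutive
  intervals.\<close>

lemma kflux_three_levels:
  assumes "c \<le> d"
  shows "kflux f \<alpha> \<beta> = kflux f (max \<alpha> d) (max \<beta> d) + kflux f (min \<alpha> c) (min \<beta> c)
    + kflux f (max c (min \<alpha> d)) (max c (min \<beta> d))"
  using assms by (auto simp: kflux_def max_def min_def)

lemma switched_add: "switched t (p + q) = switched t p + switched t q"
  by (simp add: switched_def scaleR_add_right)

lemma switched_scaleR: "switched t (c *\<^sub>R p) = c *\<^sub>R switched t p"
  by (simp add: switched_def)

lemma switched_0 [simp]: "switched t 0 = 0"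
  by (simp add: switched_def zero_prod_def)

lemma norm_switched_le: "norm (switched t p) \<le> norm p"
  unfolding switched_def norm_prod_def by (intro real_sqrt_le_mono) auto

lemma inner_switched: "x \<bullet> switched t p = switched t x \<bullet> p"
  by (auto simp: switched_def inner_prod_def)

lemma switched_measurable [measurable]:
  assumes [measurable]: "t \<in> borel_measurable M" "p \<in> borel_measurable M"
  shows "(\<lambda>x. switched (t x) (p x :: real \<times> 'a::euclidean_space)) \<in> borel_measurable M"
proof -
  have [measurable]: "(\<lambda>x. snd (p x)) \<in> borel_measurable M" "(\<lambda>x. fst (p x)) \<in> borel_measurable M"
    by (rule measurable_compose[OF assms(2)], simp add: borel_measurable_continuous_onI continuous_on_snd continuous_on_fst)+
  show ?thesis unfolding switched_def by measurable
qed

context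
  fixes f :: "real \<Rightarrow> 'a::euclidean_space"
  assumes f: "continuous_on UNIV f"
begin

lemma kflux_measurable:
  assumes [measurable]: "X \<in> borel_measurable N" "Y \<in> borel_measurable N"
  shows "(\<lambda>x. kflux f (X x) (Y x)) \<in> borel_measurable N"
proof -
  have [measurable]: "f \<in> borel_measurable borel" using f by (rule borel_measurable_continuous_onI)
  show ?thesis unfolding kflux_def by measurable
qed

text \<open>Uniform continuity in affine form: close points differ by less than
  \<open>\<eta>\<close>, and for distant points the bound of \<open>f\<close> is absorbed into a
  multiple of the distance. An estimate that is affine in the distance can be integrated against a
  kernel.\<close>

lemma continuous_quasi_Lipschitz:
  assumes "\<eta> > 0"
  obtains C where "C \<ge> 0" "\<And>x y. \<bar>x\<bar> \<le> M \<Longrightarrow> \<bar>y\<bar> \<le> M \<Longrightarrow> norm (f x - f y) \<le> \<eta> + C * \<bar>x - y\<bar>"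
proof -
  have cf: "continuous_on {-M..M} f" by (rule continuous_on_subset[OF f]) simp
  have "uniformly_continuous_on {-M..M} f" by (rule compact_uniformly_continuous[OF cf compact_Icc])
  then obtain d where d: "d > 0" "\<And>x y. x \<in> {-M..M} \<Longrightarrow> y \<in> {-M..M} \<Longrightarrow> dist y x < d \<Longrightarrow> dist (f y) (f x) < \<eta>"
    unfolding uniformly_continuous_on_def using assms by blast
  have "bounded (f ` {-M..M})" by (rule compact_imp_bounded[OF compact_continuous_image[OF cf compact_Icc]])
  then obtain B where B: "\<And>x. x \<in> {-M..M} \<Longrightarrow> norm (f x) \<le> B" unfolding bounded_iff by blast
  show thesis
  proof (rule that[of "2 * \<bar>B\<bar> / d"])
    show "2 * \<bar>B\<bar> / d \<ge> 0" using d by simp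
    fix x y :: real assume xy: "\<bar>x\<bar> \<le> M" "\<bar>y\<bar> \<le> M"
    have xyM: "x \<in> {-M..M}" "y \<in> {-M..M}" using xy by (auto simp: abs_le_iff)
    show "norm (f x - f y) \<le> \<eta> + 2 * \<bar>B\<bar> / d * \<bar>x - y\<bar>"
    proof (cases "\<bar>x - y\<bar> < d")
      case True
      then have "dist (f x) (f y) < \<eta>" using d(2)[OF xyM(2,1)] by (simp add: dist_norm)
      moreover have "0 \<le> 2 * \<bar>B\<bar> / d * \<bar>x - y\<bar>" using d(1) by simp
      ultimately show ?thesis by (simp add: dist_norm)
    next
      case False
      have "norm (f x - f y) \<le> 2 * \<bar>B\<bar>"
        using norm_triangle_ineq4[of "f x" "f y"] B[OF xyM(1)] B[OF xyM(2)] by linarith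
      also have "\<dots> \<le> 2 * \<bar>B\<bar> / d * \<bar>x - y\<bar>"
        using False d(1) mult_left_mono[of d "\<bar>x - y\<bar>" "2 * \<bar>B\<bar>"] by (simp add: field_simps)
      finally show ?thesis using assms by simp
    qed
  qed
qed

lemma kflux_quasi_Lipschitz:
  assumes "\<eta> > 0"
  obtains C where "C \<ge> 0"
    "\<And>\<alpha> \<beta> \<alpha>' \<beta>'. \<bar>\<alpha>\<bar> \<le> M \<Longrightarrow> \<bar>\<beta>\<bar> \<le> M \<Longrightarrow> \<bar>\<alpha>'\<bar> \<le> M \<Longrightarrow> \<bar>\<beta>'\<bar> \<le> M \<Longrightarrow>
      norm (kflux f \<alpha> \<beta> - kflux f \<alpha>' \<beta>') \<le> \<eta> + C * (\<bar>\<alpha> - \<alpha>'\<bar> + \<bar>\<beta> - \<beta>'\<bar>)"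
proof -
  obtain C where C: "C \<ge> 0" "\<And>x y. \<bar>x\<bar> \<le> M \<Longrightarrow> \<bar>y\<bar> \<le> M \<Longrightarrow> norm (f x - f y) \<le> \<eta> / 2 + C * \<bar>x - y\<bar>"
    using continuous_quasi_Lipschitz[OF half_gt_zero[OF assms], of M] by blast
  show thesis
  proof (rule that[of "2 * (C + 1)"])
    show "2 * (C + 1) \<ge> 0" using C(1) by simp
    fix \<alpha> \<beta> \<alpha>' \<beta>' :: real
    assume b: "\<bar>\<alpha>\<bar> \<le> M" "\<bar>\<beta>\<bar> \<le> M" "\<bar>\<alpha>'\<bar> \<le> M" "\<bar>\<beta>'\<bar> \<le> M"
    define d where "d = \<bar>\<alpha> - \<alpha>'\<bar> + \<bar>\<beta> - \<beta>'\<bar>"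
    have m: "\<bar>max \<alpha> \<beta> - max \<alpha>' \<beta>'\<bar> \<le> d" "\<bar>\<beta> - \<beta>'\<bar> \<le> d" by (auto simp: d_def)
    have bm: "\<bar>max \<alpha> \<beta>\<bar> \<le> M" "\<bar>max \<alpha>' \<beta>'\<bar> \<le> M" using b by (auto simp: max_def)
    have f1: "norm (f (max \<alpha> \<beta>) - f (max \<alpha>' \<beta>')) \<le> \<eta> / 2 + C * d"
      using C(2)[OF bm] mult_left_mono[OF m(1) C(1)] by linarith
    have f2: "norm (f \<beta> - f \<beta>') \<le> \<eta> / 2 + C * d"
      using C(2)[OF b(2,4)] mult_left_mono[OF m(2) C(1)] by linarith
    have "norm (kflux f \<alpha> \<beta> - kflux f \<alpha>' \<beta>')
      \<le> norm (max \<alpha> \<beta> - \<beta> - (max \<alpha>' \<beta>' - \<beta>')) + norm (f (max \<alpha> \<beta>) - f \<beta> - (f (max \<alpha>' \<beta>') - f \<beta>'))"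
      unfolding kflux_def diff_Pair by (rule norm_Pair_le)
    also have "norm (max \<alpha> \<beta> - \<beta> - (max \<alpha>' \<beta>' - \<beta>')) \<le> 2 * d" using m unfolding real_norm_def by arith
    also have "norm (f (max \<alpha> \<beta>) - f \<beta> - (f (max \<alpha>' \<beta>') - f \<beta>')) \<le> \<eta> + 2 * C * d"
      using f1 f2 norm_triangle_ineq4[of "f (max \<alpha> \<beta>) - f (max \<alpha>' \<beta>')" "f \<beta> - f \<beta>'"]
      by (simp add: algebra_simps)
    finally show "norm (kflux f \<alpha> \<beta> - kflux f \<alpha>' \<beta>') \<le> \<eta> + 2 * (C + 1) * (\<bar>\<alpha> - \<alpha>'\<bar> + \<bar>\<beta> - \<beta>'\<bar>)"
      by (simp add: d_def algebra_simps)
  qed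
qed

lemma kflux_bounded:
  obtains C where "C \<ge> 0" "\<And>\<alpha> \<beta>. \<bar>\<alpha>\<bar> \<le> M \<Longrightarrow> \<bar>\<beta>\<bar> \<le> M \<Longrightarrow> norm (kflux f \<alpha> \<beta>) \<le> C"
proof -
  obtain C where C: "C \<ge> 0" "\<And>\<alpha> \<beta> \<alpha>' \<beta>'. \<bar>\<alpha>\<bar> \<le> M \<Longrightarrow> \<bar>\<beta>\<bar> \<le> M \<Longrightarrow> \<bar>\<alpha>'\<bar> \<le> M \<Longrightarrow> \<bar>\<beta>'\<bar> \<le> M \<Longrightarrow>
      norm (kflux f \<alpha> \<beta> - kflux f \<alpha>' \<beta>') \<le> 1 + C * (\<bar>\<alpha> - \<alpha>'\<bar> + \<bar>\<beta> - \<beta>'\<bar>)"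
    using kflux_quasi_Lipschitz[of 1 M, OF zero_less_one] by blast
  show thesis
  proof (rule that[of "1 + C * (2 * \<bar>M\<bar>)"])
    show "1 + C * (2 * \<bar>M\<bar>) \<ge> 0" using C(1) by simp
    fix \<alpha> \<beta> :: real assume b: "\<bar>\<alpha>\<bar> \<le> M" "\<bar>\<beta>\<bar> \<le> M"
    have "norm (kflux f \<alpha> \<beta> - kflux f \<beta> \<beta>) \<le> 1 + C * (\<bar>\<alpha> - \<beta>\<bar> + \<bar>\<beta> - \<beta>\<bar>)"
      by (rule C(2)) (use b in auto)
    also have "\<dots> \<le> 1 + C * (2 * \<bar>M\<bar>)" using b C(1) by (intro add_left_mono mult_left_mono) auto
    finally show "norm (kflux f \<alpha> \<beta>) \<le> 1 + C * (2 * \<bar>M\<bar>)" by (simp add: kflux_self_le)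
  qed
qed

lemma flux_integrand_measurable:
  fixes Q :: "(real \<times> 'a) set"
  assumes [measurable]: "Q \<in> sets borel" "X \<in> borel_measurable borel" "Y \<in> borel_measurable borel"
    and "smooth \<phi>"
  shows "(\<lambda>z. indicator Q z * (kflux f (X z) (Y z) \<bullet> switched (fst z) (nabla \<phi> z)) :: real) \<in> borel_measurable borel"
proof -
  have [measurable]: "nabla \<phi> \<in> borel_measurable borel" by (rule nabla_borel_measurable[OF assms(4)])
  have [measurable]: "(fst :: real \<times> 'a \<Rightarrow> real) \<in> borel_measurable borel"
    by (intro borel_measurable_continuous_onI continuous_on_fst continuous_on_id)
  have [measurable]: "(\<lambda>z. kflux f (X z) (Y z)) \<in> borel_measurable borel"
    by (intro kflux_measurable) measurable
  show ?thesis by measurable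
qed

lemma flux_integrand_integrable:
  fixes Q :: "(real \<times> 'a) set"
  assumes "Q \<in> sets borel" "X \<in> borel_measurable borel" "Y \<in> borel_measurable borel"
    and b: "\<And>z. \<bar>X z\<bar> \<le> M" "\<And>z. \<bar>Y z\<bar> \<le> M" and \<phi>: "test_on S \<phi>"
  shows "integrable lborel (\<lambda>z. indicator Q z * (kflux f (X z) (Y z) \<bullet> switched (fst z) (nabla \<phi> z)) :: real)"
proof -
  obtain K where K: "compact K" "K \<subseteq> S" "\<And>z. z \<notin> K \<Longrightarrow> \<phi> z = 0" using test_onE[OF \<phi>] by blast
  obtain C where C: "C \<ge> 0" "\<And>\<alpha> \<beta>. \<bar>\<alpha>\<bar> \<le> M \<Longrightarrow> \<bar>\<beta>\<bar> \<le> M \<Longrightarrow> norm (kflux f \<alpha> \<beta>) \<le> C"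
    using kflux_bounded[of M] by blast
  obtain D where D: "D \<ge> 0" "\<And>z. norm (nabla \<phi> z) \<le> D" using nabla_bounded[OF \<phi>] by blast
  show ?thesis
  proof (rule integrable_bounded_support[OF _ compact_imp_bounded[OF K(1)], where B="C * D"])
    show "(\<lambda>z. indicator Q z * (kflux f (X z) (Y z) \<bullet> switched (fst z) (nabla \<phi> z)) :: real) \<in> borel_measurable borel"
      by (rule flux_integrand_measurable) (use assms test_on_smooth[OF \<phi>] in auto)
    show "indicator Q z * (kflux f (X z) (Y z) \<bullet> switched (fst z) (nabla \<phi> z)) = (0::real)" if "z \<notin> K" for z
      using nabla_eq_0_outside[OF compact_imp_closed[OF K(1)] K(3) that] by simp
    fix z
    have "\<bar>kflux f (X z) (Y z) \<bullet> switched (fst z) (nabla \<phi> z)\<bar> \<le> norm (kflux f (X z) (Y z)) * norm (switched (fst z) (nabla \<phi> z))"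
      by (rule Cauchy_Schwarz_ineq2)
    also have "\<dots> \<le> C * D"
      using C D b by (intro mult_mono order_trans[OF norm_switched_le]) auto
    finally show "norm (indicator Q z * (kflux f (X z) (Y z) \<bullet> switched (fst z) (nabla \<phi> z)) :: real) \<le> C * D"
      using mult_nonneg_nonneg[OF C(1) D(1)] by (auto split: split_indicator)
  qed
qed

lemma flux_int_add:
  assumes "Q \<in> sets borel" "X \<in> borel_measurable borel" "Y \<in> borel_measurable borel"
    and "\<And>z. \<bar>X z\<bar> \<le> M" "\<And>z. \<bar>Y z\<bar> \<le> M" and "test_on S \<phi>" "test_on S \<psi>"
  shows "flux_int Q f X Y (\<lambda>z. \<phi> z + \<psi> z) = flux_int Q f X Y \<phi> + flux_int Q f X Y \<psi>"
  unfolding flux_int_def nabla_add[OF test_on_smooth[OF assms(6)] test_on_smooth[OF assms(7)]]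
    switched_add inner_add_right distrib_left
  by (rule Bochner_Integration.integral_add) (rule flux_integrand_integrable[OF assms(1-5)], fact)+

lemma flux_int_diff:
  assumes "Q \<in> sets borel" "X \<in> borel_measurable borel" "Y \<in> borel_measurable borel"
    and "\<And>z. \<bar>X z\<bar> \<le> M" "\<And>z. \<bar>Y z\<bar> \<le> M" and "test_on S \<phi>" "test_on S \<psi>"
  shows "flux_int Q f X Y (\<lambda>z. \<phi> z - \<psi> z) = flux_int Q f X Y \<phi> - flux_int Q f X Y \<psi>"
  using flux_int_add[OF assms(1-5) test_on_diff[OF assms(6,7)] assms(7)] by simp

lemma flux_int_bound:
  assumes "Q \<in> sets borel" "X \<in> borel_measurable borel" "Y \<in> borel_measurable borel"
    and b: "\<And>z. \<bar>X z\<bar> \<le> M" "\<And>z. \<bar>Y z\<bar> \<le> M" and \<phi>: "test_on S \<phi>"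
    and C: "\<And>z. norm (kflux f (X z) (Y z)) \<le> C"
  shows "\<bar>flux_int Q f X Y \<phi>\<bar> \<le> C * (LINT z|lborel. indicator Q z * norm (nabla \<phi> z))"
proof -
  obtain K where K: "compact K" "K \<subseteq> S" "\<And>z. z \<notin> K \<Longrightarrow> \<phi> z = 0" using test_onE[OF \<phi>] by blast
  obtain D where D: "D \<ge> 0" "\<And>z. norm (nabla \<phi> z) \<le> D" using nabla_bounded[OF \<phi>] by blast
  have [measurable]: "nabla \<phi> \<in> borel_measurable borel" by (rule nabla_borel_measurable[OF test_on_smooth[OF \<phi>]])
  have [measurable]: "Q \<in> sets borel" by fact
  have i: "integrable lborel (\<lambda>z. indicator Q z * norm (nabla \<phi> z) :: real)"
    by (rule integrable_bounded_support[OF _ compact_imp_bounded[OF K(1)], where B=D])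
      (use D nabla_eq_0_outside[OF compact_imp_closed[OF K(1)] K(3)] in \<open>auto split: split_indicator\<close>)
  have "norm (flux_int Q f X Y \<phi>) \<le> (LINT z|lborel. C * (indicator Q z * norm (nabla \<phi> z)))"
    unfolding flux_int_def
  proof (rule Bochner_Integration.integral_norm_bound_integral)
    show "integrable lborel (\<lambda>z. indicator Q z * (kflux f (X z) (Y z) \<bullet> switched (fst z) (nabla \<phi> z)) :: real)"
      by (rule flux_integrand_integrable[OF assms(1-6)])
    show "integrable lborel (\<lambda>z. C * (indicator Q z * norm (nabla \<phi> z)))" using i by simp
    fix z
    have "\<bar>kflux f (X z) (Y z) \<bullet> switched (fst z) (nabla \<phi> z)\<bar> \<le> norm (kflux f (X z) (Y z)) * norm (switched (fst z) (nabla \<phi> z))"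
      by (rule Cauchy_Schwarz_ineq2)
    also have "\<dots> \<le> C * norm (nabla \<phi> z)"
      by (intro mult_mono norm_switched_le C order_trans[OF norm_ge_zero C[of z]]) auto
    finally show "norm (indicator Q z * (kflux f (X z) (Y z) \<bullet> switched (fst z) (nabla \<phi> z))) \<le> C * (indicator Q z * norm (nabla \<phi> z))"
      by (auto split: split_indicator)
  qed
  then show ?thesis by simp
qed

end

section \<open>Fubini on the doubled space and mollification along its diagonal\<close>

lemma borel_measurable_fst_comp:
  fixes f :: "'m \<Rightarrow> 'b::topological_space \<times> 'c::topological_space"
  assumes "f \<in> borel_measurable M" shows "(\<lambda>x. fst (f x)) \<in> borel_measurable M"
  by (rule borel_measurable_continuous_on[OF _ assms]) (intro continuous_intros)

lemma borel_measurable_snd_comp: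
  fixes f :: "'m \<Rightarrow> 'b::topological_space \<times> 'c::topological_space"
  assumes "f \<in> borel_measurable M" shows "(\<lambda>x. snd (f x)) \<in> borel_measurable M"
  by (rule borel_measurable_continuous_on[OF _ assms]) (intro continuous_intros)

lemma nn_integral_lborel_fst:
  fixes h :: "'e::euclidean_space \<times> 'd::euclidean_space \<Rightarrow> ennreal"
  assumes "h \<in> borel_measurable borel"
  shows "(\<integral>\<^sup>+ p. h p \<partial>lborel) = (\<integral>\<^sup>+ z. (\<integral>\<^sup>+ y. h (z, y) \<partial>lborel) \<partial>lborel)"
proof -
  have "h \<in> borel_measurable (lborel \<Otimes>\<^sub>M lborel)" unfolding lborel_prod using assms by simp
  from lborel.nn_integral_fst[OF this] show ?thesis unfolding lborel_prod by simp
qed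

lemma nn_integral_lborel_snd:
  fixes h :: "'e::euclidean_space \<times> 'd::euclidean_space \<Rightarrow> ennreal"
  assumes "h \<in> borel_measurable borel"
  shows "(\<integral>\<^sup>+ p. h p \<partial>lborel) = (\<integral>\<^sup>+ y. (\<integral>\<^sup>+ z. h (z, y) \<partial>lborel) \<partial>lborel)"
proof -
  have "h \<in> borel_measurable (lborel \<Otimes>\<^sub>M lborel)" unfolding lborel_prod using assms by simp
  from lborel_pair.nn_integral_snd[OF this] show ?thesis unfolding lborel_prod by simp
qed

lemma integral_lborel_fst:
  fixes h :: "'e::euclidean_space \<times> 'd::euclidean_space \<Rightarrow> 'b::{banach, second_countable_topology}"
  assumes "integrable lborel h"
  shows "(LINT p|lborel. h p) = (LINT z|lborel. LINT y|lborel. h (z, y))"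
    and "integrable lborel (\<lambda>z. LINT y|lborel. h (z, y))"
proof -
  have i: "integrable (lborel \<Otimes>\<^sub>M lborel) h" unfolding lborel_prod by (rule assms)
  show "(LINT p|lborel. h p) = (LINT z|lborel. LINT y|lborel. h (z, y))"
    using lborel_pair.integral_fst'[OF i] unfolding lborel_prod by simp
  show "integrable lborel (\<lambda>z. LINT y|lborel. h (z, y))"
    using lborel_pair.integrable_fst'[OF i] by simp
qed

lemma integral_lborel_snd:
  fixes h :: "'e::euclidean_space \<times> 'd::euclidean_space \<Rightarrow> 'b::{banach, second_countable_topology}"
  assumes "integrable lborel h"
  shows "(LINT p|lborel. h p) = (LINT y|lborel. LINT z|lborel. h (z, y))"
    and "integrable lborel (\<lambda>y. LINT z|lborel. h (z, y))"
proof -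
  have i: "integrable (lborel \<Otimes>\<^sub>M lborel) (\<lambda>(x, y). h (x, y))" unfolding lborel_prod using assms by simp
  show "(LINT p|lborel. h p) = (LINT y|lborel. LINT z|lborel. h (z, y))"
    using lborel_pair.integral_snd[OF i] unfolding lborel_prod by simp
  show "integrable lborel (\<lambda>y. LINT z|lborel. h (z, y))"
    using lborel_pair.integrable_snd[OF i] by simp
qed

lemma measurable_first_minus_second:
  fixes \<rho> :: "'e::euclidean_space \<Rightarrow> 'b::topological_space"
  assumes "\<rho> \<in> borel_measurable borel"
  shows "(\<lambda>p. \<rho> (fst p - snd p)) \<in> borel_measurable borel"
  by (rule measurable_compose[OF _ assms], rule borel_measurable_continuous_onI) (intro continuous_intros)

lemma measurable_of_first:
  fixes g :: "'e::euclidean_space \<Rightarrow> 'b::topological_space"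
  assumes "g \<in> borel_measurable borel"
  shows "(\<lambda>p :: 'e \<times> 'd::euclidean_space. g (fst p)) \<in> borel_measurable borel"
  by (rule measurable_compose[OF _ assms], rule borel_measurable_continuous_onI) (intro continuous_intros)

lemma measurable_of_second:
  fixes g :: "'e::euclidean_space \<Rightarrow> 'b::topological_space"
  assumes "g \<in> borel_measurable borel"
  shows "(\<lambda>p :: 'd::euclidean_space \<times> 'e. g (snd p)) \<in> borel_measurable borel"
  by (rule measurable_compose[OF _ assms], rule borel_measurable_continuous_onI) (intro continuous_intros)

lemma integrable_lborel_pair_iff:
  fixes h :: "'e::euclidean_space \<times> 'd::euclidean_space \<Rightarrow> real"
  assumes h: "h \<in> borel_measurable borel"
    and fin: "(\<integral>\<^sup>+ z. (\<integral>\<^sup>+ y. ennreal (norm (h (z, y))) \<partial>lborel) \<partial>lborel) < \<infinity>"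
  shows "integrable lborel h"
proof -
  have [measurable]: "h \<in> borel_measurable lborel" using h by simp
  have "(\<integral>\<^sup>+ p. ennreal (norm (h p)) \<partial>lborel) < \<infinity>"
    using fin nn_integral_lborel_fst[of "\<lambda>p. ennreal (norm (h p))"] by simp
  then show ?thesis by (auto intro: integrableI_bounded)
qed

lemma integrable_tensor:
  fixes g :: "'e::euclidean_space \<Rightarrow> real" and h :: "'d::euclidean_space \<Rightarrow> real"
  assumes g: "integrable lborel g" and h: "integrable lborel h"
  shows "integrable lborel (\<lambda>z. g (fst z) * h (snd z))"
proof (rule integrable_lborel_pair_iff)
  have [measurable]: "g \<in> borel_measurable borel" "h \<in> borel_measurable borel" using g h by auto
  show "(\<lambda>z. g (fst z) * h (snd z)) \<in> borel_measurable borel"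
    by (intro borel_measurable_times measurable_of_first measurable_of_second) measurable
  show "(\<integral>\<^sup>+ z. (\<integral>\<^sup>+ y. ennreal (norm (g (fst (z, y)) * h (snd (z, y)))) \<partial>lborel) \<partial>lborel) < \<infinity>"
    using g h by (simp add: abs_mult ennreal_mult nn_integral_cmult nn_integral_multc integrable_iff_bounded ennreal_mult_less_top)
qed

lemma integral_lborel_translate:
  fixes c :: "'e::euclidean_space" and f :: "'e \<Rightarrow> 'b::{banach, second_countable_topology}"
  assumes [measurable]: "f \<in> borel_measurable borel"
  shows "(LINT y|lborel. f (c + y)) = (LINT y|lborel. f y)"
  by (subst (2) lborel_distr_plus[of c, symmetric]) (simp add: integral_distr)

lemma mollifier_integral:
  assumes \<rho>: "mollifier S \<rho>"
  shows "(LINT y|lborel. \<rho> (z - y)) = 1" and "(LINT z|lborel. \<rho> (z - y)) = 1"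
proof -
  have m: "\<rho> \<in> borel_measurable borel"
    by (rule smooth_borel_measurable[OF test_on_smooth[OF mollifierD(1)[OF \<rho>]]])
  show "(LINT y|lborel. \<rho> (z - y)) = 1" "(LINT z|lborel. \<rho> (z - y)) = 1"
    using integral_lborel_reflect[OF m, of z] integral_lborel_translate[OF m, of "- y"] mollifierD(3)[OF \<rho>] by simp_all
qed

text \<open>Integrating first over the variable that \<open>g\<close> does not contain, translation
  invariance reduces the kernel to its total integral. Doubled integrals collapse to single ones
  without a change of variables on the product space.\<close>

lemma kernel_integral:
  fixes g N :: "'e::euclidean_space \<Rightarrow> real"
  assumes g: "integrable lborel g" and N: "integrable lborel N"
  shows "integrable lborel (\<lambda>p. g (fst p) * N (fst p - snd p))"
    and "(LINT p|lborel. g (fst p) * N (fst p - snd p)) = (LINT z|lborel. g z) * (LINT z|lborel. N z)"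
    and "integrable lborel (\<lambda>p. g (snd p) * N (fst p - snd p))"
    and "(LINT p|lborel. g (snd p) * N (fst p - snd p)) = (LINT z|lborel. g z) * (LINT z|lborel. N z)"
proof -
  have [measurable]: "g \<in> borel_measurable borel" "N \<in> borel_measurable borel" using g N by auto
  have [measurable]: "(\<lambda>p. g (fst p) * N (fst p - snd p)) \<in> borel_measurable borel"
    by (intro borel_measurable_times measurable_first_minus_second measurable_of_first) measurable
  have [measurable]: "(\<lambda>p. g (snd p) * N (fst p - snd p)) \<in> borel_measurable borel"
    by (intro borel_measurable_times measurable_first_minus_second measurable_of_second) measurable
  have fin: "(\<integral>\<^sup>+ z. ennreal \<bar>g z\<bar> \<partial>lborel) * (\<integral>\<^sup>+ z. ennreal \<bar>N z\<bar> \<partial>lborel) < \<infinity>"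
    using g N by (simp add: integrable_iff_bounded ennreal_mult_less_top)
  have nN: "(\<integral>\<^sup>+ y. ennreal \<bar>N (z - y)\<bar> \<partial>lborel) = (\<integral>\<^sup>+ z. ennreal \<bar>N z\<bar> \<partial>lborel)"
    "(\<integral>\<^sup>+ z. ennreal \<bar>N (z - y)\<bar> \<partial>lborel) = (\<integral>\<^sup>+ z. ennreal \<bar>N z\<bar> \<partial>lborel)" for y z
    using nn_integral_lborel_reflect[of "\<lambda>y. ennreal \<bar>N y\<bar>" z] nn_integral_lborel_translate[of "\<lambda>z. ennreal \<bar>N z\<bar>" "- y"] by simp_all
  have iN: "(LINT y|lborel. N (z - y)) = (LINT z|lborel. N z)" "(LINT z|lborel. N (z - y)) = (LINT z|lborel. N z)" for y z
    using integral_lborel_reflect[of N z] integral_lborel_translate[of N "- y"] by simp_all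
  show i1: "integrable lborel (\<lambda>p. g (fst p) * N (fst p - snd p))"
    by (rule integrable_lborel_pair_iff)
      (use fin in \<open>simp_all add: abs_mult ennreal_mult nn_integral_cmult nn_integral_multc nN\<close>)
  show i2: "integrable lborel (\<lambda>p. g (snd p) * N (fst p - snd p))"
  proof (rule integrableI_bounded)
    have "(\<integral>\<^sup>+ p. ennreal (norm (g (snd p) * N (fst p - snd p))) \<partial>lborel)
      = (\<integral>\<^sup>+ y. (\<integral>\<^sup>+ z. ennreal (norm (g (snd (z, y)) * N (fst (z, y) - snd (z, y)))) \<partial>lborel) \<partial>lborel)"
      by (rule nn_integral_lborel_snd) measurable
    also have "\<dots> < \<infinity>"
      using fin by (simp add: abs_mult ennreal_mult nn_integral_cmult nn_integral_multc nN)
    finally show "(\<integral>\<^sup>+ p. ennreal (norm (g (snd p) * N (fst p - snd p))) \<partial>lborel) < \<infinity>" .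
  qed simp
  show "(LINT p|lborel. g (fst p) * N (fst p - snd p)) = (LINT z|lborel. g z) * (LINT z|lborel. N z)"
    "(LINT p|lborel. g (snd p) * N (fst p - snd p)) = (LINT z|lborel. g z) * (LINT z|lborel. N z)"
    using integral_lborel_fst(1)[OF i1] integral_lborel_snd(1)[OF i2] by (simp_all add: iN)
qed

lemma mollified_integral:
  assumes g: "integrable lborel g" and \<rho>: "mollifier S \<rho>"
  shows "integrable lborel (\<lambda>p. g (fst p) * \<rho> (fst p - snd p))"
    and "(LINT p|lborel. g (fst p) * \<rho> (fst p - snd p)) = (LINT z|lborel. g z)"
    and "integrable lborel (\<lambda>p. g (snd p) * \<rho> (fst p - snd p))"
    and "(LINT p|lborel. g (snd p) * \<rho> (fst p - snd p)) = (LINT z|lborel. g z)"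
  using kernel_integral[OF g test_on_integrable[OF mollifierD(1)[OF \<rho>]]] mollifierD(3)[OF \<rho>] by simp_all

text \<open>A bounded function with bounded support is an almost everywhere limit of continuous functions.\<close>

lemma mollified_difference_pair:
  fixes g :: "'e::euclidean_space \<Rightarrow> 'b::euclidean_space"
  assumes g: "g \<in> borel_measurable borel" and C: "\<And>z. norm (g z) \<le> C"
    and K: "bounded K" "\<And>z. z \<notin> K \<Longrightarrow> g z = 0" and "\<eta> > 0"
  obtains r where "r > 0"
    "\<And>\<rho>. mollifier (ball 0 r) \<rho> \<Longrightarrow> integrable lborel (\<lambda>p. norm (g (fst p) - g (snd p)) * \<rho> (fst p - snd p))"
    "\<And>\<rho>. mollifier (ball 0 r) \<rho> \<Longrightarrow> (LINT p|lborel. norm (g (fst p) - g (snd p)) * \<rho> (fst p - snd p)) \<le> \<eta>"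
proof -
  note [measurable] = g
  define D where "D = max C 1"
  have D: "D > 0" "norm (g z) \<le> D" for z using C[of z] by (auto simp: D_def)
  \<comment> \<open>A continuous retraction onto the ball of radius \<open>D\<close>. It fixes the
    values of \<open>g\<close> and keeps the continuous approximants uniformly bounded, as dominated
    convergence requires.\<close>
  define clip where "clip y = (D / max D (norm y)) *\<^sub>R y" for y :: 'b
  have pos: "max D (norm y) > 0" for y :: 'b using D(1) by simp
  have clip: "continuous_on UNIV clip"
    unfolding clip_def using pos by (intro continuous_intros) (metis less_irrefl)
  have clip_le: "norm (clip y) \<le> D" for y
    unfolding clip_def using D(1) pos[of y] by (simp add: divide_le_eq mult_left_mono)
  have clip_g: "clip (g z) = g z" for z unfolding clip_def using D by (simp add: max_absorb1)
  obtain R where R: "\<And>z. z \<in> K \<Longrightarrow> norm z \<le> R" using K(1) unfolding bounded_iff by blast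
  \<comment> \<open>The kernels will have radius at most 1: if one of two points closer than 1 lies
    outside \<open>K1\<close>, then both lie outside \<open>K\<close> and the difference of the
    values of \<open>g\<close> is 0.\<close>
  define K1 where "K1 = cball (0 :: 'e) (R + 1)"
  have K1: "compact K1" "bounded K1" "K1 \<in> sets borel" by (auto simp: K1_def)
  note [measurable] = K1(3)
  have "g measurable_on UNIV"
    by (intro lebesgue_measurable_imp_measurable_on measurable_completion) auto
  then obtain N G where N: "negligible N" and G: "\<And>n. continuous_on UNIV (G n)" "\<And>x. x \<notin> N \<Longrightarrow> (\<lambda>n. G n x) \<longlonglongrightarrow> g x"
    unfolding measurable_on_def by auto
  have cF: "continuous_on UNIV (\<lambda>x. clip (G n x))" for n
    by (rule continuous_on_compose2[OF clip G(1)]) simp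
  have Fm[measurable]: "(\<lambda>x. clip (G n x)) \<in> borel_measurable borel" for n
    by (rule borel_measurable_continuous_onI[OF cF])
  have AEN: "AE x in lborel. x \<notin> N"
    using N unfolding negligible_iff_null_sets by (metis AE_completion_iff AE_not_in)
  have "(\<lambda>n. LINT x|lborel. indicator K1 x * norm (clip (G n x) - g x)) \<longlonglongrightarrow> (LINT x|(lborel :: 'e measure). 0 :: real)"
  proof (rule integral_dominated_convergence[where w="\<lambda>x. indicator K1 x * (2 * D)"])
    show "integrable lborel (\<lambda>x. indicator K1 x * (2 * D))"
      by (rule integrable_bounded_support[OF _ K1(2), where B="2 * D"]) (use D in \<open>auto split: split_indicator\<close>)
    show "AE x in lborel. (\<lambda>n. indicator K1 x * norm (clip (G n x) - g x)) \<longlonglongrightarrow> 0"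
      using AEN
    proof eventually_elim
      case (elim x)
      have "(\<lambda>n. clip (G n x)) \<longlonglongrightarrow> clip (g x)"
        by (rule continuous_on_tendsto_compose[OF clip G(2)[OF elim]]) auto
      then have "(\<lambda>n. indicator K1 x * norm (clip (G n x) - g x)) \<longlonglongrightarrow> indicator K1 x * norm (g x - g x)"
        unfolding clip_g by (intro tendsto_intros)
      then show ?case by simp
    qed
    show "AE x in lborel. norm (indicator K1 x * norm (clip (G n x) - g x)) \<le> indicator K1 x * (2 * D)" for n
    proof (rule AE_I2)
      fix x
      have "norm (clip (G n x) - g x) \<le> 2 * D"
        using norm_triangle_ineq4[of "clip (G n x)" "g x"] clip_le[of "G n x"] D(2)[of x] by linarith
      then show "norm (indicator K1 x * norm (clip (G n x) - g x)) \<le> indicator K1 x * (2 * D)"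
        by (simp split: split_indicator)
    qed
  qed measurable
  then have "\<forall>\<^sub>F n in sequentially. (LINT x|lborel. indicator K1 x * norm (clip (G n x) - g x)) < \<eta> / 3"
    using \<open>\<eta> > 0\<close> by (intro order_tendstoD) auto
  then obtain n where n: "(LINT x|lborel. indicator K1 x * norm (clip (G n x) - g x)) < \<eta> / 3"
    by (auto simp: eventually_sequentially)
  define F where "F x = clip (G n x)" for x
  define e where "e x = indicator K1 x * norm (F x - g x)" for x
  have e: "integrable lborel e" "(LINT x|lborel. e x) < \<eta> / 3"
  proof -
    have "norm (F x - g x) \<le> 2 * D" for x
      using norm_triangle_ineq4[of "F x" "g x"] clip_le[of "G n x"] D(2)[of x] unfolding F_def by linarith
    then show "integrable lborel e" unfolding e_def F_def
      by (intro integrable_bounded_support[OF _ K1(2), where B="2 * D"]) (use D in \<open>auto split: split_indicator\<close>)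
  qed (use n in \<open>simp add: e_def F_def\<close>)
  define q where "q = measure lborel K1"
  define \<delta> where "\<delta> = \<eta> / (3 * (q + 1))"
  have q: "q \<ge> 0" by (simp add: q_def)
  have \<delta>: "\<delta> > 0" "\<delta> * q \<le> \<eta> / 3" using \<open>\<eta> > 0\<close> q by (auto simp: \<delta>_def field_simps)
  have iK: "integrable lborel (\<lambda>x. \<delta> * indicator K1 x)"
    by (rule integrable_bounded_support[OF _ K1(2), where B=\<delta>]) (use \<delta> in \<open>auto split: split_indicator\<close>)
  have "uniformly_continuous_on K1 F"
    unfolding F_def by (intro compact_uniformly_continuous K1 continuous_on_subset[OF cF]) auto
  then obtain d where d: "d > 0" "\<And>x y. x \<in> K1 \<Longrightarrow> y \<in> K1 \<Longrightarrow> dist y x < d \<Longrightarrow> dist (F y) (F x) < \<delta>"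
    unfolding uniformly_continuous_on_def using \<delta>(1) by metis
  show thesis
  proof (rule that[of "min 1 d"])
    show "min 1 d > 0" using d(1) by simp
    fix \<rho> :: "'e \<Rightarrow> real" assume \<rho>: "mollifier (ball 0 (min 1 d)) \<rho>"
    note \<rho>D = mollifierD[OF \<rho>]
    have [measurable]: "\<rho> \<in> borel_measurable borel" by (rule smooth_borel_measurable[OF test_on_smooth[OF \<rho>D(1)]])
    have m: "(\<lambda>p. norm (g (fst p) - g (snd p)) * \<rho> (fst p - snd p)) \<in> borel_measurable borel"
      by (intro borel_measurable_times borel_measurable_norm[THEN measurable_compose[rotated]]
          borel_measurable_diff measurable_first_minus_second measurable_of_first measurable_of_second) measurable
    let ?b = "\<lambda>p. e (fst p) * \<rho> (fst p - snd p) + e (snd p) * \<rho> (fst p - snd p) + \<delta> * indicator K1 (fst p) * \<rho> (fst p - snd p)"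
    note M = mollified_integral[OF e(1) \<rho>] mollified_integral[OF iK \<rho>]
    have ib: "integrable lborel ?b" using M by (intro Bochner_Integration.integrable_add)
    have le: "norm (g (fst p) - g (snd p)) * \<rho> (fst p - snd p) \<le> ?b p" for p
    proof (cases "\<rho> (fst p - snd p) = 0")
      case False
      define z y where "z = fst p" and "y = snd p"
      have near: "norm (z - y) < 1" "norm (z - y) < d" using \<rho>D(4)[OF False] by (auto simp: z_def y_def)
      have "norm (g z - g y) \<le> e z + e y + \<delta> * indicator K1 z"
      proof (cases "z \<in> K1 \<and> y \<in> K1")
        case True
        then have "norm (F z - F y) < \<delta>" using d(2)[of y z] near by (simp add: dist_norm)
        then show ?thesis
          using True norm_triangle_ineq4[of "F z - F y" "(F z - g z) - (F y - g y)"] norm_triangle_ineq4[of "F z - g z" "F y - g y"]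
          by (simp add: e_def)
      next
        case False
        then have "norm z > R" "norm y > R"
          using norm_triangle_sub[of z y] norm_triangle_sub[of y z] near(1) by (auto simp: K1_def norm_minus_commute)
        then have "g z = 0" "g y = 0" using K(2) R by force+
        then show ?thesis using \<delta> by (simp add: e_def)
      qed
      then show ?thesis using mult_right_mono[OF _ \<rho>D(2)] by (simp add: z_def y_def distrib_right[symmetric])
    qed simp
    show i: "integrable lborel (\<lambda>p. norm (g (fst p) - g (snd p)) * \<rho> (fst p - snd p))"
      by (rule Bochner_Integration.integrable_bound[OF ib])
        (use m \<rho>D(2) in \<open>auto intro!: AE_I2 order_trans[OF le abs_ge_self] simp: abs_mult\<close>)
    have "(LINT p|lborel. norm (g (fst p) - g (snd p)) * \<rho> (fst p - snd p)) \<le> (LINT p|lborel. ?b p)"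
      by (rule integral_mono[OF i ib le])
    also have "\<dots> = (LINT x|lborel. e x) + (LINT x|lborel. e x) + \<delta> * q"
      using M K1 by (simp add: q_def)
    finally show "(LINT p|lborel. norm (g (fst p) - g (snd p)) * \<rho> (fst p - snd p)) \<le> \<eta>" using e(2) \<delta>(2) by linarith
  qed
qed

text \<open>The part of the doubled integral that survives the cancellation: the derivative falls on
  \<open>\<phi>\<close> at the first point and not on the kernel.\<close>

definition doubled_flux ::
  "(real \<times> 'a::euclidean_space) set \<Rightarrow> (real \<Rightarrow> 'a) \<Rightarrow> (real \<times> 'a \<Rightarrow> real) \<Rightarrow> (real \<times> 'a \<Rightarrow> real) \<Rightarrow>
    (real \<times> 'a \<Rightarrow> real) \<Rightarrow> (real \<times> 'a \<Rightarrow> real) \<Rightarrow> real" where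
  "doubled_flux Q f X Y \<phi> \<rho> =
    (LINT p|lborel. indicator Q (fst p) * indicator Q (snd p) *
      (kflux f (X (fst p)) (Y (snd p)) \<bullet> switched (fst (fst p)) (nabla \<phi> (fst p))) * \<rho> (fst p - snd p))"

lemma doubled_integrand_measurable:
  fixes f :: "real \<Rightarrow> 'a::euclidean_space" and Q :: "(real \<times> 'a) set"
  assumes f: "continuous_on UNIV f" and Q: "Q \<in> sets borel"
    and X: "X \<in> borel_measurable borel" and Y: "Y \<in> borel_measurable borel"
    and P: "P \<in> borel_measurable borel" and \<rho>: "\<rho> \<in> borel_measurable borel"
  shows "(\<lambda>p. indicator Q (fst p) * indicator Q (snd p) *
      (kflux f (X (fst p)) (Y (snd p)) \<bullet> P p) * (\<rho> (fst p - snd p) :: real)) \<in> borel_measurable borel"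
proof -
  have [measurable]: "(\<lambda>p :: (real \<times> 'a) \<times> (real \<times> 'a). X (fst p)) \<in> borel_measurable borel"
    "(\<lambda>p :: (real \<times> 'a) \<times> (real \<times> 'a). Y (snd p)) \<in> borel_measurable borel"
    "(\<lambda>p :: (real \<times> 'a) \<times> (real \<times> 'a). indicator Q (fst p) :: real) \<in> borel_measurable borel"
    "(\<lambda>p :: (real \<times> 'a) \<times> (real \<times> 'a). indicator Q (snd p) :: real) \<in> borel_measurable borel"
    "(\<lambda>p. \<rho> (fst p - snd p)) \<in> borel_measurable borel"
    by (intro measurable_of_first measurable_of_second measurable_first_minus_second X Y \<rho> borel_measurable_indicator Q)+
  have [measurable]: "(\<lambda>p. kflux f (X (fst p)) (Y (snd p))) \<in> borel_measurable borel"
    by (intro kflux_measurable[OF f]) measurable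
  note [measurable] = P
  show ?thesis by measurable
qed

lemma switched_nabla_measurable:
  fixes \<phi> :: "real \<times> 'a::euclidean_space \<Rightarrow> real"
  assumes "smooth \<phi>"
  shows "(\<lambda>z. switched (fst z) (nabla \<phi> z)) \<in> borel_measurable borel"
  by (intro switched_measurable borel_measurable_fst_comp nabla_borel_measurable assms) simp

lemma bounded_first_minus_second:
  fixes Q :: "'e::euclidean_space set"
  assumes "bounded Q" "bounded L"
  shows "bounded {p. fst p \<in> Q \<and> fst p - snd p \<in> L}"
proof -
  obtain R1 R2 where R: "\<And>z. z \<in> Q \<Longrightarrow> norm z \<le> R1" "\<And>z. z \<in> L \<Longrightarrow> norm z \<le> R2"
    using assms unfolding bounded_iff by blast
  have "norm p \<le> R1 + (R1 + R2)" if "fst p \<in> Q" "fst p - snd p \<in> L" for p :: "'e \<times> 'e"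
  proof -
    have "norm p \<le> norm (fst p) + norm (snd p)" using norm_Pair_le[of "fst p" "snd p"] by simp
    moreover have "norm (snd p) \<le> norm (fst p) + norm (fst p - snd p)"
      using norm_triangle_ineq4[of "fst p" "fst p - snd p"] by simp
    ultimately show ?thesis using R(1)[OF that(1)] R(2)[OF that(2)] by linarith
  qed
  then show ?thesis unfolding bounded_iff by blast
qed

text \<open>A sequence has no common L^1 modulus of continuity, but one of \<open>W\<close>,
  \<open>V\<close> is a fixed function. Its argument is moved to the point at which the other one is
  evaluated, and then the kernel integrates to 1. This is why the radius does not depend on
  \<open>n\<close>.\<close>

lemma doubled_flux_close:
  fixes f :: "real \<Rightarrow> 'a::euclidean_space" and W V :: "nat \<Rightarrow> real \<times> 'a \<Rightarrow> real"
  assumes f: "continuous_on UNIV f" and Q: "Q \<in> sets borel" "bounded Q"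
    and W: "\<And>n. W n \<in> borel_measurable borel" "\<And>n z. \<bar>W n z\<bar> \<le> M"
    and V: "\<And>n. V n \<in> borel_measurable borel" "\<And>n z. \<bar>V n z\<bar> \<le> M"
    and \<phi>: "test_on S \<phi>" and const: "(\<forall>n. W n = W 0) \<or> (\<forall>n. V n = V 0)" and "\<eta> > 0"
  obtains r where "r > 0"
    "\<And>\<rho> n. mollifier (ball 0 r) \<rho> \<Longrightarrow> \<bar>doubled_flux Q f (W n) (V n) \<phi> \<rho> - flux_int Q f (W n) (V n) \<phi>\<bar> \<le> \<eta>"
proof -
  define P where "P z = switched (fst z) (nabla \<phi> z)" for z
  have P[measurable]: "P \<in> borel_measurable borel"
    unfolding P_def by (rule switched_nabla_measurable[OF test_on_smooth[OF \<phi>]])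
  have [measurable]: "Q \<in> sets borel" "\<And>n. W n \<in> borel_measurable borel" "\<And>n. V n \<in> borel_measurable borel"
    using Q W V by auto
  obtain B where B: "B \<ge> 0" "\<And>z. norm (nabla \<phi> z) \<le> B" using nabla_bounded[OF \<phi>] by blast
  have PB: "norm (P z) \<le> B" for z unfolding P_def by (rule order_trans[OF norm_switched_le B(2)])
  obtain C0 where C0: "C0 \<ge> 0" "\<And>\<alpha> \<beta>. \<bar>\<alpha>\<bar> \<le> M \<Longrightarrow> \<bar>\<beta>\<bar> \<le> M \<Longrightarrow> norm (kflux f \<alpha> \<beta>) \<le> C0"
    using kflux_bounded[OF f, of M] by blast
  define q where "q = measure lborel Q"
  have q0: "q \<ge> 0" by (simp add: q_def)
  \<comment> \<open>With \<open>\<epsilon>\<close> and, below, \<open>d\<close>, the error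
    \<open>\<eta>\<close> is shared out: at most a third for the additive part of the
    quasi-Lipschitz estimate over \<open>Q\<close>, at most a third for the translation
    errors.\<close>
  define \<epsilon> where "\<epsilon> = \<eta> / (3 * (B + 1) * (q + 1))"
  have \<epsilon>: "\<epsilon> > 0" unfolding \<epsilon>_def using \<open>\<eta> > 0\<close> B(1) q0 by simp
  obtain C1 where C1: "C1 \<ge> 0"
    "\<And>\<alpha> \<beta> \<alpha>' \<beta>'. \<bar>\<alpha>\<bar> \<le> M \<Longrightarrow> \<bar>\<beta>\<bar> \<le> M \<Longrightarrow> \<bar>\<alpha>'\<bar> \<le> M \<Longrightarrow> \<bar>\<beta>'\<bar> \<le> M \<Longrightarrow>
      norm (kflux f \<alpha> \<beta> - kflux f \<alpha>' \<beta>') \<le> \<epsilon> + C1 * (\<bar>\<alpha> - \<alpha>'\<bar> + \<bar>\<beta> - \<beta>'\<bar>)"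
    using kflux_quasi_Lipschitz[OF f \<epsilon>, of M] by blast
  define d where "d = \<eta> / (3 * (B * C1 + C0 * (B + 1) + 1))"
  have dpos: "B * C1 + C0 * (B + 1) + 1 > 0"
    using mult_nonneg_nonneg[OF B(1) C1(1)] mult_nonneg_nonneg[OF C0(1), of "B + 1"] B(1) by linarith
  then have d: "d > 0" unfolding d_def using \<open>\<eta> > 0\<close> by simp
  have M: "M \<ge> 0" using W(2)[of 0 0] by simp
  have iQ: "integrable lborel (indicator Q :: _ \<Rightarrow> real)"
    by (rule integrable_bounded_support[OF _ Q(2), where B=1]) (auto split: split_indicator)
  let ?\<Delta> = "\<lambda>g \<rho> p. norm (g (fst p) - g (snd p)) * \<rho> (fst p - snd p) :: real"
  obtain r1 where r1: "r1 > 0" "\<And>\<rho>. mollifier (ball 0 r1) \<rho> \<Longrightarrow> integrable lborel (?\<Delta> (indicator Q :: _ \<Rightarrow> real) \<rho>)"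
      "\<And>\<rho>. mollifier (ball 0 r1) \<rho> \<Longrightarrow> (LINT p|lborel. ?\<Delta> (indicator Q :: _ \<Rightarrow> real) \<rho> p) \<le> d"
    by (rule mollified_difference_pair[OF _ _ Q(2) _ d, of "indicator Q :: _ \<Rightarrow> real" 1]) (auto split: split_indicator)
  obtain r2 where r2: "r2 > 0" "\<And>\<rho>. mollifier (ball 0 r2) \<rho> \<Longrightarrow> integrable lborel (?\<Delta> (\<lambda>z. indicator Q z *\<^sub>R P z) \<rho>)"
      "\<And>\<rho>. mollifier (ball 0 r2) \<rho> \<Longrightarrow> (LINT p|lborel. ?\<Delta> (\<lambda>z. indicator Q z *\<^sub>R P z) \<rho> p) \<le> d"
    by (rule mollified_difference_pair[OF _ _ Q(2) _ d, of "\<lambda>z. indicator Q z *\<^sub>R P z" B]) (use PB B(1) in \<open>auto split: split_indicator\<close>)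
  have X: "\<exists>r>0. \<forall>\<rho>. mollifier (ball 0 r) \<rho> \<longrightarrow> integrable lborel (?\<Delta> (\<lambda>z. indicator Q z * X z) \<rho>) \<and>
      (LINT p|lborel. ?\<Delta> (\<lambda>z. indicator Q z * X z) \<rho> p) \<le> d"
    if [measurable]: "X \<in> borel_measurable borel" and "\<And>z. \<bar>X z\<bar> \<le> M" for X :: "real \<times> 'a \<Rightarrow> real"
    by (rule mollified_difference_pair[OF _ _ Q(2) _ d, of "\<lambda>z. indicator Q z * X z" M])
      (use that(2) M in \<open>auto split: split_indicator\<close>)
  obtain r3 where r3: "r3 > 0" "\<And>\<rho>. mollifier (ball 0 r3) \<rho> \<Longrightarrow> integrable lborel (?\<Delta> (\<lambda>z. indicator Q z * W 0 z) \<rho>) \<and>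
      (LINT p|lborel. ?\<Delta> (\<lambda>z. indicator Q z * W 0 z) \<rho> p) \<le> d"
    using X[OF W(1,2)[of 0]] by blast
  obtain r4 where r4: "r4 > 0" "\<And>\<rho>. mollifier (ball 0 r4) \<rho> \<Longrightarrow> integrable lborel (?\<Delta> (\<lambda>z. indicator Q z * V 0 z) \<rho>) \<and>
      (LINT p|lborel. ?\<Delta> (\<lambda>z. indicator Q z * V 0 z) \<rho> p) \<le> d"
    using X[OF V(1,2)[of 0]] by blast
  define r where "r = min (min r1 r2) (min r3 r4)"
  have "\<bar>doubled_flux Q f (W n) (V n) \<phi> \<rho> - flux_int Q f (W n) (V n) \<phi>\<bar> \<le> \<eta>"
    if \<rho>: "mollifier (ball 0 r) \<rho>" for \<rho> n
  proof -
    note \<rho>D = mollifierD[OF \<rho>]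
    have sub: "ball 0 r \<subseteq> ball (0 :: real \<times> 'a) r1" "ball 0 r \<subseteq> ball (0 :: real \<times> 'a) r2"
      "ball 0 r \<subseteq> ball (0 :: real \<times> 'a) r3" "ball 0 r \<subseteq> ball (0 :: real \<times> 'a) r4" by (auto simp: r_def)
    note m1 = r1(2,3)[OF mollifier_mono[OF \<rho> sub(1)]] and m2 = r2(2,3)[OF mollifier_mono[OF \<rho> sub(2)]]
      and m3 = r3(2)[OF mollifier_mono[OF \<rho> sub(3)]] and m4 = r4(2)[OF mollifier_mono[OF \<rho> sub(4)]]
    have \<rho>m[measurable]: "\<rho> \<in> borel_measurable borel" by (rule smooth_borel_measurable[OF test_on_smooth[OF \<rho>D(1)]])
    obtain R where R: "\<And>z. \<bar>\<rho> z\<bar> \<le> R" "R \<ge> 0" using test_on_bounded[OF \<rho>D(1)] by blast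
    define D where "D p = indicator Q (fst p) * indicator Q (snd p) * (kflux f (W n (fst p)) (V n (snd p)) \<bullet> P (fst p)) * \<rho> (fst p - snd p)" for p
    have iD: "integrable lborel D"
    proof (rule integrable_bounded_support[OF _ bounded_first_minus_second[OF Q(2) bounded_ball[of 0 r]], where B="C0 * B * R"])
      show "D \<in> borel_measurable borel" unfolding D_def
        by (rule doubled_integrand_measurable[OF f Q(1) W(1) V(1) measurable_of_first[OF P] \<rho>m])
      show "D p = 0" if "p \<notin> {p. fst p \<in> Q \<and> fst p - snd p \<in> ball 0 r}" for p
        using that \<rho>D(4)[of "fst p - snd p"] by (auto simp: D_def split: split_indicator)
      fix p
      have "\<bar>kflux f (W n (fst p)) (V n (snd p)) \<bullet> P (fst p)\<bar> \<le> C0 * B"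
        by (rule order_trans[OF Cauchy_Schwarz_ineq2]) (intro mult_mono C0 PB W V norm_ge_zero)
      then have "\<bar>kflux f (W n (fst p)) (V n (snd p)) \<bullet> P (fst p)\<bar> * \<bar>\<rho> (fst p - snd p)\<bar> \<le> C0 * B * R"
        by (intro mult_mono R mult_nonneg_nonneg C0 B) auto
      moreover have "0 \<le> C0 * B * R" by (intro mult_nonneg_nonneg C0 B R)
      ultimately show "norm (D p) \<le> C0 * B * R" by (auto simp: D_def abs_mult split: split_indicator)
    qed
    define G where "G z = indicator Q z * (kflux f (W n z) (V n z) \<bullet> P z)" for z
    have iG: "integrable lborel G" unfolding G_def P_def
      by (rule flux_integrand_integrable[OF f Q(1) W(1) V(1) W(2) V(2) \<phi>])
    note mG = mollified_integral[OF iG \<rho>]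
    have flux: "flux_int Q f (W n) (V n) \<phi> = (LINT z|lborel. G z)"
      unfolding flux_int_def G_def P_def ..
    have dbl: "doubled_flux Q f (W n) (V n) \<phi> \<rho> = (LINT p|lborel. D p)"
      unfolding doubled_flux_def D_def P_def ..
    have dle: "d * (B * C1 + C0 * (B + 1)) \<le> \<eta> / 3"
    proof -
      have "d * (B * C1 + C0 * (B + 1)) \<le> d * (B * C1 + C0 * (B + 1) + 1)" using d by (intro mult_left_mono) auto
      also have "\<dots> = \<eta> / 3" using dpos by (simp add: d_def divide_simps)
      finally show ?thesis .
    qed
    have \<epsilon>le: "B * \<epsilon> * q \<le> \<eta> / 3"
    proof -
      have "B * \<epsilon> * q \<le> (B + 1) * \<epsilon> * (q + 1)" using B(1) \<epsilon> q0 by (intro mult_mono) auto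
      also have "\<dots> = \<eta> / 3" using B(1) q0 by (simp add: \<epsilon>_def divide_simps)
      finally show ?thesis .
    qed
    have BC: "B * C1 \<ge> 0" "C0 * B \<ge> 0" "B * \<epsilon> \<ge> 0" using B C1 C0 \<epsilon> by auto
    note MQ = mollified_integral[OF iQ \<rho>]
    have close: "\<bar>(LINT p|lborel. D p) - (LINT p|lborel. K p)\<bar> \<le> \<eta>"
      if K: "integrable lborel K" and le: "\<And>p. \<bar>D p - K p\<bar> \<le> B * \<epsilon> * h p + (B * C1 * h' p + c * h'' p)"
        and h: "integrable lborel h" "(LINT p|lborel. h p) = q" and h': "integrable lborel h'" "(LINT p|lborel. h' p) \<le> d"
        and h'': "integrable lborel h''" "(LINT p|lborel. h'' p) \<le> d" and c: "0 \<le> c" "c \<le> C0 * (B + 1)" for K h h' h'' c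
    proof -
      have "\<bar>LINT p|lborel. D p - K p\<bar> \<le> (LINT p|lborel. B * \<epsilon> * h p + (B * C1 * h' p + c * h'' p))"
        by (rule integral_abs_bound_integral[OF _ _ le]) (use iD K h h' h'' in auto)
      also have "\<dots> = B * \<epsilon> * q + (B * C1 * (LINT p|lborel. h' p) + c * (LINT p|lborel. h'' p))"
        using h h' h'' by simp
      also have "\<dots> \<le> B * \<epsilon> * q + (B * C1 * d + C0 * (B + 1) * d)"
        using BC(1) c d h'(2) h''(2) by (intro add_mono mult_left_mono order_refl order_trans[OF mult_left_mono[OF h''(2) c(1)] mult_right_mono]) auto
      also have "\<dots> \<le> \<eta>" using dle \<epsilon>le \<open>\<eta> > 0\<close> by (simp add: algebra_simps)
      finally show ?thesis using iD K by simp
    qed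
    from const show ?thesis
    proof
      \<comment> \<open>\<open>V\<close> is moved from the second point to the first, where
        \<open>W\<close> and the gradient already sit. A further error comes from pairs of which
        only the first point lies in \<open>Q\<close>.\<close>
      assume "\<forall>n. V n = V 0"
      then have V0: "V n = V 0" by blast
      have "\<bar>(LINT p|lborel. D p) - (LINT p|lborel. G (fst p) * \<rho> (fst p - snd p))\<bar> \<le> \<eta>"
      proof (rule close[OF mG(1) _ MQ(1) _ _ _ m1])
        fix p :: "(real \<times> 'a) \<times> (real \<times> 'a)"
        obtain z y where p: "p = (z, y)" by (cases p)
        define x where "x = \<rho> (z - y)"
        have x: "x \<ge> 0" unfolding x_def by (rule \<rho>D(2))
        have "\<bar>D p - G (fst p) * \<rho> (fst p - snd p)\<bar> \<le> B * \<epsilon> * (indicator Q z * x)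
          + (B * C1 * (\<bar>indicator Q z * V n z - indicator Q y * V n y\<bar> * x) + C0 * B * (\<bar>indicator Q z - indicator Q y\<bar> * x))"
        proof (cases "z \<in> Q")
          case z: True
          show ?thesis
          proof (cases "y \<in> Q")
            case True
            have "\<bar>(kflux f (W n z) (V n y) - kflux f (W n z) (V n z)) \<bullet> P z\<bar> \<le> (\<epsilon> + C1 * (\<bar>W n z - W n z\<bar> + \<bar>V n y - V n z\<bar>)) * B"
              by (rule order_trans[OF Cauchy_Schwarz_ineq2])
                (intro mult_mono C1 PB W V norm_ge_zero add_nonneg_nonneg mult_nonneg_nonneg, use \<epsilon> C1 in auto)
            then have "\<bar>(kflux f (W n z) (V n y) - kflux f (W n z) (V n z)) \<bullet> P z\<bar> * x \<le> (\<epsilon> + C1 * \<bar>V n y - V n z\<bar>) * B * x"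
              using x by (intro mult_right_mono) auto
            moreover have e: "D p - G (fst p) * \<rho> (fst p - snd p) = ((kflux f (W n z) (V n y) - kflux f (W n z) (V n z)) \<bullet> P z) * x"
              using z True by (simp add: D_def G_def p x_def inner_diff_left left_diff_distrib)
            ultimately show ?thesis unfolding e abs_mult using z True x by (simp add: algebra_simps abs_minus_commute)
          next
            case False
            have "\<bar>kflux f (W n z) (V n z) \<bullet> P z\<bar> \<le> C0 * B"
              by (rule order_trans[OF Cauchy_Schwarz_ineq2]) (intro mult_mono C0 PB W V norm_ge_zero)
            then have "\<bar>kflux f (W n z) (V n z) \<bullet> P z\<bar> * x \<le> C0 * B * x" using x by (rule mult_right_mono)
            moreover have "0 \<le> B * \<epsilon> * x" "0 \<le> B * C1 * (\<bar>V n z\<bar> * x)" using x BC by auto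
            ultimately show ?thesis using z False x by (simp add: D_def G_def p x_def abs_mult)
          qed
        next
          case False
          then show ?thesis using x BC by (simp add: D_def G_def p)
        qed
        then show "\<bar>D p - G (fst p) * \<rho> (fst p - snd p)\<bar> \<le> B * \<epsilon> * (indicator Q (fst p) * \<rho> (fst p - snd p))
          + (B * C1 * ?\<Delta> (\<lambda>z. indicator Q z * V 0 z) \<rho> p + C0 * B * ?\<Delta> (indicator Q :: _ \<Rightarrow> real) \<rho> p)"
          by (simp add: p x_def V0)
      qed (use m4 MQ(2) BC C0 in \<open>simp_all add: algebra_simps q_def\<close>)
      then show ?thesis unfolding dbl flux using mG(2) by simp
    next
      \<comment> \<open>Now \<open>W\<close> is fixed and everything is collected at the second
        point. The gradient of \<open>\<phi>\<close> has to move as well, whence the error term with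
        \<open>P\<close> cut off to \<open>Q\<close>.\<close>
      assume "\<forall>n. W n = W 0"
      then have W0: "W n = W 0" by blast
      have "\<bar>(LINT p|lborel. D p) - (LINT p|lborel. G (snd p) * \<rho> (fst p - snd p))\<bar> \<le> \<eta>"
      proof (rule close[OF mG(3) _ MQ(3) _ _ _ m2])
        fix p :: "(real \<times> 'a) \<times> (real \<times> 'a)"
        obtain z y where p: "p = (z, y)" by (cases p)
        define x where "x = \<rho> (z - y)"
        have x: "x \<ge> 0" unfolding x_def by (rule \<rho>D(2))
        have "\<bar>D p - G (snd p) * \<rho> (fst p - snd p)\<bar> \<le> B * \<epsilon> * (indicator Q y * x)
          + (B * C1 * (\<bar>indicator Q z * W n z - indicator Q y * W n y\<bar> * x) + C0 * (norm (indicator Q z *\<^sub>R P z - indicator Q y *\<^sub>R P y) * x))"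
        proof (cases "y \<in> Q")
          case y: True
          show ?thesis
          proof (cases "z \<in> Q")
            case True
            have "\<bar>kflux f (W n z) (V n y) \<bullet> (P z - P y)\<bar> \<le> C0 * norm (P z - P y)"
              by (rule order_trans[OF Cauchy_Schwarz_ineq2]) (intro mult_right_mono C0 W V norm_ge_zero)
            moreover have "\<bar>(kflux f (W n z) (V n y) - kflux f (W n y) (V n y)) \<bullet> P y\<bar> \<le> (\<epsilon> + C1 * (\<bar>W n z - W n y\<bar> + \<bar>V n y - V n y\<bar>)) * B"
              by (rule order_trans[OF Cauchy_Schwarz_ineq2])
                (intro mult_mono C1 PB W V norm_ge_zero add_nonneg_nonneg mult_nonneg_nonneg, use \<epsilon> C1 in auto)
            moreover have "kflux f (W n z) (V n y) \<bullet> P z - kflux f (W n y) (V n y) \<bullet> P y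
              = kflux f (W n z) (V n y) \<bullet> (P z - P y) + (kflux f (W n z) (V n y) - kflux f (W n y) (V n y)) \<bullet> P y"
              by (simp add: inner_diff_left inner_diff_right)
            ultimately have "\<bar>kflux f (W n z) (V n y) \<bullet> P z - kflux f (W n y) (V n y) \<bullet> P y\<bar>
              \<le> C0 * norm (P z - P y) + (\<epsilon> + C1 * \<bar>W n z - W n y\<bar>) * B" by simp
            then have "\<bar>kflux f (W n z) (V n y) \<bullet> P z - kflux f (W n y) (V n y) \<bullet> P y\<bar> * x
              \<le> (C0 * norm (P z - P y) + (\<epsilon> + C1 * \<bar>W n z - W n y\<bar>) * B) * x"
              using x by (rule mult_right_mono)
            moreover have e: "D p - G (snd p) * \<rho> (fst p - snd p) = (kflux f (W n z) (V n y) \<bullet> P z - kflux f (W n y) (V n y) \<bullet> P y) * x"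
              using y True by (simp add: D_def G_def p x_def left_diff_distrib)
            ultimately show ?thesis unfolding e abs_mult using y True x by (simp add: algebra_simps)
          next
            case False
            have "\<bar>kflux f (W n y) (V n y) \<bullet> P y\<bar> \<le> C0 * norm (P y)"
              by (rule order_trans[OF Cauchy_Schwarz_ineq2]) (intro mult_right_mono C0 W V norm_ge_zero)
            then have "\<bar>kflux f (W n y) (V n y) \<bullet> P y\<bar> * x \<le> C0 * norm (P y) * x" using x by (rule mult_right_mono)
            moreover have "0 \<le> B * \<epsilon> * x" "0 \<le> B * C1 * (\<bar>W n y\<bar> * x)" using x BC by auto
            ultimately show ?thesis using y False x by (simp add: D_def G_def p x_def abs_mult)
          qed
        next
          case False
          then show ?thesis using x BC C0(1) by (simp add: D_def G_def p)
        qed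
        then show "\<bar>D p - G (snd p) * \<rho> (fst p - snd p)\<bar> \<le> B * \<epsilon> * (indicator Q (snd p) * \<rho> (fst p - snd p))
          + (B * C1 * ?\<Delta> (\<lambda>z. indicator Q z * W 0 z) \<rho> p + C0 * ?\<Delta> (\<lambda>z. indicator Q z *\<^sub>R P z) \<rho> p)"
          by (simp add: p x_def W0)
      qed (use m3 MQ(4) B C0 in \<open>simp_all add: algebra_simps q_def\<close>)
      then show ?thesis unfolding dbl flux using mG(4) by simp
    qed
  qed
  moreover have "r > 0" using r1 r2 r3 r4 by (simp add: r_def)
  ultimately show thesis using that by blast
qed

section \<open>Asymptotic entropy subsolutions and doubling of variables\<close>

text \<open>Time begins at -1 to leave room for the continuation by the initial datum. Test
  functions supported here may be nonzero at t = 0, as in the entropy inequality.\<close>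

definition slab :: "real \<Rightarrow> 'a set \<Rightarrow> (real \<times> 'a) set" where
  "slab T S = {-1<..<T} \<times> S"

definition adm_test ::
  "real \<Rightarrow> 'a::euclidean_space set \<Rightarrow> (real \<times> 'a \<Rightarrow> real) \<Rightarrow> real \<Rightarrow> real \<Rightarrow> real \<Rightarrow> (real \<times> 'a \<Rightarrow> real) \<Rightarrow> bool" where
  "adm_test T \<Omega> a B R k \<phi> \<longleftrightarrow> test_on (slab T UNIV) \<phi> \<and>
    (\<forall>z. 0 \<le> \<phi> z \<and> \<phi> z \<le> B \<and> (\<phi> z \<noteq> 0 \<longrightarrow> norm z \<le> R)) \<and>
    (\<forall>z h. \<bar>\<phi> (z + h) + \<phi> (z - h) - 2 * \<phi> z\<bar> \<le> B * (norm h)\<^sup>2) \<and>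
    (\<forall>z\<in>slab T (- \<Omega>). \<phi> z \<noteq> 0 \<longrightarrow> a z \<le> k)"

text \<open>
  Boundary values \<open>a\<close> enter only through the admissible constants: where \<open>\<phi>\<close> does not vanish on the
  boundary, \<open>k\<close> has to exceed \<open>a\<close>. Hence no boundary integral is needed. The error is uniform over test
  functions that are bounded together with their second differences, since this is all that a Levy
  operator sees.
\<close>

definition asub ::
  "real \<Rightarrow> 'a::euclidean_space set \<Rightarrow> (real \<Rightarrow> 'a) \<Rightarrow> (real \<times> 'a \<Rightarrow> real) \<Rightarrow> nat filter \<Rightarrow>
    (nat \<Rightarrow> real \<times> 'a \<Rightarrow> real) \<Rightarrow> bool" where
  "asub T \<Omega> f a F w \<longleftrightarrow> (\<forall>B R. \<exists>e. (e \<longlongrightarrow> 0) F \<and>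
    (\<forall>n k \<phi>. \<bar>k\<bar> \<le> B \<longrightarrow> adm_test T \<Omega> a B R k \<phi> \<longrightarrow>
      - flux_int (slab T \<Omega>) f (w n) (\<lambda>_. k) \<phi> \<le> e n))"

lemma flux_int_reflect:
  "flux_int Q (\<lambda>s. - f (- s)) (\<lambda>z. - Y z) (\<lambda>z. - X z) \<phi> = flux_int Q f X Y \<phi>"
  unfolding flux_int_def kflux_reflect ..

lemma nabla_translate:
  assumes "smooth \<rho>" shows "nabla (\<lambda>z. \<rho> (z - y)) z = nabla \<rho> (z - y)"
proof (rule nablaI)
  have "((\<lambda>z. z - y) has_derivative (\<lambda>h. h)) (at z)" by (auto intro!: derivative_eq_intros)
  from has_derivative_compose[OF this smooth_has_nabla[OF assms]]
  show "((\<lambda>z. \<rho> (z - y)) has_derivative (\<lambda>h. nabla \<rho> (z - y) \<bullet> h)) (at z)" .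
qed

lemma nabla_reflect:
  assumes "smooth \<rho>" shows "nabla (\<lambda>y. \<rho> (z - y)) y = - nabla \<rho> (z - y)"
proof (rule nablaI)
  have "((\<lambda>y. z - y) has_derivative (\<lambda>h. - h)) (at y)" by (auto intro!: derivative_eq_intros)
  from has_derivative_compose[OF this smooth_has_nabla[OF assms]]
  show "((\<lambda>y. \<rho> (z - y)) has_derivative (\<lambda>h. - nabla \<rho> (z - y) \<bullet> h)) (at y)" by simp
qed

lemma smooth_translate:
  fixes \<rho> :: "'e::euclidean_space \<Rightarrow> real"
  assumes "smooth \<rho>" shows "smooth (\<lambda>z. \<rho> (z - y))" "smooth (\<lambda>y. \<rho> (z - y))"
proof -
  have "smooth (\<lambda>z. \<rho> (z + - y))" "smooth (\<lambda>y. \<rho> (- y + z))"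
    by (rule smooth_comp_affine[OF _ assms], simp add: bounded_linear_minus bounded_linear_ident)+
  then show "smooth (\<lambda>z. \<rho> (z - y))" "smooth (\<lambda>y. \<rho> (z - y))" by simp_all
qed

lemma product_family_bounds:
  fixes \<phi> \<rho> :: "'e::euclidean_space \<Rightarrow> real"
  assumes \<phi>: "test_on S \<phi>" and \<rho>: "test_on S' \<rho>"
  obtains B R where "B \<ge> 0" "\<And>y z. \<bar>\<phi> z * \<rho> (z - y)\<bar> \<le> B"
    "\<And>y z h. \<bar>\<phi> (z + h) * \<rho> (z + h - y) + \<phi> (z - h) * \<rho> (z - h - y) - 2 * (\<phi> z * \<rho> (z - y))\<bar> \<le> B * (norm h)\<^sup>2"
    "\<And>y z h. \<bar>\<phi> z * \<rho> (z - (y + h)) + \<phi> z * \<rho> (z - (y - h)) - 2 * (\<phi> z * \<rho> (z - y))\<bar> \<le> B * (norm h)\<^sup>2"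
    "\<And>y z. \<phi> z * \<rho> (z - y) \<noteq> 0 \<Longrightarrow> norm z \<le> R \<and> norm y \<le> R"
proof -
  define \<Psi> where "\<Psi> p = \<phi> (fst p) * \<rho> (fst p - snd p)" for p
  obtain K where K: "compact K" "K \<subseteq> S" "\<And>z. z \<notin> K \<Longrightarrow> \<phi> z = 0" using test_onE[OF \<phi>] by blast
  obtain L where L: "compact L" "L \<subseteq> S'" "\<And>z. z \<notin> L \<Longrightarrow> \<rho> z = 0" using test_onE[OF \<rho>] by blast
  define K2 where "K2 = {x - y |x y. x \<in> K \<and> y \<in> L}"
  have K2: "compact K2" unfolding K2_def by (rule compact_differences[OF K(1) L(1)])
  have supp: "z \<in> K \<and> y \<in> K2" if "\<phi> z * \<rho> (z - y) \<noteq> 0" for z y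
  proof -
    have "z \<in> K" "z - y \<in> L" using that K(3) L(3) by force+
    then have "z - (z - y) \<in> K2" unfolding K2_def by blast
    then show ?thesis using \<open>z \<in> K\<close> by simp
  qed
  have "smooth (\<lambda>p :: 'e \<times> 'e. \<phi> (fst p))" "smooth (\<lambda>p :: 'e \<times> 'e. \<rho> (fst p - snd p))"
    by (rule smooth_comp_linear[OF _ test_on_smooth[OF \<phi>]] smooth_comp_linear[OF _ test_on_smooth[OF \<rho>]];
        intro bounded_linear_sub bounded_linear_fst bounded_linear_snd)+
  then have "smooth \<Psi>" unfolding \<Psi>_def by (rule smooth_mult)
  moreover have "\<Psi> p = 0" if "p \<notin> K \<times> K2" for p
    using supp[of "fst p" "snd p"] that by (cases p) (auto simp: \<Psi>_def)
  ultimately have \<Psi>: "test_on UNIV \<Psi>"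
    unfolding test_on_def using compact_Times[OF K(1) K2] by blast
  obtain B1 where B1: "B1 \<ge> 0" "\<And>z. \<bar>\<Psi> z\<bar> \<le> B1" using test_on_bounded[OF \<Psi>] by blast
  obtain B2 where B2: "B2 \<ge> 0" "\<And>z h. \<bar>\<Psi> (z + h) + \<Psi> (z - h) - 2 * \<Psi> z\<bar> \<le> B2 * (norm h)\<^sup>2"
    using test_on_second_difference[OF \<Psi>] by blast
  obtain R1 where R1: "\<And>x. x \<in> K \<Longrightarrow> norm x \<le> R1" using compact_imp_bounded[OF K(1)] unfolding bounded_iff by blast
  obtain R2 where R2: "\<And>x. x \<in> K2 \<Longrightarrow> norm x \<le> R2" using compact_imp_bounded[OF K2] unfolding bounded_iff by blast
  have le: "B2 * (norm h)\<^sup>2 \<le> max B1 B2 * (norm h)\<^sup>2" for h :: 'e by (intro mult_right_mono) auto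
  show thesis
  proof (rule that[of "max B1 B2" "max R1 R2"])
    show "max B1 B2 \<ge> 0" using B1(1) by simp
    fix y z h :: 'e
    show "\<bar>\<phi> z * \<rho> (z - y)\<bar> \<le> max B1 B2" using B1(2)[of "(z, y)"] by (simp add: \<Psi>_def)
    show "\<bar>\<phi> (z + h) * \<rho> (z + h - y) + \<phi> (z - h) * \<rho> (z - h - y) - 2 * (\<phi> z * \<rho> (z - y))\<bar> \<le> max B1 B2 * (norm h)\<^sup>2"
      using B2(2)[of "(z, y)" "(h, 0)"] le[of h] by (simp add: \<Psi>_def)
    show "\<bar>\<phi> z * \<rho> (z - (y + h)) + \<phi> z * \<rho> (z - (y - h)) - 2 * (\<phi> z * \<rho> (z - y))\<bar> \<le> max B1 B2 * (norm h)\<^sup>2"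
      using B2(2)[of "(z, y)" "(0, h)"] le[of h] by (simp add: \<Psi>_def)
    show "norm z \<le> max R1 R2 \<and> norm y \<le> max R1 R2" if "\<phi> z * \<rho> (z - y) \<noteq> 0"
      using supp[OF that] R1[of z] R2[of y] by auto
  qed
qed

lemma bounded_slab: "bounded \<Omega> \<Longrightarrow> bounded (slab T \<Omega>)"
  unfolding slab_def by (intro bounded_Times bounded_subset[OF bounded_closed_interval[of "-1" T]]) auto

lemma open_slab: "open \<Omega> \<Longrightarrow> open (slab T \<Omega>)"
  unfolding slab_def by (intro open_Times) auto

lemma slab_disjoint: "z \<in> slab T \<Omega> \<Longrightarrow> z \<notin> slab T (- \<Omega>)"
  by (auto simp: slab_def)

lemma slab_mono: "slab T \<Omega> \<subseteq> slab T UNIV"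
  by (auto simp: slab_def)

text \<open>The gradients of the kernel in the two variables are opposite and would cancel, if the
  flux were not switched off according to the time of the respective point. This is the size of what
  remains.\<close>

definition switch_error ::
  "(real \<times> 'a::euclidean_space) set \<Rightarrow> (real \<times> 'a \<Rightarrow> real) \<Rightarrow> (real \<times> 'a \<Rightarrow> real) \<Rightarrow> real" where
  "switch_error Q \<phi> \<rho> = (LINT p|lborel. indicator Q (fst p) * indicator Q (snd p) * (\<phi> (fst p) *
    norm (switched (fst (fst p)) (nabla \<rho> (fst p - snd p)) - switched (fst (snd p)) (nabla \<rho> (fst p - snd p)))))"

text \<open>\<open>w\<close> is an asymptotic subsolution and \<open>v\<close> an asymptotic
  supersolution, the latter in reflected form. Both are sequences, since either may be the one that
  is constant in \<open>n\<close>.\<close>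

locale semi_pair =
  fixes T :: real and \<Omega> :: "'a::euclidean_space set" and f :: "real \<Rightarrow> 'a" and a :: "real \<times> 'a \<Rightarrow> real"
    and M :: real and F :: "nat filter" and w v :: "nat \<Rightarrow> real \<times> 'a \<Rightarrow> real"
  assumes op: "open \<Omega>" and bd: "bounded \<Omega>" and f: "continuous_on UNIV f"
    and wm: "\<And>n. w n \<in> borel_measurable borel" and wb: "\<And>n z. \<bar>w n z\<bar> \<le> M"
    and vm: "\<And>n. v n \<in> borel_measurable borel" and vb: "\<And>n z. \<bar>v n z\<bar> \<le> M"
    and sub: "asub T \<Omega> f a F w"
    and sup: "asub T \<Omega> (\<lambda>s. - f (- s)) (\<lambda>z. - a z) F (\<lambda>n z. - v n z)"
begin

abbreviation "Q \<equiv> slab T \<Omega>"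

lemma semi_pair_reflect: "semi_pair T \<Omega> (\<lambda>s. - f (- s)) (\<lambda>z. - a z) M F (\<lambda>n z. - v n z) (\<lambda>n z. - w n z)"
proof
  show "continuous_on UNIV (\<lambda>s. - f (- s))"
    by (intro continuous_on_minus continuous_on_compose2[OF f]) (auto intro: continuous_intros)
qed (use op bd wm wb vm vb sub sup in auto)

lemma Q_borel: "Q \<in> sets borel" "bounded Q"
  using open_slab[OF op] bounded_slab[OF bd] by auto

lemma subsolutionE:
  obtains e where "(e \<longlongrightarrow> 0) F" "\<And>n. 0 \<le> e n" "\<And>n k \<phi>. \<bar>k\<bar> \<le> B \<Longrightarrow> adm_test T \<Omega> a B R k \<phi> \<Longrightarrow>
      - flux_int Q f (w n) (\<lambda>_. k) \<phi> \<le> e n"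
proof -
  obtain e where e: "(e \<longlongrightarrow> 0) F" "\<forall>n k \<phi>. \<bar>k\<bar> \<le> B \<longrightarrow> adm_test T \<Omega> a B R k \<phi> \<longrightarrow>
      - flux_int Q f (w n) (\<lambda>_. k) \<phi> \<le> e n"
    using sub unfolding asub_def by blast
  have "((\<lambda>n. \<bar>e n\<bar>) \<longlongrightarrow> 0) F" using tendsto_rabs[OF e(1)] by simp
  then show thesis
  proof (rule that)
    show "- flux_int Q f (w n) (\<lambda>_. k) \<phi> \<le> \<bar>e n\<bar>" if "\<bar>k\<bar> \<le> B" "adm_test T \<Omega> a B R k \<phi>" for n k \<phi>
      by (rule order_trans[OF _ abs_ge_self]) (use e(2) that in blast)
  qed simp
qed

lemma supersolutionE:
  obtains e where "(e \<longlongrightarrow> 0) F" "\<And>n. 0 \<le> e n" "\<And>n k \<phi>. \<bar>k\<bar> \<le> B \<Longrightarrow> adm_test T \<Omega> (\<lambda>z. - a z) B R (- k) \<phi> \<Longrightarrow>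
      - flux_int Q f (\<lambda>_. k) (v n) \<phi> \<le> e n"
proof -
  obtain e where e: "(e \<longlongrightarrow> 0) F" "\<forall>n k \<phi>. \<bar>k\<bar> \<le> B \<longrightarrow> adm_test T \<Omega> (\<lambda>z. - a z) B R k \<phi> \<longrightarrow>
      - flux_int Q (\<lambda>s. - f (- s)) (\<lambda>z. - v n z) (\<lambda>_. k) \<phi> \<le> e n"
    using sup unfolding asub_def by blast
  have "((\<lambda>n. \<bar>e n\<bar>) \<longlongrightarrow> 0) F" using tendsto_rabs[OF e(1)] by simp
  then show thesis
  proof (rule that)
    fix n k \<phi> assume k: "\<bar>k\<bar> \<le> B" and \<phi>: "adm_test T \<Omega> (\<lambda>z. - a z) B R (- k) \<phi>"
    have "\<bar>- k\<bar> \<le> B" using k by simp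
    then have "- flux_int Q (\<lambda>s. - f (- s)) (\<lambda>z. - v n z) (\<lambda>_. - k) \<phi> \<le> e n" using e(2) \<phi> by blast
    then show "- flux_int Q f (\<lambda>_. k) (v n) \<phi> \<le> \<bar>e n\<bar>"
      using flux_int_reflect[of Q f "v n" "\<lambda>_. k" \<phi>] by simp
  qed simp
qed

lemma doubled_integrable:
  assumes X: "X \<in> borel_measurable borel" "\<And>z. \<bar>X z\<bar> \<le> N" and Y: "Y \<in> borel_measurable borel" "\<And>z. \<bar>Y z\<bar> \<le> N"
    and P: "P \<in> borel_measurable borel" "\<And>p. norm (P p) \<le> B" "bounded K" "\<And>p. p \<notin> K \<Longrightarrow> P p = 0"
  shows "integrable lborel (\<lambda>p. indicator Q (fst p) * indicator Q (snd p) * (kflux f (X (fst p)) (Y (snd p)) \<bullet> P p) :: real)"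
proof -
  obtain C0 where C0: "C0 \<ge> 0" "\<And>\<alpha> \<beta>. \<bar>\<alpha>\<bar> \<le> N \<Longrightarrow> \<bar>\<beta>\<bar> \<le> N \<Longrightarrow> norm (kflux f \<alpha> \<beta>) \<le> C0"
    using kflux_bounded[OF f, of N] by blast
  show ?thesis
  proof (rule integrable_bounded_support[OF _ P(3), where B="C0 * B"])
    show "(\<lambda>p. indicator Q (fst p) * indicator Q (snd p) * (kflux f (X (fst p)) (Y (snd p)) \<bullet> P p) :: real) \<in> borel_measurable borel"
      using doubled_integrand_measurable[OF f Q_borel(1) X(1) Y(1) P(1), of "\<lambda>_. 1"] by simp
    show "indicator Q (fst p) * indicator Q (snd p) * (kflux f (X (fst p)) (Y (snd p)) \<bullet> P p) = (0::real)" if "p \<notin> K" for p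
      using P(4)[OF that] by simp
    fix p
    have "\<bar>kflux f (X (fst p)) (Y (snd p)) \<bullet> P p\<bar> \<le> C0 * B"
      by (rule order_trans[OF Cauchy_Schwarz_ineq2]) (intro mult_mono C0 P X Y norm_ge_zero)
    moreover have "0 \<le> C0 * B" using C0(1) order_trans[OF norm_ge_zero P(2)] by simp
    ultimately show "norm (indicator Q (fst p) * indicator Q (snd p) * (kflux f (X (fst p)) (Y (snd p)) \<bullet> P p) :: real) \<le> C0 * B"
      by (auto split: split_indicator)
  qed
qed

text \<open>In the first variable the constant is \<open>max (v n y) c\<close>; it is at least
  \<open>c\<close>, hence above the boundary values wherever \<open>\<phi>\<close> lives outside
  \<open>\<Omega>\<close>. In the second variable nothing relates the constant
  \<open>max (w n z) c\<close> to the boundary values from the required side, so the displaced test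
  function must stay inside \<open>Q\<close>; this is the assumption \<open>inside\<close>. The
  truncation identities then leave the flux of \<open>c\<close> against \<open>v\<close>, tested
  with an average of \<open>\<phi>\<close>. As this functional is asymptotically monotone, the
  average may be replaced by the majorant \<open>\<theta>\<close>.\<close>

lemma doubling:
  fixes c :: real and \<phi> \<rho> \<theta> :: "real \<times> 'a \<Rightarrow> real"
  assumes \<phi>: "test_on (slab T UNIV) \<phi>" "\<And>z. 0 \<le> \<phi> z" "\<And>z. z \<in> slab T (- \<Omega>) \<Longrightarrow> \<phi> z \<noteq> 0 \<Longrightarrow> a z \<le> c"
    and \<rho>: "mollifier S \<rho>" and K: "compact K'" "K' \<subseteq> slab T UNIV"
    and inside: "\<And>z y. z \<in> Q \<Longrightarrow> \<phi> z \<noteq> 0 \<Longrightarrow> \<rho> (z - y) \<noteq> 0 \<Longrightarrow> y \<in> Q \<and> y \<in> K' \<and> \<phi> z \<le> \<theta> y"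
    and \<theta>: "test_on Q \<theta>" "\<And>y. 0 \<le> \<theta> y"
    and C0: "C0 \<ge> 0" "\<And>\<alpha> \<beta>. \<bar>\<alpha>\<bar> \<le> max M \<bar>c\<bar> \<Longrightarrow> \<bar>\<beta>\<bar> \<le> max M \<bar>c\<bar> \<Longrightarrow> norm (kflux f \<alpha> \<beta>) \<le> C0"
  obtains e where "(e \<longlongrightarrow> 0) F"
    "\<And>n. - doubled_flux Q f (\<lambda>z. max (w n z) c) (\<lambda>z. max (v n z) c) \<phi> \<rho> \<le> flux_int Q f (\<lambda>_. c) (v n) \<theta>
      + C0 * switch_error Q \<phi> \<rho> + e n"
proof -
  note \<rho>D = mollifierD[OF \<rho>]
  note sm\<phi> = test_on_smooth[OF \<phi>(1)] and sm\<rho> = test_on_smooth[OF \<rho>D(1)]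
  define N where "N = max M \<bar>c\<bar>"
  have M: "M \<ge> 0" using wb[of 0 0] by simp
  have N: "\<bar>w n z\<bar> \<le> N" "\<bar>v n z\<bar> \<le> N" "\<bar>max (w n z) c\<bar> \<le> N" "\<bar>max (v n z) c\<bar> \<le> N" "\<bar>c\<bar> \<le> N" for n z
    using wb[of n z] vb[of n z] unfolding N_def by (auto simp: max_def)
  obtain B R where BR: "B \<ge> 0" "\<And>y z. \<bar>\<phi> z * \<rho> (z - y)\<bar> \<le> B"
    "\<And>y z h. \<bar>\<phi> (z + h) * \<rho> (z + h - y) + \<phi> (z - h) * \<rho> (z - h - y) - 2 * (\<phi> z * \<rho> (z - y))\<bar> \<le> B * (norm h)\<^sup>2"
    "\<And>y z h. \<bar>\<phi> z * \<rho> (z - (y + h)) + \<phi> z * \<rho> (z - (y - h)) - 2 * (\<phi> z * \<rho> (z - y))\<bar> \<le> B * (norm h)\<^sup>2"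
    "\<And>y z. \<phi> z * \<rho> (z - y) \<noteq> 0 \<Longrightarrow> norm z \<le> R \<and> norm y \<le> R"
    using product_family_bounds[OF \<phi>(1) \<rho>D(1)] by blast
  define g where "g z = indicator Q z * \<phi> z" for z
  have Qm[measurable]: "Q \<in> sets borel" by (rule Q_borel)
  have [measurable]: "\<phi> \<in> borel_measurable borel" "\<rho> \<in> borel_measurable borel"
    by (rule smooth_borel_measurable, fact)+
  obtain B\<phi> where B\<phi>: "B\<phi> \<ge> 0" "\<And>z. \<bar>\<phi> z\<bar> \<le> B\<phi>" using test_on_bounded[OF \<phi>(1)] by blast
  have ig: "integrable lborel g" unfolding g_def
    by (rule integrable_bounded_support[OF _ Q_borel(2), where B=B\<phi>]) (use B\<phi> in \<open>auto split: split_indicator\<close>)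
  have ref\<rho>: "test_on UNIV (\<lambda>x. \<rho> (- x))"
  proof -
    obtain L where L: "compact L" "L \<subseteq> S" "\<And>z. z \<notin> L \<Longrightarrow> \<rho> z = 0" using test_onE[OF \<rho>D(1)] by blast
    have "smooth (\<lambda>x. \<rho> (- x))" using smooth_translate(2)[OF sm\<rho>, of 0] by simp
    moreover have "\<rho> (- x) = 0" if "x \<notin> uminus ` L" for x using L(3)[of "- x"] that by force
    ultimately show ?thesis unfolding test_on_def using compact_negations[OF L(1)] by blast
  qed
  \<comment> \<open>The test function of the surplus term: the contributions of all first points are
    collected at \<open>y\<close>. By \<open>inside\<close> it vanishes off \<open>Q\<close> and off
    \<open>K'\<close> and stays below \<open>\<theta>\<close>.\<close>
  define \<phi>a where "\<phi>a y = (LINT z|lborel. g z * \<rho> (z - y))" for y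
  have \<phi>a_conv: "\<phi>a = (\<lambda>y. LINT z|lborel. g z * \<rho> (- (y - z)))" unfolding \<phi>a_def by simp
  have \<phi>a_smooth: "smooth \<phi>a" unfolding \<phi>a_conv by (rule smooth_convolution[OF ig ref\<rho>])
  have nab_ref: "nabla (\<lambda>x. \<rho> (- x)) x = - nabla \<rho> (- x)" for x
    using nabla_reflect[OF sm\<rho>, of 0 x] by simp
  have \<phi>a_nabla: "nabla \<phi>a y = (LINT z|lborel. g z *\<^sub>R (- nabla \<rho> (z - y)))" for y
    unfolding \<phi>a_conv nabla_convolution[OF ig ref\<rho>] nab_ref by simp
  have g0: "g z * \<rho> (z - y) \<noteq> 0 \<Longrightarrow> y \<in> Q \<and> y \<in> K' \<and> \<phi> z \<le> \<theta> y" for z y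
    using inside[of z y] by (auto simp: g_def split: split_indicator_asm)
  have \<phi>a_0: "\<phi>a y = 0" if "\<not> (y \<in> Q \<and> y \<in> K')" for y
  proof -
    have "g z * \<rho> (z - y) = 0" for z using g0[of z y] that by blast
    then show ?thesis unfolding \<phi>a_def by (simp only: integral_zero)
  qed
  have i\<rho>: "integrable lborel (\<lambda>z. \<rho> (z - y))" for y
  proof -
    have "integrable lborel (\<lambda>z. \<rho> (- (y - z)))"
      by (rule integrable_lborel_reflect[OF test_on_integrable[OF ref\<rho>]])
    then show ?thesis by simp
  qed
  have ig\<rho>: "integrable lborel (\<lambda>z. g z * \<rho> (z - y))" for y
  proof (rule Bochner_Integration.integrable_bound)
    show "integrable lborel (\<lambda>z. B\<phi> * \<rho> (z - y))" using i\<rho> by simp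
    show "(\<lambda>z. g z * \<rho> (z - y)) \<in> borel_measurable lborel" unfolding g_def by measurable
    show "AE z in lborel. norm (g z * \<rho> (z - y)) \<le> norm (B\<phi> * \<rho> (z - y))"
      using B\<phi> by (auto simp: g_def abs_mult split: split_indicator intro!: mult_right_mono)
  qed
  have \<phi>a_le: "\<phi>a y \<le> \<theta> y" for y
  proof -
    have "\<phi>a y \<le> (LINT z|lborel. \<theta> y * \<rho> (z - y))"
      unfolding \<phi>a_def
    proof (rule integral_mono[OF ig\<rho>])
      show "integrable lborel (\<lambda>z. \<theta> y * \<rho> (z - y))" using i\<rho> by simp
      fix z show "g z * \<rho> (z - y) \<le> \<theta> y * \<rho> (z - y)"
      proof (cases "g z * \<rho> (z - y) = 0")
        case True
        show ?thesis unfolding True by (rule mult_nonneg_nonneg[OF \<theta>(2) \<rho>D(2)])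
      next
        case False
        then have "g z \<le> \<theta> y" using g0[OF False] by (auto simp: g_def split: split_indicator_asm)
        then show ?thesis using \<rho>D(2) by (rule mult_right_mono)
      qed
    qed
    also have "\<dots> = \<theta> y" using mollifier_integral(2)[OF \<rho>] by simp
    finally show ?thesis .
  qed
  have \<phi>a_test: "test_on (slab T UNIV) \<phi>a"
    unfolding test_on_def using \<phi>a_smooth K \<phi>a_0 by blast
  \<comment> \<open>Nonnegative and zero on the exterior, so the constant \<open>c\<close> is
    admissible for it. This gives the monotonicity needed to pass from \<open>\<phi>a\<close> to
    \<open>\<theta>\<close>.\<close>
  define \<theta>d where "\<theta>d y = \<theta> y - \<phi>a y" for y
  have \<theta>U: "test_on (slab T UNIV) \<theta>" by (rule test_on_mono[OF \<theta>(1) slab_mono])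
  have \<theta>d_test: "test_on (slab T UNIV) \<theta>d" unfolding \<theta>d_def by (rule test_on_diff[OF \<theta>U \<phi>a_test])
  obtain Kd where Kd: "compact Kd" "Kd \<subseteq> slab T UNIV" "\<And>z. z \<notin> Kd \<Longrightarrow> \<theta>d z = 0" using test_onE[OF \<theta>d_test] by blast
  obtain Rd where Rd: "\<And>x. x \<in> Kd \<Longrightarrow> norm x \<le> Rd" using compact_imp_bounded[OF Kd(1)] unfolding bounded_iff by blast
  obtain Bd1 where Bd1: "Bd1 \<ge> 0" "\<And>z. \<bar>\<theta>d z\<bar> \<le> Bd1" using test_on_bounded[OF \<theta>d_test] by blast
  obtain Bd2 where Bd2: "Bd2 \<ge> 0" "\<And>z h. \<bar>\<theta>d (z + h) + \<theta>d (z - h) - 2 * \<theta>d z\<bar> \<le> Bd2 * (norm h)\<^sup>2"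
    using test_on_second_difference[OF \<theta>d_test] by blast
  define B' where "B' = max N (max B (max Bd1 Bd2))"
  define R' where "R' = max R Rd"
  obtain e1 where e1: "(e1 \<longlongrightarrow> 0) F" "\<And>n. 0 \<le> e1 n" "\<And>n k \<phi>. \<bar>k\<bar> \<le> B' \<Longrightarrow> adm_test T \<Omega> a B' R' k \<phi> \<Longrightarrow>
      - flux_int Q f (w n) (\<lambda>_. k) \<phi> \<le> e1 n"
    using subsolutionE[of B' R'] by blast
  obtain e2 where e2: "(e2 \<longlongrightarrow> 0) F" "\<And>n. 0 \<le> e2 n" "\<And>n k \<phi>. \<bar>k\<bar> \<le> B' \<Longrightarrow> adm_test T \<Omega> (\<lambda>z. - a z) B' R' (- k) \<phi> \<Longrightarrow>
      - flux_int Q f (\<lambda>_. k) (v n) \<phi> \<le> e2 n"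
    using supersolutionE[of B' R'] by blast
  have BB: "B * x \<le> B' * x" "Bd2 * x \<le> B' * x" if "x \<ge> 0" for x
    using that by (auto simp: B'_def intro!: mult_right_mono)
  have NB: "N \<le> B'" "B \<le> B'" "Bd1 \<le> B'" "R \<le> R'" "Rd \<le> R'" by (auto simp: B'_def R'_def)
  have t1: "- flux_int Q f (w n) (\<lambda>_. max (v n y) c) (\<lambda>z. \<phi> z * \<rho> (z - y)) \<le> e1 n" for n y
  proof (rule e1(3))
    show "\<bar>max (v n y) c\<bar> \<le> B'" using N(4)[of n y] NB by linarith
    have "test_on (slab T UNIV) (\<lambda>z. \<phi> z * \<rho> (z - y))"
      by (rule test_on_mult(2)[OF \<phi>(1) smooth_translate(1)[OF sm\<rho>]])
    moreover have "\<bar>\<phi> (z + h) * \<rho> (z + h - y) + \<phi> (z - h) * \<rho> (z - h - y) - 2 * (\<phi> z * \<rho> (z - y))\<bar> \<le> B' * (norm h)\<^sup>2" for z h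
      using BR(3)[where z=z and h=h and y=y] BB(1)[of "(norm h)\<^sup>2"] by simp
    moreover have "\<phi> z * \<rho> (z - y) \<le> B'" "\<phi> z * \<rho> (z - y) \<noteq> 0 \<longrightarrow> norm z \<le> R'" "0 \<le> \<phi> z * \<rho> (z - y)" for z
      using BR(2)[where z=z and y=y] BR(5)[where z=z and y=y] NB \<phi>(2)[of z] \<rho>D(2)[of "z - y"] by auto
    moreover have "a z \<le> max (v n y) c" if "z \<in> slab T (- \<Omega>)" "\<phi> z * \<rho> (z - y) \<noteq> 0" for z
      using \<phi>(3)[OF that(1)] that(2) by auto
    ultimately show "adm_test T \<Omega> a B' R' (max (v n y) c) (\<lambda>z. \<phi> z * \<rho> (z - y))"
      unfolding adm_test_def by blast
  qed
  have t2: "- flux_int Q f (\<lambda>_. max (w n z) c) (v n) (\<lambda>y. \<phi> z * \<rho> (z - y)) \<le> e2 n" if z: "z \<in> Q" for n z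
  proof (rule e2(3))
    show "\<bar>max (w n z) c\<bar> \<le> B'" using N(3)[of n z] NB by linarith
    have "y \<in> K'" if "\<phi> z * \<rho> (z - y) \<noteq> 0" for y using inside[OF z] that by auto
    then have "test_on (slab T UNIV) (\<lambda>y. \<phi> z * \<rho> (z - y))"
      unfolding test_on_def using K smooth_mult[OF smooth_const smooth_translate(2)[OF sm\<rho>]] by blast
    moreover have "\<bar>\<phi> z * \<rho> (z - (y + h)) + \<phi> z * \<rho> (z - (y - h)) - 2 * (\<phi> z * \<rho> (z - y))\<bar> \<le> B' * (norm h)\<^sup>2" for y h
      using BR(4)[where z=z and h=h and y=y] BB(1)[of "(norm h)\<^sup>2"] by simp
    moreover have "\<phi> z * \<rho> (z - y) \<le> B'" "\<phi> z * \<rho> (z - y) \<noteq> 0 \<longrightarrow> norm y \<le> R'" "0 \<le> \<phi> z * \<rho> (z - y)" for y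
      using BR(2)[where z=z and y=y] BR(5)[where z=z and y=y] NB \<phi>(2)[of z] \<rho>D(2)[of "z - y"] by auto
    moreover have "- a y \<le> - max (w n z) c" if "y \<in> slab T (- \<Omega>)" "\<phi> z * \<rho> (z - y) \<noteq> 0" for y
      using inside[OF z, of y] that slab_disjoint[of y T \<Omega>] by auto
    ultimately show "adm_test T \<Omega> (\<lambda>z. - a z) B' R' (- max (w n z) c) (\<lambda>y. \<phi> z * \<rho> (z - y))"
      unfolding adm_test_def by blast
  qed
  have t3: "- flux_int Q f (\<lambda>_. c) (v n) \<theta>d \<le> e2 n" for n
  proof (rule e2(3))
    show "\<bar>c\<bar> \<le> B'" using N(5) NB by linarith
    have "\<bar>\<theta>d (y + h) + \<theta>d (y - h) - 2 * \<theta>d y\<bar> \<le> B' * (norm h)\<^sup>2" for y h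
      using Bd2(2)[of y h] BB(2)[of "(norm h)\<^sup>2"] by simp
    moreover have "\<theta>d y \<le> B'" "0 \<le> \<theta>d y" "\<theta>d y \<noteq> 0 \<longrightarrow> norm y \<le> R'" for y
      using Bd1(2)[of y] NB \<phi>a_le[of y] Rd[of y] Kd(3)[of y] by (auto simp: \<theta>d_def) (cases "y \<in> Kd"; simp)+
    moreover have "- a y \<le> - c" if "y \<in> slab T (- \<Omega>)" "\<theta>d y \<noteq> 0" for y
    proof -
      have "y \<notin> Q" using that(1) slab_disjoint by blast
      obtain Kt where Kt: "compact Kt" "Kt \<subseteq> Q" "\<And>z. z \<notin> Kt \<Longrightarrow> \<theta> z = 0" using test_onE[OF \<theta>(1)] by blast
      have "y \<notin> Kt" using \<open>y \<notin> Q\<close> Kt(2) by blast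
      then have "\<theta>d y = 0" using \<phi>a_0[of y] Kt(3)[of y] \<open>y \<notin> Q\<close> by (simp add: \<theta>d_def)
      then show ?thesis using that by simp
    qed
    ultimately show "adm_test T \<Omega> (\<lambda>z. - a z) B' R' (- c) \<theta>d"
      unfolding adm_test_def using \<theta>d_test by blast
  qed
  define q where "q = measure lborel Q"
  have iQ: "integrable lborel (indicator Q :: _ \<Rightarrow> real)"
    by (rule integrable_bounded_support[OF _ Q_borel(2), where B=1]) (auto split: split_indicator)
  have q: "(LINT z|lborel. indicator Q z) = q" by (simp add: q_def)
  define E where "E = switch_error Q \<phi> \<rho>"
  have main: "- doubled_flux Q f (\<lambda>z. max (w n z) c) (\<lambda>z. max (v n z) c) \<phi> \<rho> \<le> flux_int Q f (\<lambda>_. c) (v n) \<theta>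
      + C0 * E + (e1 n * q + e2 n * q + e2 n)" for n
  proof -
    define W V where "W z = max (w n z) c" and "V z = max (v n z) c" for z
    have m: "W \<in> borel_measurable borel" "V \<in> borel_measurable borel" "(\<lambda>_. c) \<in> borel_measurable borel"
      unfolding W_def V_def using wm vm by (auto intro: borel_measurable_max)
    obtain K where K: "compact K" "K \<subseteq> slab T UNIV" "\<And>z. z \<notin> K \<Longrightarrow> \<phi> z = 0" using test_onE[OF \<phi>(1)] by blast
    obtain L where L: "compact L" "L \<subseteq> S" "\<And>z. z \<notin> L \<Longrightarrow> \<rho> z = 0" using test_onE[OF \<rho>D(1)] by blast
    define Z where "Z = {p. fst p \<in> K \<and> fst p - snd p \<in> L}"
    have Z: "bounded Z" unfolding Z_def
      by (rule bounded_first_minus_second[OF compact_imp_bounded[OF K(1)] compact_imp_bounded[OF L(1)]])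
    have n0: "nabla \<phi> z = 0" if "z \<notin> K" for z by (rule nabla_eq_0_outside[OF compact_imp_closed[OF K(1)] K(3) that])
    have n0': "nabla \<rho> z = 0" if "z \<notin> L" for z by (rule nabla_eq_0_outside[OF compact_imp_closed[OF L(1)] L(3) that])
    obtain D\<phi> where D\<phi>: "D\<phi> \<ge> 0" "\<And>z. norm (nabla \<phi> z) \<le> D\<phi>" using nabla_bounded[OF \<phi>(1)] by blast
    obtain D\<rho> where D\<rho>: "D\<rho> \<ge> 0" "\<And>z. norm (nabla \<rho> z) \<le> D\<rho>" using nabla_bounded[OF \<rho>D(1)] by blast
    obtain B\<rho> where B\<rho>: "B\<rho> \<ge> 0" "\<And>z. \<bar>\<rho> z\<bar> \<le> B\<rho>" using test_on_bounded[OF \<rho>D(1)] by blast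
    define N1 where "N1 p = \<phi> (fst p) *\<^sub>R nabla \<rho> (fst p - snd p) + \<rho> (fst p - snd p) *\<^sub>R nabla \<phi> (fst p)" for p
    define N2 where "N2 p = - (\<phi> (fst p) *\<^sub>R nabla \<rho> (fst p - snd p))" for p
    define P1 where "P1 p = switched (fst (fst p)) (N1 p)" for p
    define P2 where "P2 p = switched (fst (snd p)) (N2 p)" for p
    define PD where "PD p = \<rho> (fst p - snd p) *\<^sub>R switched (fst (fst p)) (nabla \<phi> (fst p))" for p
    define PE where "PE p = \<phi> (fst p) *\<^sub>R (switched (fst (fst p)) (nabla \<rho> (fst p - snd p)) - switched (fst (snd p)) (nabla \<rho> (fst p - snd p)))" for p
    \<comment> \<open>The gradients of the product in the first and in the second variable: the
      terms with the gradient of \<open>\<rho>\<close> cancel up to the different switching times,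
      which are collected in \<open>PE\<close>.\<close>
    have P: "P1 p + P2 p = PD p + PE p" for p
      by (simp add: P1_def P2_def PD_def PE_def N1_def N2_def switched_add switched_scaleR
          scaleR_minus_right[symmetric] algebra_simps del: scaleR_minus_right)
        (simp add: switched_def zero_prod_def)
    have [measurable]: "nabla \<phi> \<in> borel_measurable borel" "nabla \<rho> \<in> borel_measurable borel"
      by (rule nabla_borel_measurable, fact)+
    have [measurable]: "(\<lambda>p :: (real \<times> 'a) \<times> (real \<times> 'a). \<phi> (fst p)) \<in> borel_measurable borel"
      "(\<lambda>p :: (real \<times> 'a) \<times> (real \<times> 'a). nabla \<phi> (fst p)) \<in> borel_measurable borel"
      "(\<lambda>p. \<rho> (fst p - snd p)) \<in> borel_measurable borel"
      "(\<lambda>p. nabla \<rho> (fst p - snd p)) \<in> borel_measurable borel"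
      "(\<lambda>p :: (real \<times> 'a) \<times> (real \<times> 'a). fst (fst p)) \<in> borel_measurable borel"
      "(\<lambda>p :: (real \<times> 'a) \<times> (real \<times> 'a). fst (snd p)) \<in> borel_measurable borel"
      by (intro measurable_of_first measurable_first_minus_second borel_measurable_fst_comp borel_measurable_snd_comp; simp)+
    have mP: "P1 \<in> borel_measurable borel" "P2 \<in> borel_measurable borel" "PD \<in> borel_measurable borel" "PE \<in> borel_measurable borel"
      unfolding P1_def P2_def PD_def PE_def N1_def N2_def by measurable
    have zero: "P1 p = 0" "P2 p = 0" "PD p = 0" "PE p = 0" if "p \<notin> Z" for p
      using that K(3)[of "fst p"] L(3)[of "fst p - snd p"] n0[of "fst p"] n0'[of "fst p - snd p"]
      unfolding Z_def P1_def P2_def PD_def PE_def N1_def N2_def by auto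
    have bnd: "norm (P1 p) \<le> 2 * (B\<phi> * D\<rho>) + B\<rho> * D\<phi>" "norm (P2 p) \<le> 2 * (B\<phi> * D\<rho>) + B\<rho> * D\<phi>"
      "norm (PD p) \<le> 2 * (B\<phi> * D\<rho>) + B\<rho> * D\<phi>" "norm (PE p) \<le> 2 * (B\<phi> * D\<rho>) + B\<rho> * D\<phi>" for p
    proof -
      have a1: "norm (\<phi> (fst p) *\<^sub>R nabla \<rho> (fst p - snd p)) \<le> B\<phi> * D\<rho>"
        unfolding norm_scaleR by (intro mult_mono B\<phi> D\<rho>) auto
      have a2: "norm (\<rho> (fst p - snd p) *\<^sub>R nabla \<phi> (fst p)) \<le> B\<rho> * D\<phi>"
        unfolding norm_scaleR by (intro mult_mono B\<rho> D\<phi>) auto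
      have pos: "0 \<le> B\<phi> * D\<rho>" "0 \<le> B\<rho> * D\<phi>" using B\<phi> D\<phi> B\<rho> D\<rho> by auto
      show "norm (P1 p) \<le> 2 * (B\<phi> * D\<rho>) + B\<rho> * D\<phi>"
        unfolding P1_def N1_def using a1 a2 pos norm_triangle_ineq[of "\<phi> (fst p) *\<^sub>R nabla \<rho> (fst p - snd p)" "\<rho> (fst p - snd p) *\<^sub>R nabla \<phi> (fst p)"]
        by (intro order_trans[OF norm_switched_le]) linarith
      show "norm (P2 p) \<le> 2 * (B\<phi> * D\<rho>) + B\<rho> * D\<phi>"
        unfolding P2_def N2_def using a1 pos by (intro order_trans[OF norm_switched_le]) (simp del: norm_scaleR)
      show "norm (PD p) \<le> 2 * (B\<phi> * D\<rho>) + B\<rho> * D\<phi>"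
        unfolding PD_def switched_scaleR[symmetric] using a2 pos by (intro order_trans[OF norm_switched_le]) (simp del: norm_scaleR)
      have "norm (PE p) \<le> B\<phi> * (D\<rho> + D\<rho>)"
        unfolding PE_def norm_scaleR
        by (intro mult_mono order_trans[OF norm_triangle_ineq4] add_mono order_trans[OF norm_switched_le D\<rho>(2)] B\<phi>) auto
      then show "norm (PE p) \<le> 2 * (B\<phi> * D\<rho>) + B\<rho> * D\<phi>" using pos by (simp add: algebra_simps)
    qed
    define G where "G X Y P p = indicator Q (fst p) * indicator Q (snd p) * (kflux f (X (fst p)) (Y (snd p)) \<bullet> P p)"
      for X Y :: "real \<times> 'a \<Rightarrow> real" and P p
    have iG: "integrable lborel (G X Y P1)" "integrable lborel (G X Y P2)" "integrable lborel (G X Y PD)" "integrable lborel (G X Y PE)"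
      if "X \<in> borel_measurable borel" "\<And>z. \<bar>X z\<bar> \<le> N" "Y \<in> borel_measurable borel" "\<And>z. \<bar>Y z\<bar> \<le> N" for X Y
      unfolding G_def by (rule doubled_integrable[OF that mP(1) bnd(1) Z zero(1)] doubled_integrable[OF that mP(2) bnd(2) Z zero(2)]
          doubled_integrable[OF that mP(3) bnd(3) Z zero(3)] doubled_integrable[OF that mP(4) bnd(4) Z zero(4)], assumption?)+
    have N': "\<bar>W z\<bar> \<le> N" "\<bar>V z\<bar> \<le> N" for z unfolding W_def V_def using N(3,4) by auto
    note i1 = iG(1)[OF wm[of n] N(1) m(2) N'(2)] and i2 = iG(2)[OF m(1) N'(1) vm[of n] N(2)]
      and i3 = iG(2)[OF m(3) N(5) vm[of n] N(2)] and iD = iG(3)[OF m(1) N'(1) m(2) N'(2)] and iE = iG(4)[OF m(1) N'(1) m(2) N'(2)]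
    \<comment> \<open>Both entropy inequalities are rewritten for the same truncated pair
      \<open>W\<close>, \<open>V\<close>; the second one yields the additional flux of
      \<open>c\<close>.\<close>
    have split: "G (w n) V P1 p + G W (v n) P2 p - G (\<lambda>_. c) (v n) P2 p = G W V PD p + G W V PE p" for p
    proof -
      have "kflux f (w n (fst p)) (V (snd p)) = kflux f (W (fst p)) (V (snd p))"
        unfolding V_def W_def by (rule kflux_max_right)
      moreover have "kflux f (W (fst p)) (v n (snd p)) = kflux f (W (fst p)) (V (snd p)) + kflux f c (v n (snd p))"
        unfolding V_def W_def by (rule kflux_max_left)
      moreover have "kflux f (W (fst p)) (V (snd p)) \<bullet> P1 p + kflux f (W (fst p)) (V (snd p)) \<bullet> P2 p
        = kflux f (W (fst p)) (V (snd p)) \<bullet> PD p + kflux f (W (fst p)) (V (snd p)) \<bullet> PE p"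
        unfolding inner_add_right[symmetric] P ..
      ultimately show ?thesis unfolding G_def by (simp add: inner_add_left algebra_simps split: split_indicator)
    qed
    have I1: "- (e1 n * q) \<le> (LINT p|lborel. G (w n) V P1 p)"
    proof -
      have inner: "(LINT z|lborel. G (w n) V P1 (z, y)) = indicator Q y * flux_int Q f (w n) (\<lambda>_. V y) (\<lambda>z. \<phi> z * \<rho> (z - y))" for y
        unfolding flux_int_def integral_mult_right_zero[symmetric]
        by (intro Bochner_Integration.integral_cong refl)
          (simp add: G_def P1_def N1_def nabla_mult[OF sm\<phi> smooth_translate(1)[OF sm\<rho>]] nabla_translate[OF sm\<rho>])
      have "(LINT y|lborel. (- e1 n) * indicator Q y) \<le> (LINT y|lborel. LINT z|lborel. G (w n) V P1 (z, y))"
      proof (rule integral_mono[OF _ integral_lborel_snd(2)[OF i1]])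
        show "integrable lborel (\<lambda>y. (- e1 n) * indicator Q y)" using iQ by simp
        show "(- e1 n) * indicator Q y \<le> (LINT z|lborel. G (w n) V P1 (z, y))" for y
          unfolding inner using t1[of n y] by (auto simp: V_def split: split_indicator)
      qed
      then show ?thesis unfolding integral_lborel_snd(1)[OF i1] by (simp add: q_def)
    qed
    have I2: "- (e2 n * q) \<le> (LINT p|lborel. G W (v n) P2 p)"
    proof -
      have inner: "(LINT y|lborel. G W (v n) P2 (z, y)) = indicator Q z * flux_int Q f (\<lambda>_. W z) (v n) (\<lambda>y. \<phi> z * \<rho> (z - y))" for z
        unfolding flux_int_def integral_mult_right_zero[symmetric]
        by (intro Bochner_Integration.integral_cong refl)
          (simp add: G_def P2_def N2_def nabla_mult[OF smooth_const smooth_translate(2)[OF sm\<rho>]] nabla_reflect[OF sm\<rho>])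
      have "(LINT z|lborel. (- e2 n) * indicator Q z) \<le> (LINT z|lborel. LINT y|lborel. G W (v n) P2 (z, y))"
      proof (rule integral_mono[OF _ integral_lborel_fst(2)[OF i2]])
        show "integrable lborel (\<lambda>y. (- e2 n) * indicator Q y)" using iQ by simp
        show "(- e2 n) * indicator Q z \<le> (LINT y|lborel. G W (v n) P2 (z, y))" for z
          unfolding inner using t2[of z n] by (auto simp: W_def split: split_indicator)
      qed
      then show ?thesis unfolding integral_lborel_fst(1)[OF i2] by (simp add: q_def)
    qed
    have I3: "(LINT p|lborel. G (\<lambda>_. c) (v n) P2 p) \<le> flux_int Q f (\<lambda>_. c) (v n) \<theta> + e2 n"
    proof -
      have inner: "(LINT z|lborel. G (\<lambda>_. c) (v n) P2 (z, y)) = indicator Q y * (kflux f c (v n y) \<bullet> switched (fst y) (nabla \<phi>a y))" for y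
      proof -
        have i: "integrable lborel (\<lambda>z. g z *\<^sub>R (- nabla \<rho> (z - y)))"
          using convolution_integrable[OF ig, of "\<lambda>x. nabla (\<lambda>x. \<rho> (- x)) x" D\<rho> y]
            continuous_on_nabla[OF test_on_smooth[OF ref\<rho>]] D\<rho> unfolding nab_ref by simp
        have "indicator Q y * (kflux f c (v n y) \<bullet> switched (fst y) (nabla \<phi>a y))
          = indicator Q y * (LINT z|lborel. switched (fst y) (kflux f c (v n y)) \<bullet> (g z *\<^sub>R (- nabla \<rho> (z - y))))"
          unfolding \<phi>a_nabla inner_switched using integral_inner_right[of "switched (fst y) (kflux f c (v n y))", OF i] by simp
        also have "\<dots> = (LINT z|lborel. G (\<lambda>_. c) (v n) P2 (z, y))"
          unfolding integral_mult_right_zero[symmetric]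
          by (intro Bochner_Integration.integral_cong refl)
            (simp add: G_def P2_def N2_def inner_switched g_def)
        finally show ?thesis by simp
      qed
      have "(LINT p|lborel. G (\<lambda>_. c) (v n) P2 p) = flux_int Q f (\<lambda>_. c) (v n) \<phi>a"
        unfolding integral_lborel_snd(1)[OF i3] inner flux_int_def ..
      moreover have "flux_int Q f (\<lambda>_. c) (v n) \<theta>d = flux_int Q f (\<lambda>_. c) (v n) \<theta> - flux_int Q f (\<lambda>_. c) (v n) \<phi>a"
        unfolding \<theta>d_def by (rule flux_int_diff[OF f Qm m(3) vm N(5) N(2) \<theta>U \<phi>a_test])
      ultimately show ?thesis using t3[of n] by simp
    qed
    have IE: "\<bar>LINT p|lborel. G W V PE p\<bar> \<le> C0 * E"
    proof -
      define X where "X p = \<phi> (fst p) * norm (switched (fst (fst p)) (nabla \<rho> (fst p - snd p)) - switched (fst (snd p)) (nabla \<rho> (fst p - snd p)))" for p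
      have X: "X p = norm (PE p)" for p by (simp add: X_def PE_def \<phi>(2))
      have [measurable]: "(\<lambda>p :: (real \<times> 'a) \<times> (real \<times> 'a). indicator Q (fst p) :: real) \<in> borel_measurable borel"
        "(\<lambda>p :: (real \<times> 'a) \<times> (real \<times> 'a). indicator Q (snd p) :: real) \<in> borel_measurable borel"
        by (intro measurable_of_first measurable_of_second borel_measurable_indicator Qm)+
      note [measurable] = mP(4)
      have i: "integrable lborel (\<lambda>p. indicator Q (fst p) * indicator Q (snd p) * X p :: real)"
        unfolding X by (rule integrable_bounded_support[OF _ Z, where B="2 * (B\<phi> * D\<rho>) + B\<rho> * D\<phi>"])
          (use bnd(4) zero(4) order_trans[OF norm_ge_zero bnd(4)] in \<open>auto split: split_indicator\<close>)
      have "norm (LINT p|lborel. G W V PE p) \<le> (LINT p|lborel. C0 * (indicator Q (fst p) * indicator Q (snd p) * X p))"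
      proof (rule Bochner_Integration.integral_norm_bound_integral[OF iE])
        show "integrable lborel (\<lambda>p. C0 * (indicator Q (fst p) * indicator Q (snd p) * X p))" using i by simp
        fix p
        have "\<bar>kflux f (W (fst p)) (V (snd p)) \<bullet> PE p\<bar> \<le> C0 * X p"
          unfolding X using N'[unfolded N_def]
          by (intro order_trans[OF Cauchy_Schwarz_ineq2] mult_right_mono C0(2)) auto
        then show "norm (G W V PE p) \<le> C0 * (indicator Q (fst p) * indicator Q (snd p) * X p)"
          by (auto simp: G_def split: split_indicator)
      qed
      then show ?thesis unfolding X_def E_def switch_error_def by simp
    qed
    have "doubled_flux Q f W V \<phi> \<rho> = (LINT p|lborel. G W V PD p)"
      unfolding doubled_flux_def G_def PD_def by (intro Bochner_Integration.integral_cong refl) (simp add: mult.assoc mult.commute)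
    moreover have "(LINT p|lborel. G (w n) V P1 p) + (LINT p|lborel. G W (v n) P2 p) - (LINT p|lborel. G (\<lambda>_. c) (v n) P2 p)
      = (LINT p|lborel. G W V PD p) + (LINT p|lborel. G W V PE p)"
    proof -
      have "(LINT p|lborel. G (w n) V P1 p) + (LINT p|lborel. G W (v n) P2 p) - (LINT p|lborel. G (\<lambda>_. c) (v n) P2 p)
        = (LINT p|lborel. G (w n) V P1 p + G W (v n) P2 p - G (\<lambda>_. c) (v n) P2 p)"
        using i1 i2 i3 by simp
      also have "\<dots> = (LINT p|lborel. G W V PD p) + (LINT p|lborel. G W V PE p)"
        unfolding split using iD iE by simp
      finally show ?thesis .
    qed
    ultimately show ?thesis using I1 I2 I3 IE unfolding W_def V_def by linarith
  qed
  have "((\<lambda>n. e1 n * q + e2 n * q + e2 n) \<longlongrightarrow> 0) F"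
    using tendsto_add[OF tendsto_add[OF tendsto_mult_right[OF e1(1)] tendsto_mult_right[OF e2(1)]] e2(1)] by simp
  then show thesis using that main unfolding E_def by blast
qed

end

lemma ex_product_mollifier:
  fixes \<rho>1 :: "real \<Rightarrow> real" and \<rho>2 :: "'a::euclidean_space \<Rightarrow> real"
  assumes \<rho>1: "mollifier S1 \<rho>1" and \<rho>2: "mollifier S2 \<rho>2"
  shows "mollifier (S1 \<times> S2) (\<lambda>z. \<rho>1 (fst z) * \<rho>2 (snd z))"
    and "snd (nabla (\<lambda>z. \<rho>1 (fst z) * \<rho>2 (snd z)) z) = \<rho>1 (fst z) *\<^sub>R nabla \<rho>2 (snd z)"
proof -
  note D1 = mollifierD[OF \<rho>1] and D2 = mollifierD[OF \<rho>2]
  note s1 = test_on_smooth[OF D1(1)] and s2 = test_on_smooth[OF D2(1)]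
  have sm: "smooth (\<lambda>z :: real \<times> 'a. \<rho>1 (fst z))" "smooth (\<lambda>z :: real \<times> 'a. \<rho>2 (snd z))"
    by (rule smooth_comp_linear[OF bounded_linear_fst s1], rule smooth_comp_linear[OF bounded_linear_snd s2])
  obtain K1 where K1: "compact K1" "K1 \<subseteq> S1" "\<And>z. z \<notin> K1 \<Longrightarrow> \<rho>1 z = 0" using test_onE[OF D1(1)] by blast
  obtain K2 where K2: "compact K2" "K2 \<subseteq> S2" "\<And>z. z \<notin> K2 \<Longrightarrow> \<rho>2 z = 0" using test_onE[OF D2(1)] by blast
  have t: "test_on (S1 \<times> S2) (\<lambda>z. \<rho>1 (fst z) * \<rho>2 (snd z))" unfolding test_on_def
  proof (intro conjI smooth_mult sm exI[of _ "K1 \<times> K2"])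
    show "compact (K1 \<times> K2)" by (rule compact_Times[OF K1(1) K2(1)])
    show "\<forall>z. z \<notin> K1 \<times> K2 \<longrightarrow> \<rho>1 (fst z) * \<rho>2 (snd z) = 0" using K1(3) K2(3) by auto
  qed (use K1 K2 in auto)
  have "(LINT z|lborel. \<rho>1 (fst z) * \<rho>2 (snd z)) = 1"
    unfolding integral_lborel_fst(1)[OF test_on_integrable[OF t]] using D1(3) D2(3) by simp
  then show "mollifier (S1 \<times> S2) (\<lambda>z. \<rho>1 (fst z) * \<rho>2 (snd z))"
    unfolding mollifier_def using t D1(2) D2(2) by simp
  have "nabla (\<lambda>z. \<rho>1 (fst z) * \<rho>2 (snd z)) z = (\<rho>2 (snd z) *\<^sub>R nabla \<rho>1 (fst z), \<rho>1 (fst z) *\<^sub>R nabla \<rho>2 (snd z))"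
  proof (rule nablaI)
    have d1: "((\<lambda>z :: real \<times> 'a. \<rho>1 (fst z)) has_derivative (\<lambda>h. nabla \<rho>1 (fst z) \<bullet> fst h)) (at z)"
      using has_derivative_compose[OF bounded_linear_imp_has_derivative[OF bounded_linear_fst] smooth_has_nabla[OF s1]] .
    have d2: "((\<lambda>z :: real \<times> 'a. \<rho>2 (snd z)) has_derivative (\<lambda>h. nabla \<rho>2 (snd z) \<bullet> snd h)) (at z)"
      using has_derivative_compose[OF bounded_linear_imp_has_derivative[OF bounded_linear_snd] smooth_has_nabla[OF s2]] .
    show "((\<lambda>z. \<rho>1 (fst z) * \<rho>2 (snd z)) has_derivative
        (\<lambda>h. (\<rho>2 (snd z) *\<^sub>R nabla \<rho>1 (fst z), \<rho>1 (fst z) *\<^sub>R nabla \<rho>2 (snd z)) \<bullet> h)) (at z)"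
      using has_derivative_mult[OF d1 d2] by (simp add: inner_prod_def algebra_simps)
  qed
  then show "snd (nabla (\<lambda>z. \<rho>1 (fst z) * \<rho>2 (snd z)) z) = \<rho>1 (fst z) *\<^sub>R nabla \<rho>2 (snd z)" by simp
qed

text \<open>
  The time scale of the mollifier is taken much smaller than its space scale: then the points on
  different sides of \<open>t = 0\<close>, where the flux is discontinuous in time, do not contribute.
\<close>

lemma ex_anisotropic_mollifier:
  fixes \<Omega> :: "'a::euclidean_space set" and \<phi> :: "real \<times> 'a \<Rightarrow> real"
  assumes \<Omega>: "open \<Omega>" "bounded \<Omega>" and \<phi>: "\<And>z. 0 \<le> \<phi> z" "\<And>z. \<phi> z \<le> B"
    and pos: "\<tau> > 0" "r > 0" "\<eta> > 0"
  obtains \<rho> where "mollifier (ball 0 \<tau> \<times> ball e0 r) \<rho>" "switch_error (slab T \<Omega>) \<phi> \<rho> \<le> \<eta>"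
proof -
  obtain \<rho>2 where \<rho>2: "mollifier (ball e0 r) \<rho>2" using ex_mollifier[OF pos(2)] by blast
  note D2 = mollifierD[OF \<rho>2]
  note i2 = norm_nabla_integrable[OF D2(1)]
  define k where "k = (LINT x|lborel. norm (nabla \<rho>2 x))"
  have k: "k \<ge> 0" unfolding k_def by (rule Bochner_Integration.integral_nonneg) simp
  define m where "m = measure lborel \<Omega>"
  have m: "m \<ge> 0" by (simp add: m_def)
  have B: "B \<ge> 0" using \<phi>(1)[of 0] \<phi>(2)[of 0] by linarith
  \<comment> \<open>Only times within \<open>s\<close> of 0 contribute, a set of measure
    \<open>2 * s * m\<close>. There the kernel gradient in space has integral \<open>k\<close>,
    whatever \<open>s\<close> is. Thus \<open>s\<close> can be chosen after the space kernel
    \<open>\<rho>2\<close>.\<close>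
  define s where "s = min \<tau> (\<eta> / (2 * B * k * m + 1))"
  have den: "2 * B * k * m + 1 > 0" using B k m by (simp add: add_nonneg_pos)
  have s: "s > 0" "s \<le> \<tau>" using pos den by (auto simp: s_def)
  obtain \<rho>1 where \<rho>1: "mollifier (ball (0::real) s) \<rho>1" using ex_mollifier[OF s(1)] by blast
  note D1 = mollifierD[OF \<rho>1]
  define \<rho> where "\<rho> z = \<rho>1 (fst z) * \<rho>2 (snd z)" for z
  have \<rho>: "mollifier (ball 0 s \<times> ball e0 r) \<rho>" unfolding \<rho>_def by (rule ex_product_mollifier[OF \<rho>1 \<rho>2])
  have nab: "snd (nabla \<rho> z) = \<rho>1 (fst z) *\<^sub>R nabla \<rho>2 (snd z)" for z
    unfolding \<rho>_def by (rule ex_product_mollifier[OF \<rho>1 \<rho>2])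
  define X where "X p = indicator (slab T \<Omega>) (fst p) * indicator (slab T \<Omega>) (snd p) * (\<phi> (fst p) *
      norm (switched (fst (fst p)) (nabla \<rho> (fst p - snd p)) - switched (fst (snd p)) (nabla \<rho> (fst p - snd p))))" for p
  define g where "g = (\<lambda>z. B * indicator ({-s..s} \<times> \<Omega>) z)"
  define N where "N = (\<lambda>z. \<rho>1 (fst z) * norm (nabla \<rho>2 (snd z)))"
  have box: "{-s..s} \<times> \<Omega> \<in> sets borel" "bounded ({-s..s} \<times> \<Omega>)"
    using \<Omega> by (auto intro!: borel_Times bounded_Times)
  have g: "integrable lborel g" "(LINT z|lborel. g z) = B * (2 * s * m)"
  proof -
    show "integrable lborel g" unfolding g_def
      by (rule integrable_bounded_support[OF _ box(2), where B=B]) (use box(1) B in \<open>auto split: split_indicator\<close>)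
    have "emeasure (lborel \<Otimes>\<^sub>M lborel) ({-s..s} \<times> \<Omega>) = emeasure lborel {-s..s} * emeasure lborel \<Omega>"
      by (rule lborel.emeasure_pair_measure_Times) (use \<Omega> in auto)
    then show "(LINT z|lborel. g z) = B * (2 * s * m)"
      using s(1) box(1) by (simp add: g_def m_def lborel_prod measure_def enn2real_mult)
  qed
  have N: "integrable lborel N" "(LINT z|lborel. N z) = k"
  proof -
    show i: "integrable lborel N" unfolding N_def by (rule integrable_tensor[OF test_on_integrable[OF D1(1)] i2])
    show "(LINT z|lborel. N z) = k" unfolding integral_lborel_fst(1)[OF i] using D1(3) by (simp add: N_def k_def)
  qed
  have XY: "X p \<le> g (fst p) * N (fst p - snd p)" for p
  proof -
    obtain t x s' y where p: "p = ((t, x), (s', y))" by (cases p) auto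
    have eq: "norm (switched t (nabla \<rho> ((t, x) - (s', y))) - switched s' (nabla \<rho> ((t, x) - (s', y))))
      = (if (t > 0) = (s' > 0) then 0 else N (t - s', x - y))"
      using nab[of "(t, x) - (s', y)"] D1(2)[of "t - s'"] by (auto simp: switched_def norm_Pair N_def)
    have N0: "0 \<le> N (t - s', x - y)" using D1(2) by (simp add: N_def)
    show ?thesis
    proof (cases "(t > 0) = (s' > 0) \<or> x \<notin> \<Omega> \<or> \<rho>1 (t - s') = 0")
      case True
      then have "X p = 0" unfolding X_def p fst_conv snd_conv eq by (auto simp: slab_def N_def)
      then show ?thesis using B N0 by (simp add: g_def p)
    next
      case False
      then have "t - s' \<in> ball 0 s" using D1(4) by blast
      then have "(t, x) \<in> {-s..s} \<times> \<Omega>" using False by auto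
      moreover have "X p \<le> \<phi> (t, x) * N (t - s', x - y)"
        unfolding X_def p fst_conv snd_conv eq using False \<phi>(1)[of "(t, x)"] N0 by (auto split: split_indicator)
      ultimately show ?thesis using mult_right_mono[OF \<phi>(2) N0, of "(t, x)"] by (simp add: g_def p)
    qed
  qed
  note gN = kernel_integral(1,2)[OF g(1) N(1)]
  have "(LINT p|lborel. X p) \<le> (LINT p|lborel. g (fst p) * N (fst p - snd p))"
  proof (rule integral_mono'[OF gN(1) XY])
    show "0 \<le> g (fst p) * N (fst p - snd p)" for p
      using B D1(2) by (intro mult_nonneg_nonneg) (simp_all add: g_def N_def)
  qed
  also have "\<dots> = s * (2 * B * k * m)" unfolding gN(2) g(2) N(2) by simp
  also have "\<dots> \<le> s * (2 * B * k * m + 1)" using s(1) by (intro mult_left_mono) auto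
  also have "\<dots> \<le> \<eta> / (2 * B * k * m + 1) * (2 * B * k * m + 1)"
    using den by (intro mult_right_mono) (auto simp: s_def)
  also have "\<dots> = \<eta>" using den by simp
  finally have "switch_error (slab T \<Omega>) \<phi> \<rho> \<le> \<eta>" unfolding switch_error_def X_def .
  moreover have "mollifier (ball 0 \<tau> \<times> ball e0 r) \<rho>" by (rule mollifier_mono[OF \<rho>]) (use s in auto)
  ultimately show thesis using that by blast
qed

text \<open>
  The index filter is required to make every bounded sequence convergent (an ultrafilter), so that all
  limits below exist and are linear.
\<close>

locale comparison = semi_pair +
  assumes F: "F \<noteq> bot" and conv: "\<And>X :: nat \<Rightarrow> real. bounded (range X) \<Longrightarrow> \<exists>L. (X \<longlongrightarrow> L) F"
    and const: "(\<forall>n. w n = w 0) \<or> (\<forall>n. v n = v 0)"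
begin

lemma Lim_tendsto: "bounded (range X) \<Longrightarrow> (X \<longlongrightarrow> Lim F X) F" for X :: "nat \<Rightarrow> real"
  using conv tendsto_Lim[OF F] by metis

text \<open>This functional stands in for the average of the nonlinear flux with respect to a Young
  measure. Since the limit is taken of the integrals, no limit is ever interchanged with
  \<open>f\<close>.\<close>

definition LF :: "(nat \<Rightarrow> real \<times> 'a \<Rightarrow> real) \<Rightarrow> (nat \<Rightarrow> real \<times> 'a \<Rightarrow> real) \<Rightarrow> (real \<times> 'a \<Rightarrow> real) \<Rightarrow> real" where
  "LF X Y \<phi> = Lim F (\<lambda>n. flux_int Q f (X n) (Y n) \<phi>)"

definition bseq :: "real \<Rightarrow> (nat \<Rightarrow> real \<times> 'a \<Rightarrow> real) \<Rightarrow> bool" where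
  "bseq N X \<longleftrightarrow> (\<forall>n. X n \<in> borel_measurable borel) \<and> (\<forall>n z. \<bar>X n z\<bar> \<le> N)"

lemma bseqD: "bseq N X \<Longrightarrow> X n \<in> borel_measurable borel" "bseq N X \<Longrightarrow> \<bar>X n z\<bar> \<le> N"
  unfolding bseq_def by blast+

lemma bseq_wv: "M \<le> N \<Longrightarrow> bseq N w" "M \<le> N \<Longrightarrow> bseq N v"
  using wm vm order_trans[OF wb] order_trans[OF vb] by (auto simp: bseq_def)

lemma bseq_const: "\<bar>c\<bar> \<le> N \<Longrightarrow> bseq N (\<lambda>_ _. c)"
  by (auto simp: bseq_def)

lemma bseq_max: "bseq N X \<Longrightarrow> bseq N Y \<Longrightarrow> bseq N (\<lambda>n z. max (X n z) (Y n z))"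
  unfolding bseq_def by (auto simp: max_def[of "X _ (_, _)"] intro!: borel_measurable_max)

lemma bseq_min: "bseq N X \<Longrightarrow> bseq N Y \<Longrightarrow> bseq N (\<lambda>n z. min (X n z) (Y n z))"
  unfolding bseq_def by (auto simp: min_def[of "X _ (_, _)"] intro!: borel_measurable_min)

lemma LF_tendsto:
  assumes "bseq N X" "bseq N Y" "test_on S \<phi>"
  shows "((\<lambda>n. flux_int Q f (X n) (Y n) \<phi>) \<longlongrightarrow> LF X Y \<phi>) F"
proof -
  obtain C where C: "C \<ge> 0" "\<And>\<alpha> \<beta>. \<bar>\<alpha>\<bar> \<le> N \<Longrightarrow> \<bar>\<beta>\<bar> \<le> N \<Longrightarrow> norm (kflux f \<alpha> \<beta>) \<le> C"
    using kflux_bounded[OF f, of N] by blast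
  have "\<bar>flux_int Q f (X n) (Y n) \<phi>\<bar> \<le> C * (LINT z|lborel. indicator Q z * norm (nabla \<phi> z))" for n
    by (rule flux_int_bound[OF f Q_borel(1) bseqD(1)[OF assms(1)] bseqD(1)[OF assms(2)] bseqD(2)[OF assms(1)] bseqD(2)[OF assms(2)] assms(3)])
      (use C bseqD(2)[OF assms(1)] bseqD(2)[OF assms(2)] in auto)
  then have "bounded (range (\<lambda>n. flux_int Q f (X n) (Y n) \<phi>))" unfolding bounded_iff by auto
  then show ?thesis unfolding LF_def by (rule Lim_tendsto)
qed

lemma LF_add:
  assumes "bseq N X" "bseq N Y" "test_on S \<phi>" "test_on S \<psi>"
  shows "LF X Y (\<lambda>z. \<phi> z + \<psi> z) = LF X Y \<phi> + LF X Y \<psi>"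
proof -
  have "flux_int Q f (X n) (Y n) (\<lambda>z. \<phi> z + \<psi> z) = flux_int Q f (X n) (Y n) \<phi> + flux_int Q f (X n) (Y n) \<psi>" for n
    by (rule flux_int_add[OF f Q_borel(1) bseqD(1)[OF assms(1)] bseqD(1)[OF assms(2)] bseqD(2)[OF assms(1)] bseqD(2)[OF assms(2)] assms(3,4)])
  then have "((\<lambda>n. flux_int Q f (X n) (Y n) (\<lambda>z. \<phi> z + \<psi> z)) \<longlongrightarrow> LF X Y \<phi> + LF X Y \<psi>) F"
    using tendsto_add[OF LF_tendsto[OF assms(1-3)] LF_tendsto[OF assms(1,2,4)]] by simp
  from tendsto_Lim[OF F this] show ?thesis unfolding LF_def .
qed

lemma LF_diff:
  assumes "bseq N X" "bseq N Y" "test_on S \<phi>" "test_on S \<psi>"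
  shows "LF X Y (\<lambda>z. \<phi> z - \<psi> z) = LF X Y \<phi> - LF X Y \<psi>"
  using LF_add[OF assms(1,2) test_on_diff[OF assms(3,4)] assms(4)] by simp

lemma LF_scale:
  assumes "bseq N X" "bseq N Y" "test_on S \<phi>"
  shows "LF X Y (\<lambda>z. c * \<phi> z) = c * LF X Y \<phi>"
proof -
  have n: "nabla (\<lambda>z. c * \<phi> z) z = c *\<^sub>R nabla \<phi> z" for z
    using nabla_mult[OF smooth_const[of c] test_on_smooth[OF assms(3)]] by simp
  have "flux_int Q f (X n) (Y n) (\<lambda>z. c * \<phi> z) = c * flux_int Q f (X n) (Y n) \<phi>" for n
    unfolding flux_int_def n switched_scaleR inner_scaleR_right integral_mult_right_zero[symmetric]
    by (simp add: mult.left_commute)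
  then have "((\<lambda>n. flux_int Q f (X n) (Y n) (\<lambda>z. c * \<phi> z)) \<longlongrightarrow> c * LF X Y \<phi>) F"
    using tendsto_mult_left[OF LF_tendsto[OF assms]] by simp
  from tendsto_Lim[OF F this] show ?thesis unfolding LF_def .
qed

lemma LF_sum:
  assumes "bseq N X" "bseq N Y" "\<And>i. i \<in> I \<Longrightarrow> test_on S (\<phi> i)"
  shows "LF X Y (\<lambda>z. \<Sum>i\<in>I. \<phi> i z) = (\<Sum>i\<in>I. LF X Y (\<phi> i))"
  using assms(3)
proof (induction I rule: infinite_finite_induct)
  case (insert i I)
  then have "test_on S (\<phi> i)" "test_on S (\<lambda>z. \<Sum>i\<in>I. \<phi> i z)" by (auto intro: test_on_sum)
  then show ?case using insert LF_add[OF assms(1,2), of S "\<phi> i" "\<lambda>z. \<Sum>i\<in>I. \<phi> i z"] by simp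
qed (simp_all add: LF_def flux_int_def tendsto_Lim[OF F tendsto_const])

lemma LF_bound:
  assumes "bseq N X" "bseq N Y" "test_on S \<phi>" and C: "\<And>n z. norm (kflux f (X n z) (Y n z)) \<le> C"
  shows "\<bar>LF X Y \<phi>\<bar> \<le> C * (LINT z|lborel. indicator Q z * norm (nabla \<phi> z))"
proof -
  have "\<bar>flux_int Q f (X n) (Y n) \<phi>\<bar> \<le> C * (LINT z|lborel. indicator Q z * norm (nabla \<phi> z))" for n
    by (rule flux_int_bound[OF f Q_borel(1) bseqD(1)[OF assms(1)] bseqD(1)[OF assms(2)] bseqD(2)[OF assms(1)] bseqD(2)[OF assms(2)] assms(3) C])
  then show ?thesis
    using tendsto_upperbound[OF tendsto_rabs[OF LF_tendsto[OF assms(1-3)]] _ F] by simp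
qed

text \<open>A kernel concentrated near the displacement \<open>e0\<close> carries the support of
  \<open>\<phi>\<close> in \<open>Q\<close> to points of \<open>Q\<close> in a compact part of the
  slab, at arbitrarily small displacement. The number \<open>\<eta>\<close> bounds the flux of
  \<open>c\<close> against \<open>v\<close> for a majorant of the displaced \<open>\<phi>\<close>.
  Time and space have separate radii, because the time scale of the kernel is chosen last and much
  smaller.\<close>

definition inward :: "real \<Rightarrow> (real \<times> 'a \<Rightarrow> real) \<Rightarrow> real \<Rightarrow> real \<Rightarrow> bool" where
  "inward c \<phi> \<eta> r \<longleftrightarrow> (\<exists>e0 r' \<tau> K' \<theta>. 0 < r' \<and> 0 < \<tau> \<and> ball e0 r' \<subseteq> ball 0 r \<and> compact K' \<and> K' \<subseteq> slab T UNIV \<and>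
    test_on Q \<theta> \<and> (\<forall>y. 0 \<le> \<theta> y) \<and> LF (\<lambda>_ _. c) v \<theta> \<le> \<eta> \<and>
    (\<forall>z y. z \<in> Q \<longrightarrow> \<phi> z \<noteq> 0 \<longrightarrow> \<bar>fst z - fst y\<bar> < \<tau> \<longrightarrow> snd z - snd y \<in> ball e0 r' \<longrightarrow>
      y \<in> Q \<and> y \<in> K' \<and> \<phi> z \<le> \<theta> y))"

text \<open>The order of choices matters: the radius from \<open>doubled_flux_close\<close>, then
  the displacement, then a time scale with small switching error, then the limit along
  \<open>F\<close> for this fixed kernel, and at last \<open>\<epsilon>\<close> to 0. Since the
  radius is uniform in \<open>n\<close>, the limit in \<open>n\<close> may precede the shrinking of
  the kernel.\<close>

lemma doubling_limit:
  assumes \<phi>: "test_on (slab T UNIV) \<phi>" "\<And>z. 0 \<le> \<phi> z" "\<And>z. z \<in> slab T (- \<Omega>) \<Longrightarrow> \<phi> z \<noteq> 0 \<Longrightarrow> a z \<le> c"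
    and shift: "\<And>r. r > 0 \<Longrightarrow> inward c \<phi> \<eta> r"
  shows "- \<eta> \<le> LF (\<lambda>n z. max (w n z) c) (\<lambda>n z. max (v n z) c) \<phi>"
proof -
  define N where "N = max M \<bar>c\<bar>"
  define W V where "W n z = max (w n z) c" and "V n z = max (v n z) c" for n z
  have bs: "bseq N w" "bseq N v" "bseq N (\<lambda>_ _. c)" by (auto simp: N_def intro: bseq_wv bseq_const)
  then have bW: "bseq N W" "bseq N V" unfolding W_def V_def by (auto intro: bseq_max)
  have constWV: "(\<forall>n. W n = W 0) \<or> (\<forall>n. V n = V 0)"
    using const
  proof
    assume "\<forall>n. w n = w 0"
    then have "W n = W 0" for n unfolding W_def by metis
    then show ?thesis by blast
  next
    assume "\<forall>n. v n = v 0"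
    then have "V n = V 0" for n unfolding V_def by metis
    then show ?thesis by blast
  qed
  obtain C0 where C0: "C0 \<ge> 0" "\<And>\<alpha> \<beta>. \<bar>\<alpha>\<bar> \<le> N \<Longrightarrow> \<bar>\<beta>\<bar> \<le> N \<Longrightarrow> norm (kflux f \<alpha> \<beta>) \<le> C0"
    using kflux_bounded[OF f, of N] by blast
  obtain B where B: "B \<ge> 0" "\<And>z. \<bar>\<phi> z\<bar> \<le> B" using test_on_bounded[OF \<phi>(1)] by blast
  have main: "- LF W V \<phi> \<le> \<eta> + 2 * \<epsilon>" if "\<epsilon> > 0" for \<epsilon>
  proof -
    obtain r where r: "r > 0" "\<And>\<rho> n. mollifier (ball 0 r) \<rho> \<Longrightarrow> \<bar>doubled_flux Q f (W n) (V n) \<phi> \<rho> - flux_int Q f (W n) (V n) \<phi>\<bar> \<le> \<epsilon>"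
      using doubled_flux_close[OF f Q_borel bseqD[OF bW(1)] bseqD[OF bW(2)] \<phi>(1) constWV \<open>\<epsilon> > 0\<close>] by blast
    \<comment> \<open>Half of \<open>r\<close> is spent on the space displacement and half on time,
      so that the kernel fits into the ball of radius \<open>r\<close>.\<close>
    obtain e0 r' \<tau> K' \<theta> where s: "0 < r'" "0 < \<tau>" "ball e0 r' \<subseteq> ball 0 (r / 2)" "compact K'" "K' \<subseteq> slab T UNIV"
      "test_on Q \<theta>" "\<forall>y. 0 \<le> \<theta> y" "LF (\<lambda>_ _. c) v \<theta> \<le> \<eta>"
      "\<forall>z y. z \<in> Q \<longrightarrow> \<phi> z \<noteq> 0 \<longrightarrow> \<bar>fst z - fst y\<bar> < \<tau> \<longrightarrow> snd z - snd y \<in> ball e0 r' \<longrightarrow>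
        y \<in> Q \<and> y \<in> K' \<and> \<phi> z \<le> \<theta> y"
      using shift[of "r / 2"] r(1) unfolding inward_def by auto
    have pos: "min \<tau> (r / 2) > 0" "\<epsilon> / (C0 + 1) > 0" using s(2) r(1) C0(1) \<open>\<epsilon> > 0\<close> by auto
    have B': "\<And>z. \<phi> z \<le> B" using B(2) abs_le_D1 by blast
    obtain \<rho> where \<rho>: "mollifier (ball 0 (min \<tau> (r / 2)) \<times> ball e0 r') \<rho>"
      and E: "switch_error Q \<phi> \<rho> \<le> \<epsilon> / (C0 + 1)"
      by (rule ex_anisotropic_mollifier[OF op bd \<phi>(2) B' pos(1) s(1) pos(2), of e0])
    have sub_r: "ball 0 (min \<tau> (r / 2)) \<times> ball e0 r' \<subseteq> ball (0 :: real \<times> 'a) r"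
    proof
      fix z :: "real \<times> 'a" assume z: "z \<in> ball 0 (min \<tau> (r / 2)) \<times> ball e0 r'"
      then have "norm (fst z) < r / 2" "snd z \<in> ball 0 (r / 2)" using s(3) by auto
      then have "norm (fst z) + norm (snd z) < r" by simp
      then show "z \<in> ball 0 r" using norm_Pair_le[of "fst z" "snd z"] by simp
    qed
    have inside: "y \<in> Q \<and> y \<in> K' \<and> \<phi> z \<le> \<theta> y" if "z \<in> Q" "\<phi> z \<noteq> 0" "\<rho> (z - y) \<noteq> 0" for z y
    proof -
      have "z - y \<in> ball 0 (min \<tau> (r / 2)) \<times> ball e0 r'" by (rule mollifierD(4)[OF \<rho> that(3)])
      then have "\<bar>fst z - fst y\<bar> < \<tau>" "snd z - snd y \<in> ball e0 r'" by (auto simp: mem_Times_iff)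
      then show ?thesis using s(9) that by blast
    qed
    obtain e where e: "(e \<longlongrightarrow> 0) F" "\<And>n. - doubled_flux Q f (\<lambda>z. max (w n z) c) (\<lambda>z. max (v n z) c) \<phi> \<rho> \<le> flux_int Q f (\<lambda>_. c) (v n) \<theta> + C0 * switch_error Q \<phi> \<rho> + e n"
      using doubling[OF \<phi> \<rho> s(4,5) inside s(6) _ C0(1) C0(2)[unfolded N_def]] s(7) by blast
    have C0\<epsilon>: "C0 * (\<epsilon> / (C0 + 1)) \<le> \<epsilon>" using C0(1) \<open>\<epsilon> > 0\<close> by (simp add: divide_simps)
    have "- flux_int Q f (W n) (V n) \<phi> \<le> flux_int Q f (\<lambda>_. c) (v n) \<theta> + \<epsilon> + e n + \<epsilon>" for n
    proof -
      have "C0 * switch_error Q \<phi> \<rho> \<le> \<epsilon>"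
        using mult_left_mono[OF E C0(1)] C0\<epsilon> by linarith
      then show ?thesis using e(2)[of n] r(2)[OF mollifier_mono[OF \<rho> sub_r], of n] unfolding W_def V_def by linarith
    qed
    moreover have "((\<lambda>n. flux_int Q f (\<lambda>_. c) (v n) \<theta> + \<epsilon> + e n + \<epsilon>) \<longlongrightarrow> LF (\<lambda>_ _. c) v \<theta> + \<epsilon> + 0 + \<epsilon>) F"
      by (intro tendsto_add tendsto_const e(1) LF_tendsto[OF bs(3,2) s(6)])
    ultimately have "- LF W V \<phi> \<le> LF (\<lambda>_ _. c) v \<theta> + \<epsilon> + 0 + \<epsilon>"
      using tendsto_le[OF F _ tendsto_minus[OF LF_tendsto[OF bW \<phi>(1)]]] by simp
    then show ?thesis using s(8) by simp
  qed
  have "- LF W V \<phi> \<le> \<eta>"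
  proof (rule field_le_epsilon)
    fix \<epsilon> :: real assume "\<epsilon> > 0"
    then show "- LF W V \<phi> \<le> \<eta> + \<epsilon>" using main[of "\<epsilon> / 2"] by simp
  qed
  then show ?thesis unfolding W_def[abs_def] V_def[abs_def] by simp
qed

text \<open>A test function supported in \<open>Q\<close> vanishes on the exterior, so the condition
  that relates constants to boundary values is vacuous for it.\<close>

lemma adm_interior:
  assumes \<phi>: "test_on Q \<phi>" "\<And>z. 0 \<le> \<phi> z"
  obtains B R where "\<And>b k. adm_test T \<Omega> b B R k \<phi>" "\<bar>c\<bar> \<le> B"
proof -
  obtain K where K: "compact K" "K \<subseteq> Q" "\<And>z. z \<notin> K \<Longrightarrow> \<phi> z = 0" using test_onE[OF \<phi>(1)] by blast
  obtain R where R: "\<And>x. x \<in> K \<Longrightarrow> norm x \<le> R" using compact_imp_bounded[OF K(1)] unfolding bounded_iff by blast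
  obtain B1 where B1: "B1 \<ge> 0" "\<And>z. \<bar>\<phi> z\<bar> \<le> B1" using test_on_bounded[OF \<phi>(1)] by blast
  obtain B2 where B2: "B2 \<ge> 0" "\<And>z h. \<bar>\<phi> (z + h) + \<phi> (z - h) - 2 * \<phi> z\<bar> \<le> B2 * (norm h)\<^sup>2"
    using test_on_second_difference[OF \<phi>(1)] by blast
  define B where "B = max \<bar>c\<bar> (max B1 B2)"
  have "B2 * (norm h)\<^sup>2 \<le> B * (norm h)\<^sup>2" for h :: "real \<times> 'a" by (intro mult_right_mono) (auto simp: B_def)
  then have "\<bar>\<phi> (z + h) + \<phi> (z - h) - 2 * \<phi> z\<bar> \<le> B * (norm h)\<^sup>2" for z h using B2(2)[of z h] order_trans by blast
  moreover have "\<phi> z \<le> B" for z using B1(2)[of z] by (auto simp: B_def)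
  moreover have "\<phi> z \<noteq> 0 \<longrightarrow> norm z \<le> R" for z using K(3)[of z] R[of z] by blast
  moreover have "\<phi> z = 0" if "z \<in> slab T (- \<Omega>)" for z using slab_disjoint[of z T \<Omega>] that K(2) K(3)[of z] by blast
  ultimately have "adm_test T \<Omega> b B R k \<phi>" for b k
    unfolding adm_test_def using test_on_mono[OF \<phi>(1) slab_mono] \<phi>(2) by blast
  then show thesis using that[of B R] by (auto simp: B_def)
qed

lemma LF_const_nonneg:
  assumes "test_on Q \<phi>" "\<And>z. 0 \<le> \<phi> z"
  shows "0 \<le> LF (\<lambda>_ _. c) v \<phi>"
proof -
  obtain B R where B: "\<And>b k. adm_test T \<Omega> b B R k \<phi>" "\<bar>c\<bar> \<le> B" using adm_interior[OF assms, of c] by blast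
  obtain e where e: "(e \<longlongrightarrow> 0) F" "\<And>n. 0 \<le> e n" "\<And>n k \<phi>. \<bar>k\<bar> \<le> B \<Longrightarrow> adm_test T \<Omega> (\<lambda>z. - a z) B R (- k) \<phi> \<Longrightarrow>
      - flux_int Q f (\<lambda>_. k) (v n) \<phi> \<le> e n"
    using supersolutionE[of B R] by blast
  have "- e n \<le> flux_int Q f (\<lambda>_. c) (v n) \<phi>" for n using e(3)[OF B(2) B(1), of n] by simp
  moreover have "bseq (max M \<bar>c\<bar>) (\<lambda>_ _. c)" "bseq (max M \<bar>c\<bar>) v" by (auto intro: bseq_wv bseq_const)
  ultimately show ?thesis
    using tendsto_le[OF F LF_tendsto[OF _ _ assms(1)] tendsto_minus[OF e(1)]] by simp
qed

text \<open>The choice of -M for the level makes truncation the identity and the surplus flux zero.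
  The shifted doubling then becomes the usual interior one, with a centred kernel.\<close>

lemma LF_interior_nonneg:
  assumes \<phi>: "test_on Q \<phi>" "\<And>z. 0 \<le> \<phi> z"
  shows "0 \<le> LF w v \<phi>"
proof -
  obtain K where K: "compact K" "K \<subseteq> Q" "\<And>z. z \<notin> K \<Longrightarrow> \<phi> z = 0" using test_onE[OF \<phi>(1)] by blast
  obtain B where B: "B \<ge> 0" "\<And>z. \<bar>\<phi> z\<bar> \<le> B" using test_on_bounded[OF \<phi>(1)] by blast
  obtain \<theta> V where \<theta>: "test_on Q \<theta>" "\<And>z. 0 \<le> \<theta> z" "\<And>z. \<theta> z \<le> 1" "open V" "K \<subseteq> V" "\<And>z. z \<in> V \<Longrightarrow> \<theta> z = 1"
    using ex_cutoff[OF K(1) open_slab[OF op] K(2)] by blast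
  obtain K' where K': "compact K'" "K' \<subseteq> Q" "\<And>z. z \<notin> K' \<Longrightarrow> \<theta> z = 0" using test_onE[OF \<theta>(1)] by blast
  obtain d where d: "d > 0" "(\<Union>x\<in>K. ball x d) \<subseteq> V"
    using compact_subset_open_imp_ball_epsilon_subset[OF K(1) \<theta>(4,5)] by blast
  have M: "M \<ge> 0" using wb[of 0 0] by simp
  have le: "- M \<le> w n z" "- M \<le> v n z" for n z using wb[of n z] vb[of n z] by auto
  have "- 0 \<le> LF (\<lambda>n z. max (w n z) (- M)) (\<lambda>n z. max (v n z) (- M)) \<phi>"
  proof (rule doubling_limit[OF test_on_mono[OF \<phi>(1) slab_mono] \<phi>(2)])
    show "a z \<le> - M" if "z \<in> slab T (- \<Omega>)" "\<phi> z \<noteq> 0" for z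
      using slab_disjoint[of z T \<Omega>] that K(2) K(3)[of z] by blast
    fix r :: real assume "r > 0"
    have z: "LF (\<lambda>_ _. - M) v (\<lambda>y. B * \<theta> y) \<le> 0"
      unfolding LF_def flux_int_def using le(2) by (simp add: kflux_self_le tendsto_Lim[OF F tendsto_const])
    have in': "y \<in> Q \<and> y \<in> K' \<and> \<phi> z \<le> B * \<theta> y"
      if "\<phi> z \<noteq> 0" "\<bar>fst z - fst y\<bar> < d / 2" "snd z - snd y \<in> ball 0 (min (d / 2) r)" for z y
    proof -
      have "z \<in> K" using that(1) K(3) by blast
      have "dist z y \<le> norm (fst (z - y)) + norm (snd (z - y))"
        unfolding dist_norm using norm_Pair_le[of "fst (z - y)" "snd (z - y)"] unfolding prod.collapse .
      also have "\<dots> < d" using that(2,3) by simp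
      finally have "y \<in> ball z d" by simp
      then have "y \<in> V" using d(2) \<open>z \<in> K\<close> by blast
      then have "\<theta> y = 1" by (rule \<theta>(6))
      moreover have "y \<in> K'" using K'(3)[of y] \<open>\<theta> y = 1\<close> by auto
      ultimately show ?thesis using K'(2) B(2)[of z] by auto
    qed
    show "inward (- M) \<phi> 0 r"
      unfolding inward_def
    proof (intro exI conjI)
      show "0 < min (d / 2) r" "0 < d / 2" using d(1) \<open>r > 0\<close> by auto
      show "ball 0 (min (d / 2) r) \<subseteq> ball (0::'a) r" by auto
      show "test_on Q (\<lambda>y. B * \<theta> y)" by (rule test_on_mult(1)[OF \<theta>(1) smooth_const])
      show "compact K'" by fact
      show "K' \<subseteq> slab T UNIV" using K'(2) slab_mono by blast
      show "\<forall>y. 0 \<le> B * \<theta> y" using B(1) \<theta>(2) by simp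
      show "LF (\<lambda>_ _. - M) v (\<lambda>y. B * \<theta> y) \<le> 0" by (rule z)
      show "\<forall>z y. z \<in> Q \<longrightarrow> \<phi> z \<noteq> 0 \<longrightarrow> \<bar>fst z - fst y\<bar> < d / 2 \<longrightarrow> snd z - snd y \<in> ball 0 (min (d / 2) r) \<longrightarrow>
        y \<in> Q \<and> y \<in> K' \<and> \<phi> z \<le> B * \<theta> y" using in' by blast
    qed
  qed
  then show ?thesis using le by (simp add: max_absorb1)
qed

end

section \<open>Boundary layers\<close>

text \<open>The difference quotient in the direction of the gradient converges to the squared norm
  of the gradient.\<close>

lemma nabla_le_of_Lipschitz:
  fixes \<phi> :: "'e::euclidean_space \<Rightarrow> real"
  assumes "smooth \<phi>" "open S" "x \<in> S" "\<And>y. y \<in> S \<Longrightarrow> \<bar>\<phi> y - \<phi> x\<bar> \<le> L * norm (y - x)" "0 \<le> L"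
  shows "norm (nabla \<phi> x) \<le> L"
proof (cases "nabla \<phi> x = 0")
  case False
  define u where "u = nabla \<phi> x"
  have d1: "((\<lambda>t. x + t *\<^sub>R u) has_derivative (\<lambda>t. t *\<^sub>R u)) (at 0)" by (auto intro!: derivative_eq_intros)
  have "(\<phi> has_derivative (\<lambda>h. u \<bullet> h)) (at (x + 0 *\<^sub>R u))" using smooth_has_nabla[OF assms(1), of x] by (simp add: u_def)
  from has_derivative_compose[OF d1 this]
  have "((\<lambda>t. \<phi> (x + t *\<^sub>R u)) has_real_derivative (u \<bullet> u)) (at 0)"
    by (simp add: has_field_derivative_def mult_commute_abs)
  then have lim: "((\<lambda>h. (\<phi> (x + h *\<^sub>R u) - \<phi> x) / h) \<longlongrightarrow> u \<bullet> u) (at 0)" by (simp add: DERIV_def)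
  have "((\<lambda>h. x + h *\<^sub>R u) \<longlongrightarrow> x) (at 0)" by (auto intro!: tendsto_eq_intros)
  then have "\<forall>\<^sub>F h in at 0. x + h *\<^sub>R u \<in> S" using assms(2,3) by (rule topological_tendstoD)
  then have "\<forall>\<^sub>F h in at 0. (\<phi> (x + h *\<^sub>R u) - \<phi> x) / h \<le> L * norm u"
    using eventually_neq_at_within[of 0 0 UNIV]
  proof eventually_elim
    case (elim h)
    have "(\<phi> (x + h *\<^sub>R u) - \<phi> x) / h \<le> \<bar>\<phi> (x + h *\<^sub>R u) - \<phi> x\<bar> / \<bar>h\<bar>"
      by (metis abs_divide abs_ge_self)
    also have "\<dots> \<le> (L * norm (h *\<^sub>R u)) / \<bar>h\<bar>" using assms(4)[OF elim(1)] by (intro divide_right_mono) auto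
    also have "\<dots> = L * norm u" using elim(2) by simp
    finally show ?case .
  qed
  from tendsto_upperbound[OF lim this] have "u \<bullet> u \<le> L * norm u" by simp
  then have "norm u * norm u \<le> L * norm u" by (simp add: dot_square_norm power2_eq_square)
  then show ?thesis using False by (simp add: u_def)
qed (use assms in simp)

text \<open>The value 1 is demanded only between 2 and \<open>A\<close>, since the step will be the
  convolution of the indicator of a bounded interval. The slope \<open>K\<close> can be chosen
  independently of \<open>A\<close>.\<close>

definition smooth_step :: "real \<Rightarrow> real \<Rightarrow> (real \<Rightarrow> real) \<Rightarrow> bool" where
  "smooth_step K A s \<longleftrightarrow> smooth s \<and> (\<forall>t. 0 \<le> s t \<and> s t \<le> 1) \<and> (\<forall>t\<le>1. s t = 0) \<and>
    (\<forall>t. 2 \<le> t \<and> t \<le> A \<longrightarrow> s t = 1) \<and> (\<forall>t t'. \<bar>s t - s t'\<bar> \<le> K * \<bar>t - t'\<bar>)"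

lemma ex_smooth_steps:
  obtains K where "K \<ge> 0" "\<And>A. \<exists>s. smooth_step K A s"
proof -
  \<comment> \<open>A kernel with support in (1,2): its convolution with the indicator of [0,A] is 0
    up to 1 and equal to 1 from 2 to \<open>A\<close>, and the slope is bounded by the L^1 norm of
    the derivative of the kernel.\<close>
  obtain \<rho> where \<rho>: "mollifier (ball (3 / 2 :: real) (1 / 2)) \<rho>" using ex_mollifier[of "1/2" "3/2"] by auto
  note D = mollifierD[OF \<rho>]
  note sm = test_on_smooth[OF D(1)]
  have [measurable]: "nabla \<rho> \<in> borel_measurable borel" "\<rho> \<in> borel_measurable borel"
    by (rule nabla_borel_measurable[OF sm], rule smooth_borel_measurable[OF sm])
  note i2 = norm_nabla_integrable[OF D(1)]
  define K where "K = (LINT x|lborel. norm (nabla \<rho> x))"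
  have K: "K \<ge> 0" unfolding K_def by (rule Bochner_Integration.integral_nonneg) simp
  have "\<exists>s. smooth_step K A s" for A
  proof -
    define s where "s t = (LINT y|lborel. indicator {0..A} y * \<rho> (t - y))" for t
    have iA: "integrable lborel (indicator {0..A} :: real \<Rightarrow> real)"
      by (rule integrable_bounded_support[OF _ bounded_closed_interval[of 0 A], where B=1]) (auto split: split_indicator)
    have \<rho>z: "(LINT y|lborel. \<rho> (t - y)) = 1" "integrable lborel (\<lambda>y. \<rho> (t - y))" for t
      using mollifier_integral(1)[OF \<rho>] integrable_lborel_reflect[OF test_on_integrable[OF D(1)]] by auto
    have isx: "integrable lborel (\<lambda>y. indicator {0..A} y * \<rho> (t - y))" for t
      using integrable_mult_indicator[OF _ \<rho>z(2), of "{0..A}"] by simp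
    have supp: "1 < x \<and> x < 2" if "\<rho> x \<noteq> 0" for x using D(4)[OF that] unfolding mem_ball dist_real_def
      by (auto simp: abs_if field_simps split: if_splits)
    have ss: "smooth s" unfolding s_def by (rule smooth_convolution[OF iA D(1)])
    have s0: "0 \<le> s t" for t unfolding s_def by (intro Bochner_Integration.integral_nonneg) (simp add: D(2))
    have s1: "s t \<le> 1" for t
    proof -
      have "s t \<le> (LINT y|lborel. \<rho> (t - y))" unfolding s_def
        by (rule integral_mono[OF isx \<rho>z(2)]) (use D(2) in \<open>auto split: split_indicator\<close>)
      then show ?thesis using \<rho>z by simp
    qed
    have sz: "s t = 0" if "t \<le> 1" for t
    proof -
      have "indicator {0..A} y * \<rho> (t - y) = 0" for y using supp[of "t - y"] that
        by (cases "\<rho> (t - y) = 0") (auto split: split_indicator)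
      then show ?thesis unfolding s_def by (simp only: integral_zero)
    qed
    have so: "s t = 1" if "2 \<le> t" "t \<le> A" for t
    proof -
      have "indicator {0..A} y * \<rho> (t - y) = \<rho> (t - y)" for y using supp[of "t - y"] that
        by (cases "\<rho> (t - y) = 0") (auto split: split_indicator)
      then show ?thesis unfolding s_def by (simp only: \<rho>z)
    qed
    have nab: "norm (nabla s t) \<le> K" for t
    proof -
      have i: "integrable lborel (\<lambda>y. norm (nabla \<rho> (t - y)))" by (rule integrable_lborel_reflect[OF i2])
      have "norm (nabla s t) \<le> (LINT y|lborel. norm (nabla \<rho> (t - y)))"
        unfolding s_def nabla_convolution[OF iA D(1)]
      proof (rule Bochner_Integration.integral_norm_bound_integral[OF _ i])
        show "integrable lborel (\<lambda>y. indicator {0..A} y *\<^sub>R nabla \<rho> (t - y))"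
          by (rule Bochner_Integration.integrable_bound[OF i]) (auto split: split_indicator)
      qed (auto split: split_indicator)
      also have "\<dots> = K" unfolding K_def by (rule integral_lborel_reflect) measurable
      finally show ?thesis .
    qed
    have "\<bar>s t - s t'\<bar> \<le> K * \<bar>t - t'\<bar>" for t t'
      using Lipschitz_of_nabla_bound[OF ss nab, of t t'] by simp
    then show ?thesis unfolding smooth_step_def using ss s0 s1 sz so by blast
  qed
  then show thesis using that K by blast
qed

text \<open>The factor \<open>T + 1\<close> is the length of the time interval from -1 to
  \<open>T\<close>.\<close>

lemma slab_integral_le:
  fixes p :: "'a::euclidean_space \<Rightarrow> real" and q :: "real \<times> 'a \<Rightarrow> real"
  assumes T: "T > 0" and p: "integrable lborel p" and q: "q \<in> borel_measurable borel" "\<And>z. 0 \<le> q z"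
    and le: "\<And>z. q z \<le> B * (indicator {-1<..<T} (fst z) * p (snd z))"
  shows "integrable lborel q" and "(LINT z|lborel. q z) \<le> B * (T + 1) * (LINT x|lborel. p x)"
proof -
  have "integrable lborel (indicator {-1<..<T} :: real \<Rightarrow> real)"
    by (rule integrable_bounded_support[OF _ bounded_subset[OF bounded_closed_interval[of "-1" T]], where B=1])
      (auto split: split_indicator)
  note h = integrable_tensor[OF this p]
  then have Bh: "integrable lborel (\<lambda>z. B * (indicator {-1<..<T} (fst z) * p (snd z)))" by simp
  show i: "integrable lborel q"
    by (rule Bochner_Integration.integrable_bound[OF Bh])
      (use q order_trans[OF q(2) le] le in auto)
  have "(LINT z|lborel. q z) \<le> (LINT z|lborel. B * (indicator {-1<..<T} (fst z) * p (snd z)))"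
    by (rule integral_mono[OF i Bh le])
  also have "\<dots> = B * (T + 1) * (LINT x|lborel. p x)"
    unfolding Bochner_Integration.integral_mult_right_zero integral_lborel_fst(1)[OF h] using T by simp
  finally show "(LINT z|lborel. q z) \<le> B * (T + 1) * (LINT x|lborel. p x)" .
qed

text \<open>For an epigraph, \<open>g\<close> is the height above the graph. Its unit growth along
  \<open>\<nu>\<close> gives the inward shift and the disjoint translates of a layer; its Lipschitz
  constant limits what a small perturbation of the shift can destroy.\<close>

locale Lipschitz_chart =
  fixes \<Omega> :: "'a::euclidean_space set" and x0 :: 'a and r :: real and \<nu> :: 'a and g :: "'a \<Rightarrow> real" and L :: real
  assumes r: "r > 0" and \<nu>: "norm \<nu> = 1" and gc: "continuous_on UNIV g" and L: "1 \<le> L"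
    and gL: "\<And>x y. x \<in> ball x0 r \<Longrightarrow> y \<in> ball x0 r \<Longrightarrow> \<bar>g x - g y\<bar> \<le> L * norm (x - y)"
    and gs: "\<And>x s. g (x + s *\<^sub>R \<nu>) = g x + s"
    and chart: "\<Omega> \<inter> ball x0 r = {x \<in> ball x0 r. 0 < g x}"

text \<open>Cut-offs that vanish near the boundary and are 1 from depth
  \<open>3 * \<delta> j\<close> on. The ratio 16 separates the transition zones:
  \<open>3 * \<delta> (Suc j)\<close> lies below \<open>\<delta> j / 2\<close>, with room for a
  displacement. A layer has measure of order \<open>\<delta> j\<close> and a slope of the inverse
  order, whence the uniform L^1 bound for the gradients.\<close>

locale chart_layers = Lipschitz_chart \<Omega> x0 r \<nu> g L
  for \<Omega> :: "'a::euclidean_space set" and x0 r \<nu> g L +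
  fixes \<mu> :: "nat \<Rightarrow> 'a \<Rightarrow> real" and \<delta> :: "nat \<Rightarrow> real" and C :: real
  assumes C: "C \<ge> 0" and \<mu>s: "\<And>j. smooth (\<mu> j)" and \<mu>0: "\<And>j x. 0 \<le> \<mu> j x" and \<mu>1: "\<And>j x. \<mu> j x \<le> 1"
    and \<delta>0: "\<And>j. 0 < \<delta> j" and \<delta>Suc: "\<And>j. \<delta> (Suc j) = \<delta> j / 16" and \<delta>lim: "\<delta> \<longlonglongrightarrow> 0"
    and \<mu>zero: "\<And>j x. x \<in> ball x0 (r / 2) \<Longrightarrow> g x \<le> \<delta> j / 2 \<Longrightarrow> \<mu> j x = 0"
    and \<mu>one: "\<And>j x. x \<in> ball x0 (r / 2) \<Longrightarrow> 3 * \<delta> j \<le> g x \<Longrightarrow> \<mu> j x = 1"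
    and \<mu>int: "\<And>j. (LINT x|lborel. indicator {x \<in> ball x0 (r / 2). 0 < g x} x * norm (nabla (\<mu> j) x)) \<le> C"
    and \<mu>meas: "\<And>j. measure lborel {x \<in> ball x0 (r / 2). 0 < g x \<and> g x \<le> 3 * \<delta> j} \<le> C * \<delta> j"

context Lipschitz_chart
begin

lemma g_measurable [measurable]: "g \<in> borel_measurable borel"
  using gc by (rule borel_measurable_continuous_onI)

text \<open>Translates of the layer by multiples of \<open>4\<delta>\<nu>\<close> are disjoint, which bounds its measure.\<close>

lemma layer_measure:
  assumes \<delta>: "\<delta> > 0" "\<delta> \<le> r / 16"
  shows "measure lborel {x \<in> ball x0 (r / 2). 0 < g x \<and> g x \<le> 3 * \<delta>} \<le> 16 * measure lborel (ball x0 r) / r * \<delta>"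
proof -
  define S where "S = {x \<in> ball x0 (r / 2). 0 < g x \<and> g x \<le> 3 * \<delta>}"
  have S[measurable]: "S \<in> sets borel" unfolding S_def by measurable
  \<comment> \<open>As many translates as stay in \<open>ball x0 r\<close>: the displacement
    \<open>4 * real n * \<delta>\<close> is at most r/2. As the quotient is at least 2, its integer
    part loses at most a factor 2.\<close>
  define n where "n = nat \<lfloor>r / (8 * \<delta>)\<rfloor>"
  have q: "r / (8 * \<delta>) \<ge> 2" using \<delta> by (simp add: divide_simps)
  have n: "real n \<le> r / (8 * \<delta>)" "real n \<ge> r / (16 * \<delta>)"
  proof -
    have "real n = real_of_int \<lfloor>r / (8 * \<delta>)\<rfloor>" using q by (simp add: n_def)
    moreover have "r / (16 * \<delta>) = (r / (8 * \<delta>)) / 2" using \<delta> by (simp add: divide_simps)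
    ultimately show "real n \<le> r / (8 * \<delta>)" "real n \<ge> r / (16 * \<delta>)" using q by linarith+
  qed
  define A where "A i = {y. - (4 * real i * \<delta>) *\<^sub>R \<nu> + y \<in> S}" for i
  have [measurable]: "A i \<in> sets borel" for i
  proof -
    have "A i = (\<lambda>y. - (4 * real i * \<delta>) *\<^sub>R \<nu> + y) -` S \<inter> space borel" by (auto simp: A_def)
    also have "\<dots> \<in> sets borel" by (rule measurable_sets[OF _ S]) simp
    finally show ?thesis .
  qed
  have eA: "emeasure lborel (A i) = emeasure lborel S" for i
  proof -
    have "(\<integral>\<^sup>+ y. indicator S (- (4 * real i * \<delta>) *\<^sub>R \<nu> + y) \<partial>lborel) = (\<integral>\<^sup>+ y. indicator S y \<partial>lborel)"
      by (rule nn_integral_lborel_translate) simp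
    moreover have "(\<integral>\<^sup>+ y. indicator S (- (4 * real i * \<delta>) *\<^sub>R \<nu> + y) \<partial>lborel) = (\<integral>\<^sup>+ y. indicator (A i) y \<partial>lborel)"
      by (intro nn_integral_cong) (auto simp: A_def split: split_indicator)
    moreover have "(\<integral>\<^sup>+ y. indicator (A i) y \<partial>lborel) = emeasure lborel (A i)" "(\<integral>\<^sup>+ y. indicator S y \<partial>lborel) = emeasure lborel S"
      by (rule nn_integral_indicator; simp)+
    ultimately show ?thesis by (simp only:)
  qed
  have gA: "4 * real i * \<delta> < g y \<and> g y \<le> 4 * real i * \<delta> + 3 * \<delta>" if "y \<in> A i" for i y
    using that gs[of y "- (4 * real i * \<delta>)"] by (auto simp: A_def S_def add.commute)
  have disj: "disjoint_family_on A {..<n}"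
    unfolding disjoint_family_on_def
  proof (intro ballI impI)
    have *: False if "i < j" "y \<in> A i" "y \<in> A j" for i j y
    proof -
      have "real i + 1 \<le> real j" using that(1) by simp
      then have "(4 * \<delta>) * (real i + 1) \<le> (4 * \<delta>) * real j" using \<delta> by (intro mult_left_mono) auto
      then show False using gA[OF that(2)] gA[OF that(3)] \<delta> by (simp add: algebra_simps)
    qed
    fix i j :: nat assume "i \<noteq> j"
    then show "A i \<inter> A j = {}" using *[of i j] *[of j i] by (cases "i < j") auto
  qed
  have sub: "(\<Union>i<n. A i) \<subseteq> ball x0 r"
  proof
    fix y assume "y \<in> (\<Union>i<n. A i)"
    then obtain i where i: "i < n" "y \<in> A i" by auto
    define x where "x = - (4 * real i * \<delta>) *\<^sub>R \<nu> + y"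
    have x: "dist x0 x < r / 2" using i(2) by (auto simp: A_def S_def x_def)
    have "dist x y = 4 * real i * \<delta>" using \<delta> \<nu> by (simp add: x_def dist_norm)
    also have "\<dots> \<le> 4 * real n * \<delta>" using i(1) \<delta> by simp
    also have "\<dots> \<le> 4 * (r / (8 * \<delta>)) * \<delta>" using n(1) \<delta> by (intro mult_right_mono mult_left_mono) auto
    also have "\<dots> = r / 2" using \<delta> by simp
    finally show "y \<in> ball x0 r" using x dist_triangle[of x0 y x] by simp
  qed
  have finS: "emeasure lborel S < \<infinity>"
    by (rule emeasure_bounded_finite[OF bounded_subset[OF bounded_ball[of x0 "r/2"]]]) (auto simp: S_def)
  have "ennreal (real n * measure lborel S) = (\<Sum>i<n. emeasure lborel (A i))"
    using finS by (simp add: eA emeasure_eq_ennreal_measure ennreal_of_nat_eq_real_of_nat ennreal_mult)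
  also have "\<dots> = emeasure lborel (\<Union>i<n. A i)" by (rule sum_emeasure[OF _ disj]) auto
  also have "\<dots> \<le> emeasure lborel (ball x0 r)" by (rule emeasure_mono[OF sub]) simp
  also have "\<dots> = ennreal (measure lborel (ball x0 r))"
    using emeasure_bounded_finite[OF bounded_ball[of x0 r]] by (simp add: emeasure_eq_ennreal_measure)
  finally have "real n * measure lborel S \<le> measure lborel (ball x0 r)" by simp
  moreover have "r / (16 * \<delta>) * measure lborel S \<le> real n * measure lborel S" using n(2) by (intro mult_right_mono) auto
  ultimately have "r / (16 * \<delta>) * measure lborel S \<le> measure lborel (ball x0 r)" by linarith
  then show ?thesis unfolding S_def[symmetric] using \<delta> r by (simp add: field_simps)
qed

definition layer :: "real \<Rightarrow> real \<Rightarrow> ('a \<Rightarrow> real) \<Rightarrow> bool" where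
  "layer K \<delta> \<mu> \<longleftrightarrow> smooth \<mu> \<and> (\<forall>x. 0 \<le> \<mu> x \<and> \<mu> x \<le> 1) \<and>
    (\<forall>x\<in>ball x0 (r / 2). (g x \<le> \<delta> / 2 \<longrightarrow> \<mu> x = 0) \<and> (3 * \<delta> \<le> g x \<longrightarrow> \<mu> x = 1) \<and> norm (nabla \<mu> x) \<le> K * L / \<delta> \<and>
      (nabla \<mu> x \<noteq> 0 \<longrightarrow> 0 < g x \<and> g x \<le> 3 * \<delta>))"

text \<open>The height \<open>g\<close> is mollified at a scale at which it changes by at most
  \<open>\<delta> / 2\<close>, which preserves its Lipschitz constant. A smooth step applied to the
  result divided by \<open>\<delta>\<close> has slope of order \<open>L / \<delta>\<close>,
  independently of the scale of mollification.\<close>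

lemma boundary_layer:
  assumes \<delta>: "\<delta> > 0" and K: "K \<ge> 0" "\<And>A. \<exists>s. smooth_step K A s"
  shows "\<exists>\<mu>. layer K \<delta> \<mu>"
proof -
  define \<epsilon> where "\<epsilon> = min (r / 2) (\<delta> / (2 * L))"
  have \<epsilon>: "\<epsilon> > 0" "\<epsilon> \<le> r / 2" "L * \<epsilon> \<le> \<delta> / 2"
  proof -
    show "\<epsilon> > 0" "\<epsilon> \<le> r / 2" using r L \<delta> by (auto simp: \<epsilon>_def)
    have "L * \<epsilon> \<le> L * (\<delta> / (2 * L))" using L by (intro mult_left_mono) (auto simp: \<epsilon>_def)
    then show "L * \<epsilon> \<le> \<delta> / 2" using L by simp
  qed
  obtain \<rho> where \<rho>: "mollifier (ball (0::'a) \<epsilon>) \<rho>" using ex_mollifier[OF \<epsilon>(1)] by blast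
  note D = mollifierD[OF \<rho>]
  note sm = test_on_smooth[OF D(1)]
  have [measurable]: "\<rho> \<in> borel_measurable borel" by (rule smooth_borel_measurable[OF sm])
  \<comment> \<open>Cutting off makes the height integrable. At points of the half ball the kernel,
    whose radius is at most r/2, does not notice the cut.\<close>
  define g1 where "g1 x = indicator (ball x0 r) x * g x" for x
  have gB: "\<bar>g x\<bar> \<le> \<bar>g x0\<bar> + L * r" if "x \<in> ball x0 r" for x
  proof -
    have "\<bar>g x - g x0\<bar> \<le> L * norm (x - x0)" using that r by (intro gL) auto
    also have "\<dots> \<le> L * r" using that L by (intro mult_left_mono) (auto simp: dist_norm norm_minus_commute)
    finally show ?thesis by linarith
  qed
  have [measurable]: "g1 \<in> borel_measurable borel"
    unfolding g1_def by (intro borel_measurable_times borel_measurable_indicator borel_measurable_continuous_onI gc) simp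
  have ig: "integrable lborel g1"
    by (rule integrable_bounded_support[OF _ bounded_ball[of x0 r], where B="\<bar>g x0\<bar> + L * r"])
      (use gB L r in \<open>auto simp: g1_def split: split_indicator\<close>)
  define G where "G x = (LINT y|lborel. g1 y * \<rho> (x - y))" for x
  have Gs: "smooth G" unfolding G_def by (rule smooth_convolution[OF ig D(1)])
  have G2: "G x = (LINT h|lborel. g1 (x - h) * \<rho> h)" for x
  proof -
    have "(\<lambda>h. g1 (x - h) * \<rho> h) \<in> borel_measurable borel" by measurable
    from integral_lborel_reflect[OF this, of x] show ?thesis unfolding G_def by simp
  qed
  have iG: "integrable lborel (\<lambda>h. g1 (x - h) * \<rho> h)" for x
  proof -
    obtain B where B: "B \<ge> 0" "\<And>z. \<bar>\<rho> z\<bar> \<le> B" using test_on_bounded[OF D(1)] by blast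
    have "integrable lborel (\<lambda>y. g1 y * \<rho> (x - y))"
      using convolution_integrable[OF ig, of \<rho> B x] smooth_continuous_on[OF sm] B by simp
    from integrable_lborel_reflect[OF this, of x] show ?thesis by simp
  qed
  have inb: "x - h \<in> ball x0 r \<and> norm h < \<epsilon>" if "x \<in> ball x0 (r / 2)" "\<rho> h \<noteq> 0" for x h
  proof -
    have "norm h < \<epsilon>" using D(4)[OF that(2)] by simp
    moreover have "dist x (x - h) = norm h" by (simp add: dist_norm)
    ultimately show ?thesis using that(1) \<epsilon>(2) dist_triangle[of x0 "x - h" x] by simp
  qed
  have i\<rho>: "integrable lborel \<rho>" by (rule test_on_integrable[OF D(1)])
  have Gg: "\<bar>G x - g x\<bar> \<le> L * \<epsilon>" if x: "x \<in> ball x0 (r / 2)" for x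
  proof -
    have "G x - g x = (LINT h|lborel. g1 (x - h) * \<rho> h - g x * \<rho> h)"
      unfolding G2 using iG i\<rho> D(3) by simp
    also have "norm \<dots> \<le> (LINT h|lborel. L * \<epsilon> * \<rho> h)"
    proof (rule Bochner_Integration.integral_norm_bound_integral)
      show "integrable lborel (\<lambda>h. g1 (x - h) * \<rho> h - g x * \<rho> h)" using iG i\<rho> by simp
      show "integrable lborel (\<lambda>h. L * \<epsilon> * \<rho> h)" using i\<rho> by simp
      fix h
      show "norm (g1 (x - h) * \<rho> h - g x * \<rho> h) \<le> L * \<epsilon> * \<rho> h"
      proof (cases "\<rho> h = 0")
        case False
        note b = inb[OF x False]
        have "x \<in> ball x0 r" using x r by auto
        then have "\<bar>g (x - h) - g x\<bar> \<le> L * norm (x - h - x)" using b by (intro gL) auto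
        also have "\<dots> \<le> L * \<epsilon>" using b L by (intro mult_left_mono) auto
        finally have "\<bar>g (x - h) - g x\<bar> * \<rho> h \<le> L * \<epsilon> * \<rho> h" using D(2) by (rule mult_right_mono)
        moreover have "g1 (x - h) * \<rho> h - g x * \<rho> h = (g (x - h) - g x) * \<rho> h"
          using b by (simp add: g1_def left_diff_distrib)
        ultimately show ?thesis using D(2)[of h] by (simp add: abs_mult)
      qed simp
    qed
    also have "\<dots> = L * \<epsilon>" using D(3) by simp
    finally show ?thesis by simp
  qed
  have GL: "\<bar>G x - G y\<bar> \<le> L * norm (x - y)" if x: "x \<in> ball x0 (r / 2)" and y: "y \<in> ball x0 (r / 2)" for x y
  proof -
    have "G x - G y = (LINT h|lborel. g1 (x - h) * \<rho> h - g1 (y - h) * \<rho> h)" unfolding G2 using iG by simp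
    also have "norm \<dots> \<le> (LINT h|lborel. L * norm (x - y) * \<rho> h)"
    proof (rule Bochner_Integration.integral_norm_bound_integral)
      show "integrable lborel (\<lambda>h. g1 (x - h) * \<rho> h - g1 (y - h) * \<rho> h)" using iG by simp
      show "integrable lborel (\<lambda>h. L * norm (x - y) * \<rho> h)" using i\<rho> by simp
      fix h
      show "norm (g1 (x - h) * \<rho> h - g1 (y - h) * \<rho> h) \<le> L * norm (x - y) * \<rho> h"
      proof (cases "\<rho> h = 0")
        case False
        note b = inb[OF x False] inb[OF y False]
        have "\<bar>g (x - h) - g (y - h)\<bar> \<le> L * norm (x - y)" using gL[of "x - h" "y - h"] b by simp
        then have "\<bar>g (x - h) - g (y - h)\<bar> * \<rho> h \<le> L * norm (x - y) * \<rho> h" using D(2) by (rule mult_right_mono)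
        moreover have "g1 (x - h) * \<rho> h - g1 (y - h) * \<rho> h = (g (x - h) - g (y - h)) * \<rho> h"
          using b by (simp add: g1_def left_diff_distrib)
        ultimately show ?thesis using D(2)[of h] by (simp add: abs_mult)
      qed simp
    qed
    also have "\<dots> = L * norm (x - y)" using D(3) by simp
    finally show ?thesis by simp
  qed
  \<comment> \<open>An upper bound of \<open>G\<close> divided by \<open>\<delta>\<close> on the
    half ball: there the step does not leave the value 1 again.\<close>
  define A where "A = (\<bar>g x0\<bar> + L * r + L * \<epsilon>) / \<delta>"
  obtain s :: "real \<Rightarrow> real" where s: "smooth s" "\<And>t. 0 \<le> s t" "\<And>t. s t \<le> 1" "\<And>t. t \<le> 1 \<Longrightarrow> s t = 0"
    "\<And>t. 2 \<le> t \<Longrightarrow> t \<le> A \<Longrightarrow> s t = 1" "\<And>t t'. \<bar>s t - s t'\<bar> \<le> K * \<bar>t - t'\<bar>"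
    using K(2)[of A] unfolding smooth_step_def by auto
  define \<mu> where "\<mu> x = s (inverse \<delta> * G x)" for x
  have \<mu>s: "smooth \<mu>" unfolding \<mu>_def by (intro smooth_comp_real[OF s(1)] smooth_mult smooth_const Gs)
  have \<mu>0: "\<mu> x = 0" if "x \<in> ball x0 (r / 2)" "g x \<le> \<delta> / 2" for x
  proof -
    have "G x \<le> \<delta>" using Gg[OF that(1)] that(2) \<epsilon>(3) by linarith
    then show ?thesis unfolding \<mu>_def using \<delta> by (intro s(4)) (simp add: field_simps)
  qed
  \<comment> \<open>The bound with 5/2 instead of 3 yields an open set, containing all points with
    \<open>3 * \<delta> \<le> g x\<close>, on which \<open>\<mu>\<close> is constant. Hence the
    gradient vanishes there.\<close>
  have \<mu>1: "\<mu> x = 1" if "x \<in> ball x0 (r / 2)" "5 / 2 * \<delta> \<le> g x" for x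
  proof -
    have "2 * \<delta> \<le> G x" using Gg[OF that(1)] that(2) \<epsilon>(3) by linarith
    moreover have "G x \<le> \<bar>g x0\<bar> + L * r + L * \<epsilon>" using Gg[OF that(1)] gB[of x] that(1) r by auto
    ultimately show ?thesis unfolding \<mu>_def A_def using \<delta> by (intro s(5)) (auto simp: field_simps A_def)
  qed
  have \<mu>L: "norm (nabla \<mu> x) \<le> K * L / \<delta>" if x: "x \<in> ball x0 (r / 2)" for x
  proof (rule nabla_le_of_Lipschitz[OF \<mu>s open_ball x])
    fix y assume y: "y \<in> ball x0 (r / 2)"
    have "\<bar>\<mu> y - \<mu> x\<bar> \<le> K * \<bar>inverse \<delta> * G y - inverse \<delta> * G x\<bar>" unfolding \<mu>_def by (rule s(6))
    also have "\<bar>inverse \<delta> * G y - inverse \<delta> * G x\<bar> = inverse \<delta> * \<bar>G y - G x\<bar>"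
      using \<delta> by (simp add: right_diff_distrib[symmetric] abs_mult)
    also have "K * (inverse \<delta> * \<bar>G y - G x\<bar>) \<le> K * (inverse \<delta> * (L * norm (y - x)))"
      using GL[OF y x] K(1) \<delta> by (intro mult_left_mono) auto
    finally show "\<bar>\<mu> y - \<mu> x\<bar> \<le> K * L / \<delta> * norm (y - x)" by (simp add: field_simps)
  qed (use K(1) L \<delta> in auto)
  have \<mu>n: "0 < g x \<and> g x \<le> 3 * \<delta>" if x: "x \<in> ball x0 (r / 2)" "nabla \<mu> x \<noteq> 0" for x
  proof (rule ccontr)
    assume "\<not> ?thesis"
    then consider "g x < \<delta> / 2" | "5 / 2 * \<delta> < g x" using \<delta> by linarith
    then show False
    proof cases
      case 1
      have "open (ball x0 (r / 2) \<inter> {y. g y < \<delta> / 2})"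
        by (intro open_Int open_ball open_Collect_less gc continuous_on_const)
      then have "nabla \<mu> x = 0" by (rule nabla_eq_0_locally_const[where c=0]) (use x 1 \<mu>0 in auto)
      then show False using x by simp
    next
      case 2
      have "open (ball x0 (r / 2) \<inter> {y. 5 / 2 * \<delta> < g y})"
        by (intro open_Int open_ball open_Collect_less gc continuous_on_const)
      then have "nabla \<mu> x = 0" by (rule nabla_eq_0_locally_const[where c=1]) (use x 2 \<mu>1 in auto)
      then show False using x by simp
    qed
  qed
  have "0 \<le> \<mu> x \<and> \<mu> x \<le> 1" for x unfolding \<mu>_def using s(2,3) by blast
  then show ?thesis unfolding layer_def using \<mu>s \<mu>0 \<mu>1 \<mu>L \<mu>n \<delta> by (intro exI[of _ \<mu>]) force
qed

lemma ex_chart_layers: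
  obtains \<mu> \<delta> C where "chart_layers \<Omega> x0 r \<nu> g L \<mu> \<delta> C"
proof -
  obtain K where K: "K \<ge> 0" "\<And>A. \<exists>s. smooth_step K A s"
    using ex_smooth_steps by blast
  \<comment> \<open>The sequence starts at r/16, the largest thickness for which
    \<open>layer_measure\<close> applies.\<close>
  define \<delta> where "\<delta> j = r / 16 * (1 / 16) ^ j" for j :: nat
  have \<delta>: "\<delta> j > 0" "\<delta> j \<le> r / 16" for j
    using r power_le_one[of "1/16::real" j] mult_left_mono[of "(1/16)^j" 1 "r / 16"] by (auto simp: \<delta>_def)
  have "\<forall>j. \<exists>\<mu>. layer K (\<delta> j) \<mu>" using boundary_layer[OF \<delta>(1) K] by blast
  from choice[OF this] obtain \<mu> where "\<forall>j. layer K (\<delta> j) (\<mu> j)" by blast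
  note \<mu> = this[unfolded layer_def]
  define V where "V = 16 * measure lborel (ball x0 r) / r"
  have V: "V \<ge> 0" using r by (simp add: V_def)
  have lay: "measure lborel {x \<in> ball x0 (r / 2). 0 < g x \<and> g x \<le> 3 * \<delta> j} \<le> V * \<delta> j" for j
    unfolding V_def by (rule layer_measure[OF \<delta>])
  have int: "(LINT x|lborel. indicator {x \<in> ball x0 (r / 2). 0 < g x} x * norm (nabla (\<mu> j) x)) \<le> K * L * V" for j
  proof -
    define S where "S = {x \<in> ball x0 (r / 2). 0 < g x \<and> g x \<le> 3 * \<delta> j}"
    have S: "S \<in> sets borel" "bounded S" unfolding S_def by (measurable, auto intro: bounded_subset[OF bounded_ball[of x0 "r/2"]])
    have iS: "integrable lborel (\<lambda>x. K * L / \<delta> j * indicator S x)"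
      by (rule integrable_bounded_support[OF _ S(2), where B="\<bar>K * L / \<delta> j\<bar>"])
        (use S(1) in \<open>auto split: split_indicator\<close>)
    have nn: "0 \<le> K * L / \<delta> j" using K(1) L \<delta>(1)[of j] by simp
    have "(LINT x|lborel. indicator {x \<in> ball x0 (r / 2). 0 < g x} x * norm (nabla (\<mu> j) x)) \<le> (LINT x|lborel. K * L / \<delta> j * indicator S x)"
    proof (rule integral_mono'[OF iS])
      fix x
      show "indicator {x \<in> ball x0 (r / 2). 0 < g x} x * norm (nabla (\<mu> j) x) \<le> K * L / \<delta> j * indicator S x"
      proof (cases "x \<in> ball x0 (r / 2) \<and> nabla (\<mu> j) x \<noteq> 0")
        case True
        then have "norm (nabla (\<mu> j) x) \<le> K * L / \<delta> j" "x \<in> S" using \<mu> unfolding S_def by blast+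
        then show ?thesis using nn by (auto split: split_indicator)
      qed (use nn in \<open>auto split: split_indicator\<close>)
    qed (use nn in \<open>simp split: split_indicator\<close>)
    also have "\<dots> = K * L / \<delta> j * measure lborel S" by simp
    also have "\<dots> \<le> K * L / \<delta> j * (V * \<delta> j)" using lay[of j] K(1) L \<delta>(1)[of j] unfolding S_def by (intro mult_left_mono) auto
    also have "\<dots> = K * L * V" using \<delta>(1)[of j] by simp
    finally show ?thesis .
  qed
  have tend: "\<delta> \<longlonglongrightarrow> 0" unfolding \<delta>_def by (intro tendsto_mult_right_zero LIMSEQ_power_zero) simp
  show thesis
  proof (rule that[of \<mu> \<delta> "max V (K * L * V)"], unfold_locales)
    show "max V (K * L * V) \<ge> 0" using V by simp
    show "\<delta> (Suc j) = \<delta> j / 16" for j by (simp add: \<delta>_def)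
    show "measure lborel {x \<in> ball x0 (r / 2). 0 < g x \<and> g x \<le> 3 * \<delta> j} \<le> max V (K * L * V) * \<delta> j" for j
      by (rule order_trans[OF lay]) (use \<delta>(1)[of j] in \<open>auto intro: mult_right_mono\<close>)
    show "(LINT x|lborel. indicator {x \<in> ball x0 (r / 2). 0 < g x} x * norm (nabla (\<mu> j) x)) \<le> max V (K * L * V)" for j
      using int[of j] by simp
    show "smooth (\<mu> j)" "0 \<le> \<mu> j x" "\<mu> j x \<le> 1" for j x using \<mu> by blast+
    show "\<mu> j x = 0" if "x \<in> ball x0 (r / 2)" "g x \<le> \<delta> j / 2" for j x using \<mu> that by blast
    show "\<mu> j x = 1" if "x \<in> ball x0 (r / 2)" "3 * \<delta> j \<le> g x" for j x using \<mu> that by blast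
  qed (use \<delta> tend in auto)
qed

end

section \<open>Comparison up to the boundary\<close>

context chart_layers
begin

lemma \<delta>_less: "j < l \<Longrightarrow> \<delta> l \<le> \<delta> j / 16"
proof (induction l)
  case (Suc l)
  then show ?case using \<delta>Suc[of l] \<delta>0[of l] by (cases "j = l") auto
qed simp

text \<open>Where \<open>\<mu> j\<close> is not 0 the height exceeds \<open>\<delta> j / 2\<close>
  and thus \<open>3 * \<delta> l\<close> for every later \<open>l\<close>, so \<open>\<mu> l\<close>
  is already 1.\<close>

lemma \<mu>_mono: "j \<le> l \<Longrightarrow> x \<in> ball x0 (r / 2) \<Longrightarrow> \<mu> j x \<le> \<mu> l x"
proof (cases "j = l \<or> g x \<le> \<delta> j / 2")
  case True
  then show "j \<le> l \<Longrightarrow> x \<in> ball x0 (r / 2) \<Longrightarrow> \<mu> j x \<le> \<mu> l x" using \<mu>zero[of x j] \<mu>0[of l x] by auto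
next
  case False
  assume "j \<le> l" "x \<in> ball x0 (r / 2)"
  then have "\<mu> l x = 1" using False \<delta>_less[of j l] \<delta>0[of j] by (intro \<mu>one) auto
  then show "\<mu> j x \<le> \<mu> l x" using \<mu>1[of j x] by simp
qed

lemma smooth_layer: "smooth (\<lambda>z :: real \<times> 'a. \<mu> j (snd z))"
  by (rule smooth_comp_linear[OF bounded_linear_snd \<mu>s])

lemma nabla_layer: "nabla (\<lambda>z :: real \<times> 'a. \<mu> j (snd z)) z = (0, nabla (\<mu> j) (snd z))"
proof (rule nablaI)
  show "((\<lambda>z :: real \<times> 'a. \<mu> j (snd z)) has_derivative (\<lambda>h. (0, nabla (\<mu> j) (snd z)) \<bullet> h)) (at z)"
  proof -
    have "((\<lambda>z :: real \<times> 'a. \<mu> j (snd z)) has_derivative (\<lambda>h. nabla (\<mu> j) (snd z) \<bullet> snd h)) (at z)"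
      using has_derivative_compose[OF bounded_linear_imp_has_derivative[OF bounded_linear_snd] smooth_has_nabla[OF \<mu>s]] .
    then show ?thesis by (simp add: inner_prod_def)
  qed
qed

lemma in_domain: "x \<in> ball x0 r \<Longrightarrow> x \<in> \<Omega> \<longleftrightarrow> 0 < g x"
  using arg_cong[OF chart, of "\<lambda>S. x \<in> S"] by simp

text \<open>The factor \<open>\<mu> j\<close> removes a neighbourhood of the boundary. A test
  function of the chart thereby becomes one of the interior, to which the interior results
  apply.\<close>

lemma test_on_layer:
  assumes "test_on (slab T (ball x0 (r / 2))) \<Psi>"
  shows "test_on (slab T \<Omega>) (\<lambda>z. \<Psi> z * \<mu> j (snd z))"
proof -
  obtain K where K: "compact K" "K \<subseteq> slab T (ball x0 (r / 2))" "\<And>z. z \<notin> K \<Longrightarrow> \<Psi> z = 0" using test_onE[OF assms] by blast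
  have "closed {z :: real \<times> 'a. \<delta> j / 2 \<le> g (snd z)}"
    by (intro closed_Collect_le continuous_on_const continuous_on_compose2[OF gc] continuous_on_snd continuous_on_id) auto
  then have "compact (K \<inter> {z. \<delta> j / 2 \<le> g (snd z)})" by (rule compact_Int_closed[OF K(1)])
  moreover have "K \<inter> {z. \<delta> j / 2 \<le> g (snd z)} \<subseteq> slab T \<Omega>"
  proof
    fix z assume z: "z \<in> K \<inter> {z. \<delta> j / 2 \<le> g (snd z)}"
    then have zs: "z \<in> slab T (ball x0 (r / 2))" using K(2) by blast
    then have "snd z \<in> ball x0 r" using r by (auto simp: slab_def)
    moreover have "0 < g (snd z)" using z \<delta>0[of j] by simp
    ultimately have "snd z \<in> \<Omega>" using in_domain by blast
    then show "z \<in> slab T \<Omega>" using zs by (auto simp: slab_def)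
  qed
  moreover have "\<Psi> z * \<mu> j (snd z) = 0" if "z \<notin> K \<inter> {z. \<delta> j / 2 \<le> g (snd z)}" for z
  proof (cases "z \<in> K")
    case True
    then have "snd z \<in> ball x0 (r / 2)" using K(2) by (auto simp: slab_def)
    then show ?thesis using \<mu>zero[of "snd z" j] that True by simp
  qed (use K(3) in simp)
  ultimately show ?thesis
    unfolding test_on_def using smooth_mult[OF test_on_smooth[OF assms] smooth_layer] by blast
qed

lemma layer_gradient_integral:
  assumes T: "T > 0" and \<Omega>: "open \<Omega>" and \<psi>: "test_on (slab T (ball x0 (r / 2))) \<psi>" and B: "\<And>z. \<bar>\<psi> z\<bar> \<le> B"
  shows "(LINT z|lborel. indicator (slab T \<Omega>) z * (\<bar>\<psi> z\<bar> * norm (nabla (\<mu> j) (snd z)))) \<le> B * (T + 1) * C"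
    and "integrable lborel (\<lambda>z. indicator (slab T \<Omega>) z * (\<bar>\<psi> z\<bar> * norm (nabla (\<mu> j) (snd z))))"
proof -
  have B0: "B \<ge> 0" using B[of 0] by simp
  have nm[measurable]: "nabla (\<mu> j) \<in> borel_measurable borel" by (rule nabla_borel_measurable[OF \<mu>s])
  define S where "S = {x \<in> ball x0 (r / 2). 0 < g x}"
  have S[measurable]: "S \<in> sets borel" unfolding S_def by measurable
  have "bounded (nabla (\<mu> j) ` cball x0 (r / 2))"
    by (intro compact_imp_bounded compact_continuous_image continuous_on_nabla \<mu>s compact_cball)
  then obtain D where D: "D > 0" "\<And>y. y \<in> nabla (\<mu> j) ` cball x0 (r / 2) \<Longrightarrow> norm y \<le> D" unfolding bounded_pos by blast
  have D': "norm (nabla (\<mu> j) x) \<le> D" if "x \<in> ball x0 (r / 2)" for x using D(2)[OF imageI, of x] that by simp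
  have ip: "integrable lborel (\<lambda>x. indicator S x * norm (nabla (\<mu> j) x))"
  proof (rule integrable_bounded_support[OF _ bounded_ball[of x0 "r/2"], where B=D])
    show "norm (indicator S x * norm (nabla (\<mu> j) x)) \<le> D" for x
    proof (cases "x \<in> S")
      case True
      then have "x \<in> ball x0 (r / 2)" by (simp add: S_def)
      then show ?thesis using D'[of x] True by simp
    qed (use D(1) in simp)
  qed (simp_all add: S_def)
  obtain K where K: "compact K" "K \<subseteq> slab T (ball x0 (r / 2))" "\<And>z. z \<notin> K \<Longrightarrow> \<psi> z = 0" using test_onE[OF \<psi>] by blast
  have le: "indicator (slab T \<Omega>) z * (\<bar>\<psi> z\<bar> * norm (nabla (\<mu> j) (snd z)))
    \<le> B * (indicator {-1<..<T} (fst z) * (indicator S (snd z) * norm (nabla (\<mu> j) (snd z))))" for z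
  proof (cases "z \<in> slab T \<Omega> \<and> \<psi> z \<noteq> 0")
    case True
    then have "z \<in> slab T (ball x0 (r / 2))" using K by blast
    then have b: "fst z \<in> {-1<..<T}" "snd z \<in> ball x0 (r / 2)" by (auto simp: slab_def)
    then have "snd z \<in> S" using True in_domain[of "snd z"] r by (auto simp: S_def slab_def)
    then show ?thesis using True b B[of z] by (auto intro!: mult_right_mono)
  qed (use B0 in \<open>auto split: split_indicator\<close>)
  have m: "(\<lambda>z. indicator (slab T \<Omega>) z * (\<bar>\<psi> z\<bar> * norm (nabla (\<mu> j) (snd z)))) \<in> borel_measurable borel"
    using open_slab[OF \<Omega>, of T] measurable_of_second[of "\<lambda>x. norm (nabla (\<mu> j) x)", where 'd=real]
    by (intro borel_measurable_times borel_measurable_indicator borel_measurable_abs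
        smooth_borel_measurable[OF test_on_smooth[OF \<psi>]]) auto
  note sl = slab_integral_le[OF T ip m _ le]
  show "integrable lborel (\<lambda>z. indicator (slab T \<Omega>) z * (\<bar>\<psi> z\<bar> * norm (nabla (\<mu> j) (snd z))))"
    by (rule sl(1)) simp
  show "(LINT z|lborel. indicator (slab T \<Omega>) z * (\<bar>\<psi> z\<bar> * norm (nabla (\<mu> j) (snd z)))) \<le> B * (T + 1) * C"
    by (rule order_trans[OF sl(2)]) (use \<mu>int[of j] T B0 in \<open>auto simp: S_def intro!: mult_left_mono\<close>)
qed

end

section \<open>Doubling with a shift into the domain\<close>

context comparison
begin

text \<open>The values at \<open>\<Psi>\<close> times \<open>\<mu> j\<close> increase with
  \<open>j\<close> by \<open>LF_const_nonneg\<close>, and they are bounded because the layer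
  gradients are bounded in L^1. Hence they converge and their differences become small. The limit is
  a weak boundary value of the flux of \<open>c\<close> against \<open>v\<close>.\<close>

lemma mass_tail:
  assumes "chart_layers \<Omega> x0 r \<nu> g L \<mu> \<delta> C" and T: "T > 0"
    and \<Psi>: "test_on (slab T (ball x0 (r / 2))) \<Psi>" "\<And>z. 0 \<le> \<Psi> z" and "\<eta> > 0"
  obtains J where "\<And>j l. J \<le> j \<Longrightarrow> j \<le> l \<Longrightarrow>
    LF (\<lambda>_ _. c) v (\<lambda>z. \<Psi> z * (\<mu> l (snd z) - \<mu> j (snd z))) \<le> \<eta>"
proof -
  interpret chart_layers \<Omega> x0 r \<nu> g L \<mu> \<delta> C by fact
  define N where "N = max M \<bar>c\<bar>"
  have bs: "bseq N v" "bseq N (\<lambda>_ _. c)" by (auto simp: N_def intro: bseq_wv bseq_const)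
  define A where "A j = LF (\<lambda>_ _. c) v (\<lambda>z. \<Psi> z * \<mu> j (snd z))" for j
  have tst: "test_on Q (\<lambda>z. \<Psi> z * \<mu> j (snd z))" for j by (rule test_on_layer[OF \<Psi>(1)])
  have diff: "LF (\<lambda>_ _. c) v (\<lambda>z. \<Psi> z * (\<mu> l (snd z) - \<mu> j (snd z))) = A l - A j" for j l
    using LF_diff[OF bs(2,1) tst[of l] tst[of j]] by (simp add: A_def right_diff_distrib)
  obtain K where K: "compact K" "K \<subseteq> slab T (ball x0 (r / 2))" "\<And>z. z \<notin> K \<Longrightarrow> \<Psi> z = 0" using test_onE[OF \<Psi>(1)] by blast
  have "A j \<le> A l" if "j \<le> l" for j l
  proof -
    have "0 \<le> LF (\<lambda>_ _. c) v (\<lambda>z. \<Psi> z * \<mu> l (snd z) - \<Psi> z * \<mu> j (snd z))"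
    proof (rule LF_const_nonneg[OF test_on_diff[OF tst tst]])
      fix z
      show "0 \<le> \<Psi> z * \<mu> l (snd z) - \<Psi> z * \<mu> j (snd z)"
      proof (cases "z \<in> K")
        case True
        then have "snd z \<in> ball x0 (r / 2)" using K(2) by (auto simp: slab_def)
        then show ?thesis using \<mu>_mono[OF that] \<Psi>(2)[of z] by (simp add: mult_left_mono)
      qed (use K(3) in simp)
    qed
    then show ?thesis using diff[of l j] by (simp add: right_diff_distrib)
  qed
  then have inc: "incseq A" by (auto simp: incseq_def)
  obtain C0 where C0: "C0 \<ge> 0" "\<And>\<alpha> \<beta>. \<bar>\<alpha>\<bar> \<le> N \<Longrightarrow> \<bar>\<beta>\<bar> \<le> N \<Longrightarrow> norm (kflux f \<alpha> \<beta>) \<le> C0"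
    using kflux_bounded[OF f, of N] by blast
  obtain B where B: "B \<ge> 0" "\<And>z. \<bar>\<Psi> z\<bar> \<le> B" using test_on_bounded[OF \<Psi>(1)] by blast
  note i\<Psi> = norm_nabla_integrable[OF \<Psi>(1)]
  define I where "I = (LINT z|lborel. norm (nabla \<Psi> z))"
  have upper: "A j \<le> C0 * (I + B * (T + 1) * C)" for j
  proof -
    note lg = layer_gradient_integral[OF T op \<Psi>(1) B(2), of j]
    have "\<bar>A j\<bar> \<le> C0 * (LINT z|lborel. indicator Q z * norm (nabla (\<lambda>z. \<Psi> z * \<mu> j (snd z)) z))"
      unfolding A_def by (rule LF_bound[OF bs(2,1) tst]) (use C0 bseqD(2)[OF bs(1)] in \<open>auto simp: N_def\<close>)
    also have "\<dots> \<le> C0 * (LINT z|lborel. norm (nabla \<Psi> z) + indicator Q z * (\<bar>\<Psi> z\<bar> * norm (nabla (\<mu> j) (snd z))))"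
    proof (intro mult_left_mono C0 integral_mono')
      show "integrable lborel (\<lambda>z. norm (nabla \<Psi> z) + indicator Q z * (\<bar>\<Psi> z\<bar> * norm (nabla (\<mu> j) (snd z))))"
        using i\<Psi> lg(2) by (rule Bochner_Integration.integrable_add)
      fix z
      have "norm (nabla (\<lambda>z. \<Psi> z * \<mu> j (snd z)) z) \<le> \<bar>\<Psi> z\<bar> * norm (nabla (\<mu> j) (snd z)) + \<bar>\<mu> j (snd z)\<bar> * norm (nabla \<Psi> z)"
        unfolding nabla_mult[OF test_on_smooth[OF \<Psi>(1)] smooth_layer] nabla_layer
        by (rule order_trans[OF norm_triangle_ineq]) (simp add: norm_Pair)
      also have "\<bar>\<mu> j (snd z)\<bar> * norm (nabla \<Psi> z) \<le> 1 * norm (nabla \<Psi> z)"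
        using \<mu>0[of j "snd z"] \<mu>1[of j "snd z"] by (intro mult_right_mono) auto
      finally show "indicator Q z * norm (nabla (\<lambda>z. \<Psi> z * \<mu> j (snd z)) z) \<le> norm (nabla \<Psi> z) + indicator Q z * (\<bar>\<Psi> z\<bar> * norm (nabla (\<mu> j) (snd z)))"
        by (auto split: split_indicator)
      show "0 \<le> norm (nabla \<Psi> z) + indicator Q z * (\<bar>\<Psi> z\<bar> * norm (nabla (\<mu> j) (snd z)))" by simp
    qed
    also have "\<dots> \<le> C0 * (I + B * (T + 1) * C)"
      using lg i\<Psi> C0(1) by (intro mult_left_mono) (auto simp: I_def)
    finally show ?thesis by simp
  qed
  obtain a' where a': "A \<longlonglongrightarrow> a'" "\<And>i. A i \<le> a'" using incseq_convergent[OF inc] upper by blast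
  have "\<forall>\<^sub>F j in sequentially. a' - \<eta> < A j" using a'(1) \<open>\<eta> > 0\<close> by (intro order_tendstoD(1)) auto
  then obtain J where J: "\<And>j. j \<ge> J \<Longrightarrow> a' - \<eta> < A j" by (auto simp: eventually_sequentially)
  show thesis
  proof (rule that[of J])
    fix j l assume "J \<le> j" "j \<le> l"
    then show "LF (\<lambda>_ _. c) v (\<lambda>z. \<Psi> z * (\<mu> l (snd z) - \<mu> j (snd z))) \<le> \<eta>"
      unfolding diff using J[of j] a'(2)[of l] by linarith
  qed
qed

text \<open>The test function is concentrated where the height is below
  \<open>3 * \<delta> (Suc j)\<close>. A displacement by \<open>2 * L * \<epsilon>\<close> along
  \<open>\<nu>\<close> takes these points to the zone where \<open>\<mu> l\<close> is 1 and
  \<open>\<mu> j\<close> is still 0. The majorant can thus be built from the difference of two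
  layers, and by \<open>mass_tail\<close> its surplus is at most \<open>\<eta>\<close> however small
  the displacement is.\<close>

lemma upper_levels:
  assumes cl: "chart_layers \<Omega> x0 r \<nu> g L \<mu> \<delta> C" and T: "T > 0"
    and \<psi>: "test_on (slab T (ball x0 (r / 4))) \<psi>" "\<And>z. 0 \<le> \<psi> z"
    and adm: "\<And>z. z \<in> slab T (- \<Omega>) \<Longrightarrow> \<psi> z \<noteq> 0 \<Longrightarrow> a z \<le> c" and "\<eta> > 0"
  obtains J where "\<And>j. J \<le> j \<Longrightarrow>
    - \<eta> \<le> LF (\<lambda>n z. max (w n z) c) (\<lambda>n z. max (v n z) c) (\<lambda>z. \<psi> z * (1 - \<mu> j (snd z)))"
proof -
  interpret chart_layers \<Omega> x0 r \<nu> g L \<mu> \<delta> C by fact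
  define N where "N = max M \<bar>c\<bar>"
  have bs: "bseq N v" "bseq N (\<lambda>_ _. c)" by (auto simp: N_def intro: bseq_wv bseq_const)
  have sl: "slab T (ball x0 (r / 4)) \<subseteq> slab T (ball x0 (r / 2))" using r by (auto simp: slab_def)
  obtain K where K: "compact K" "K \<subseteq> slab T (ball x0 (r / 4))" "\<And>z. z \<notin> K \<Longrightarrow> \<psi> z = 0" using test_onE[OF \<psi>(1)] by blast
  have K': "K \<subseteq> slab T (ball x0 (r / 2))" using K(2) sl by blast
  obtain B where B: "B \<ge> 0" "\<And>z. \<bar>\<psi> z\<bar> \<le> B" using test_on_bounded[OF \<psi>(1)] by blast
  obtain \<Psi> V where \<Psi>: "test_on (slab T (ball x0 (r / 2))) \<Psi>" "\<And>z. 0 \<le> \<Psi> z" "\<And>z. \<Psi> z \<le> 1" "open V" "K \<subseteq> V" "\<And>z. z \<in> V \<Longrightarrow> \<Psi> z = 1"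
    using ex_cutoff[OF K(1) open_slab[OF open_ball] K'] by blast
  obtain K\<Psi> where K\<Psi>: "compact K\<Psi>" "K\<Psi> \<subseteq> slab T (ball x0 (r / 2))" "\<And>z. z \<notin> K\<Psi> \<Longrightarrow> \<Psi> z = 0" using test_onE[OF \<Psi>(1)] by blast
  obtain d where d: "d > 0" "(\<Union>x\<in>K. ball x d) \<subseteq> V"
    using compact_subset_open_imp_ball_epsilon_subset[OF K(1) \<Psi>(4,5)] by blast
  define \<eta>' where "\<eta>' = \<eta> / (B + 1)"
  have \<eta>': "\<eta>' > 0" using B(1) \<open>\<eta> > 0\<close> by (simp add: \<eta>'_def)
  obtain J where J: "\<And>j l. J \<le> j \<Longrightarrow> j \<le> l \<Longrightarrow>
    LF (\<lambda>_ _. c) v (\<lambda>z. \<Psi> z * (\<mu> l (snd z) - \<mu> j (snd z))) \<le> \<eta>'"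
    using mass_tail[OF cl T \<Psi>(1,2) \<eta>'] by blast
  have main: "- \<eta> \<le> LF (\<lambda>n z. max (w n z) c) (\<lambda>n z. max (v n z) c) (\<lambda>z. \<psi> z * (1 - \<mu> (Suc j) (snd z)))" if "J \<le> j" for j
  proof (rule doubling_limit)
    have "slab T (ball x0 (r / 4)) \<subseteq> slab T UNIV" by (rule slab_mono)
    then show "test_on (slab T UNIV) (\<lambda>z. \<psi> z * (1 - \<mu> (Suc j) (snd z)))"
      by (intro test_on_mult(2)[OF test_on_mono[OF \<psi>(1)]] smooth_diff smooth_const smooth_layer)
    show "0 \<le> \<psi> z * (1 - \<mu> (Suc j) (snd z))" for z using \<psi>(2)[of z] \<mu>1[of "Suc j" "snd z"] by simp
    show "a z \<le> c" if "z \<in> slab T (- \<Omega>)" "\<psi> z * (1 - \<mu> (Suc j) (snd z)) \<noteq> 0" for z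
      using adm[OF that(1)] that(2) by auto
    fix rr :: real assume rr: "rr > 0"
    \<comment> \<open>All limits on the displacement together: the chart, the prescribed radius, the
      thickness of the layer, and the distance over which \<open>\<Psi>\<close> keeps the value
      1.\<close>
    define m where "m = min (min r rr) (min (\<delta> (Suc j)) d)"
    have m: "m > 0" "m \<le> r" "m \<le> rr" "m \<le> \<delta> (Suc j)" "m \<le> d" using r rr d \<delta>0[of "Suc j"] by (auto simp: m_def)
    define \<epsilon> where "\<epsilon> = m / (8 * L + 8)"
    have \<epsilon>: "\<epsilon> > 0" "(2 * L + 1) * \<epsilon> < m / 4" "3 * L * \<epsilon> \<le> m"
    proof -
      show e: "\<epsilon> > 0" using m L by (simp add: \<epsilon>_def)
      have "(8 * L + 8) * \<epsilon> = m" using L by (simp add: \<epsilon>_def)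
      then have "8 * (L * \<epsilon>) + 8 * \<epsilon> = m" by (simp add: algebra_simps)
      moreover have "L * \<epsilon> > 0" using L e by simp
      ultimately show "(2 * L + 1) * \<epsilon> < m / 4" "3 * L * \<epsilon> \<le> m" using e by (auto simp: algebra_simps)
    qed
    \<comment> \<open>The kernel is evaluated at the difference of first and second point, so the
      second point lies near the first one minus \<open>e0\<close>, that is, deeper inside. The
      radius \<open>\<epsilon>\<close> of the kernel can spoil at most
      \<open>L * \<epsilon>\<close>, half of the gain in height.\<close>
    define e0 where "e0 = - (2 * L * \<epsilon>) *\<^sub>R \<nu>"
    have ne0: "norm e0 = 2 * L * \<epsilon>" using L \<epsilon>(1) \<nu> by (simp add: e0_def abs_mult)
    have "L * \<epsilon> > 0" using L \<epsilon>(1) by simp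
    then have "\<forall>\<^sub>F l in sequentially. \<delta> l < L * \<epsilon> / 3" using \<delta>lim by (intro order_tendstoD(2)) auto
    then obtain l0 where l0: "\<And>l. l \<ge> l0 \<Longrightarrow> \<delta> l < L * \<epsilon> / 3" by (auto simp: eventually_sequentially)
    \<comment> \<open>So large that \<open>3 * \<delta> l\<close> is below
      \<open>L * \<epsilon>\<close>, the least height of a displaced point. The index
      \<open>l\<close> depends on the displacement, whereas \<open>j\<close> does not.\<close>
    define l where "l = max l0 j"
    have l: "\<delta> l < L * \<epsilon> / 3" "j \<le> l" using l0[of l] by (auto simp: l_def)
    define \<theta> where "\<theta> z = B * (\<Psi> z * (\<mu> l (snd z) - \<mu> j (snd z)))" for z
    have td: "test_on Q (\<lambda>z. \<Psi> z * (\<mu> l (snd z) - \<mu> j (snd z)))"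
      using test_on_diff[OF test_on_layer[OF \<Psi>(1), of l] test_on_layer[OF \<Psi>(1), of j]] by (simp add: right_diff_distrib)
    have \<theta>0: "0 \<le> \<theta> z" for z
    proof (cases "z \<in> K\<Psi>")
      case True
      then have "snd z \<in> ball x0 (r / 2)" using K\<Psi>(2) by (auto simp: slab_def)
      then show ?thesis using \<mu>_mono[OF l(2)] \<Psi>(2)[of z] B(1) by (simp add: \<theta>_def)
    qed (use K\<Psi>(3) in \<open>simp add: \<theta>_def\<close>)
    have L\<theta>: "LF (\<lambda>_ _. c) v \<theta> \<le> \<eta>"
    proof -
      have "LF (\<lambda>_ _. c) v \<theta> = B * LF (\<lambda>_ _. c) v (\<lambda>z. \<Psi> z * (\<mu> l (snd z) - \<mu> j (snd z)))"
        unfolding \<theta>_def by (rule LF_scale[OF bs(2,1) td])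
      also have "\<dots> \<le> B * \<eta>'" using J[OF \<open>J \<le> j\<close> l(2)] B(1) by (rule mult_left_mono)
      also have "\<dots> \<le> \<eta>" using B(1) \<open>\<eta> > 0\<close> by (simp add: \<eta>'_def divide_simps)
      finally show ?thesis .
    qed
    have inside: "y \<in> Q \<and> y \<in> K\<Psi> \<and> \<psi> z * (1 - \<mu> (Suc j) (snd z)) \<le> \<theta> y"
      if z: "z \<in> Q" and nz: "\<psi> z * (1 - \<mu> (Suc j) (snd z)) \<noteq> 0" and t: "\<bar>fst z - fst y\<bar> < d / 2" and x: "snd z - snd y \<in> ball e0 \<epsilon>" for z y
    proof -
      have zK: "z \<in> K" by (rule ccontr) (use nz K(3)[of z] in simp)
      define x' where "x' = snd z" define y' where "y' = snd y"
      have x'4: "x' \<in> ball x0 (r / 4)" using zK K(2) by (auto simp: slab_def x'_def)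
      have x'\<Omega>: "x' \<in> \<Omega>" using z by (auto simp: slab_def x'_def)
      have x'2: "x' \<in> ball x0 (r / 2)" "x' \<in> ball x0 r" using x'4 r by auto
      have g0: "0 < g x'" using in_domain[OF x'2(2)] x'\<Omega> by simp
      have g3: "g x' < 3 * \<delta> (Suc j)"
      proof (rule ccontr)
        assume "\<not> ?thesis"
        then have "\<mu> (Suc j) x' = 1" using \<mu>one[OF x'2(1), of "Suc j"] by simp
        then show False using nz by (simp add: x'_def)
      qed
      have en: "norm (x' - y' - e0) < \<epsilon>" using x by (simp add: x'_def y'_def dist_norm norm_minus_commute)
      have xy: "norm (x' - y') < m / 4"
        using en ne0 \<epsilon>(2) norm_triangle_ineq[of "x' - y' - e0" e0] by (simp add: algebra_simps)
      have y'2: "y' \<in> ball x0 (r / 2)"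
        using x'4 xy m(2) dist_triangle[of x0 y' x'] by (simp add: dist_norm)
      have y'r: "y' \<in> ball x0 r" using y'2 r by auto
      define p where "p = x' + (2 * L * \<epsilon>) *\<^sub>R \<nu>"
      have "norm (p - x') = 2 * L * \<epsilon>" using L \<epsilon>(1) \<nu> by (simp add: p_def abs_mult)
      moreover have "2 * L * \<epsilon> < r / 4" using \<epsilon>(1,2) m(2) by (simp add: algebra_simps)
      ultimately have pr: "p \<in> ball x0 r"
        using x'4 r dist_triangle[of x0 p x'] by (simp add: dist_norm norm_minus_commute)
      have gp: "g p = g x' + 2 * L * \<epsilon>" unfolding p_def by (rule gs)
      have "norm (p - y') < \<epsilon>" using en by (simp add: p_def e0_def algebra_simps)
      then have "\<bar>g p - g y'\<bar> \<le> L * \<epsilon>" using gL[OF pr y'r] mult_left_mono[of "norm (p - y')" \<epsilon> L] L by linarith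
      then have gy: "L * \<epsilon> < g y'" "g y' \<le> g x' + 3 * L * \<epsilon>" using gp g0 by linarith+
      have m1: "\<mu> l y' = 1" using \<mu>one[OF y'2, of l] l(1) gy(1) by linarith
      \<comment> \<open>Here the use of \<open>Suc j\<close> pays off: the height is below
        \<open>4 * \<delta> (Suc j)\<close>, a quarter of \<open>\<delta> j\<close>.\<close>
      have "g y' \<le> \<delta> j / 2" using gy(2) g3 \<epsilon>(3) m(4) \<delta>Suc[of j] \<delta>0[of j] by linarith
      then have m0: "\<mu> j y' = 0" using \<mu>zero[OF y'2] by simp
      have "dist z y \<le> norm (fst (z - y)) + norm (snd (z - y))"
        unfolding dist_norm using norm_Pair_le[of "fst (z - y)" "snd (z - y)"] unfolding prod.collapse .
      also have "\<dots> < d" using t xy m(5) d(1) by (simp add: x'_def y'_def)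
      finally have "y \<in> ball z d" by simp
      then have "y \<in> V" using d(2) zK by blast
      then have \<Psi>y: "\<Psi> y = 1" by (rule \<Psi>(6))
      then have yK: "y \<in> K\<Psi>" using K\<Psi>(3)[of y] by auto
      have "y' \<in> \<Omega>" using in_domain[OF y'r] gy(1) \<open>L * \<epsilon> > 0\<close> by simp
      then have "y \<in> Q" using yK K\<Psi>(2) by (auto simp: slab_def y'_def)
      moreover have "\<psi> z * (1 - \<mu> (Suc j) (snd z)) \<le> B * 1"
        by (intro mult_mono) (use B(1) B(2)[of z] \<mu>0[of "Suc j" "snd z"] \<mu>1[of "Suc j" "snd z"] in auto)
      moreover have "\<theta> y = B" using \<Psi>y m0 m1 by (simp add: \<theta>_def y'_def)
      ultimately show ?thesis using yK by simp
    qed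
    show "inward c (\<lambda>z. \<psi> z * (1 - \<mu> (Suc j) (snd z))) \<eta> rr"
      unfolding inward_def
    proof (intro exI conjI)
      show "0 < \<epsilon>" "0 < d / 2" "compact K\<Psi>" using \<epsilon> d K\<Psi> by auto
      show "ball e0 \<epsilon> \<subseteq> ball 0 rr"
      proof
        fix x assume "x \<in> ball e0 \<epsilon>"
        then have "norm (x - e0) < \<epsilon>" by (simp add: dist_norm norm_minus_commute)
        then have "norm x < \<epsilon> + 2 * L * \<epsilon>" using ne0 norm_triangle_ineq[of "x - e0" e0] by simp
        then show "x \<in> ball 0 rr" using \<epsilon>(2) m(1,3) by (simp add: algebra_simps)
      qed
      show "K\<Psi> \<subseteq> slab T UNIV" using K\<Psi>(2) by (auto simp: slab_def)
      show "test_on Q \<theta>" unfolding \<theta>_def by (rule test_on_mult(1)[OF td smooth_const])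
      show "\<forall>y. 0 \<le> \<theta> y" using \<theta>0 by blast
      show "LF (\<lambda>_ _. c) v \<theta> \<le> \<eta>" by (rule L\<theta>)
      show "\<forall>z y. z \<in> Q \<longrightarrow> \<psi> z * (1 - \<mu> (Suc j) (snd z)) \<noteq> 0 \<longrightarrow> \<bar>fst z - fst y\<bar> < d / 2 \<longrightarrow> snd z - snd y \<in> ball e0 \<epsilon> \<longrightarrow>
        y \<in> Q \<and> y \<in> K\<Psi> \<and> \<psi> z * (1 - \<mu> (Suc j) (snd z)) \<le> \<theta> y" using inside by blast
    qed
  qed
  show thesis
  proof (rule that[of "Suc J"])
    fix j assume "Suc J \<le> j"
    then obtain i where "j = Suc i" "J \<le> i" by (cases j) auto
    then show "- \<eta> \<le> LF (\<lambda>n z. max (w n z) c) (\<lambda>n z. max (v n z) c) (\<lambda>z. \<psi> z * (1 - \<mu> j (snd z)))"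
      using main[of i] by simp
  qed
qed

lemma comparison_reflect: "comparison T \<Omega> (\<lambda>s. - f (- s)) (\<lambda>z. - a z) M F (\<lambda>n z. - v n z) (\<lambda>n z. - w n z)"
proof (intro comparison.intro comparison_axioms.intro semi_pair_reflect F)
  show "(\<forall>n. (\<lambda>z. - v n z) = (\<lambda>z. - v 0 z)) \<or> (\<forall>n. (\<lambda>z. - w n z) = (\<lambda>z. - w 0 z))"
    using const
  proof
    assume "\<forall>n. w n = w 0"
    then have "(\<lambda>z. - w n z) = (\<lambda>z. - w 0 z)" for n by metis
    then show ?thesis by blast
  next
    assume "\<forall>n. v n = v 0"
    then have "(\<lambda>z. - v n z) = (\<lambda>z. - v 0 z)" for n by metis
    then show ?thesis by blast
  qed
qed (rule conv)

text \<open>This is \<open>upper_levels\<close> for the reflected problem, in which \<open>w\<close>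
  and \<open>v\<close> exchange their roles and \<open>max\<close> becomes
  \<open>min\<close>.\<close>

lemma lower_levels:
  assumes cl: "chart_layers \<Omega> x0 r \<nu> g L \<mu> \<delta> C" and T: "T > 0"
    and \<psi>: "test_on (slab T (ball x0 (r / 4))) \<psi>" "\<And>z. 0 \<le> \<psi> z"
    and adm: "\<And>z. z \<in> slab T (- \<Omega>) \<Longrightarrow> \<psi> z \<noteq> 0 \<Longrightarrow> c \<le> a z" and "\<eta> > 0"
  obtains J where "\<And>j. J \<le> j \<Longrightarrow>
    - \<eta> \<le> LF (\<lambda>n z. min (w n z) c) (\<lambda>n z. min (v n z) c) (\<lambda>z. \<psi> z * (1 - \<mu> j (snd z)))"
proof -
  interpret R: comparison T \<Omega> "\<lambda>s. - f (- s)" "\<lambda>z. - a z" M F "\<lambda>n z. - v n z" "\<lambda>n z. - w n z"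
    by (rule comparison_reflect)
  have adm': "- a z \<le> - c" if "z \<in> slab T (- \<Omega>)" "\<psi> z \<noteq> 0" for z using adm[OF that] by simp
  obtain J where J: "\<And>j. J \<le> j \<Longrightarrow>
    - \<eta> \<le> R.LF (\<lambda>n z. max (- v n z) (- c)) (\<lambda>n z. max (- w n z) (- c)) (\<lambda>z. \<psi> z * (1 - \<mu> j (snd z)))"
    using R.upper_levels[OF cl T \<psi> adm' \<open>\<eta> > 0\<close>] by blast
  have mm: "max (- x) (- y) = - min x y" for x y :: real by auto
  have eq: "R.LF (\<lambda>n z. max (- v n z) (- c)) (\<lambda>n z. max (- w n z) (- c)) \<phi> = LF (\<lambda>n z. min (w n z) c) (\<lambda>n z. min (v n z) c) \<phi>" for \<phi>
    unfolding R.LF_def LF_def mm by (simp only: flux_int_reflect[of _ f])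
  show thesis by (rule that[of J]) (rule J[unfolded eq])
qed

end

text \<open>One half of the product rule for \<open>\<psi>\<close> times (1 minus
  \<open>\<mu> j\<close>). It is supported in a layer of measure of order \<open>\<delta> j\<close>
  and so tends to 0 for fixed \<open>\<psi>\<close>, while the other half, with the gradient of
  \<open>\<mu> j\<close>, is only bounded.\<close>

lemma (in chart_layers) layer_slab_integral:
  assumes T: "T > 0" and \<Omega>: "open \<Omega>" and \<psi>: "test_on (slab T (ball x0 (r / 2))) \<psi>" and D: "\<And>z. norm (nabla \<psi> z) \<le> D"
  shows "(LINT z|lborel. indicator (slab T \<Omega>) z * ((1 - \<mu> j (snd z)) * norm (nabla \<psi> z))) \<le> D * (T + 1) * C * \<delta> j"
    and "integrable lborel (\<lambda>z. indicator (slab T \<Omega>) z * ((1 - \<mu> j (snd z)) * norm (nabla \<psi> z)))"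
proof -
  have D0: "D \<ge> 0" using D[of 0] norm_ge_zero order_trans by blast
  define S where "S = {x \<in> ball x0 (r / 2). 0 < g x \<and> g x \<le> 3 * \<delta> j}"
  have S: "S \<in> sets borel" "bounded S" unfolding S_def by (measurable, auto intro: bounded_subset[OF bounded_ball[of x0 "r/2"]])
  have iS: "integrable lborel (indicator S :: 'a \<Rightarrow> real)"
    by (rule integrable_bounded_support[OF _ S(2), where B=1]) (use S(1) in \<open>auto split: split_indicator\<close>)
  obtain K where K: "compact K" "K \<subseteq> slab T (ball x0 (r / 2))" "\<And>z. z \<notin> K \<Longrightarrow> \<psi> z = 0" using test_onE[OF \<psi>] by blast
  have le: "indicator (slab T \<Omega>) z * ((1 - \<mu> j (snd z)) * norm (nabla \<psi> z)) \<le> D * (indicator {-1<..<T} (fst z) * indicator S (snd z))" for z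
  proof (cases "z \<in> slab T \<Omega> \<and> nabla \<psi> z \<noteq> 0 \<and> \<mu> j (snd z) \<noteq> 1")
    case True
    then have "z \<in> K" using nabla_eq_0_outside[of K \<psi> z, OF compact_imp_closed[OF K(1)] K(3)] by blast
    then have b: "fst z \<in> {-1<..<T}" "snd z \<in> ball x0 (r / 2)" using K(2) by (auto simp: slab_def)
    then have "0 < g (snd z)" using True in_domain[of "snd z"] r by (auto simp: slab_def)
    moreover have "g (snd z) \<le> 3 * \<delta> j" using \<mu>one[OF b(2), of j] True by linarith
    ultimately have "snd z \<in> S" using b(2) by (simp add: S_def)
    moreover have "(1 - \<mu> j (snd z)) * norm (nabla \<psi> z) \<le> 1 * D"
      using \<mu>0[of j "snd z"] \<mu>1[of j "snd z"] D by (intro mult_mono) auto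
    ultimately show ?thesis using True b by simp
  qed (use D0 in \<open>auto split: split_indicator\<close>)
  have sm: "smooth (\<lambda>z :: real \<times> 'a. 1 - \<mu> j (snd z))" by (intro smooth_diff smooth_const smooth_layer)
  have m: "(\<lambda>z. indicator (slab T \<Omega>) z * ((1 - \<mu> j (snd z)) * norm (nabla \<psi> z))) \<in> borel_measurable borel"
    using open_slab[OF \<Omega>, of T] smooth_borel_measurable[OF sm] nabla_borel_measurable[OF test_on_smooth[OF \<psi>]]
    by (intro borel_measurable_times borel_measurable_indicator) auto
  have nn: "0 \<le> indicator (slab T \<Omega>) z * ((1 - \<mu> j (snd z)) * norm (nabla \<psi> z))" for z using \<mu>1[of j "snd z"] by simp
  note sl = slab_integral_le[OF T iS m nn le]
  show "integrable lborel (\<lambda>z. indicator (slab T \<Omega>) z * ((1 - \<mu> j (snd z)) * norm (nabla \<psi> z)))" by (rule sl(1))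
  have "D * (T + 1) * measure lborel S \<le> D * (T + 1) * (C * \<delta> j)" using \<mu>meas[of j] T D0 unfolding S_def by (intro mult_left_mono) auto
  then show "(LINT z|lborel. indicator (slab T \<Omega>) z * ((1 - \<mu> j (snd z)) * norm (nabla \<psi> z))) \<le> D * (T + 1) * C * \<delta> j"
    using sl(2) by (simp add: mult.assoc)
qed

locale comparison_boundary = comparison +
  assumes T: "T > 0" and ac: "continuous_on (slab T UNIV) a" and ab: "\<And>z. z \<in> slab T UNIV \<Longrightarrow> \<bar>a z\<bar> \<le> M"
    and chart: "\<And>x0. x0 \<in> frontier \<Omega> \<Longrightarrow> \<exists>r \<nu> g L. Lipschitz_chart \<Omega> x0 r \<nu> g L"
begin

text \<open>The pointwise splitting of the flux passes to the limit because each of the three parts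
  has a limit along \<open>F\<close>.\<close>

lemma LF_three_levels:
  assumes "test_on S \<phi>" "l \<le> u"
  shows "LF w v \<phi> = LF (\<lambda>n z. max (w n z) u) (\<lambda>n z. max (v n z) u) \<phi>
    + LF (\<lambda>n z. min (w n z) l) (\<lambda>n z. min (v n z) l) \<phi>
    + LF (\<lambda>n z. max l (min (w n z) u)) (\<lambda>n z. max l (min (v n z) u)) \<phi>"
proof -
  define N where "N = max M (max \<bar>u\<bar> \<bar>l\<bar>)"
  have c: "bseq N (\<lambda>_ _. u)" "bseq N (\<lambda>_ _. l)" "bseq N w" "bseq N v" by (auto simp: N_def intro: bseq_wv bseq_const)
  note b = bseq_max[OF c(3,1)] bseq_max[OF c(4,1)] bseq_min[OF c(3,2)] bseq_min[OF c(4,2)]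
    bseq_max[OF c(2) bseq_min[OF c(3,1)]] bseq_max[OF c(2) bseq_min[OF c(4,1)]]
  note int = flux_integrand_integrable[OF f Q_borel(1) _ _ _ _ assms(1)]
  have "flux_int Q f (w n) (v n) \<phi> = flux_int Q f (\<lambda>z. max (w n z) u) (\<lambda>z. max (v n z) u) \<phi>
    + flux_int Q f (\<lambda>z. min (w n z) l) (\<lambda>z. min (v n z) l) \<phi>
    + flux_int Q f (\<lambda>z. max l (min (w n z) u)) (\<lambda>z. max l (min (v n z) u)) \<phi>" for n
  proof -
    have i1: "integrable lborel (\<lambda>z. indicator Q z * (kflux f (max (w n z) u) (max (v n z) u) \<bullet> switched (fst z) (nabla \<phi> z)))"
      by (rule int[OF bseqD(1)[OF b(1)] bseqD(1)[OF b(2)] bseqD(2)[OF b(1)] bseqD(2)[OF b(2)]])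
    have i2: "integrable lborel (\<lambda>z. indicator Q z * (kflux f (min (w n z) l) (min (v n z) l) \<bullet> switched (fst z) (nabla \<phi> z)))"
      by (rule int[OF bseqD(1)[OF b(3)] bseqD(1)[OF b(4)] bseqD(2)[OF b(3)] bseqD(2)[OF b(4)]])
    have i3: "integrable lborel (\<lambda>z. indicator Q z * (kflux f (max l (min (w n z) u)) (max l (min (v n z) u)) \<bullet> switched (fst z) (nabla \<phi> z)))"
      by (rule int[OF bseqD(1)[OF b(5)] bseqD(1)[OF b(6)] bseqD(2)[OF b(5)] bseqD(2)[OF b(6)]])
    show ?thesis
      unfolding flux_int_def Bochner_Integration.integral_add[OF i1 i2, symmetric]
        Bochner_Integration.integral_add[OF Bochner_Integration.integrable_add[OF i1 i2] i3, symmetric]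
      by (intro Bochner_Integration.integral_cong refl)
        (simp only: kflux_three_levels[OF assms(2), of f "w n _" "v n _"] inner_add_left distrib_left)
  qed
  then have "((\<lambda>n. flux_int Q f (w n) (v n) \<phi>) \<longlongrightarrow> LF (\<lambda>n z. max (w n z) u) (\<lambda>n z. max (v n z) u) \<phi>
    + LF (\<lambda>n z. min (w n z) l) (\<lambda>n z. min (v n z) l) \<phi>
    + LF (\<lambda>n z. max l (min (w n z) u)) (\<lambda>n z. max l (min (v n z) u)) \<phi>) F"
    using tendsto_add[OF tendsto_add[OF LF_tendsto[OF b(1,2) assms(1)] LF_tendsto[OF b(3,4) assms(1)]] LF_tendsto[OF b(5,6) assms(1)]]
    by simp
  from tendsto_Lim[OF F this] show ?thesis unfolding LF_def[of w v] .
qed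

text \<open>On each piece of a partition the datum varies by less than \<open>\<tau>\<close>, and
  \<open>u\<close>, \<open>l\<close> are levels just above and below it. The outer parts are
  nonnegative up to \<open>\<eta>'\<close>. The middle part takes values in an interval of length
  \<open>\<tau>\<close>, so its flux is at most \<open>2 * \<eta>\<close>, multiplied by the L^1
  norm of a gradient. The delicate point is to bound the sum of these norms independently of the
  partition, which itself depends on \<open>\<eta>\<close>.\<close>

lemma LF_boundary_nonneg:
  assumes cl: "chart_layers \<Omega> x0 r \<nu> g L \<mu> \<delta> C"
    and \<phi>: "test_on (slab T (ball x0 (r / 4))) \<phi>" "\<And>z. 0 \<le> \<phi> z"
  shows "0 \<le> LF w v \<phi>"
proof -
  interpret chart_layers \<Omega> x0 r \<nu> g L \<mu> \<delta> C by fact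
  define V where "V = slab T (ball x0 (r / 4))"
  have V: "open V" unfolding V_def by (rule open_slab[OF open_ball])
  have sl: "V \<subseteq> slab T (ball x0 (r / 2))" "V \<subseteq> slab T UNIV" using r by (auto simp: slab_def V_def)
  obtain B where B: "B \<ge> 0" "\<And>z. \<bar>\<phi> z\<bar> \<le> B" using test_on_bounded[OF \<phi>(1)] by blast
  have bs: "bseq M w" "bseq M v" by (auto intro: bseq_wv)
  have main: "- (2 * \<eta> + 2 * \<eta> * (1 + B * (T + 1) * C)) \<le> LF w v \<phi>" if \<eta>: "\<eta> > 0" for \<eta>
  proof -
    obtain C1 where C1: "C1 \<ge> 0" "\<And>\<alpha> \<beta> \<alpha>' \<beta>'. \<bar>\<alpha>\<bar> \<le> M + 1 \<Longrightarrow> \<bar>\<beta>\<bar> \<le> M + 1 \<Longrightarrow> \<bar>\<alpha>'\<bar> \<le> M + 1 \<Longrightarrow> \<bar>\<beta>'\<bar> \<le> M + 1 \<Longrightarrow>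
        norm (kflux f \<alpha> \<beta> - kflux f \<alpha>' \<beta>') \<le> \<eta> + C1 * (\<bar>\<alpha> - \<alpha>'\<bar> + \<bar>\<beta> - \<beta>'\<bar>)"
      using kflux_quasi_Lipschitz[OF f \<eta>, of "M + 1"] by blast
    define \<tau> where "\<tau> = min 1 (\<eta> / (C1 + 1))"
    have \<tau>: "\<tau> > 0" "\<tau> \<le> 1" "C1 * \<tau> \<le> \<eta>"
    proof -
      show "\<tau> > 0" "\<tau> \<le> 1" using \<eta> C1(1) by (auto simp: \<tau>_def)
      have "C1 * \<tau> \<le> C1 * (\<eta> / (C1 + 1))" using C1(1) by (intro mult_left_mono) (auto simp: \<tau>_def)
      also have "\<dots> \<le> \<eta>" using C1(1) \<eta> by (simp add: divide_simps)
      finally show "C1 * \<tau> \<le> \<eta>" .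
    qed
    define W where "W p = slab T UNIV \<inter> a -` ball (a p) (\<tau> / 2)" for p
    have W: "open (W p)" "p \<in> W p" if "p \<in> V" for p
    proof -
      have "open (a -` ball (a p) (\<tau> / 2) \<inter> slab T UNIV)"
        using ac open_ball unfolding continuous_on_open_vimage[OF open_slab[OF open_UNIV]] by blast
      then show "open (W p)" unfolding W_def by (simp add: Int_commute)
      show "p \<in> W p" using that sl(2) \<tau>(1) by (auto simp: W_def)
    qed
    have P: "\<exists>(n :: nat) \<psi> p. (\<forall>i<n. p i \<in> V \<and> test_on (V \<inter> W (p i)) (\<psi> i)) \<and>
        (\<forall>i z. 0 \<le> \<psi> i z) \<and> (\<forall>z. \<phi> z = (\<Sum>i<n. \<psi> i z))"
      by (rule ex_partition[OF \<phi>(1)[folded V_def] \<phi>(2) V]) (use W in auto)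
    obtain n :: nat and \<psi> p where part0: "\<forall>i<n. p i \<in> V \<and> test_on (V \<inter> W (p i)) (\<psi> i)"
      "\<forall>i z. 0 \<le> \<psi> i z" "\<forall>z. \<phi> z = (\<Sum>i<n. \<psi> i z)"
      using P by (elim exE conjE) (rule that)
    have part: "\<And>i. i < n \<Longrightarrow> p i \<in> V" "\<And>i. i < n \<Longrightarrow> test_on (V \<inter> W (p i)) (\<psi> i)"
      "\<And>i z. 0 \<le> \<psi> i z" "\<And>z. \<phi> z = (\<Sum>i<n. \<psi> i z)"
      using part0(1) spec[OF spec[OF part0(2)]] spec[OF part0(3)] by simp_all
    have \<psi>V: "test_on (slab T (ball x0 (r / 4))) (\<psi> i)" if "i < n" for i
      using test_on_mono[OF part(2)[OF that]] unfolding V_def by blast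
    have \<psi>2: "test_on (slab T (ball x0 (r / 2))) (\<psi> i)" if "i < n" for i
      using test_on_mono[OF \<psi>V[OF that]] sl(1) unfolding V_def by blast
    have osc: "a (p i) - \<tau> / 2 \<le> a z \<and> a z \<le> a (p i) + \<tau> / 2" if i: "i < n" and nz: "\<psi> i z \<noteq> 0" for i z
    proof -
      obtain K where K: "compact K" "K \<subseteq> V \<inter> W (p i)" "\<And>z. z \<notin> K \<Longrightarrow> \<psi> i z = 0" using test_onE[OF part(2)[OF i]] by blast
      have "z \<in> K" using K(3)[of z] nz by blast
      then have "z \<in> W (p i)" using K(2) by blast
      then have "\<bar>a (p i) - a z\<bar> < \<tau> / 2" by (auto simp: W_def dist_real_def)
      then show ?thesis by linarith
    qed
    define \<eta>' where "\<eta>' = \<eta> / (real n + 1)"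
    have \<eta>': "\<eta>' > 0" using \<eta> by (simp add: \<eta>'_def)
    define u l where "u i = a (p i) + \<tau> / 2" and "l i = a (p i) - \<tau> / 2" for i
    have "\<exists>J. \<forall>j\<ge>J. - \<eta>' \<le> LF (\<lambda>n z. max (w n z) (u i)) (\<lambda>n z. max (v n z) (u i)) (\<lambda>z. \<psi> i z * (1 - \<mu> j (snd z))) \<and>
        - \<eta>' \<le> LF (\<lambda>n z. min (w n z) (l i)) (\<lambda>n z. min (v n z) (l i)) (\<lambda>z. \<psi> i z * (1 - \<mu> j (snd z)))" if i: "i < n" for i
    proof -
      have "a z \<le> u i" "l i \<le> a z" if "z \<in> slab T (- \<Omega>)" "\<psi> i z \<noteq> 0" for z
        using osc[OF i that(2)] by (auto simp: u_def l_def)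
      note adm = this
      obtain J1 where J1: "\<And>j. J1 \<le> j \<Longrightarrow> - \<eta>' \<le> LF (\<lambda>n z. max (w n z) (u i)) (\<lambda>n z. max (v n z) (u i)) (\<lambda>z. \<psi> i z * (1 - \<mu> j (snd z)))"
        using upper_levels[OF cl T \<psi>V[OF i] part(3) adm(1) \<eta>'] by blast
      obtain J2 where J2: "\<And>j. J2 \<le> j \<Longrightarrow> - \<eta>' \<le> LF (\<lambda>n z. min (w n z) (l i)) (\<lambda>n z. min (v n z) (l i)) (\<lambda>z. \<psi> i z * (1 - \<mu> j (snd z)))"
        using lower_levels[OF cl T \<psi>V[OF i] part(3) adm(2) \<eta>'] by blast
      show ?thesis using J1 J2 by (intro exI[of _ "max J1 J2"]) auto
    qed
    then have "\<forall>i\<in>{..<n}. \<exists>J. \<forall>j\<ge>J. - \<eta>' \<le> LF (\<lambda>n z. max (w n z) (u i)) (\<lambda>n z. max (v n z) (u i)) (\<lambda>z. \<psi> i z * (1 - \<mu> j (snd z))) \<and>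
        - \<eta>' \<le> LF (\<lambda>n z. min (w n z) (l i)) (\<lambda>n z. min (v n z) (l i)) (\<lambda>z. \<psi> i z * (1 - \<mu> j (snd z)))" by blast
    from bchoice[OF this] obtain J where J: "\<And>i j. i < n \<Longrightarrow> J i \<le> j \<Longrightarrow>
        - \<eta>' \<le> LF (\<lambda>n z. max (w n z) (u i)) (\<lambda>n z. max (v n z) (u i)) (\<lambda>z. \<psi> i z * (1 - \<mu> j (snd z))) \<and>
        - \<eta>' \<le> LF (\<lambda>n z. min (w n z) (l i)) (\<lambda>n z. min (v n z) (l i)) (\<lambda>z. \<psi> i z * (1 - \<mu> j (snd z)))" by auto
    have "\<forall>i\<in>{..<n}. \<exists>D\<ge>0. \<forall>z. norm (nabla (\<psi> i) z) \<le> D"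
    proof
      fix i assume "i \<in> {..<n}"
      then have "i < n" by simp
      obtain D where "D \<ge> 0" "\<And>z. norm (nabla (\<psi> i) z) \<le> D" using nabla_bounded[OF \<psi>V[OF \<open>i < n\<close>]] by blast
      then show "\<exists>D\<ge>0. \<forall>z. norm (nabla (\<psi> i) z) \<le> D" by blast
    qed
    from bchoice[OF this] obtain D where D: "\<And>i. i < n \<Longrightarrow> D i \<ge> 0" "\<And>i z. i < n \<Longrightarrow> norm (nabla (\<psi> i) z) \<le> D i" by auto
    \<comment> \<open>Contribution of the gradients of the pieces, which are not controlled in terms
      of \<open>\<eta>\<close>. It will be multiplied by \<open>\<delta> j\<close>, and
      \<open>j\<close> is chosen after the partition.\<close>
    define S where "S = (\<Sum>i<n. D i * (T + 1) * C)"
    have S: "S \<ge> 0" unfolding S_def using D(1) T C by (intro sum_nonneg) auto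
    have "\<forall>\<^sub>F j in sequentially. \<delta> j < 1 / (S + 1)" using \<delta>lim S by (intro order_tendstoD(2)) auto
    then obtain j0 where j0: "\<And>j. j \<ge> j0 \<Longrightarrow> \<delta> j < 1 / (S + 1)" by (auto simp: eventually_sequentially)
    define j where "j = j0 + (\<Sum>i<n. J i)"
    have jJ: "J i \<le> j" if "i < n" for i
      using member_le_sum[of i "{..<n}" J] that by (simp add: j_def)
    have S\<delta>: "S * \<delta> j \<le> 1"
    proof -
      have "S * \<delta> j \<le> (S + 1) * (1 / (S + 1))" using j0[of j] \<delta>0[of j] S by (intro mult_mono) (auto simp: j_def)
      then show ?thesis using S by simp
    qed
    \<comment> \<open>The layer gradient weighted by one piece. As the pieces add up to
      \<open>\<phi>\<close>, these integrals have a sum that is bounded in terms of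
      \<open>\<phi>\<close> alone.\<close>
    define R where "R i = (LINT z|lborel. indicator Q z * (\<bar>\<psi> i z\<bar> * norm (nabla (\<mu> j) (snd z))))" for i
    have piece: "- (2 * \<eta>' + 2 * \<eta> * (R i + D i * (T + 1) * C * \<delta> j)) \<le> LF w v (\<psi> i)" if i: "i < n" for i
    proof -
      define \<zeta> where "\<zeta> z = \<psi> i z * (1 - \<mu> j (snd z))" for z
      have \<zeta>: "test_on (slab T (ball x0 (r / 4))) \<zeta>" unfolding \<zeta>_def
        by (intro test_on_mult(2)[OF \<psi>V[OF i]] smooth_diff smooth_const smooth_layer)
      have in\<psi>: "test_on Q (\<lambda>z. \<psi> i z * \<mu> j (snd z))" by (rule test_on_layer[OF \<psi>2[OF i]])
      \<comment> \<open>The interior part is nonnegative already; only the part in the layer has to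
        be split into levels.\<close>
      have "LF w v (\<lambda>z. \<psi> i z * \<mu> j (snd z) + \<zeta> z) = LF w v (\<lambda>z. \<psi> i z * \<mu> j (snd z)) + LF w v \<zeta>"
        by (rule LF_add[OF bs test_on_mono[OF in\<psi> subset_UNIV] test_on_mono[OF \<zeta> subset_UNIV]])
      moreover have "\<psi> i z * \<mu> j (snd z) + \<zeta> z = \<psi> i z" for z by (simp add: \<zeta>_def algebra_simps)
      moreover have "0 \<le> LF w v (\<lambda>z. \<psi> i z * \<mu> j (snd z))"
        by (rule LF_interior_nonneg[OF in\<psi>]) (use part(3) \<mu>0 in simp)
      ultimately have 1: "LF w v \<zeta> \<le> LF w v (\<psi> i)" by simp
      have lu: "l i \<le> u i" using \<tau>(1) by (simp add: l_def u_def)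
      have M1: "\<bar>u i\<bar> \<le> M + 1" "\<bar>l i\<bar> \<le> M + 1" using ab[of "p i"] part(1)[OF i] sl(2) \<tau> by (auto simp: u_def l_def)
      define X where "X x = max (l i) (min x (u i))" for x
      have Xb: "\<bar>X x\<bar> \<le> M + 1" "\<bar>X x - X y\<bar> \<le> \<tau>" for x y
        using M1 lu \<tau>(1) by (auto simp: X_def max_def min_def l_def u_def)
      have bX: "bseq (M + 1) (\<lambda>n z. X (w n z))" "bseq (M + 1) (\<lambda>n z. X (v n z))" unfolding X_def
        using bseq_max[OF bseq_const[OF M1(2)] bseq_min[OF bseq_wv(1) bseq_const[OF M1(1)]]]
          bseq_max[OF bseq_const[OF M1(2)] bseq_min[OF bseq_wv(2) bseq_const[OF M1(1)]]] by auto
      have kX: "norm (kflux f (X x) (X y)) \<le> 2 * \<eta>" for x y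
      proof -
        have "norm (kflux f (X x) (X y) - kflux f (X y) (X y)) \<le> \<eta> + C1 * (\<bar>X x - X y\<bar> + \<bar>X y - X y\<bar>)"
          by (rule C1(2)) (rule Xb)+
        also have "\<dots> \<le> \<eta> + C1 * \<tau>" using Xb(2)[of x y] C1(1) by (intro add_left_mono mult_left_mono) auto
        finally show ?thesis using \<tau>(3) by (simp add: kflux_self_le)
      qed
      have "\<bar>LF (\<lambda>n z. X (w n z)) (\<lambda>n z. X (v n z)) \<zeta>\<bar> \<le> 2 * \<eta> * (LINT z|lborel. indicator Q z * norm (nabla \<zeta> z))"
        by (rule LF_bound[OF bX \<zeta> kX])
      also have "\<dots> \<le> 2 * \<eta> * (R i + D i * (T + 1) * C * \<delta> j)"
      proof (rule mult_left_mono)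
        obtain Bi where Bi: "Bi \<ge> 0" "\<And>z. \<bar>\<psi> i z\<bar> \<le> Bi" using test_on_bounded[OF \<psi>V[OF i]] by blast
        note lg = layer_gradient_integral(2)[OF T op \<psi>2[OF i] Bi(2), of j]
        note ls = layer_slab_integral[OF T op \<psi>2[OF i] D(2)[OF i], of j]
        have "(LINT z|lborel. indicator Q z * norm (nabla \<zeta> z))
          \<le> (LINT z|lborel. indicator Q z * (\<bar>\<psi> i z\<bar> * norm (nabla (\<mu> j) (snd z))) + indicator Q z * ((1 - \<mu> j (snd z)) * norm (nabla (\<psi> i) z)))"
        proof (rule integral_mono'[OF Bochner_Integration.integrable_add[OF lg ls(2)]])
          fix z
          have sm: "smooth (\<lambda>z :: real \<times> 'a. 1 - \<mu> j (snd z))" by (intro smooth_diff smooth_const smooth_layer)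
          have "nabla (\<lambda>z :: real \<times> 'a. 1 - \<mu> j (snd z)) z = - (0, nabla (\<mu> j) (snd z))"
            using nabla_diff[OF smooth_const[of 1] smooth_layer, of j z] nabla_layer by simp
          then have "nabla \<zeta> z = \<psi> i z *\<^sub>R (- (0, nabla (\<mu> j) (snd z))) + (1 - \<mu> j (snd z)) *\<^sub>R nabla (\<psi> i) z"
            unfolding \<zeta>_def using nabla_mult[OF test_on_smooth[OF \<psi>V[OF i]] sm, of z] by simp
          then have "norm (nabla \<zeta> z) \<le> norm (\<psi> i z *\<^sub>R (- (0 :: real, nabla (\<mu> j) (snd z)))) + norm ((1 - \<mu> j (snd z)) *\<^sub>R nabla (\<psi> i) z)"
            using norm_triangle_ineq by metis
          also have "\<dots> = \<bar>\<psi> i z\<bar> * norm (nabla (\<mu> j) (snd z)) + (1 - \<mu> j (snd z)) * norm (nabla (\<psi> i) z)"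
            using \<mu>1[of j "snd z"] by (simp add: norm_Pair)
          finally show "indicator Q z * norm (nabla \<zeta> z)
            \<le> indicator Q z * (\<bar>\<psi> i z\<bar> * norm (nabla (\<mu> j) (snd z))) + indicator Q z * ((1 - \<mu> j (snd z)) * norm (nabla (\<psi> i) z))"
            by (auto split: split_indicator)
          show "0 \<le> indicator Q z * (\<bar>\<psi> i z\<bar> * norm (nabla (\<mu> j) (snd z))) + indicator Q z * ((1 - \<mu> j (snd z)) * norm (nabla (\<psi> i) z))"
            using \<mu>1[of j "snd z"] by simp
        qed
        also have "\<dots> = R i + (LINT z|lborel. indicator Q z * ((1 - \<mu> j (snd z)) * norm (nabla (\<psi> i) z)))"
          unfolding R_def by (rule Bochner_Integration.integral_add[OF lg ls(2)])
        finally show "(LINT z|lborel. indicator Q z * norm (nabla \<zeta> z)) \<le> R i + D i * (T + 1) * C * \<delta> j" using ls(1) by linarith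
      qed (use \<eta> in simp)
      finally have 2: "- (2 * \<eta> * (R i + D i * (T + 1) * C * \<delta> j)) \<le> LF (\<lambda>n z. X (w n z)) (\<lambda>n z. X (v n z)) \<zeta>" by linarith
      have "LF w v \<zeta> = LF (\<lambda>n z. max (w n z) (u i)) (\<lambda>n z. max (v n z) (u i)) \<zeta>
        + LF (\<lambda>n z. min (w n z) (l i)) (\<lambda>n z. min (v n z) (l i)) \<zeta> + LF (\<lambda>n z. X (w n z)) (\<lambda>n z. X (v n z)) \<zeta>"
        unfolding X_def by (rule LF_three_levels[OF \<zeta> lu])
      then show ?thesis using 1 2 J[OF i jJ[OF i]] unfolding \<zeta>_def[symmetric] by linarith
    qed
    have Rsum: "(\<Sum>i<n. R i) \<le> B * (T + 1) * C"
    proof -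
      have i: "integrable lborel (\<lambda>z. indicator Q z * (\<bar>\<psi> i z\<bar> * norm (nabla (\<mu> j) (snd z))))" if i: "i < n" for i
      proof -
        obtain Bi where Bi: "Bi \<ge> 0" "\<And>z. \<bar>\<psi> i z\<bar> \<le> Bi" using test_on_bounded[OF \<psi>V[OF i]] by blast
        show ?thesis by (rule layer_gradient_integral(2)[OF T op \<psi>2[OF i] Bi(2)])
      qed
      have "(\<Sum>i<n. R i) = (LINT z|lborel. (\<Sum>i<n. indicator Q z * (\<bar>\<psi> i z\<bar> * norm (nabla (\<mu> j) (snd z)))))"
        unfolding R_def by (rule Bochner_Integration.integral_sum[symmetric]) (use i in simp)
      also have "\<dots> = (LINT z|lborel. indicator Q z * (\<bar>\<phi> z\<bar> * norm (nabla (\<mu> j) (snd z))))"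
        using part(3) by (intro Bochner_Integration.integral_cong refl)
          (simp add: part(4) sum_distrib_left sum_distrib_right sum_nonneg)
      also have "\<dots> \<le> B * (T + 1) * C"
        by (rule layer_gradient_integral(1)[OF T op test_on_mono[OF \<phi>(1)] B(2)]) (use sl(1) in \<open>simp add: V_def\<close>)
      finally show ?thesis .
    qed
    have "LF w v \<phi> = (\<Sum>i<n. LF w v (\<psi> i))"
    proof -
      have "\<phi> = (\<lambda>z. \<Sum>i<n. \<psi> i z)" using part(4) by blast
      then show ?thesis using LF_sum[OF bs, of "{..<n}" _ \<psi>, OF \<psi>V] by simp
    qed
    also have "\<dots> \<ge> (\<Sum>i<n. - (2 * \<eta>' + 2 * \<eta> * (R i + D i * (T + 1) * C * \<delta> j)))"
      by (rule sum_mono) (use piece in simp)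
    also have "(\<Sum>i<n. - (2 * \<eta>' + 2 * \<eta> * (R i + D i * (T + 1) * C * \<delta> j))) = - (real n * (2 * \<eta>') + 2 * \<eta> * ((\<Sum>i<n. R i) + S * \<delta> j))"
      unfolding sum_negf sum.distrib sum_distrib_left[symmetric] S_def sum_distrib_right by simp
    finally have fin: "- (real n * (2 * \<eta>') + 2 * \<eta> * ((\<Sum>i<n. R i) + S * \<delta> j)) \<le> LF w v \<phi>" .
    have "real n * (2 * \<eta>') \<le> 2 * \<eta>" using \<eta> by (simp add: \<eta>'_def divide_simps)
    moreover have "2 * \<eta> * ((\<Sum>i<n. R i) + S * \<delta> j) \<le> 2 * \<eta> * (1 + B * (T + 1) * C)"
      using Rsum S\<delta> \<eta> by (intro mult_left_mono) auto
    ultimately show ?thesis using fin by linarith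
  qed
  define k where "k = 2 + 2 * (1 + B * (T + 1) * C)"
  have k: "k > 0" using B(1) T C by (auto simp: k_def intro!: add_pos_nonneg)
  have k': "2 * \<eta> + 2 * \<eta> * (1 + B * (T + 1) * C) = \<eta> * k" for \<eta> by (simp add: k_def algebra_simps)
  have "- \<epsilon> \<le> LF w v \<phi>" if "\<epsilon> > 0" for \<epsilon>
  proof -
    have "\<epsilon> / k > 0" using that k by simp
    from main[OF this, unfolded k'] show ?thesis using k by simp
  qed
  then show ?thesis using field_le_epsilon[of 0 "LF w v \<phi>"] by force
qed

text \<open>By additivity and a partition of \<open>\<phi>\<close> the claim is local. A point is
  interior, on the boundary or exterior, and near exterior points the functional is 0 because it
  integrates over \<open>Q\<close>.\<close>

lemma LF_nonneg:
  assumes \<phi>: "test_on (slab T UNIV) \<phi>" "\<And>z. 0 \<le> \<phi> z"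
  shows "0 \<le> LF w v \<phi>"
proof -
  have V: "open (slab T (UNIV :: 'a set))" by (rule open_slab[OF open_UNIV])
  have bs: "bseq M w" "bseq M v" by (auto intro: bseq_wv)
  have "\<exists>W. open W \<and> z \<in> W \<and> (\<forall>\<psi>. test_on (slab T UNIV \<inter> W) \<psi> \<longrightarrow> (\<forall>z. 0 \<le> \<psi> z) \<longrightarrow> 0 \<le> LF w v \<psi>)"
    if z: "z \<in> slab T UNIV" for z
  proof -
    have zt: "fst z \<in> {-1<..<T}" using z by (auto simp: slab_def)
    consider "snd z \<in> \<Omega>" | "snd z \<in> frontier \<Omega>" | "snd z \<in> - closure \<Omega>"
      using op by (auto simp: frontier_def interior_open)
    then show ?thesis
    proof cases
      case 1
      then have "z \<in> Q" using zt by (cases z) (auto simp: slab_def)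
      then show ?thesis using LF_interior_nonneg test_on_mono[of "slab T UNIV \<inter> Q" _ Q] open_slab[OF op] by blast
    next
      case 2
      obtain r \<nu> g L where "Lipschitz_chart \<Omega> (snd z) r \<nu> g L" using chart[OF 2] by blast
      then interpret Lipschitz_chart \<Omega> "snd z" r \<nu> g L .
      obtain \<mu> \<delta> C where cl: "chart_layers \<Omega> (snd z) r \<nu> g L \<mu> \<delta> C" using ex_chart_layers by blast
      have "z \<in> slab T (ball (snd z) (r / 4))" using zt r by (cases z) (auto simp: slab_def)
      moreover have "0 \<le> LF w v \<psi>" if "test_on (slab T UNIV \<inter> slab T (ball (snd z) (r / 4))) \<psi>" "\<forall>z. 0 \<le> \<psi> z" for \<psi>
        by (rule LF_boundary_nonneg[OF cl test_on_mono[OF that(1)]]) (use that(2) in auto)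
      ultimately show ?thesis using open_slab[OF open_ball] by blast
    next
      case 3
      have "z \<in> slab T (- closure \<Omega>)" using zt 3 by (cases z) (auto simp: slab_def)
      moreover have "0 \<le> LF w v \<psi>" if \<psi>: "test_on (slab T UNIV \<inter> slab T (- closure \<Omega>)) \<psi>" for \<psi>
      proof -
        obtain K where K: "compact K" "K \<subseteq> slab T UNIV \<inter> slab T (- closure \<Omega>)" "\<And>z. z \<notin> K \<Longrightarrow> \<psi> z = 0" using test_onE[OF \<psi>] by blast
        have "indicator Q z * (kflux f (w n z) (v n z) \<bullet> switched (fst z) (nabla \<psi> z)) = (0::real)" for n z
        proof (cases "z \<in> Q")
          case True
          then have "z \<notin> K" using K(2) closure_subset[of \<Omega>] by (auto simp: slab_def)
          then show ?thesis using nabla_eq_0_outside[of K \<psi> z, OF compact_imp_closed[OF K(1)] K(3)] by simp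
        qed simp
        then have "flux_int Q f (w n) (v n) \<psi> = 0" for n unfolding flux_int_def by (simp only: integral_zero)
        then show ?thesis unfolding LF_def by (simp add: tendsto_Lim[OF F tendsto_const])
      qed
      ultimately show ?thesis using open_slab[of "- closure \<Omega>" T] by blast
    qed
  qed
  then have "\<forall>z\<in>slab T UNIV. \<exists>W. open W \<and> z \<in> W \<and> (\<forall>\<psi>. test_on (slab T UNIV \<inter> W) \<psi> \<longrightarrow> (\<forall>z. 0 \<le> \<psi> z) \<longrightarrow> 0 \<le> LF w v \<psi>)"
    by blast
  from bchoice[OF this] obtain W where W: "\<And>z. z \<in> slab T UNIV \<Longrightarrow> open (W z)" "\<And>z. z \<in> slab T UNIV \<Longrightarrow> z \<in> W z"
    "\<And>z \<psi>. z \<in> slab T UNIV \<Longrightarrow> test_on (slab T UNIV \<inter> W z) \<psi> \<Longrightarrow> \<forall>z. 0 \<le> \<psi> z \<Longrightarrow> 0 \<le> LF w v \<psi>"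
    by blast
  have P: "\<exists>(n :: nat) \<psi> p. (\<forall>i<n. p i \<in> slab T UNIV \<and> test_on (slab T UNIV \<inter> W (p i)) (\<psi> i)) \<and>
      (\<forall>i z. 0 \<le> \<psi> i z) \<and> (\<forall>z. \<phi> z = (\<Sum>i<n. \<psi> i z))"
    by (rule ex_partition[OF \<phi> V]) (use W in auto)
  obtain n :: nat and \<psi> p where part0: "\<forall>i<n. p i \<in> slab T UNIV \<and> test_on (slab T UNIV \<inter> W (p i)) (\<psi> i)"
    "\<forall>i z. 0 \<le> \<psi> i z" "\<forall>z. \<phi> z = (\<Sum>i<n. \<psi> i z)"
    using P by (elim exE conjE) (rule that)
  have part: "\<And>i. i < n \<Longrightarrow> p i \<in> slab T UNIV" "\<And>i. i < n \<Longrightarrow> test_on (slab T UNIV \<inter> W (p i)) (\<psi> i)"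
    "\<And>i z. 0 \<le> \<psi> i z" "\<And>z. \<phi> z = (\<Sum>i<n. \<psi> i z)"
    using part0(1) spec[OF spec[OF part0(2)]] spec[OF part0(3)] by simp_all
  have \<psi>U: "test_on UNIV (\<psi> i)" if "i < n" for i using test_on_mono[OF part(2)[OF that] subset_UNIV] .
  have "\<phi> = (\<lambda>z. \<Sum>i<n. \<psi> i z)" using part(4) by blast
  then have "LF w v \<phi> = (\<Sum>i<n. LF w v (\<psi> i))" using LF_sum[OF bs, of "{..<n}" _ \<psi>, OF \<psi>U] by simp
  also have "\<dots> \<ge> 0" by (rule sum_nonneg) (use W(3)[OF part(1) part(2)] part(3) in simp)
  finally show ?thesis .
qed

end

section \<open>From the Kato inequality to convergence in L^1\<close>

lemma ex_time_weight:
  fixes C :: "'a::euclidean_space set"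
  assumes T: "0 < T" and T': "T' < T" and C: "compact C"
  obtains \<phi> :: "real \<times> 'a \<Rightarrow> real" where "test_on (slab T UNIV) \<phi>" "\<And>z. 0 \<le> \<phi> z"
    "\<And>z. z \<in> {0<..<T} \<times> C \<Longrightarrow> \<phi> z = flat_exp 0 (T' - fst z)"
    "\<And>z. z \<in> {0<..<T} \<times> C \<Longrightarrow> nabla \<phi> z = (- flat_exp 2 (T' - fst z), 0)"
proof -
  obtain \<kappa> N where \<kappa>: "test_on {-1<..<T + 1} \<kappa>" "\<And>t. 0 \<le> \<kappa> t" "\<And>t. \<kappa> t \<le> 1" "open N" "{-1/2..T} \<subseteq> N" "\<And>t. t \<in> N \<Longrightarrow> \<kappa> t = 1"
  proof -
    have sub: "{-1/2..T} \<subseteq> {-1<..<T + 1}" using T by auto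
    show thesis using ex_cutoff[OF compact_Icc open_greaterThanLessThan sub] that by blast
  qed
  obtain \<xi> X where \<xi>: "test_on UNIV \<xi>" "\<And>x. 0 \<le> \<xi> x" "\<And>x. \<xi> x \<le> 1" "open X" "C \<subseteq> X" "\<And>x. x \<in> X \<Longrightarrow> \<xi> x = 1"
    using ex_cutoff[OF C open_UNIV subset_UNIV] by blast
  define h where "h t = flat_exp 0 (- t + T')" for t
  have hs: "smooth h" unfolding h_def
    using smooth_comp_affine[OF bounded_linear_minus[OF bounded_linear_ident] smooth_flat_exp, of 0 T'] by simp
  have h0: "0 \<le> h t" "t \<ge> T' \<Longrightarrow> h t = 0" for t by (auto simp: h_def flat_exp_def)
  have hd: "(h has_real_derivative - flat_exp 2 (T' - t)) (at t)" for t
  proof -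
    have "((\<lambda>t. - t + T') has_real_derivative - 1) (at t)" by (auto intro!: derivative_eq_intros)
    from DERIV_chain2[OF flat_exp_has_derivative this, of 0]
    show ?thesis by (simp add: h_def[abs_def] add.commute numeral_2_eq_2)
  qed
  \<comment> \<open>\<open>\<kappa>\<close> cuts off at negative times, \<open>h\<close> vanishes
    from \<open>T'\<close> on and keeps the support away from \<open>T\<close>, and
    \<open>\<xi>\<close> is 1 around \<open>C\<close>. On the set in question only exp(-1/(T' - t))
    remains, whose derivative is strictly negative before \<open>T'\<close>.\<close>
  define \<phi> where "\<phi> z = (\<kappa> (fst z) * h (fst z)) * \<xi> (snd z)" for z :: "real \<times> 'a"
  have sm1: "smooth (\<lambda>t. \<kappa> t * h t)" by (rule smooth_mult[OF test_on_smooth[OF \<kappa>(1)] hs])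
  have sm: "smooth \<phi>" unfolding \<phi>_def
    by (rule smooth_mult[OF smooth_comp_linear[OF bounded_linear_fst sm1] smooth_comp_linear[OF bounded_linear_snd test_on_smooth[OF \<xi>(1)]]])
  have \<phi>t: "test_on (slab T UNIV) \<phi>"
  proof -
    obtain K1 where K1: "compact K1" "K1 \<subseteq> {-1<..<T + 1}" "\<And>t. t \<notin> K1 \<Longrightarrow> \<kappa> t = 0" using test_onE[OF \<kappa>(1)] by blast
    obtain K2 where K2: "compact K2" "K2 \<subseteq> UNIV" "\<And>x. x \<notin> K2 \<Longrightarrow> \<xi> x = 0" using test_onE[OF \<xi>(1)] by blast
    have "compact ((K1 \<inter> {..T'}) \<times> K2)" by (intro compact_Times compact_Int_closed K1 K2) simp
    moreover have "(K1 \<inter> {..T'}) \<times> K2 \<subseteq> slab T UNIV" using K1(2) T' by (auto simp: slab_def)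
    moreover have "\<phi> z = 0" if "z \<notin> (K1 \<inter> {..T'}) \<times> K2" for z
      using that K1(3)[of "fst z"] K2(3)[of "snd z"] h0(2)[of "fst z"] by (cases z) (auto simp: \<phi>_def not_le)
    ultimately show ?thesis unfolding test_on_def using sm by blast
  qed
  have \<phi>0: "0 \<le> \<phi> z" for z unfolding \<phi>_def by (intro mult_nonneg_nonneg \<kappa> h0 \<xi>)
  have nab: "nabla \<phi> z = (- flat_exp 2 (T' - fst z), 0)" if z: "z \<in> {0<..<T} \<times> C" for z
  proof (rule nablaI)
    have o: "open (N \<times> X)" by (rule open_Times[OF \<kappa>(4) \<xi>(4)])
    have zi: "z \<in> N \<times> X" using z \<kappa>(5) \<xi>(5) by (cases z) (auto simp: subset_iff)
    have eq: "h (fst y) = \<phi> y" if "y \<in> N \<times> X" for y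
      using \<kappa>(6)[of "fst y"] \<xi>(6)[of "snd y"] that by (cases y) (simp add: \<phi>_def)
    have "((\<lambda>y :: real \<times> 'a. h (fst y)) has_derivative (\<lambda>k. - flat_exp 2 (T' - fst z) * fst k)) (at z)"
      using has_derivative_compose[OF bounded_linear_imp_has_derivative[OF bounded_linear_fst] hd[unfolded has_field_derivative_def]] .
    then have hdz: "((\<lambda>y :: real \<times> 'a. h (fst y)) has_derivative (\<lambda>k. (- flat_exp 2 (T' - fst z), 0) \<bullet> k)) (at z)"
      by (simp add: inner_prod_def)
    show "(\<phi> has_derivative (\<lambda>k. (- flat_exp 2 (T' - fst z), 0) \<bullet> k)) (at z)"
      by (rule has_derivative_transform_within_open[OF hdz o zi eq])
  qed
  have val: "\<phi> z = flat_exp 0 (T' - fst z)" if "z \<in> {0<..<T} \<times> C" for z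
  proof -
    have "fst z \<in> N" "snd z \<in> X" using that \<kappa>(5) \<xi>(5) by (auto simp: mem_Times_iff subset_iff)
    then show ?thesis using \<kappa>(6)[of "fst z"] \<xi>(6)[of "snd z"] by (simp add: \<phi>_def h_def)
  qed
  show thesis by (rule that[of \<phi>, OF \<phi>t \<phi>0 val nab])
qed

context comparison_boundary
begin

text \<open>A test function that depends on time alone over \<open>\<Omega>\<close> removes the
  spatial flux. Its time derivative is not positive, so nonnegativity of \<open>LF\<close> says that
  the weighted integral of the positive part has a limit that is at most 0. Nonpositive times
  contribute nothing because \<open>w\<close> and \<open>v\<close> agree there. The weight
  degenerates near \<open>T'\<close>, and the strip left over has measure proportional to
  \<open>\<epsilon>\<close>.\<close>

lemma positive_part_vanishes:
  assumes agree: "\<And>n z. fst z \<le> 0 \<Longrightarrow> w n z = v n z"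
  shows "((\<lambda>n. LINT z|lborel. indicator ({0<..<T} \<times> \<Omega>) z * max (w n z - v n z) 0) \<longlongrightarrow> 0) F"
proof -
  define Q0 where "Q0 = {0<..<T} \<times> \<Omega>"
  have Q0m[measurable]: "Q0 \<in> sets borel" unfolding Q0_def using op by (intro borel_Times) auto
  have Q0b: "bounded Q0" unfolding Q0_def
    by (intro bounded_Times bd bounded_subset[OF bounded_closed_interval[of 0 T]]) auto
  have M: "M \<ge> 0" using wb[of 0 0] by simp
  define P where "P n z = max (w n z - v n z) 0" for n z
  have Pm[measurable]: "P n \<in> borel_measurable borel" for n
    unfolding P_def using wm[of n] vm[of n] by (intro borel_measurable_max borel_measurable_diff) auto
  have Pb: "0 \<le> P n z" "P n z \<le> 2 * M" for n z using wb[of n z] vb[of n z] by (auto simp: P_def)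
  have iP: "integrable lborel (\<lambda>z. indicator Q0 z * P n z)" for n
    by (rule integrable_bounded_support[OF _ Q0b, where B="2 * M"]) (use Pb M in \<open>auto split: split_indicator\<close>)
  define I where "I n = (LINT z|lborel. indicator Q0 z * P n z)" for n
  define q where "q = measure lborel \<Omega>"
  have q: "q \<ge> 0" by (simp add: q_def)
  have [measurable]: "\<Omega> \<in> sets borel" using op by simp
  have I0: "0 \<le> I n" for n unfolding I_def by (intro Bochner_Integration.integral_nonneg) (simp add: Pb)
  have boundedI: "bounded (range I)"
  proof -
    have i2: "integrable lborel (\<lambda>z. indicator Q0 z * (2 * M))"
    proof (rule integrable_bounded_support[OF _ Q0b, where B="2 * M"])
      show "norm (indicator Q0 z * (2 * M)) \<le> 2 * M" for z
        using M by (cases "z \<in> Q0") simp_all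
    qed (use M in simp_all)
    have "I n \<le> (LINT z|lborel. indicator Q0 z * (2 * M))" for n
      unfolding I_def by (rule integral_mono[OF iP i2]) (intro mult_left_mono Pb, simp)
    then show ?thesis unfolding bounded_iff using I0 by (intro exI[of _ "LINT z|lborel. indicator Q0 z * (2 * M)"]) auto
  qed
  note limI = Lim_tendsto[OF boundedI]
  have main: "Lim F I \<le> 4 * M * q * \<epsilon>" if \<epsilon>: "\<epsilon> > 0" "2 * \<epsilon> < T" for \<epsilon>
  proof -
    define T' where "T' = T - \<epsilon>"
    have cl: "compact (closure \<Omega>)" using bd by (simp add: compact_closure)
    have "T' < T" using \<epsilon> by (simp add: T'_def)
    then obtain \<phi> :: "real \<times> 'a \<Rightarrow> real" where \<phi>: "test_on (slab T UNIV) \<phi>" "\<And>z. 0 \<le> \<phi> z"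
      "\<And>z. z \<in> {0<..<T} \<times> closure \<Omega> \<Longrightarrow> \<phi> z = flat_exp 0 (T' - fst z)"
      "\<And>z. z \<in> {0<..<T} \<times> closure \<Omega> \<Longrightarrow> nabla \<phi> z = (- flat_exp 2 (T' - fst z), 0)"
      using ex_time_weight[OF T _ cl] by blast
    note \<phi>t = \<phi>(1) and \<phi>0 = \<phi>(2)
    have nab: "nabla \<phi> z = (- flat_exp 2 (T' - fst z), 0)" if z: "z \<in> Q0" for z
      by (rule \<phi>(4)) (use z closure_subset[of \<Omega>] in \<open>auto simp: Q0_def\<close>)
    have fl: "flux_int Q f (w n) (v n) \<phi> = - (LINT z|lborel. indicator Q0 z * P n z * flat_exp 2 (T' - fst z))" for n
    proof -
      have "indicator Q z * (kflux f (w n z) (v n z) \<bullet> switched (fst z) (nabla \<phi> z)) = - (indicator Q0 z * P n z * flat_exp 2 (T' - fst z))" for z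
      proof (cases "z \<in> Q0")
        case True
        then have "z \<in> Q" by (auto simp: Q0_def slab_def)
        then show ?thesis unfolding nab[OF True] using True by (auto simp: kflux_def switched_def P_def inner_prod_def max_def)
      next
        case False
        show ?thesis
        proof (cases "z \<in> Q")
          case True
          then have "fst z \<le> 0" using False by (cases z) (auto simp: Q0_def slab_def)
          then have "kflux f (w n z) (v n z) = 0" using agree[of z n] by (simp add: kflux_self_le)
          then show ?thesis using False by simp
        qed (use False in simp)
      qed
      then show ?thesis unfolding flux_int_def by simp
    qed
    define J where "J n = (LINT z|lborel. indicator Q0 z * P n z * flat_exp 2 (T' - fst z))" for n
    have "((\<lambda>n. flux_int Q f (w n) (v n) \<phi>) \<longlongrightarrow> LF w v \<phi>) F"
      by (rule LF_tendsto[OF bseq_wv \<phi>t]) auto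
    then have "((\<lambda>n. - J n) \<longlongrightarrow> LF w v \<phi>) F" unfolding fl J_def .
    then have Jlim: "(J \<longlongrightarrow> - LF w v \<phi>) F" using tendsto_minus by fastforce
    \<comment> \<open>A lower bound of \<open>flat_exp 2\<close> on the interval from
      \<open>\<epsilon>\<close> to \<open>T\<close>, which contains the values \<open>T' - t\<close>
      for positive times \<open>t\<close> up to \<open>T - 2 * \<epsilon>\<close>.\<close>
    define m where "m = (1 / T)\<^sup>2 * exp (- (1 / \<epsilon>))"
    have m: "m > 0" using T by (simp add: m_def)
    define S where "S = {T - 2 * \<epsilon><..<T} \<times> \<Omega>"
    have Sm[measurable]: "S \<in> sets borel" unfolding S_def by (intro borel_Times) auto
    have Sb: "bounded S" unfolding S_def
      by (intro bounded_Times bd bounded_subset[OF bounded_closed_interval[of "T - 2 * \<epsilon>" T]]) auto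
    have iS: "integrable lborel (\<lambda>z. 2 * M * indicator S z)"
      by (rule integrable_bounded_support[OF _ Sb, where B="2 * M"]) (use M in \<open>auto split: split_indicator\<close>)
    have fm: "(\<lambda>z :: real \<times> 'a. flat_exp 2 (T' - fst z)) \<in> borel_measurable borel"
      by (rule measurable_of_first[of "\<lambda>t. flat_exp 2 (T' - t)"])
        (use smooth_borel_measurable[OF smooth_translate(2)[OF smooth_flat_exp, of 2 T']] in simp)
    have iJ: "integrable lborel (\<lambda>z. indicator Q0 z * P n z * flat_exp 2 (T' - fst z))" for n
    proof -
      have "bounded (flat_exp 2 ` {-\<epsilon>..T})"
        by (intro compact_imp_bounded compact_continuous_image smooth_continuous_on smooth_flat_exp compact_Icc)
      then obtain B where B: "\<And>y. y \<in> flat_exp 2 ` {-\<epsilon>..T} \<Longrightarrow> norm y \<le> B" unfolding bounded_iff by blast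
      have B0: "B \<ge> 0" using order_trans[OF norm_ge_zero B[of "flat_exp 2 0"]] \<epsilon> T by auto
      show ?thesis
      proof (rule integrable_bounded_support[OF _ Q0b, where B="2 * M * B"])
        show "(\<lambda>z. indicator Q0 z * P n z * flat_exp 2 (T' - fst z)) \<in> borel_measurable borel"
          by (intro borel_measurable_times borel_measurable_indicator fm Pm Q0m)
        fix z
        show "norm (indicator Q0 z * P n z * flat_exp 2 (T' - fst z)) \<le> 2 * M * B"
        proof (cases "z \<in> Q0")
          case True
          then have "T' - fst z \<in> {-\<epsilon>..T}" using \<epsilon> by (auto simp: Q0_def T'_def)
          then have "\<bar>flat_exp 2 (T' - fst z)\<bar> \<le> B" using B[of "flat_exp 2 (T' - fst z)"] by simp
          then show ?thesis using True Pb[of n z] M by (simp add: abs_mult mult_mono)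
        qed (use M B0 in simp)
      qed simp
    qed
    have IJ: "I n \<le> inverse m * J n + 2 * M * (2 * \<epsilon> * q)" for n
    proof -
      have "I n \<le> (LINT z|lborel. inverse m * (indicator Q0 z * P n z * flat_exp 2 (T' - fst z)) + 2 * M * indicator S z)"
        unfolding I_def
      proof (rule integral_mono[OF iP])
        show "integrable lborel (\<lambda>z. inverse m * (indicator Q0 z * P n z * flat_exp 2 (T' - fst z)) + 2 * M * indicator S z)"
          using iJ iS by simp
        fix z
        have fp: "0 \<le> flat_exp 2 s" for s by (simp add: flat_exp_def)
        show "indicator Q0 z * P n z \<le> inverse m * (indicator Q0 z * P n z * flat_exp 2 (T' - fst z)) + 2 * M * indicator S z"
        proof (cases "z \<in> Q0")
          case z: True
          show ?thesis
          proof (cases "fst z > T - 2 * \<epsilon>")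
            case True
            then have "z \<in> S" using z by (cases z) (auto simp: Q0_def S_def)
            moreover have "0 \<le> inverse m * (P n z * flat_exp 2 (T' - fst z))"
              using m Pb(1)[of n z] fp by (intro mult_nonneg_nonneg) auto
            ultimately show ?thesis using z Pb(2)[of n z] by simp
          next
            case False
            define s where "s = T' - fst z"
            have s: "\<epsilon> \<le> s" "s \<le> T" "s > 0" using False z \<epsilon> by (auto simp: s_def T'_def Q0_def)
            have "m \<le> (1 / s)\<^sup>2 * exp (- (1 / s))"
              unfolding m_def using s \<epsilon> T by (intro mult_mono power_mono) (auto simp: field_simps)
            then have "m \<le> flat_exp 2 s" using s by (simp add: flat_exp_def)
            then have "1 \<le> inverse m * flat_exp 2 s" using m by (simp add: field_simps)
            then have "P n z * 1 \<le> P n z * (inverse m * flat_exp 2 s)" by (rule mult_left_mono[OF _ Pb(1)])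
            moreover have "0 \<le> 2 * M * (indicator S z :: real)" using M by simp
            ultimately show ?thesis using z by (simp add: s_def mult_ac)
          qed
        next
          case False
          then show ?thesis using M by simp
        qed
      qed
      also have "\<dots> = inverse m * J n + 2 * M * measure lborel S" using iJ iS by (simp add: J_def)
      also have "measure lborel S = 2 * \<epsilon> * q"
      proof -
        have "emeasure (lborel \<Otimes>\<^sub>M lborel) S = emeasure lborel {T - 2 * \<epsilon><..<T} * emeasure lborel \<Omega>"
          unfolding S_def by (rule lborel.emeasure_pair_measure_Times) auto
        then have "emeasure lborel S = ennreal (2 * \<epsilon>) * ennreal q"
          using \<epsilon> emeasure_bounded_finite[OF bd] by (simp add: lborel_prod q_def emeasure_eq_ennreal_measure)
        then show ?thesis using \<epsilon> q by (simp add: measure_def ennreal_mult[symmetric])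
      qed
      finally show ?thesis .
    qed
    have "Lim F I \<le> inverse m * (- LF w v \<phi>) + 2 * M * (2 * \<epsilon> * q)"
      by (rule tendsto_le[OF F tendsto_add[OF tendsto_mult[OF tendsto_const Jlim] tendsto_const] limI]) (intro always_eventually allI IJ)
    also have "\<dots> \<le> 2 * M * (2 * \<epsilon> * q)" using LF_nonneg[OF \<phi>t \<phi>0] m by (simp add: mult_nonneg_nonneg)
    finally show ?thesis by (simp add: mult_ac)
  qed
  have "Lim F I \<le> 0"
  proof (rule field_le_epsilon)
    fix e :: real assume e: "e > 0"
    define \<epsilon> where "\<epsilon> = min (T / 3) (e / (4 * M * q + 1))"
    have den: "4 * M * q + 1 > 0" using M q by (simp add: add_nonneg_pos)
    have \<epsilon>: "\<epsilon> > 0" "2 * \<epsilon> < T" using T e den by (auto simp: \<epsilon>_def min_def)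
    have "4 * M * q * \<epsilon> \<le> (4 * M * q + 1) * (e / (4 * M * q + 1))"
      using M q \<epsilon> den by (intro mult_mono) (auto simp: \<epsilon>_def)
    then have "4 * M * q * \<epsilon> \<le> e" using den by simp
    then show "Lim F I \<le> 0 + e" using main[OF \<epsilon>] by simp
  qed
  moreover have "0 \<le> Lim F I" using tendsto_lowerbound[OF limI _ F] I0 by simp
  ultimately show ?thesis using limI unfolding I_def P_def Q0_def by simp
qed

end

text \<open>Zorn's lemma for the reversed order. A minimal proper filter decides every predicate,
  since otherwise it could be refined by a principal filter. The infimum of a nonempty chain is
  proper because each nonempty finite subset has a least element.\<close>

lemma ex_ultrafilter_below:
  fixes G :: "'i filter"
  assumes "G \<noteq> bot"
  obtains F where "F \<le> G" "F \<noteq> bot" "\<And>P. eventually P F \<or> eventually (\<lambda>x. \<not> P x) F"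
proof -
  define A where "A = {F. F \<noteq> bot \<and> F \<le> G}"
  have "\<exists>m\<in>A. \<forall>F\<in>A. F \<le> m \<longrightarrow> F = m"
  proof (rule predicate_Zorn[where P="\<lambda>F H. H \<le> F" and A=A])
    show "partial_order_on A (relation_of (\<lambda>F H. H \<le> F) A)"
      by (rule partial_order_on_relation_ofI) auto
    fix \<C> assume "\<C> \<in> Chains (relation_of (\<lambda>F H. H \<le> F) A)"
    then have C: "\<C> \<subseteq> A" "\<And>F H. F \<in> \<C> \<Longrightarrow> H \<in> \<C> \<Longrightarrow> F \<le> H \<or> H \<le> F"
      by (auto simp: Chains_def relation_of_def)
    show "\<exists>u\<in>A. \<forall>a\<in>\<C>. u \<le> a"
    proof (cases "\<C> = {}")
      case True
      then show ?thesis using assms by (auto simp: A_def)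
    next
      case False
      have fin: "X \<noteq> {} \<Longrightarrow> \<exists>m\<in>X. \<forall>a\<in>X. m \<le> a" if "finite X" "X \<subseteq> \<C>" for X
        using that
      proof (induction X rule: finite_induct)
        case (insert x X)
        show ?case
        proof (cases "X = {}")
          case False
          then obtain m where m: "m \<in> X" "\<forall>a\<in>X. m \<le> a" using insert by auto
          then have "x \<le> m \<or> m \<le> x" using C(2)[of x m] insert.prems by auto
          then show ?thesis using m order_trans[of x m] by (elim disjE) auto
        qed simp
      qed simp
      have "Inf \<C> \<noteq> bot"
      proof (rule Inf_filter_not_bot)
        fix X assume X: "X \<subseteq> \<C>" "finite X"
        show "Inf X \<noteq> bot"
        proof (cases "X = {}")
          case True
          have "top \<noteq> (bot :: 'i filter)"
          proof
            assume "top = (bot :: 'i filter)"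
            then have "G \<le> bot" using top_greatest[of G] by simp
            then show False using assms by (simp add: bot.extremum_unique)
          qed
          then show ?thesis using True by simp
        next
          case False
          then obtain m where m: "m \<in> X" "\<forall>a\<in>X. m \<le> a" using fin[OF X(2,1)] by blast
          then have "m \<le> Inf X" by (simp add: Inf_greatest)
          moreover have "m \<noteq> bot" using m(1) X(1) C(1) by (auto simp: A_def)
          ultimately show ?thesis using bot.extremum_uniqueI[of m] by metis
        qed
      qed
      moreover obtain F0 where "F0 \<in> \<C>" using False by blast
      then have "Inf \<C> \<le> G" using C(1) Inf_lower[of F0 \<C>] by (auto simp: A_def)
      ultimately have "Inf \<C> \<in> A" by (simp add: A_def)
      then show ?thesis by (intro bexI[of _ "Inf \<C>"]) (auto intro: Inf_lower)
    qed
  qed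
  then obtain F where F: "F \<in> A" "\<And>H. H \<in> A \<Longrightarrow> H \<le> F \<Longrightarrow> H = F" by blast
  show thesis
  proof (rule that[of F])
    show "F \<le> G" "F \<noteq> bot" using F(1) by (auto simp: A_def)
    fix P
    show "eventually P F \<or> eventually (\<lambda>x. \<not> P x) F"
    proof (cases "inf F (principal {x. P x}) = bot")
      case True
      then have "eventually (\<lambda>x. \<not> P x) F"
        by (simp add: trivial_limit_def eventually_inf_principal)
      then show ?thesis ..
    next
      case False
      then have "inf F (principal {x. P x}) = F" using F(1) by (intro F(2)) (auto simp: A_def intro: le_infI1)
      then have "F \<le> principal {x. P x}" by (metis inf.cobounded2)
      then show ?thesis by (simp add: le_principal)
    qed
  qed
qed

text \<open>The image filter has a cluster point in a compact interval, and a filter that decides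
  every predicate converges to its cluster points.\<close>

lemma ultrafilter_convergent:
  fixes X :: "'i \<Rightarrow> real"
  assumes F: "F \<noteq> bot" "\<And>P. eventually P F \<or> eventually (\<lambda>x. \<not> P x) F" and X: "bounded (range X)"
  shows "\<exists>L. (X \<longlongrightarrow> L) F"
proof -
  obtain B where B: "\<And>n. \<bar>X n\<bar> \<le> B" using X unfolding bounded_iff by auto
  have "filtermap X F \<noteq> bot" using F(1) by (simp add: filtermap_bot_iff)
  moreover have "eventually (\<lambda>x. x \<in> {-B..B}) (filtermap X F)"
    unfolding eventually_filtermap using B by (intro always_eventually) (auto simp: abs_le_iff minus_le_iff)
  ultimately obtain L where L: "inf (nhds L) (filtermap X F) \<noteq> bot"
    using compact_Icc[of "-B" B] unfolding compact_filter by blast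
  have "(X \<longlongrightarrow> L) F"
  proof (rule topological_tendstoI)
    fix S assume S: "open S" "L \<in> S"
    show "eventually (\<lambda>n. X n \<in> S) F"
    proof (rule ccontr)
      assume "\<not> ?thesis"
      then have "eventually (\<lambda>n. X n \<notin> S) F" using F(2) by blast
      then have "eventually (\<lambda>x. x \<notin> S) (filtermap X F)" by (simp add: eventually_filtermap)
      moreover have "eventually (\<lambda>x. x \<in> S) (nhds L)" using S by (rule eventually_nhds_in_open)
      ultimately have "eventually (\<lambda>x. False) (inf (nhds L) (filtermap X F))"
        unfolding eventually_inf by blast
      then show False using L by (simp add: trivial_limit_def)
    qed
  qed
  then show ?thesis ..
qed

lemma asub_mono: "asub T \<Omega> f a G w \<Longrightarrow> F \<le> G \<Longrightarrow> asub T \<Omega> f a F w"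
  unfolding asub_def using tendsto_mono by meson

text \<open>If convergence failed, an ultrafilter could be chosen that lives on the indices with
  distance at least \<open>\<epsilon>\<close>. Along it both positive parts vanish in the limit, by
  comparing \<open>U\<close> with \<open>u\<close> and \<open>u\<close> with \<open>U\<close>, which
  contradicts the choice.\<close>

lemma L1_convergence:
  fixes \<Omega> :: "'a::euclidean_space set" and U :: "nat \<Rightarrow> real \<times> 'a \<Rightarrow> real"
  assumes \<Omega>: "open \<Omega>" "bounded \<Omega>" and f: "continuous_on UNIV f"
    and U: "\<And>n. U n \<in> borel_measurable borel" "\<And>n z. \<bar>U n z\<bar> \<le> M"
    and u: "u \<in> borel_measurable borel" "\<And>z. \<bar>u z\<bar> \<le> M"
    and subU: "asub T \<Omega> f a sequentially U" and supU: "asub T \<Omega> (\<lambda>s. - f (- s)) (\<lambda>z. - a z) sequentially (\<lambda>n z. - U n z)"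
    and subu: "asub T \<Omega> f a sequentially (\<lambda>_. u)" and supu: "asub T \<Omega> (\<lambda>s. - f (- s)) (\<lambda>z. - a z) sequentially (\<lambda>_ z. - u z)"
    and T: "T > 0" and a: "continuous_on (slab T UNIV) a" "\<And>z. z \<in> slab T UNIV \<Longrightarrow> \<bar>a z\<bar> \<le> M"
    and chart: "\<And>x0. x0 \<in> frontier \<Omega> \<Longrightarrow> \<exists>r \<nu> g L. Lipschitz_chart \<Omega> x0 r \<nu> g L"
    and agree: "\<And>n z. fst z \<le> 0 \<Longrightarrow> U n z = u z"
  shows "(\<lambda>n. LINT z|lborel. indicator ({0<..<T} \<times> \<Omega>) z * \<bar>U n z - u z\<bar>) \<longlonglongrightarrow> 0"
proof (rule ccontr)
  define I where "I n = (LINT z|lborel. indicator ({0<..<T} \<times> \<Omega>) z * \<bar>U n z - u z\<bar>)" for n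
  have M: "M \<ge> 0" using u(2)[of 0] by simp
  have Q0m[measurable]: "{0<..<T} \<times> \<Omega> \<in> sets borel" using \<Omega> by (intro borel_Times) auto
  have Q0b: "bounded ({0<..<T} \<times> \<Omega>)"
    by (intro bounded_Times \<Omega> bounded_subset[OF bounded_closed_interval[of 0 T]]) auto
  note [measurable] = U(1) u(1)
  have i: "integrable lborel (\<lambda>z. indicator ({0<..<T} \<times> \<Omega>) z * max (U n z - u z) 0)"
    "integrable lborel (\<lambda>z. indicator ({0<..<T} \<times> \<Omega>) z * max (u z - U n z) 0)" for n
  proof -
    have b: "\<bar>max (U n z - u z) 0\<bar> \<le> 2 * M" "\<bar>max (u z - U n z) 0\<bar> \<le> 2 * M" for z
      using U(2)[of n z] u(2)[of z] by auto
    show "integrable lborel (\<lambda>z. indicator ({0<..<T} \<times> \<Omega>) z * max (U n z - u z) 0)"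
      by (rule integrable_bounded_support[OF _ Q0b, where B="2 * M"])
        (measurable, use b M in \<open>auto simp: abs_mult split: split_indicator\<close>)
    show "integrable lborel (\<lambda>z. indicator ({0<..<T} \<times> \<Omega>) z * max (u z - U n z) 0)"
      by (rule integrable_bounded_support[OF _ Q0b, where B="2 * M"])
        (measurable, use b M in \<open>auto simp: abs_mult split: split_indicator\<close>)
  qed
  have I: "I n = (LINT z|lborel. indicator ({0<..<T} \<times> \<Omega>) z * max (U n z - u z) 0)
      + (LINT z|lborel. indicator ({0<..<T} \<times> \<Omega>) z * max (u z - U n z) 0)" for n
    unfolding Bochner_Integration.integral_add[OF i, symmetric] I_def
    by (intro Bochner_Integration.integral_cong refl) (auto split: split_indicator)
  assume "\<not> ?thesis"
  then obtain \<epsilon> where \<epsilon>: "\<epsilon> > 0" "\<not> (\<forall>\<^sub>F n in sequentially. dist (I n) 0 < \<epsilon>)"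
    unfolding I_def[symmetric] tendsto_iff by blast
  define G where "G = inf sequentially (principal {n. \<not> dist (I n) 0 < \<epsilon>})"
  have "G \<noteq> bot" unfolding G_def trivial_limit_def eventually_inf_principal using \<epsilon>(2) by simp
  then obtain F where F: "F \<le> G" "F \<noteq> bot" "\<And>P. eventually P F \<or> eventually (\<lambda>x. \<not> P x) F"
    using ex_ultrafilter_below by blast
  have Fs: "F \<le> sequentially" using F(1) by (simp add: G_def)
  have conv: "\<exists>L. (X \<longlongrightarrow> L) F" if "bounded (range X)" for X :: "nat \<Rightarrow> real"
    by (rule ultrafilter_convergent[OF F(2,3) that])
  interpret A: comparison_boundary T \<Omega> f a M F U "\<lambda>_. u"
    by (unfold_locales) (fact \<Omega> f U u asub_mono[OF subU Fs] asub_mono[OF supu Fs] F(2) conv T a chart | simp)+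
  interpret B: comparison_boundary T \<Omega> f a M F "\<lambda>_. u" U
    by (unfold_locales) (fact \<Omega> f U u asub_mono[OF subu Fs] asub_mono[OF supU Fs] F(2) conv T a chart | simp)+
  have "(I \<longlongrightarrow> 0 + 0) F"
    unfolding I by (intro tendsto_add A.positive_part_vanishes B.positive_part_vanishes) (simp_all add: agree)
  then have "\<forall>\<^sub>F n in F. dist (I n) 0 < \<epsilon>" using \<epsilon>(1) by (intro tendstoD) auto
  moreover have "\<forall>\<^sub>F n in F. \<not> dist (I n) 0 < \<epsilon>"
    using F(1) unfolding G_def by (simp add: le_principal)
  ultimately have "\<forall>\<^sub>F n in F. False" by eventually_elim simp
  then show False using F(2) by (simp add: trivial_limit_def)
qed

section \<open>The fractional Laplacian\<close>

text \<open>Domination by a series of constants on balls requires no more than the volume of balls.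
  Dyadic radii turn integrals of powers of the norm into geometric series, at infinity as well as at
  the origin.\<close>

lemma nn_integral_finite_by_balls:
  fixes \<rho> :: "'a::euclidean_space \<Rightarrow> real"
  assumes c: "\<And>j. 0 \<le> c j" and r: "\<And>j. 0 \<le> r j" and sum: "summable (\<lambda>j :: nat. c j * r j ^ DIM('a))"
    and \<rho>: "\<And>z. \<rho> z > 0 \<Longrightarrow> \<exists>j. norm z \<le> r j \<and> \<rho> z \<le> c j"
  shows "(\<integral>\<^sup>+ z. ennreal (\<rho> z) \<partial>lborel) < \<infinity>"
proof -
  have "(\<integral>\<^sup>+ z. ennreal (\<rho> z) \<partial>lborel) \<le> (\<integral>\<^sup>+ z. (\<Sum>j. ennreal (c j) * indicator (cball 0 (r j)) z) \<partial>(lborel :: 'a measure))"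
  proof (rule nn_integral_mono)
    fix z
    show "ennreal (\<rho> z) \<le> (\<Sum>j. ennreal (c j) * indicator (cball 0 (r j)) z)"
    proof (cases "\<rho> z > 0")
      case True
      then obtain j where j: "norm z \<le> r j" "\<rho> z \<le> c j" using \<rho> by blast
      have "ennreal (\<rho> z) \<le> (\<Sum>i\<in>{j}. ennreal (c i) * indicator (cball 0 (r i)) z)"
        using j by (simp add: ennreal_leI)
      also have "\<dots> \<le> (\<Sum>j. ennreal (c j) * indicator (cball 0 (r j)) z)"
        by (rule sum_le_suminf) auto
      finally show ?thesis .
    qed (simp add: ennreal_neg)
  qed
  also have "\<dots> = (\<Sum>j. ennreal (c j) * emeasure lborel (cball (0 :: 'a) (r j)))"
  proof (subst nn_integral_suminf)
    show "(\<lambda>z :: 'a. ennreal (c j) * indicator (cball 0 (r j)) z) \<in> borel_measurable lborel" for j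
      by (intro borel_measurable_times_ennreal borel_measurable_indicator) auto
  qed (simp add: nn_integral_cmult_indicator)
  also have "\<dots> = (\<Sum>j. ennreal (c j * (unit_ball_vol (real DIM('a)) * r j ^ DIM('a))))"
    using c r by (simp add: emeasure_cball ennreal_mult)
  also have "\<dots> = ennreal (\<Sum>j. c j * (unit_ball_vol (real DIM('a)) * r j ^ DIM('a)))"
    using summable_mult[OF sum, of "unit_ball_vol (real DIM('a))"] c r
    by (intro suminf_ennreal2) (auto simp: mult_ac)
  finally show ?thesis by (auto intro: le_less_trans)
qed

definition frac_weight :: "real \<Rightarrow> 'a::euclidean_space \<Rightarrow> real" where
  "frac_weight \<alpha> z = norm z powr (- (real DIM('a) + \<alpha>))"

lemma frac_weight_nonneg: "0 \<le> frac_weight \<alpha> z"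
  by (simp add: frac_weight_def)

lemma frac_weight_minus: "frac_weight \<alpha> (- z) = frac_weight \<alpha> z"
  by (simp add: frac_weight_def)

lemma frac_weight_measurable [measurable]: "frac_weight \<alpha> \<in> borel_measurable borel"
  unfolding frac_weight_def[abs_def] by measurable

lemma dyadic_ge_1:
  fixes y :: real
  assumes "1 \<le> y" shows "\<exists>j :: nat. 2 ^ j \<le> y \<and> y \<le> 2 * 2 ^ j"
proof -
  define j where "j = nat \<lfloor>log 2 y\<rfloor>"
  have "0 \<le> log 2 y" using assms by simp
  then have "real j \<le> log 2 y" "log 2 y \<le> real j + 1" unfolding j_def by linarith+
  then have "2 powr real j \<le> y" "y \<le> 2 powr (real j + 1)"
    using assms le_log_iff[of 2 y "real j"] log_le_iff[of 2 y "real j + 1"] by auto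
  then show ?thesis by (intro exI[of _ j]) (simp add: powr_realpow powr_add)
qed

text \<open>On the dyadic shell of radius 2^j the weight is at most 2^(-j(d+\<alpha>)), against a
  volume of order 2^(jd). The ratio of the series is 2^(-\<alpha>).\<close>

lemma frac_weight_far:
  assumes "0 < \<alpha>"
  shows "integrable lborel (\<lambda>z :: 'a::euclidean_space. indicator {z. 1 \<le> norm z} z * frac_weight \<alpha> z)"
proof (rule integrableI_nonneg)
  let ?d = "real DIM('a)"
  define c where "c j = (2 ^ j) powr (- (?d + \<alpha>))" for j :: nat
  have eq: "c j * (2 * 2 ^ j) ^ DIM('a) = 2 ^ DIM('a) * (2 powr (- \<alpha>)) ^ j" for j
  proof -
    have "(2 ^ j) ^ DIM('a) = (2 :: real) powr (real j * ?d)"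
      by (simp add: powr_realpow[symmetric] powr_powr)
    moreover have "c j = 2 powr (real j * (- (?d + \<alpha>)))"
      by (simp add: c_def powr_realpow[symmetric] powr_powr)
    moreover have "(2 powr (- \<alpha>)) ^ j = 2 powr (real j * (- \<alpha>))"
      by (simp add: powr_realpow[symmetric] powr_powr mult.commute)
    ultimately show ?thesis by (simp add: power_mult_distrib powr_add[symmetric] algebra_simps)
  qed
  show "(\<integral>\<^sup>+ z. ennreal (indicator {z :: 'a. 1 \<le> norm z} z * frac_weight \<alpha> z) \<partial>lborel) < \<infinity>"
  proof (rule nn_integral_finite_by_balls[where c=c and r="\<lambda>j. 2 * 2 ^ j"])
    have "2 powr (- \<alpha>) < 1" using assms by (simp add: powr_less_one)
    then show "summable (\<lambda>j. c j * (2 * 2 ^ j) ^ DIM('a))"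
      unfolding eq by (intro summable_mult summable_geometric) simp
    fix z :: 'a assume "0 < indicator {z. 1 \<le> norm z} z * frac_weight \<alpha> z"
    then have z: "1 \<le> norm z" by (auto split: split_indicator_asm)
    then obtain j :: nat where j: "2 ^ j \<le> norm z" "norm z \<le> 2 * 2 ^ j" using dyadic_ge_1 by blast
    have "frac_weight \<alpha> z \<le> c j"
      unfolding frac_weight_def c_def using j assms by (intro powr_mono2') auto
    then show "\<exists>j. norm z \<le> 2 * 2 ^ j \<and> indicator {z. 1 \<le> norm z} z * frac_weight \<alpha> z \<le> c j"
      using j z by (intro exI[of _ j]) simp
  qed (auto simp: c_def)
qed (auto simp: frac_weight_nonneg)

text \<open>The squared norm, which stems from second differences, makes the ratio of the series at
  the origin 2^(\<alpha>-2). This is where \<alpha> < 2 enters.\<close>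

lemma frac_weight_near:
  assumes "0 < \<alpha>" "\<alpha> < 2"
  shows "integrable lborel (\<lambda>z :: 'a::euclidean_space. indicator (ball 0 1) z * (frac_weight \<alpha> z * (norm z)\<^sup>2))"
proof (rule integrableI_nonneg)
  let ?d = "real DIM('a)"
  define c where "c j = (1 / (2 * 2 ^ j)) powr (- (?d + \<alpha>)) * (1 / 2 ^ j)\<^sup>2" for j :: nat
  have eq: "c j * (1 / 2 ^ j) ^ DIM('a) = 2 powr (?d + \<alpha>) * (2 powr (\<alpha> - 2)) ^ j" for j
  proof -
    have "(1 / (2 * 2 ^ j)) = (2 :: real) powr (- (real j + 1))"
      by (simp only: powr_minus_divide powr_add) (simp add: powr_realpow)
    then have "(1 / (2 * 2 ^ j)) powr (- (?d + \<alpha>)) = (2 :: real) powr ((real j + 1) * (?d + \<alpha>))"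
      by (simp add: powr_powr) (simp add: algebra_simps)
    moreover have p: "(1 / 2 ^ j) = (2 :: real) powr (- real j)"
      by (simp add: powr_realpow[symmetric] powr_minus field_simps)
    then have "(1 / 2 ^ j)\<^sup>2 = (2 :: real) powr (- 2 * real j)"
      by (simp add: powr_realpow[symmetric] powr_powr mult.commute)
    moreover have "(1 / 2 ^ j) ^ DIM('a) = (2 :: real) powr (- real j * ?d)"
      using p by (simp add: powr_realpow[symmetric] powr_powr mult.commute)
    moreover have "(2 powr (\<alpha> - 2)) ^ j = 2 powr (real j * (\<alpha> - 2))"
      by (simp add: powr_realpow[symmetric] powr_powr mult.commute)
    ultimately show ?thesis by (simp add: c_def powr_add[symmetric] algebra_simps)
  qed
  show "(\<integral>\<^sup>+ z. ennreal (indicator (ball (0 :: 'a) 1) z * (frac_weight \<alpha> z * (norm z)\<^sup>2)) \<partial>lborel) < \<infinity>"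
  proof (rule nn_integral_finite_by_balls[where c=c and r="\<lambda>j. 1 / 2 ^ j"])
    have "2 powr (\<alpha> - 2) < 1" using assms by (simp add: powr_less_one)
    then show "summable (\<lambda>j. c j * (1 / 2 ^ j) ^ DIM('a))"
      unfolding eq by (intro summable_mult summable_geometric) simp
    fix z :: 'a assume "0 < indicator (ball 0 1) z * (frac_weight \<alpha> z * (norm z)\<^sup>2)"
    then have z: "norm z < 1" "norm z > 0" by (auto split: split_indicator_asm)
    then have "1 \<le> 1 / norm z" by simp
    then obtain j :: nat where "2 ^ j \<le> 1 / norm z" "1 / norm z \<le> 2 * 2 ^ j" using dyadic_ge_1 by blast
    then have j: "norm z \<le> 1 / 2 ^ j" "1 / (2 * 2 ^ j) \<le> norm z" using z by (auto simp: field_simps)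
    have "frac_weight \<alpha> z * (norm z)\<^sup>2 \<le> c j"
      unfolding frac_weight_def c_def using j assms z by (intro mult_mono power_mono powr_mono2') auto
    then show "\<exists>j. norm z \<le> 1 / 2 ^ j \<and> indicator (ball 0 1) z * (frac_weight \<alpha> z * (norm z)\<^sup>2) \<le> c j"
      using j z by (intro exI[of _ j]) simp
  qed (auto simp: c_def)
  show "(\<lambda>z :: 'a. indicator (ball 0 1) z * (frac_weight \<alpha> z * (norm z)\<^sup>2)) \<in> borel_measurable lborel"
    by (intro borel_measurable_times borel_measurable_indicator) auto
qed (auto simp: frac_weight_nonneg)

lemma frac_const_nonneg: "0 < \<alpha> \<Longrightarrow> 0 \<le> frac_const d \<alpha>"
  unfolding frac_const_def by (intro divide_nonneg_nonneg mult_nonneg_nonneg less_imp_le[OF Gamma_real_pos]) auto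

lemma scaled_frac_measure:
  assumes "0 < \<alpha>" "0 \<le> c"
  shows "scale_measure (ennreal c) (frac_measure \<alpha>) =
    density lebesgue (\<lambda>z :: 'a::euclidean_space. ennreal (c * frac_const DIM('a) \<alpha> * frac_weight \<alpha> z))"
proof (rule measure_eqI)
  show "sets (scale_measure (ennreal c) (frac_measure \<alpha>)) = sets (density lebesgue (\<lambda>z :: 'a. ennreal (c * frac_const DIM('a) \<alpha> * frac_weight \<alpha> z)))"
    by (simp add: frac_measure_def)
  fix A assume "A \<in> sets (scale_measure (ennreal c) (frac_measure \<alpha> :: 'a measure))"
  then have [measurable]: "A \<in> sets lebesgue" by (simp add: frac_measure_def)
  have m: "frac_weight \<alpha> \<in> borel_measurable (lebesgue :: 'a measure)" by (rule measurable_completion) simp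
  have "emeasure (scale_measure (ennreal c) (frac_measure \<alpha>)) A =
    ennreal c * (\<integral>\<^sup>+ z. ennreal (frac_const DIM('a) \<alpha> * frac_weight \<alpha> z) * indicator A z \<partial>lebesgue)"
    unfolding frac_measure_def frac_weight_def[symmetric] using m by (simp add: emeasure_density)
  also have "\<dots> = (\<integral>\<^sup>+ z. ennreal c * (ennreal (frac_const DIM('a) \<alpha> * frac_weight \<alpha> z) * indicator A z) \<partial>lebesgue)"
    by (intro nn_integral_cmult[symmetric] borel_measurable_times_ennreal borel_measurable_indicator
        measurable_compose[OF _ measurable_ennreal] borel_measurable_times borel_measurable_const m) fact
  also have "\<dots> = (\<integral>\<^sup>+ z. ennreal (c * frac_const DIM('a) \<alpha> * frac_weight \<alpha> z) * indicator A z \<partial>lebesgue)"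
    using assms frac_const_nonneg[of \<alpha> "DIM('a)"]
    by (simp add: ennreal_mult[symmetric] mult.assoc[symmetric] frac_weight_nonneg)
  also have "\<dots> = emeasure (density lebesgue (\<lambda>z :: 'a. ennreal (c * frac_const DIM('a) \<alpha> * frac_weight \<alpha> z))) A"
    using m by (simp add: emeasure_density)
  finally show "emeasure (scale_measure (ennreal c) (frac_measure \<alpha>)) A =
    emeasure (density lebesgue (\<lambda>z :: 'a. ennreal (c * frac_const DIM('a) \<alpha> * frac_weight \<alpha> z))) A" .
qed

lemma set_integral_scaled_frac_measure:
  fixes g :: "'a::euclidean_space \<Rightarrow> real"
  assumes "0 < \<alpha>" "0 \<le> c" and [measurable]: "g \<in> borel_measurable borel" "S \<in> sets borel"
  shows "(LINT z:S|scale_measure (ennreal c) (frac_measure \<alpha>). g z) =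
    c * frac_const DIM('a) \<alpha> * (LINT z|lborel. indicator S z * (frac_weight \<alpha> z * g z))"
proof -
  define C where "C = c * frac_const DIM('a) \<alpha>"
  have C: "C \<ge> 0" using assms frac_const_nonneg[of \<alpha> "DIM('a)"] by (simp add: C_def)
  have "(LINT z:S|scale_measure (ennreal c) (frac_measure \<alpha>). g z) =
      (LINT z|density lebesgue (\<lambda>z :: 'a. ennreal (C * frac_weight \<alpha> z)). indicator S z * g z)"
    unfolding scaled_frac_measure[OF assms(1,2)] C_def by (simp add: set_lebesgue_integral_def)
  also have "\<dots> = (LINT z|lebesgue. (C * frac_weight \<alpha> z) *\<^sub>R (indicator S z * g z))"
  proof (rule integral_density)
    show "(\<lambda>z. indicator S z * g z) \<in> borel_measurable lebesgue" "(\<lambda>z. C * frac_weight \<alpha> z) \<in> borel_measurable lebesgue"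
      by (rule measurable_completion; simp)+
  qed (simp add: C frac_weight_nonneg)
  also have "\<dots> = (LINT z|lborel. (C * frac_weight \<alpha> z) *\<^sub>R (indicator S z * g z))"
    by (rule integral_completion) simp
  also have "\<dots> = C * (LINT z|lborel. indicator S z * (frac_weight \<alpha> z * g z))"
    unfolding integral_mult_right_zero[symmetric] by (simp add: mult_ac)
  finally show ?thesis by (simp add: C_def)
qed

lemma nonlocal_ge_bound:
  fixes v :: "'a::euclidean_space \<Rightarrow> real"
  assumes \<alpha>: "0 < \<alpha>" and c: "0 \<le> c" and v[measurable]: "v \<in> borel_measurable borel" and B: "\<And>x. \<bar>v x\<bar> \<le> B"
  shows "\<bar>nonlocal_ge (scale_measure (ennreal c) (frac_measure \<alpha>)) 1 v x\<bar> \<le>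
    c * (2 * B * (frac_const DIM('a) \<alpha> * (LINT z|lborel. indicator {z :: 'a. 1 \<le> norm z} z * frac_weight \<alpha> z)))"
proof -
  let ?A = "{z :: 'a. 1 \<le> norm z}"
  have A: "?A \<in> sets borel" by measurable
  have C: "0 \<le> c * frac_const DIM('a) \<alpha>" using c frac_const_nonneg[OF \<alpha>] by simp
  have "\<bar>LINT z|lborel. indicator ?A z * (frac_weight \<alpha> z * (v (x + z) - v x))\<bar> \<le>
      (LINT z|lborel. 2 * B * (indicator ?A z * frac_weight \<alpha> z))"
  proof (rule integral_abs_bound_integral)
    have b: "\<bar>indicator ?A z * (frac_weight \<alpha> z * (v (x + z) - v x))\<bar> \<le> 2 * B * (indicator ?A z * frac_weight \<alpha> z)" for z
    proof -
      have "frac_weight \<alpha> z * \<bar>v (x + z) - v x\<bar> \<le> frac_weight \<alpha> z * (2 * B)"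
        using B[of "x + z"] B[of x] by (intro mult_left_mono frac_weight_nonneg) linarith
      then show ?thesis using frac_weight_nonneg[of \<alpha> z] by (simp add: abs_mult mult_ac split: split_indicator)
    qed
    then show "\<And>z. \<bar>indicator ?A z * (frac_weight \<alpha> z * (v (x + z) - v x))\<bar> \<le> 2 * B * (indicator ?A z * frac_weight \<alpha> z)" .
    show i: "integrable lborel (\<lambda>z. 2 * B * (indicator ?A z * frac_weight \<alpha> z))"
      by (intro integrable_mult_right frac_weight_far \<alpha>)
    show "integrable lborel (\<lambda>z. indicator ?A z * (frac_weight \<alpha> z * (v (x + z) - v x)))"
      by (rule Bochner_Integration.integrable_bound[OF i])
        (use A in measurable, use b in \<open>auto intro!: AE_I2 order_trans[OF b abs_ge_self]\<close>)
  qed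
  also have "\<dots> = 2 * B * (LINT z|lborel. indicator ?A z * frac_weight \<alpha> z)" by simp
  finally have "(c * frac_const DIM('a) \<alpha>) * \<bar>LINT z|lborel. indicator ?A z * (frac_weight \<alpha> z * (v (x + z) - v x))\<bar> \<le>
      (c * frac_const DIM('a) \<alpha>) * (2 * B * (LINT z|lborel. indicator ?A z * frac_weight \<alpha> z))"
    using C by (rule mult_left_mono)
  then show ?thesis
    unfolding nonlocal_ge_def
    by (subst set_integral_scaled_frac_measure[OF \<alpha> c _ A]) (use C c frac_const_nonneg[OF \<alpha>, of "DIM('a)"] in \<open>simp_all add: abs_mult mult_ac\<close>)
qed

lemma nonlocal_lt_eq_0:
  fixes v :: "'a::euclidean_space \<Rightarrow> real"
  assumes "\<And>z. norm z < r \<Longrightarrow> v (x + z) = v x"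
  shows "nonlocal_lt \<mu> r v x = 0"
proof -
  have "(LINT z:{z. \<epsilon> < norm z \<and> norm z < r}|\<mu>. v (x + z) - v x) = 0" for \<epsilon>
  proof -
    have "(\<lambda>z. indicator {z. \<epsilon> < norm z \<and> norm z < r} z *\<^sub>R (v (x + z) - v x)) = (\<lambda>_. 0)"
      using assms by (auto split: split_indicator)
    then show ?thesis unfolding set_lebesgue_integral_def by simp
  qed
  then show ?thesis unfolding nonlocal_lt_def by (simp add: tendsto_Lim)
qed

text \<open>Symmetrising in \<open>z\<close> turns the singular integral into one of second differences.\<close>

lemma nonlocal_lt_bound:
  fixes v :: "'a::euclidean_space \<Rightarrow> real"
  assumes \<alpha>: "0 < \<alpha>" "\<alpha> < 2" and c: "0 \<le> c" and v[measurable]: "v \<in> borel_measurable borel"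
    and V: "\<And>x. \<bar>v x\<bar> \<le> V"
    and B: "\<And>h. \<bar>v (x + h) + v (x - h) - 2 * v x\<bar> \<le> B * (norm h)\<^sup>2"
  shows "\<bar>nonlocal_lt (scale_measure (ennreal c) (frac_measure \<alpha>)) 1 v x\<bar> \<le>
    c * (B * (frac_const DIM('a) \<alpha> * (LINT z|lborel. indicator (ball (0 :: 'a) 1) z * (frac_weight \<alpha> z * (norm z)\<^sup>2))))"
proof -
  define \<mu> where "\<mu> = scale_measure (ennreal c) (frac_measure \<alpha> :: 'a measure)"
  define C where "C = c * frac_const DIM('a) \<alpha>"
  have C: "0 \<le> C" using c frac_const_nonneg[OF \<alpha>(1)] by (simp add: C_def)
  define A where "A \<epsilon> = {z :: 'a. \<epsilon> < norm z \<and> norm z < 1}" for \<epsilon>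
  have Am[measurable]: "A \<epsilon> \<in> sets borel" for \<epsilon> unfolding A_def by measurable
  define D where "D z = frac_weight \<alpha> z * (v (x + z) + v (x - z) - 2 * v x)" for z
  define K where "K z = B * (indicator (ball (0 :: 'a) 1) z * (frac_weight \<alpha> z * (norm z)\<^sup>2))" for z
  have iK: "integrable lborel K" unfolding K_def by (intro integrable_mult_right frac_weight_near \<alpha>)
  have Dm[measurable]: "D \<in> borel_measurable borel" unfolding D_def by measurable
  have DK: "\<bar>indicator (A \<epsilon>) z * D z\<bar> \<le> K z" if "\<epsilon> \<ge> 0" for \<epsilon> z
  proof (cases "z \<in> A \<epsilon>")
    case True
    have "\<bar>D z\<bar> \<le> frac_weight \<alpha> z * (B * (norm z)\<^sup>2)"
      unfolding D_def abs_mult using frac_weight_nonneg[of \<alpha> z] B[of z] by (simp add: mult_left_mono)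
    then show ?thesis using True by (simp add: K_def A_def mult_ac)
  next
    case False
    have "0 \<le> B * (norm z)\<^sup>2" using B[of z] by (rule order_trans[OF abs_ge_zero])
    then have "0 \<le> (B * (norm z)\<^sup>2) * (indicator (ball (0 :: 'a) 1) z * frac_weight \<alpha> z)"
      using frac_weight_nonneg[of \<alpha> z] by (intro mult_nonneg_nonneg[of "B * (norm z)\<^sup>2"]) auto
    then show ?thesis using False by (simp add: K_def mult_ac)
  qed
  have iD: "integrable lborel (\<lambda>z. indicator (A \<epsilon>) z * D z)" if "\<epsilon> \<ge> 0" for \<epsilon>
    by (rule Bochner_Integration.integrable_bound[OF iK])
      (measurable, use DK[OF that] in \<open>auto intro!: AE_I2 order_trans[OF DK[OF that] abs_ge_self]\<close>)
  define G where "G \<epsilon> = C * (1 / 2 * (LINT z|lborel. indicator (A \<epsilon>) z * D z))" for \<epsilon>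
  have eq: "(LINT z:{z. \<epsilon> < norm z \<and> norm z < 1}|\<mu>. v (x + z) - v x) = G \<epsilon>" if "\<epsilon> > 0" for \<epsilon>
  proof -
    define g where "g z = indicator (A \<epsilon>) z * (frac_weight \<alpha> z * (v (x + z) - v x))" for z
    have gm[measurable]: "g \<in> borel_measurable borel" unfolding g_def by measurable
    have Ab: "bounded (A \<epsilon>)" unfolding A_def by (rule bounded_subset[OF bounded_ball[of 0 1]]) auto
    have ig: "integrable lborel g"
    proof (rule integrable_bounded_support[OF gm Ab])
      fix z show "norm (g z) \<le> \<epsilon> powr (- (real DIM('a) + \<alpha>)) * (2 * V)"
      proof (cases "z \<in> A \<epsilon>")
        case True
        have "frac_weight \<alpha> z \<le> \<epsilon> powr (- (real DIM('a) + \<alpha>))"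
          using True that \<alpha> unfolding frac_weight_def A_def by (intro powr_mono2') auto
        moreover have "\<bar>v (x + z) - v x\<bar> \<le> 2 * V" using V[of "x + z"] V[of x] by linarith
        ultimately show ?thesis using True frac_weight_nonneg[of \<alpha> z]
          by (simp add: g_def abs_mult mult_mono)
      next
        case False
        then show ?thesis using order_trans[OF abs_ge_zero V] by (simp add: g_def)
      qed
    qed (simp add: g_def)
    have ig': "integrable lborel (\<lambda>z. g (- z))" "(LINT z|lborel. g (- z)) = (LINT z|lborel. g z)"
      using integrable_lborel_reflect[OF ig, of 0] integral_lborel_reflect[OF gm, of 0] by simp_all
    have "2 * (LINT z|lborel. g z) = (LINT z|lborel. g z + g (- z))"
      using ig ig' by simp
    also have "\<dots> = (LINT z|lborel. indicator (A \<epsilon>) z * D z)"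
      by (intro Bochner_Integration.integral_cong refl)
        (auto simp: g_def D_def A_def frac_weight_minus algebra_simps split: split_indicator)
    finally have "(LINT z|lborel. g z) = 1 / 2 * (LINT z|lborel. indicator (A \<epsilon>) z * D z)" by simp
    then show ?thesis
      unfolding \<mu>_def A_def[symmetric] G_def C_def g_def
      by (subst set_integral_scaled_frac_measure[OF \<alpha>(1) c]) auto
  qed
  have Gb: "\<bar>G \<epsilon>\<bar> \<le> C * (LINT z|lborel. K z)" if "\<epsilon> \<ge> 0" for \<epsilon>
  proof -
    have "\<bar>LINT z|lborel. indicator (A \<epsilon>) z * D z\<bar> \<le> (LINT z|lborel. K z)"
      by (rule integral_abs_bound_integral[OF iD[OF that] iK DK[OF that]])
    then have "\<bar>1 / 2 * (LINT z|lborel. indicator (A \<epsilon>) z * D z)\<bar> \<le> (LINT z|lborel. K z)" by simp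
    from mult_left_mono[OF this C] show ?thesis unfolding G_def abs_mult[of C] using C by (simp only: abs_of_nonneg)
  qed
  \<comment> \<open>\<open>nonlocal_lt\<close> is a \<open>Lim\<close> and carries information only
    once convergence is known. The limit exists by dominated convergence, with the majorant
    \<open>K\<close> supplied by the second differences.\<close>
  have "(G \<longlongrightarrow> G 0) (at_right 0)"
  proof (rule tendsto_at_right_sequentially[of 0 1])
    fix S :: "nat \<Rightarrow> real" assume S: "\<And>n. 0 < S n" "\<And>n. S n < 1" "decseq S" "S \<longlonglongrightarrow> 0"
    have "(\<lambda>n. LINT z|lborel. indicator (A (S n)) z * D z) \<longlonglongrightarrow> (LINT z|lborel. indicator (A 0) z * D z)"
    proof (rule integral_dominated_convergence[where w=K])
      show "AE z in lborel. (\<lambda>n. indicator (A (S n)) z * D z) \<longlonglongrightarrow> indicator (A 0) z * D z"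
      proof (rule AE_I2)
        fix z
        have "\<forall>\<^sub>F n in sequentially. indicator (A (S n)) z * D z = indicator (A 0) z * D z"
        proof (cases "z = 0")
          case True
          then show ?thesis using S(1) by (auto simp: A_def less_imp_not_less split: split_indicator)
        next
          case False
          then have "\<forall>\<^sub>F n in sequentially. S n < norm z" using S(4) by (intro order_tendstoD) auto
          then show ?thesis by eventually_elim (use False in \<open>auto simp: A_def split: split_indicator\<close>)
        qed
        then show "(\<lambda>n. indicator (A (S n)) z * D z) \<longlonglongrightarrow> indicator (A 0) z * D z" by (rule tendsto_eventually)
      qed
      show "\<And>n. AE z in lborel. norm (indicator (A (S n)) z * D z) \<le> K z"
        using DK S(1) by (intro AE_I2) (simp only: real_norm_def less_imp_le)
    qed (use iK in measurable)
    then show "(\<lambda>n. G (S n)) \<longlonglongrightarrow> G 0" unfolding G_def by (intro tendsto_intros)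
  qed simp
  moreover have "\<forall>\<^sub>F \<epsilon> in at_right 0. G \<epsilon> = (LINT z:{z. \<epsilon> < norm z \<and> norm z < 1}|\<mu>. v (x + z) - v x)"
    by (rule eventually_mono[OF eventually_at_right_less]) (simp add: eq)
  ultimately have "((\<lambda>\<epsilon>. LINT z:{z. \<epsilon> < norm z \<and> norm z < 1}|\<mu>. v (x + z) - v x) \<longlongrightarrow> G 0) (at_right 0)"
    by (rule Lim_transform_eventually)
  then have "nonlocal_lt \<mu> 1 v x = G 0" unfolding nonlocal_lt_def by (intro tendsto_Lim) simp_all
  then show ?thesis using Gb[of 0] unfolding \<mu>_def C_def K_def by (simp add: mult_ac)
qed

section \<open>Entropy solutions as asymptotic sub- and supersolutions\<close>

text \<open>Solutions are Lebesgue measurable and essentially bounded. Truncating a Borel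
  representative makes it bounded everywhere, so that the doubling can work with Borel functions and
  pointwise bounds.\<close>

lemma lebesgue_on_borel_representative:
  fixes g :: "'e::euclidean_space \<Rightarrow> real"
  assumes S: "S \<in> sets borel" and g: "g \<in> borel_measurable (lebesgue_on S)"
    and C: "AE x in lebesgue_on S. \<bar>g x\<bar> \<le> C" "0 \<le> C"
  obtains h where "h \<in> borel_measurable borel" "\<And>x. \<bar>h x\<bar> \<le> C" "AE x in lborel. x \<in> S \<longrightarrow> g x = h x"
proof -
  have Sl: "S \<inter> space lebesgue \<in> sets lebesgue" using S by simp
  have "(\<lambda>x. indicator S x *\<^sub>R g x) \<in> borel_measurable lebesgue"
    using g borel_measurable_restrict_space_iff[OF Sl] by blast
  then obtain h where h: "h \<in> borel_measurable lborel" "AE x in lborel. indicator S x *\<^sub>R g x = h x"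
    using completion_ex_borel_measurable_real by blast
  show thesis
  proof (rule that[of "\<lambda>x. max (- C) (min C (h x))"])
    show "(\<lambda>x. max (- C) (min C (h x))) \<in> borel_measurable borel" using h(1) by simp
    show "\<bar>max (- C) (min C (h x))\<bar> \<le> C" for x using C(2) by auto
    have "AE x in lborel. x \<in> S \<longrightarrow> \<bar>g x\<bar> \<le> C"
      using C(1) unfolding AE_restrict_space_iff[OF Sl] AE_completion_iff .
    then show "AE x in lborel. x \<in> S \<longrightarrow> g x = max (- C) (min C (h x))"
      using h(2) by eventually_elim auto
  qed
qed

lemma integral_lebesgue_on_eq:
  fixes g h :: "'e::euclidean_space \<Rightarrow> real"
  assumes S: "S \<in> sets borel" and h: "(\<lambda>x. indicator S x * h x) \<in> borel_measurable borel"
    and eq: "AE x in lborel. x \<in> S \<longrightarrow> g x = h x"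
  shows "(LINT x|lebesgue_on S. g x) = (LINT x|lborel. indicator S x * h x)"
proof -
  have eq': "AE x in lebesgue. indicator S x * h x = indicator S x *\<^sub>R g x"
    unfolding AE_completion_iff using eq by eventually_elim (auto split: split_indicator)
  have h': "(\<lambda>x. indicator S x * h x) \<in> borel_measurable lebesgue"
    by (rule measurable_completion) (use h in simp)
  have "(LINT x|lebesgue_on S. g x) = (LINT x|lebesgue. indicator S x *\<^sub>R g x)"
    using S by (intro integral_restrict_space) simp
  also have "\<dots> = (LINT x|lebesgue. indicator S x * h x)"
    by (rule integral_cong_AE[OF borel_measurable_AE[OF h' eq'] h']) (use eq' in eventually_elim, auto)
  also have "\<dots> = (LINT x|lborel. indicator S x * h x)" by (rule integral_completion) (use h in simp)
  finally show ?thesis .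
qed

text \<open>If \<open>g\<close> is not integrable its integral is 0 by convention, and the bound is
  trivial. The nonlocal terms can thus be estimated without discussing their measurability.\<close>

lemma abs_integral_lebesgue_on_le:
  fixes g :: "'e::euclidean_space \<Rightarrow> real"
  assumes S: "S \<in> sets borel" and K: "K \<in> sets borel" "bounded K"
    and g: "AE x in lborel. x \<in> S \<longrightarrow> \<bar>g x\<bar> \<le> B * indicator K x" and B: "0 \<le> B"
  shows "\<bar>LINT x|lebesgue_on S. g x\<bar> \<le> B * measure lborel K"
proof -
  have Sl: "S \<inter> space lebesgue \<in> sets lebesgue" using S by simp
  have iK: "integrable lebesgue (\<lambda>x. B * indicator K x)"
    using K emeasure_bounded_finite[OF K(2)] by (intro integrable_mult_right integrable_real_indicator) auto
  have mK: "(LINT x|lebesgue. B * indicator K x) = B * measure lborel K" using K by simp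
  show ?thesis
  proof (cases "integrable (lebesgue_on S) g")
    case True
    then have i: "integrable lebesgue (\<lambda>x. indicator S x *\<^sub>R g x)" using integrable_restrict_space[OF Sl] by blast
    have "\<bar>LINT x|lebesgue. indicator S x *\<^sub>R g x\<bar> \<le> (LINT x|lebesgue. \<bar>indicator S x *\<^sub>R g x\<bar>)"
      by (rule integral_abs_bound)
    also have "\<dots> \<le> (LINT x|lebesgue. B * indicator K x)"
    proof (rule integral_mono_AE[OF integrable_abs[OF i] iK])
      have "AE x in lebesgue. x \<in> S \<longrightarrow> \<bar>g x\<bar> \<le> B * indicator K x" using g unfolding AE_completion_iff .
      then show "AE x in lebesgue. \<bar>indicator S x *\<^sub>R g x\<bar> \<le> B * indicator K x"
        by eventually_elim (use B in \<open>auto split: split_indicator\<close>)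
    qed
    finally show ?thesis unfolding integral_restrict_space[OF Sl] mK .
  next
    case False
    then show ?thesis using B by (simp add: not_integrable_integral_eq)
  qed
qed

lemma partial_t_eq_nabla:
  fixes \<phi> :: "real \<times> 'a::euclidean_space \<Rightarrow> real"
  assumes "smooth \<phi>" shows "((\<lambda>\<tau>. \<phi> (\<tau>, x)) has_real_derivative fst (nabla \<phi> (t, x))) (at t)"
    and "partial_t \<phi> t x = fst (nabla \<phi> (t, x))"
proof -
  have "((\<lambda>\<tau>. (\<tau>, x)) has_derivative (\<lambda>h. (h, 0))) (at t)" by (auto intro!: derivative_eq_intros)
  from has_derivative_compose[OF this smooth_has_nabla[OF assms]]
  have "((\<lambda>\<tau>. \<phi> (\<tau>, x)) has_derivative (\<lambda>h. nabla \<phi> (t, x) \<bullet> (h, 0))) (at t)" .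
  then show d: "((\<lambda>\<tau>. \<phi> (\<tau>, x)) has_real_derivative fst (nabla \<phi> (t, x))) (at t)"
    by (simp add: has_field_derivative_def inner_prod_def)
  show "partial_t \<phi> t x = fst (nabla \<phi> (t, x))" unfolding partial_t_def by (rule DERIV_imp_deriv[OF d])
qed

lemma grad_x_eq_nabla:
  fixes \<phi> :: "real \<times> 'a::euclidean_space \<Rightarrow> real"
  assumes "smooth \<phi>" shows "grad_x \<phi> t x = snd (nabla \<phi> (t, x))"
proof -
  have "deriv (\<lambda>h. \<phi> (t, x + h *\<^sub>R i)) 0 = snd (nabla \<phi> (t, x)) \<bullet> i" for i
  proof -
    have d: "((\<lambda>h. (t, x + h *\<^sub>R i)) has_derivative (\<lambda>h. (0, h *\<^sub>R i))) (at 0)" by (auto intro!: derivative_eq_intros)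
    have "(\<phi> has_derivative (\<lambda>h. nabla \<phi> (t, x) \<bullet> h)) (at (t, x + 0 *\<^sub>R i))"
      using smooth_has_nabla[OF assms, of "(t, x)"] by simp
    from has_derivative_compose[OF d this]
    have "((\<lambda>h. \<phi> (t, x + h *\<^sub>R i)) has_derivative (\<lambda>h. nabla \<phi> (t, x) \<bullet> (0, h *\<^sub>R i))) (at 0)" .
    then have "((\<lambda>h. \<phi> (t, x + h *\<^sub>R i)) has_real_derivative snd (nabla \<phi> (t, x)) \<bullet> i) (at 0)"
      by (simp add: has_field_derivative_def inner_prod_def mult_commute_abs)
    then show ?thesis by (rule DERIV_imp_deriv)
  qed
  then show ?thesis unfolding grad_x_def by (simp add: euclidean_representation)
qed

lemma test_on_slab_Cc_infty:
  fixes \<phi> :: "real \<times> 'a::euclidean_space \<Rightarrow> real"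
  assumes "test_on (slab T UNIV) \<phi>" shows "Cc_infty ({0..<T} \<times> UNIV) \<phi>"
proof -
  obtain K where K: "compact K" "K \<subseteq> slab T UNIV" "\<And>z. z \<notin> K \<Longrightarrow> \<phi> z = 0" using test_onE[OF assms] by blast
  have "closed ({0::real..} \<times> (UNIV :: 'a set))" by (intro closed_Times closed_atLeast closed_UNIV)
  then have "compact (K \<inter> {0..} \<times> UNIV)" by (rule compact_Int_closed[OF K(1)])
  moreover have "K \<inter> {0..} \<times> UNIV \<subseteq> {0..<T} \<times> UNIV" using K(2) by (auto simp: slab_def)
  moreover have "\<phi> z = 0" if "z \<in> {0..<T} \<times> UNIV - (K \<inter> {0..} \<times> UNIV)" for z
    using that by (intro K(3)) auto
  moreover have "Ck_on k ({0..<T} \<times> UNIV) \<phi>" for k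
    using test_on_smooth[OF assms] Ck_on_subset[OF _ subset_UNIV] unfolding smooth_def by blast
  ultimately show ?thesis unfolding Cc_infty_def by blast
qed

lemma part_le_0: "s * a \<le> 0 \<Longrightarrow> part s a = 0"
  by (simp add: part_def)

text \<open>One formula for both signs: the flux \<open>s *\<^sub>R f (s * r)\<close> is
  \<open>f\<close> itself for \<open>s = 1\<close> and the reflected flux for
  \<open>s = -1\<close>.\<close>

lemma kflux_signed:
  assumes "s \<in> {1, -1}"
  shows "kflux (\<lambda>r. s *\<^sub>R f (s * r)) (s * \<alpha>) (s * k) = (part s (\<alpha> - k), entropy_flux f s \<alpha> k)"
  using assms by (auto simp: kflux_def part_def entropy_flux_def sgn_part_def max_def algebra_simps)

text \<open>At nonpositive times the flux is switched off and \<open>w\<close> does not depend on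
  time, so only the time integral of the derivative of \<open>\<phi>\<close> is left. As
  \<open>\<phi>\<close> vanishes at time -1, it equals \<open>\<phi> (0, x)\<close> and reproduces
  the initial term of the entropy inequality.\<close>

lemma entropy_lhs_local_eq_flux_int:
  fixes f :: "real \<Rightarrow> 'a::euclidean_space"
  assumes \<Omega>: "open \<Omega>" "bounded \<Omega>" and T: "0 < T" and f: "continuous_on UNIV f"
    and w: "w \<in> borel_measurable borel" "\<And>z. \<bar>w z\<bar> \<le> M"
    and w0: "\<And>z. fst z \<le> 0 \<Longrightarrow> w z = v0 (snd z)" and u0: "AE x in lborel. x \<in> \<Omega> \<longrightarrow> u0 x = v0 x"
    and v0: "v0 \<in> borel_measurable borel"
    and u: "AE z in lborel. z \<in> {0<..<T} \<times> \<Omega> \<longrightarrow> u z = w z"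
    and s: "s \<in> {1, -1}" and \<phi>: "test_on (slab T UNIV) \<phi>"
  shows "entropy_lhs_local T \<Omega> f u s k \<phi> - (LINT x|lebesgue_on \<Omega>. part s (u0 x - k) * \<phi> (0, x)) =
    - flux_int (slab T \<Omega>) (\<lambda>r. s *\<^sub>R f (s * r)) (\<lambda>z. s * w z) (\<lambda>_. s * k) \<phi>"
proof -
  define Q where "Q = {0<..<T} \<times> \<Omega>"
  define R where "R = {-1<..0 :: real} \<times> \<Omega>"
  note sm = test_on_smooth[OF \<phi>]
  have [measurable]: "\<Omega> \<in> sets borel" using \<Omega> by simp
  have Qm[measurable]: "Q \<in> sets borel" "R \<in> sets borel" unfolding Q_def R_def by (intro borel_Times; simp)+
  define h where "h z = kflux (\<lambda>r. s *\<^sub>R f (s * r)) (s * w z) (s * k) \<bullet> switched (fst z) (nabla \<phi> z)" for z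
  have fs: "continuous_on UNIV (\<lambda>r. s *\<^sub>R f (s * r))"
    by (intro continuous_intros continuous_on_compose2[OF f]) auto
  have sw: "(\<lambda>z. s * w z) \<in> borel_measurable borel" "\<And>z. \<bar>s * w z\<bar> \<le> max M \<bar>k\<bar>" "\<bar>s * k\<bar> \<le> max M \<bar>k\<bar>"
    using w s by (auto simp: abs_mult le_max_iff_disj)
  have ih: "integrable lborel (\<lambda>z. indicator S z * h z)" if "S \<in> sets borel" for S
    unfolding h_def by (rule flux_integrand_integrable[OF fs that sw(1) _ sw(2) _ \<phi>]) (use sw(3) in auto)
  have hQ: "h z = part s (w z - k) * partial_t \<phi> (fst z) (snd z) + entropy_flux f s (w z) k \<bullet> grad_x \<phi> (fst z) (snd z)"
    if "z \<in> Q" for z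
    using that unfolding h_def kflux_signed[OF s] partial_t_eq_nabla(2)[OF sm] grad_x_eq_nabla[OF sm]
    by (auto simp: switched_def inner_prod_def Q_def)
  have hR: "h z = part s (v0 (snd z) - k) * fst (nabla \<phi> z)" if "fst z \<le> 0" for z
    using that w0[OF that] unfolding h_def kflux_signed[OF s] by (simp add: switched_def inner_prod_def)
  have 1: "entropy_lhs_local T \<Omega> f u s k \<phi> = - (LINT z|lborel. indicator Q z * h z)"
    unfolding entropy_lhs_local_def Q_def[symmetric] case_prod_beta'
  proof (subst integral_lebesgue_on_eq[where h=h])
    show "AE z in lborel. z \<in> Q \<longrightarrow>
      part s (u (fst z, snd z) - k) * partial_t \<phi> (fst z) (snd z) + entropy_flux f s (u (fst z, snd z)) k \<bullet> grad_x \<phi> (fst z) (snd z) = h z"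
      using u unfolding Q_def[symmetric] by eventually_elim (simp add: hQ)
  qed (use borel_measurable_integrable[OF ih[OF Qm(1)]] in simp_all)
  have 2: "flux_int (slab T \<Omega>) (\<lambda>r. s *\<^sub>R f (s * r)) (\<lambda>z. s * w z) (\<lambda>_. s * k) \<phi> =
      (LINT z|lborel. indicator Q z * h z) + (LINT z|lborel. indicator R z * h z)"
    unfolding flux_int_def h_def[symmetric] Bochner_Integration.integral_add[OF ih[OF Qm(1)] ih[OF Qm(2)], symmetric]
    using T by (intro Bochner_Integration.integral_cong refl) (auto simp: slab_def Q_def R_def split: split_indicator)
  have 3: "(LINT z|lborel. indicator R z * h z) = (LINT x|lborel. indicator \<Omega> x * (part s (v0 x - k) * \<phi> (0, x)))"
    unfolding integral_lborel_snd[OF ih[OF Qm(2)]]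
  proof (rule Bochner_Integration.integral_cong[OF refl])
    fix x
    define g where "g t = fst (nabla \<phi> (t, x))" for t
    have gc: "isCont g t" for t
    proof -
      have "continuous_on UNIV (\<lambda>t. fst (nabla \<phi> (t, x)))"
        by (intro continuous_intros continuous_on_compose2[OF continuous_on_nabla[OF sm, of UNIV]]) auto
      then show ?thesis unfolding g_def by (simp add: continuous_on_eq_continuous_at)
    qed
    have "(LINT t|lborel. g t * indicator {-1..0} t) = \<phi> (0, x) - \<phi> (-1, x)"
      by (rule integral_FTC_Icc_real) (use partial_t_eq_nabla(1)[OF sm, of x, folded g_def] gc in auto)
    moreover have "\<phi> (-1, x) = 0"
    proof -
      obtain K where "K \<subseteq> slab T UNIV" "\<And>z. z \<notin> K \<Longrightarrow> \<phi> z = 0" using test_onE[OF \<phi>] by metis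
      moreover have "(-1, x) \<notin> slab T UNIV" by (simp add: slab_def)
      ultimately show ?thesis by blast
    qed
    moreover have "(LINT t|lborel. g t * indicator {-1<..0} t) = (LINT t|lborel. g t * indicator {-1..0} t)"
    proof (rule integral_cong_AE)
      have [measurable]: "g \<in> borel_measurable borel"
        using gc by (intro borel_measurable_continuous_onI) (simp add: continuous_on_eq_continuous_at)
      show "(\<lambda>t. g t * indicator {-1<..0} t) \<in> borel_measurable lborel" "(\<lambda>t. g t * indicator {-1..0} t) \<in> borel_measurable lborel"
        by simp_all
      show "AE t in lborel. g t * indicator {-1<..0} t = g t * indicator {-1..0} t"
        using AE_lborel_singleton[of "-1 :: real"] by eventually_elim (auto split: split_indicator)
    qed
    ultimately have "(LINT t|lborel. g t * indicator {-1<..0} t) = \<phi> (0, x)" by simp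
    moreover have "(LINT t|lborel. indicator R (t, x) * h (t, x)) =
      (LINT t|lborel. (indicator \<Omega> x * part s (v0 x - k)) * (g t * indicator {-1<..0} t))"
      by (intro Bochner_Integration.integral_cong refl) (auto simp: R_def g_def hR split: split_indicator)
    ultimately show "(LINT t|lborel. indicator R (t, x) * h (t, x)) = indicator \<Omega> x * (part s (v0 x - k) * \<phi> (0, x))"
      by simp
  qed
  have 4: "(LINT x|lebesgue_on \<Omega>. part s (u0 x - k) * \<phi> (0, x)) = (LINT x|lborel. indicator \<Omega> x * (part s (v0 x - k) * \<phi> (0, x)))"
  proof (rule integral_lebesgue_on_eq)
    have "(\<lambda>x. \<phi> (0, x)) \<in> borel_measurable borel"
      by (intro borel_measurable_continuous_onI continuous_on_compose2[OF smooth_continuous_on[OF sm, of UNIV]] continuous_intros) auto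
    then show "(\<lambda>x. indicator \<Omega> x * (part s (v0 x - k) * \<phi> (0, x))) \<in> borel_measurable borel"
      using v0 unfolding part_def by simp
    show "AE x in lborel. x \<in> \<Omega> \<longrightarrow> part s (u0 x - k) * \<phi> (0, x) = part s (v0 x - k) * \<phi> (0, x)"
      using u0 by eventually_elim simp
  qed simp
  show ?thesis unfolding 1 2 3 4 by simp
qed

text \<open>For a constant on the admissible side of the datum the boundary integrand is zero
  pointwise, and the initial term is left.\<close>

lemma entropy_rhs_eq_initial:
  assumes "open \<Omega>" and "\<And>t x. t \<in> {0<..<T} \<Longrightarrow> x \<in> frontier \<Omega> \<Longrightarrow> part s (ubar (t, x) - k) * \<phi> (t, x) = 0"
  shows "entropy_rhs T \<Omega> f I ubar u0 s k \<phi> = (LINT x|lebesgue_on \<Omega>. part s (u0 x - k) * \<phi> (0, x))"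
proof -
  have "(LINT t|lebesgue_on {0<..<T}. (LINT x:frontier \<Omega>|surface_measure. part s (ubar (t, x) - k) * \<phi> (t, x))) =
      (LINT t|lebesgue_on {0<..<T}. 0)"
  proof (rule Bochner_Integration.integral_cong[OF refl])
    fix t assume "t \<in> space (lebesgue_on {0<..<T})"
    then have "t \<in> {0<..<T}" by simp
    then have "(\<lambda>x. indicator (frontier \<Omega>) x *\<^sub>R (part s (ubar (t, x) - k) * \<phi> (t, x))) = (\<lambda>_. 0)"
      using assms(2) by (auto split: split_indicator)
    then show "(LINT x:frontier \<Omega>|surface_measure. part s (ubar (t, x) - k) * \<phi> (t, x)) = 0"
      unfolding set_lebesgue_integral_def by simp
  qed
  then show ?thesis unfolding entropy_rhs_def by simp
qed

text \<open>The operator depends on the value at \<open>x\<close> itself and otherwise on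
  \<open>v\<close> up to null sets. This transfers it from a solution to its Borel representative on
  almost every time slice.\<close>

lemma nonlocal_ge_cong:
  fixes v v' :: "'a::euclidean_space \<Rightarrow> real"
  assumes \<alpha>: "0 < \<alpha>" and c: "0 \<le> c" and [measurable]: "v' \<in> borel_measurable borel"
    and x: "v x = v' x" and v: "AE y in lborel. v y = v' y"
  shows "nonlocal_ge (scale_measure (ennreal c) (frac_measure \<alpha>)) r v x =
    nonlocal_ge (scale_measure (ennreal c) (frac_measure \<alpha>)) r v' x"
proof -
  let ?\<mu> = "scale_measure (ennreal c) (frac_measure \<alpha>) :: 'a measure"
  let ?g = "\<lambda>v z. indicator {z. r \<le> norm z} z *\<^sub>R (v (x + z) - v x)"
  have "AE z in lborel. v (x + z) = v' (x + z)"
  proof -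
    have "AE y in distr lborel borel ((+) x). v y = v' y" unfolding lborel_distr_plus by (rule v)
    then show ?thesis by (rule AE_distrD[rotated]) simp
  qed
  then have eq: "AE z in lborel. ?g v' z = ?g v z" by eventually_elim (simp add: x)
  have m': "?g v' \<in> borel_measurable lebesgue" by (rule measurable_completion) simp
  have m: "?g v \<in> borel_measurable lebesgue"
    by (rule borel_measurable_AE[OF m']) (use eq in \<open>simp only: AE_completion_iff\<close>)
  have fm: "(\<lambda>z. ennreal (c * frac_const DIM('a) \<alpha> * frac_weight \<alpha> z)) \<in> borel_measurable (lebesgue :: 'a measure)"
    by (rule measurable_completion) simp
  have "AE z in ?\<mu>. ?g v z = ?g v' z"
    unfolding scaled_frac_measure[OF \<alpha> c] AE_density[OF fm] AE_completion_iff
    using eq by eventually_elim metis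
  then show ?thesis unfolding nonlocal_ge_def set_lebesgue_integral_def
    by (intro integral_cong_AE) (use m m' in \<open>simp_all add: frac_measure_def\<close>)
qed

text \<open>Fubini, but stated at points of the product: the exceptional times form a null set, and
  its product with the whole space is null again. In this form it combines with other
  almost-everywhere statements at the same point.\<close>

lemma AE_slices:
  fixes P :: "'e::euclidean_space \<times> 'd::euclidean_space \<Rightarrow> bool"
  assumes "AE z in lborel. P z"
  shows "AE z in (lborel :: ('e \<times> 'd) measure). AE y in lborel. P (fst z, y)"
proof -
  have "AE z in lborel \<Otimes>\<^sub>M lborel. P z" unfolding lborel_prod by (rule assms)
  then have "AE t in lborel. AE y in lborel. P (t, y)" by (rule lborel_pair.AE_pair)
  then obtain N where N: "{t. \<not> (AE y in lborel. P (t, y))} \<subseteq> N" "N \<in> sets lborel" "emeasure lborel N = 0"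
    by (auto elim: AE_E)
  have "emeasure (lborel \<Otimes>\<^sub>M lborel) (N \<times> (UNIV :: 'd set)) = emeasure lborel N * emeasure lborel (UNIV :: 'd set)"
    by (rule lborel.emeasure_pair_measure_Times) (use N in auto)
  then have 0: "emeasure lborel (N \<times> (UNIV :: 'd set)) = 0" using N(3) by (simp add: lborel_prod)
  have s: "N \<times> (UNIV :: 'd set) \<in> sets lborel" using N(2) borel_Times[of N UNIV] by simp
  show ?thesis by (rule AE_I[OF _ 0 s]) (use N(1) in auto)
qed

locale dirichlet_data =
  fixes T \<alpha> M :: real and \<Omega> :: "'a::euclidean_space set" and f :: "real \<Rightarrow> 'a" and b :: "real \<Rightarrow> real"
    and uc ubar :: "real \<times> 'a \<Rightarrow> real" and u0 v0 :: "'a \<Rightarrow> real"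
  assumes T: "0 < T" and \<Omega>: "open \<Omega>" "bounded \<Omega>" and f: "continuous_on UNIV f"
    and b: "continuous_on UNIV b" "mono b" and \<alpha>: "0 < \<alpha>" "\<alpha> < 2"
    and ubar: "continuous_on ({0..T} \<times> UNIV) ubar" "\<And>z. z \<in> {0..T} \<times> UNIV \<Longrightarrow> \<bar>ubar z\<bar> \<le> M"
    and uc: "\<And>z. z \<in> {0<..<T} \<times> (- \<Omega>) \<Longrightarrow> uc z = ubar z"
    and v0: "v0 \<in> borel_measurable borel" "\<And>x. \<bar>v0 x\<bar> \<le> M" and u0: "AE x in lborel. x \<in> \<Omega> \<longrightarrow> u0 x = v0 x"
begin

lemma M: "0 \<le> M"
  using v0(2)[of 0] by simp

lemma Q_borel: "{0<..<T} \<times> \<Omega> \<in> sets borel" and Q_bounded: "bounded ({0<..<T} \<times> \<Omega>)"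
  using \<Omega> by (auto intro!: borel_Times bounded_Times bounded_subset[OF bounded_closed_interval[of 0 T]])

lemma b_measurable [measurable]: "b \<in> borel_measurable borel"
  using b(1) by (rule borel_measurable_continuous_onI)

lemma frontier_subset: "frontier \<Omega> \<subseteq> - \<Omega>"
  using \<Omega>(1) by (auto simp: frontier_def interior_open)

text \<open>The values on \<open>Q\<close> are left open, for a representative of the solution. At
  nonpositive times the equality is exact and not merely almost everywhere, so any two extensions
  agree there, as the comparison demands.\<close>

definition extended :: "(real \<times> 'a \<Rightarrow> real) \<Rightarrow> bool" where
  "extended w \<longleftrightarrow> w \<in> borel_measurable borel \<and> (\<forall>z. fst z \<le> 0 \<longrightarrow> w z = v0 (snd z)) \<and>
    (\<forall>z\<in>{0<..<T} \<times> (- \<Omega>). w z = ubar z)"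

lemma ex_extended:
  assumes u: "u \<in> borel_measurable (lebesgue_on ({0<..<T} \<times> \<Omega>))"
    and C: "AE z in lebesgue_on ({0<..<T} \<times> \<Omega>). \<bar>u z\<bar> \<le> C" "M \<le> C"
  obtains w where "extended w" "\<And>z. \<bar>w z\<bar> \<le> C" "AE z in lborel. z \<in> {0<..<T} \<times> \<Omega> \<longrightarrow> u z = w z"
proof -
  have "0 \<le> C" using M C(2) by simp
  from lebesgue_on_borel_representative[OF Q_borel u C(1) this]
  obtain h where h: "h \<in> borel_measurable borel" "\<And>x. \<bar>h x\<bar> \<le> C" "AE x in lborel. x \<in> {0<..<T} \<times> \<Omega> \<longrightarrow> u x = h x"
    by blast
  define R where "R = {0<..<T} \<times> (- \<Omega>)"
  have R: "R \<in> sets borel" unfolding R_def using \<Omega> by (intro borel_Times) auto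
  have N: "{..0} \<times> UNIV \<in> sets (borel :: (real \<times> 'a) measure)" by (intro borel_Times) auto
  define w where "w z = indicator ({..0} \<times> UNIV) z * v0 (snd z) + indicator ({0<..<T} \<times> \<Omega>) z * h z + indicator R z * ubar z" for z
  show thesis
  proof (rule that[of w])
    have "continuous_on R ubar" by (rule continuous_on_subset[OF ubar(1)]) (auto simp: R_def)
    then have "(\<lambda>z. indicator R z *\<^sub>R ubar z) \<in> borel_measurable borel"
      by (rule borel_measurable_continuous_on_indicator[OF R])
    then have "(\<lambda>z. indicator R z * ubar z) \<in> borel_measurable borel" by simp
    then have "w \<in> borel_measurable borel" unfolding w_def
      by (intro borel_measurable_add borel_measurable_times[of "indicator ({..0} \<times> UNIV)"]
          borel_measurable_times[of "indicator ({0<..<T} \<times> \<Omega>)"] borel_measurable_indicator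
          measurable_of_second[OF v0(1)] h(1) N Q_borel)
    then show "extended w" unfolding extended_def by (auto simp: w_def R_def split: split_indicator)
    show "\<bar>w z\<bar> \<le> C" for z
    proof -
      have "\<bar>ubar z\<bar> \<le> C" if "z \<in> R" using ubar(2)[of z] that C(2) by (auto simp: R_def)
      moreover have "\<bar>v0 (snd z)\<bar> \<le> C" using v0(2)[of "snd z"] C(2) by simp
      ultimately show ?thesis using h(2)[of z] \<open>0 \<le> C\<close>
        by (cases z) (auto simp: w_def R_def split: split_indicator)
    qed
    show "AE z in lborel. z \<in> {0<..<T} \<times> \<Omega> \<longrightarrow> u z = w z"
      using h(3) by eventually_elim (auto simp: w_def R_def split: split_indicator)
  qed
qed

lemma extended_eq_exterior:
  assumes w: "extended w" "AE z in lborel. z \<in> {0<..<T} \<times> \<Omega> \<longrightarrow> u z = w z"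
    and u: "AE z in lebesgue_on ({0<..<T} \<times> (- \<Omega>)). u z = uc z"
  shows "AE z in lborel. z \<in> {0<..<T} \<times> UNIV \<longrightarrow> u z = w z"
proof -
  have "{0<..<T} \<times> (- \<Omega>) \<in> sets borel" using \<Omega> by (intro borel_Times) auto
  then have "AE z in lborel. z \<in> {0<..<T} \<times> (- \<Omega>) \<longrightarrow> u z = uc z"
    using u AE_restrict_space_iff[of "{0<..<T} \<times> (- \<Omega>)" lebesgue] by (simp add: AE_completion_iff)
  then show ?thesis using w(2)
  proof eventually_elim
    case (elim z)
    show ?case
    proof
      assume "z \<in> {0<..<T} \<times> UNIV"
      then consider "z \<in> {0<..<T} \<times> \<Omega>" | "z \<in> {0<..<T} \<times> (- \<Omega>)" by auto
      then show "u z = w z"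
      proof cases
        case 2
        then show ?thesis using elim(1) uc[OF 2] w(1) unfolding extended_def by metis
      qed (use elim in blast)
    qed
  qed
qed

lemma part_b_le_0: "s \<in> {1, -1} \<Longrightarrow> s * (r - k) \<le> 0 \<Longrightarrow> part s (b r - b k) = 0"
  using monoD[OF b(2), of r k] monoD[OF b(2), of k r] by (auto simp: part_def)

text \<open>
  The convolution with the tail of the Levy measure preserves the integral of the truncation
  \<open>q\<close> of \<open>s (b(u) - b(k))\<close>, which is supported where \<open>s (u - k) > 0\<close>.
\<close>

lemma nonlocal_ge_sign:
  assumes s: "s \<in> {1, -1}" and c: "0 \<le> c"
    and w: "w \<in> borel_measurable borel" "\<And>z. \<bar>w z\<bar> \<le> C"
    and wk: "\<And>z. z \<in> {0<..<T} \<times> (- \<Omega>) \<Longrightarrow> s * (w z - k) \<le> 0"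
    and \<theta>: "\<theta> \<in> borel_measurable borel" "\<And>t. 0 \<le> \<theta> t" "\<And>t. \<theta> t \<le> 1"
    and u: "AE z in lborel. z \<in> {0<..<T} \<times> UNIV \<longrightarrow> u z = w z"
  shows "(LINT z|lebesgue_on ({0<..<T} \<times> \<Omega>).
    nonlocal_ge (scale_measure (ennreal c) (frac_measure \<alpha>)) 1 (\<lambda>y. b (u (fst z, y))) (snd z) *
      sgn_part s (u z - k) * \<theta> (fst z)) \<le> 0"
proof -
  define Q where "Q = {0<..<T} \<times> \<Omega>"
  define S where "S = {0<..<T} \<times> (UNIV :: 'a set)"
  define K0 where "K0 = c * frac_const DIM('a) \<alpha>"
  have K0: "0 \<le> K0" unfolding K0_def using c frac_const_nonneg[OF \<alpha>(1)] by simp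
  have Qm[measurable]: "Q \<in> sets borel" unfolding Q_def by (rule Q_borel)
  have Ql: "Q \<inter> space lebesgue \<in> sets lebesgue" by simp
  have Sm[measurable]: "S \<in> sets borel" unfolding S_def by (intro borel_Times) auto
  note [measurable] = w(1) \<theta>(1)
  define p where "p z = part s (b (w z) - b k)" for z
  define q where "q z = indicator S z * (\<theta> (fst z) * p z)" for z
  have pm[measurable]: "p \<in> borel_measurable borel" unfolding p_def part_def by simp
  have th: "(\<lambda>z :: real \<times> 'a. \<theta> (fst z)) \<in> borel_measurable borel" by (rule measurable_of_first[OF \<theta>(1)])
  have qm[measurable]: "q \<in> borel_measurable borel" unfolding q_def
    by (intro borel_measurable_times borel_measurable_indicator Sm th pm)
  have p0: "0 \<le> p z" for z by (simp add: p_def part_def)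
  have q0: "0 \<le> q z" for z unfolding q_def using p0 \<theta>(2) by simp
  obtain P where P: "\<And>r. \<bar>r\<bar> \<le> C \<Longrightarrow> \<bar>b r\<bar> \<le> P"
  proof -
    have "bounded (b ` {-C..C})"
      by (intro compact_imp_bounded compact_continuous_image continuous_on_subset[OF b(1)]) auto
    then obtain P where "\<And>y. y \<in> b ` {-C..C} \<Longrightarrow> norm y \<le> P" unfolding bounded_iff by blast
    then show thesis by (intro that[of P]) (auto simp: abs_le_iff)
  qed
  define P' where "P' = P + \<bar>b k\<bar>"
  have pb: "p z \<le> P'" for z
    using P[OF w(2), of z] s by (auto simp: p_def part_def P'_def)
  have qb: "q z \<le> P'" for z
  proof -
    have "\<theta> (fst z) * p z \<le> 1 * P'" using \<theta> pb p0 by (intro mult_mono) auto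
    then show ?thesis using order_trans[OF p0[of z] pb[of z]] by (auto simp: q_def split: split_indicator)
  qed
  have supp: "z \<in> Q \<and> s * (w z - k) > 0" if "q z \<noteq> 0" for z
  proof -
    have z: "z \<in> S" "p z \<noteq> 0" using that by (auto simp: q_def split: split_indicator_asm)
    then have g: "s * (w z - k) > 0" using part_b_le_0[OF s] unfolding p_def by (meson not_le)
    moreover have "z \<notin> {0<..<T} \<times> (- \<Omega>)" using wk[of z] g by auto
    ultimately show ?thesis using z(1) by (auto simp: S_def Q_def)
  qed
  have iq: "integrable lborel q"
    by (rule integrable_bounded_support[OF qm Q_bounded, where B=P'])
      (use supp q0 qb in \<open>auto simp: Q_def\<close>)
  define W where "W y = indicator {y :: 'a. 1 \<le> norm y} y * frac_weight \<alpha> y" for y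
  have W0: "0 \<le> W y" for y unfolding W_def by (simp add: frac_weight_nonneg)
  have iW: "integrable lborel W" unfolding W_def by (rule frac_weight_far[OF \<alpha>(1)])
  have Wm[measurable]: "W \<in> borel_measurable borel" using borel_measurable_integrable[OF iW] by simp
  define m where "m = (LINT y|lborel. W y)"
  \<comment> \<open>Jump density times the truncation at the landing point; jumps displace the space
    variable only. By translation invariance the total integral is \<open>m\<close> times that of
    \<open>q\<close>.\<close>
  define G where "G r = W (snd r) * q (fst r + (0, snd r))" for r
  have Gm: "G \<in> borel_measurable borel" unfolding G_def
    by (intro borel_measurable_times measurable_of_second[OF Wm] measurable_compose[OF _ qm]
        borel_measurable_continuous_onI continuous_intros)
  have iG: "integrable lborel G"
  proof (rule integrableI_nonneg)
    show "AE r in lborel. 0 \<le> G r" by (simp add: G_def W0 q0)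
    have "(\<integral>\<^sup>+ r. ennreal (G r) \<partial>lborel) = (\<integral>\<^sup>+ y. (\<integral>\<^sup>+ z. ennreal (G (z, y)) \<partial>lborel) \<partial>lborel)"
      by (rule nn_integral_lborel_snd) (use Gm in simp)
    also have "\<dots> = (\<integral>\<^sup>+ y. ennreal (W y) * (\<integral>\<^sup>+ z. ennreal (q z) \<partial>lborel) \<partial>lborel)"
    proof (rule nn_integral_cong)
      fix y
      have "(\<integral>\<^sup>+ z. ennreal (G (z, y)) \<partial>lborel) = (\<integral>\<^sup>+ z. ennreal (W y) * ennreal (q ((0, y) + z)) \<partial>lborel)"
        by (intro nn_integral_cong) (simp add: G_def ennreal_mult W0 q0 add.commute)
      also have "\<dots> = ennreal (W y) * (\<integral>\<^sup>+ z. ennreal (q ((0, y) + z)) \<partial>lborel)"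
        by (rule nn_integral_cmult) simp
      also have "(\<integral>\<^sup>+ z. ennreal (q ((0, y) + z)) \<partial>lborel) = (\<integral>\<^sup>+ z. ennreal (q z) \<partial>lborel)"
        by (rule nn_integral_lborel_translate) simp
      finally show "(\<integral>\<^sup>+ z. ennreal (G (z, y)) \<partial>lborel) = ennreal (W y) * (\<integral>\<^sup>+ z. ennreal (q z) \<partial>lborel)" .
    qed
    also have "\<dots> = ennreal m * ennreal (LINT z|lborel. q z)"
      using iW iq W0 q0 by (subst nn_integral_multc) (simp_all add: nn_integral_eq_integral m_def)
    also have "\<dots> < \<infinity>" by (simp add: ennreal_mult_less_top)
    finally show "(\<integral>\<^sup>+ r. ennreal (G r) \<partial>lborel) < \<infinity>" .
  qed (use Gm in simp)
  define N where "N z = (LINT y|lborel. G (z, y))" for z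
  have iN: "integrable lborel N" unfolding N_def by (rule integral_lborel_fst(2)[OF iG])
  have N0: "0 \<le> N z" for z unfolding N_def by (intro Bochner_Integration.integral_nonneg) (simp add: G_def W0 q0)
  have intN: "(LINT z|lborel. N z) = m * (LINT z|lborel. q z)"
  proof -
    have "(LINT z|lborel. N z) = (LINT y|lborel. LINT z|lborel. G (z, y))"
      unfolding N_def integral_lborel_fst(1)[OF iG, symmetric] by (rule integral_lborel_snd(1)[OF iG])
    also have "\<dots> = (LINT y|lborel. W y * (LINT z|lborel. q z))"
    proof (rule Bochner_Integration.integral_cong[OF refl])
      fix y
      have "(LINT z|lborel. q ((0, y) + z)) = (LINT z|lborel. q z)"
      proof -
        have "(LINT z|lborel. q z) = (LINT z|distr lborel borel ((+) (0, y)). q z)" by (simp add: lborel_distr_plus)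
        also have "\<dots> = (LINT z|lborel. q ((0, y) + z))" by (rule integral_distr) simp_all
        finally show ?thesis by simp
      qed
      then show "(LINT z|lborel. G (z, y)) = W y * (LINT z|lborel. q z)" by (simp add: G_def add.commute)
    qed
    finally show ?thesis by (simp add: m_def)
  qed
  have iNq: "integrable lborel (\<lambda>z. K0 * (N z - m * q z))" using iN iq by simp
  let ?g = "\<lambda>z. nonlocal_ge (scale_measure (ennreal c) (frac_measure \<alpha>)) 1 (\<lambda>y. b (u (fst z, y))) (snd z) *
      sgn_part s (u z - k) * \<theta> (fst z)"
  \<comment> \<open>Where \<open>s * (u z - k)\<close> is positive, a jump increases
    \<open>s\<close> times b(u) by at most as much as its truncation: the truncation is exact at the
    starting point and dominates at the landing point. Elsewhere the sign factor and
    \<open>q\<close> vanish, and \<open>N\<close> is nonnegative.\<close>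
  have le: "AE z in lborel. z \<in> Q \<longrightarrow> ?g z \<le> K0 * (N z - m * q z)"
    using u AE_slices[OF u]
  proof eventually_elim
    case (elim z)
    show ?case
    proof
      assume z: "z \<in> Q"
      obtain t x where tx: "z = (t, x)" by (cases z)
      have zS: "z \<in> S" "t \<in> {0<..<T}" using z by (auto simp: Q_def S_def tx)
      have uz: "u z = w z" using elim(1) zS(1) unfolding S_def by blast
      show "?g z \<le> K0 * (N z - m * q z)"
      proof (cases "s * (w z - k) > 0")
        case False
        then have "q z = 0" "sgn_part s (u z - k) = 0" using supp[of z] by (auto simp: sgn_part_def uz)
        then show ?thesis using K0 N0 by simp
      next
        case True
        have wt[measurable]: "(\<lambda>y. w (t, y)) \<in> borel_measurable borel"
          by (rule measurable_compose[OF _ w(1)], rule borel_measurable_continuous_onI) (intro continuous_intros)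
        have qt[measurable]: "(\<lambda>y. q (t, x + y)) \<in> borel_measurable borel"
          by (rule measurable_compose[OF _ qm], rule borel_measurable_continuous_onI) (intro continuous_intros)
        have sl: "AE y in lborel. b (u (t, y)) = b (w (t, y))"
          using elim(2) zS(2) by (auto simp: tx)
        have "nonlocal_ge (scale_measure (ennreal c) (frac_measure \<alpha>)) 1 (\<lambda>y. b (u (t, y))) x =
            nonlocal_ge (scale_measure (ennreal c) (frac_measure \<alpha>)) 1 (\<lambda>y. b (w (t, y))) x"
          by (rule nonlocal_ge_cong[OF \<alpha>(1) c _ _ sl]) (use uz tx in auto)
        also have "\<dots> = K0 * (LINT y|lborel. W y * (b (w (t, x + y)) - b (w (t, x))))"
          unfolding nonlocal_ge_def K0_def
          by (subst set_integral_scaled_frac_measure[OF \<alpha>(1) c]) (simp_all add: W_def mult_ac)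
        finally have g: "?g z = K0 * (LINT y|lborel. (s * \<theta> t) * (W y * (b (w (t, x + y)) - b (w (t, x)))))"
          using True unfolding uz by (simp add: tx sgn_part_def)
        have bnd: "integrable lborel (\<lambda>y. W y * h y)" if [measurable]: "h \<in> borel_measurable borel" and h: "\<And>y. \<bar>h y\<bar> \<le> B" for h :: "'a \<Rightarrow> real" and B
          by (rule Bochner_Integration.integrable_bound[OF integrable_mult_left[OF iW, of B]])
            (use W0 order_trans[OF h abs_ge_self] in \<open>auto intro!: AE_I2 mult_left_mono simp: abs_mult\<close>)
        have i1: "integrable lborel (\<lambda>y. W y * (b (w (t, x + y)) - b (w (t, x))))"
        proof (rule bnd[where B="2 * P"])
          show "\<bar>b (w (t, x + y)) - b (w (t, x))\<bar> \<le> 2 * P" for y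
            using P[OF w(2), of "(t, x + y)"] P[OF w(2), of "(t, x)"] by linarith
        qed measurable
        have i2: "integrable lborel (\<lambda>y. W y * q (t, x + y))"
          by (rule bnd[OF qt, where B=P']) (use q0 qb in simp)
        have "(LINT y|lborel. (s * \<theta> t) * (W y * (b (w (t, x + y)) - b (w (t, x))))) \<le>
            (LINT y|lborel. W y * q (t, x + y) - q z * W y)"
        proof (rule integral_mono[OF integrable_mult_right[OF i1]])
          show "integrable lborel (\<lambda>y. W y * q (t, x + y) - q z * W y)" using i2 iW by simp
          fix y
          have "s * (b (w (t, x + y)) - b k) \<le> p (t, x + y)" by (simp add: p_def part_def)
          moreover have "s * (b (w (t, x)) - b k) = p z"
          proof -
            have "0 \<le> s * (b (w z) - b k)" using True s monoD[OF b(2), of k "w z"] monoD[OF b(2), of "w z" k] by auto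
            then show ?thesis by (simp add: p_def part_def tx)
          qed
          ultimately have "s * (b (w (t, x + y)) - b (w (t, x))) \<le> p (t, x + y) - p z" by (simp add: algebra_simps)
          then have "W y * \<theta> t * (s * (b (w (t, x + y)) - b (w (t, x)))) \<le> W y * \<theta> t * (p (t, x + y) - p z)"
            using W0 \<theta>(2) by (intro mult_left_mono mult_nonneg_nonneg)
          then show "(s * \<theta> t) * (W y * (b (w (t, x + y)) - b (w (t, x)))) \<le> W y * q (t, x + y) - q z * W y"
            using zS(2) by (simp add: q_def S_def tx algebra_simps)
        qed
        also have "\<dots> = N z - m * q z"
          using i2 iW by (simp add: N_def G_def m_def tx)
        finally show ?thesis unfolding g using K0 by (simp add: mult_left_mono)
      qed
    qed
  qed
  \<comment> \<open>Without integrability the integral is 0 by convention, which satisfies the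
    claim.\<close>
  show ?thesis
  proof (cases "integrable (lebesgue_on Q) ?g")
    case True
    have iQ: "integrable lborel (\<lambda>z. indicator Q z * (K0 * (N z - m * q z)))"
      using integrable_real_mult_indicator[OF _ iNq, of Q] by (simp add: mult.commute)
    have "(LINT z|lebesgue_on Q. ?g z) \<le> (LINT z|lebesgue_on Q. K0 * (N z - m * q z))"
    proof (rule integral_mono_AE[OF True])
      show "integrable (lebesgue_on Q) (\<lambda>z. K0 * (N z - m * q z))"
        unfolding integrable_restrict_space[OF Ql] using iQ by (simp add: integrable_completion)
      show "AE z in lebesgue_on Q. ?g z \<le> K0 * (N z - m * q z)"
        unfolding AE_restrict_space_iff[OF Ql] AE_completion_iff by (rule le)
    qed
    also have "\<dots> = (LINT z|lborel. indicator Q z * (K0 * (N z - m * q z)))"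
      by (rule integral_lebesgue_on_eq) (use borel_measurable_integrable[OF iQ] in simp_all)
    \<comment> \<open>Off \<open>Q\<close> the truncation \<open>q\<close> vanishes and
      \<open>N\<close> is nonnegative, so enlarging the domain can only increase the integral. Over
      the whole space it is 0 by \<open>intN\<close>.\<close>
    also have "\<dots> \<le> (LINT z|lborel. K0 * (N z - m * q z))"
    proof (rule integral_mono[OF iQ iNq])
      fix z
      show "indicator Q z * (K0 * (N z - m * q z)) \<le> K0 * (N z - m * q z)"
      proof (cases "z \<in> Q")
        case False
        then have "q z = 0" using supp by blast
        then show ?thesis using K0 N0[of z] False by simp
      qed simp
    qed
    also have "\<dots> = 0" using iN iq by (simp add: intN)
    finally show ?thesis unfolding Q_def .
  next
    case False
    then show ?thesis unfolding Q_def by (simp add: not_integrable_integral_eq)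
  qed
qed

end

section \<open>The maximum principle for the nonlocal problem\<close>

context dirichlet_data
begin

lemma exterior_part_eq_0:
  assumes s: "s \<in> {1, -1}" and "\<And>z. z \<in> {0<..<T} \<times> (- \<Omega>) \<Longrightarrow> \<phi> z \<noteq> 0 \<Longrightarrow> s * ubar z \<le> s * k"
  shows "\<And>z. z \<in> {0<..<T} \<times> (- \<Omega>) \<Longrightarrow> part s (b (uc z) - b k) * \<phi> z = 0"
    and "\<And>t x. t \<in> {0<..<T} \<Longrightarrow> x \<in> frontier \<Omega> \<Longrightarrow> part s (ubar (t, x) - k) * \<phi> (t, x) = 0"
proof -
  show "part s (b (uc z) - b k) * \<phi> z = 0" if "z \<in> {0<..<T} \<times> (- \<Omega>)" for z
    using part_b_le_0[OF s, of "ubar z" k] assms(2)[OF that] uc[OF that] by (cases "\<phi> z = 0") (auto simp: algebra_simps)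
  show "part s (ubar (t, x) - k) * \<phi> (t, x) = 0" if "t \<in> {0<..<T}" "x \<in> frontier \<Omega>" for t x
    using assms(2)[of "(t, x)"] that frontier_subset
    by (cases "\<phi> (t, x) = 0") (auto simp: algebra_simps intro!: disjI1 part_le_0)
qed

text \<open>The constant \<open>s * M\<close> lies beyond all data, and the test function depends
  only on time on the unit neighbourhood of \<open>\<Omega>\<close>. The initial and boundary terms
  vanish. The short-jump term vanishes, since over \<open>\<Omega>\<close> the operator annihilates
  the test function and outside its factor is 0. The long-jump term has the right sign by
  \<open>nonlocal_ge_sign\<close>. What is left is a nonnegative weighted integral of the excess
  over \<open>M\<close> that is at most 0. The resulting bound does not depend on \<open>c\<close>,
  hence not on n.\<close>

lemma maximum_principle:
  assumes sol: "nonlocal_entropy_solution T \<Omega> f b (scale_measure (ennreal c) (frac_measure \<alpha>)) uc ubar u0 u"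
    and c: "0 \<le> c"
  shows "AE z in lborel. z \<in> {0<..<T} \<times> \<Omega> \<longrightarrow> \<bar>u z\<bar> \<le> M"
proof -
  define \<mu> where "\<mu> = scale_measure (ennreal c) (frac_measure \<alpha> :: 'a measure)"
  define Q where "Q = {0<..<T} \<times> \<Omega>"
  define S where "S = {0<..<T} \<times> (UNIV :: 'a set)"
  have Sm: "S \<in> sets borel" unfolding S_def by (intro borel_Times) auto
  have Qm[measurable]: "Q \<in> sets borel" unfolding Q_def by (rule Q_borel)
  note sol' = sol[unfolded nonlocal_entropy_solution_def, folded \<mu>_def]
  obtain C where C: "AE z in lebesgue_on S. norm (u z) \<le> C" and um: "u \<in> borel_measurable (lebesgue_on S)"
    using sol' unfolding Linf_on_def S_def by blast
  have "AE z in lborel. z \<in> S \<longrightarrow> norm (u z) \<le> C"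
    using C AE_restrict_space_iff[of S lebesgue] Sm by (simp add: AE_completion_iff)
  then have "AE z in lborel. z \<in> Q \<longrightarrow> \<bar>u z\<bar> \<le> max C M" by eventually_elim (auto simp: Q_def S_def)
  then have uC: "AE z in lebesgue_on Q. \<bar>u z\<bar> \<le> max C M"
    using AE_restrict_space_iff[of Q lebesgue] Qm by (simp add: AE_completion_iff)
  have "u \<in> borel_measurable (restrict_space (lebesgue_on S) Q)" by (rule measurable_restrict_space1[OF um])
  then have "u \<in> borel_measurable (lebesgue_on Q)"
    using Qm Sm by (simp add: restrict_restrict_space Q_def S_def Times_Int_Times)
  then obtain w where w: "extended w" "\<And>z. \<bar>w z\<bar> \<le> max C M" "AE z in lborel. z \<in> Q \<longrightarrow> u z = w z"
    using ex_extended[OF _ uC[unfolded Q_def] max.cobounded2, folded Q_def] by blast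
  have wm[measurable]: "w \<in> borel_measurable borel" using w(1) by (simp add: extended_def)
  have w0: "w z = v0 (snd z)" if "fst z \<le> 0" for z using w(1) that unfolding extended_def by blast
  have uw: "AE z in lborel. z \<in> S \<longrightarrow> u z = w z"
    unfolding S_def by (rule extended_eq_exterior[OF w(1) w(3)[unfolded Q_def]]) (use sol' in blast)
  have main: "AE z in lborel. z \<in> Q \<longrightarrow> fst z < T' \<longrightarrow> s * w z \<le> M" if s: "s \<in> {1, -1}" and T': "T' < T" for s T'
  proof -
    define k where "k = s * M"
    have ss: "s * s = 1" using s by auto
    have sk: "s * (r - k) \<le> 0" if "\<bar>r\<bar> \<le> M" for r using that s by (auto simp: k_def algebra_simps)
    \<comment> \<open>The radius 1 is the range of the short jumps for r = 1, the value at which the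
      entropy inequality is used here.\<close>
    define K where "K = {x + y |x y. x \<in> closure \<Omega> \<and> y \<in> cball (0 :: 'a) 1}"
    have "compact (closure \<Omega>)" using \<Omega> by (simp add: compact_closure)
    then have Kc: "compact K" unfolding K_def by (rule compact_sums) simp
    have KI: "x + y \<in> K" if "x \<in> \<Omega>" "norm y \<le> 1" for x y
      unfolding K_def using that closure_subset[of \<Omega>] by auto
    have K0: "x \<in> K" if "x \<in> \<Omega>" for x using KI[OF that, of 0] by simp
    obtain \<phi> :: "real \<times> 'a \<Rightarrow> real" where \<phi>: "test_on (slab T UNIV) \<phi>" "\<And>z. 0 \<le> \<phi> z"
      "\<And>z. z \<in> {0<..<T} \<times> K \<Longrightarrow> \<phi> z = flat_exp 0 (T' - fst z)"
      "\<And>z. z \<in> {0<..<T} \<times> K \<Longrightarrow> nabla \<phi> z = (- flat_exp 2 (T' - fst z), 0)"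
      using ex_time_weight[OF T T' Kc] by blast
    have ub: "s * ubar z \<le> s * k" if "z \<in> {0<..<T} \<times> (- \<Omega>)" for z
      using sk[OF ubar(2)[of z]] that by (auto simp: algebra_simps)
    then have ub': "\<And>z. z \<in> {0<..<T} \<times> (- \<Omega>) \<Longrightarrow> \<phi> z \<noteq> 0 \<Longrightarrow> s * ubar z \<le> s * k" by blast
    note ext = exterior_part_eq_0[OF s, of \<phi> k, OF ub']
    have ineq: "entropy_lhs_local T \<Omega> f u s k \<phi>
        - (LINT (t, x)|lebesgue_on Q. nonlocal_ge \<mu> 1 (\<lambda>y. b (u (t, y))) x * sgn_part s (u (t, x) - k) * \<phi> (t, x))
        - (LINT (t, x)|lebesgue_on S. part s (b (u (t, x)) - b k) * nonlocal_lt \<mu> 1 (\<lambda>y. \<phi> (t, y)) x)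
        \<le> (LINT x|lebesgue_on \<Omega>. part s (u0 x - k) * \<phi> (0, x))"
    proof -
      have "entropy_rhs T \<Omega> f I ubar u0 s k \<phi> = (LINT x|lebesgue_on \<Omega>. part s (u0 x - k) * \<phi> (0, x))" for I
        by (rule entropy_rhs_eq_initial[OF \<Omega>(1)]) (rule ext(2))
      moreover note test_on_slab_Cc_infty[OF \<phi>(1)]
      ultimately show ?thesis
        using sol'[THEN conjunct2, THEN conjunct1, rule_format, OF s, of 1 \<phi> k] \<phi>(2) ext(1)
        unfolding Q_def S_def by simp
    qed
    have u0': "(LINT x|lebesgue_on \<Omega>. part s (u0 x - k) * \<phi> (0, x)) = 0"
    proof (rule integral_eq_zero_AE)
      have "AE x in lborel. x \<in> \<Omega> \<longrightarrow> part s (u0 x - k) * \<phi> (0, x) = 0"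
        using u0 by eventually_elim (simp add: part_le_0 sk v0)
      then show "AE x in lebesgue_on \<Omega>. part s (u0 x - k) * \<phi> (0, x) = 0"
        using AE_restrict_space_iff[of \<Omega> lebesgue] \<Omega> by (simp add: AE_completion_iff)
    qed
    have lt: "(LINT (t, x)|lebesgue_on S. part s (b (u (t, x)) - b k) * nonlocal_lt \<mu> 1 (\<lambda>y. \<phi> (t, y)) x) = 0"
    proof (rule integral_eq_zero_AE)
      have "AE z in lborel. z \<in> S \<longrightarrow> part s (b (u z) - b k) * nonlocal_lt \<mu> 1 (\<lambda>y. \<phi> (fst z, y)) (snd z) = 0"
        using uw
      proof eventually_elim
        case (elim z)
        show ?case
        proof
          assume z: "z \<in> S"
          show "part s (b (u z) - b k) * nonlocal_lt \<mu> 1 (\<lambda>y. \<phi> (fst z, y)) (snd z) = 0"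
          proof (cases "snd z \<in> \<Omega>")
            case True
            have "nonlocal_lt \<mu> 1 (\<lambda>y. \<phi> (fst z, y)) (snd z) = 0"
            proof (rule nonlocal_lt_eq_0)
              fix y :: 'a assume "norm y < 1"
              then show "\<phi> (fst z, snd z + y) = \<phi> (fst z, snd z)"
                using \<phi>(3)[of "(fst z, snd z + y)"] \<phi>(3)[of "(fst z, snd z)"] KI[OF True, of y] K0[OF True] z
                by (auto simp: S_def)
            qed
            then show ?thesis by simp
          next
            case False
            then have "z \<in> {0<..<T} \<times> (- \<Omega>)" using z by (cases z) (auto simp: S_def)
            then have "u z = ubar z" using elim z w(1) unfolding extended_def by metis
            moreover have "\<bar>ubar z\<bar> \<le> M" by (rule ubar(2)) (use z in \<open>auto simp: S_def\<close>)
            ultimately show ?thesis using part_b_le_0[OF s sk] by simp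
          qed
        qed
      qed
      then show "AE z in lebesgue_on S. (case z of (t, x) \<Rightarrow> part s (b (u (t, x)) - b k) * nonlocal_lt \<mu> 1 (\<lambda>y. \<phi> (t, y)) x) = 0"
        using AE_restrict_space_iff[of S lebesgue] Sm by (simp add: AE_completion_iff case_prod_beta)
    qed
    have ge: "(LINT (t, x)|lebesgue_on Q. nonlocal_ge \<mu> 1 (\<lambda>y. b (u (t, y))) x * sgn_part s (u (t, x) - k) * \<phi> (t, x)) \<le> 0"
    proof -
      have "(LINT (t, x)|lebesgue_on Q. nonlocal_ge \<mu> 1 (\<lambda>y. b (u (t, y))) x * sgn_part s (u (t, x) - k) * \<phi> (t, x)) =
        (LINT z|lebesgue_on Q. nonlocal_ge \<mu> 1 (\<lambda>y. b (u (fst z, y))) (snd z) * sgn_part s (u z - k) * flat_exp 0 (T' - fst z))"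
      proof (rule Bochner_Integration.integral_cong[OF refl])
        fix z assume "z \<in> space (lebesgue_on Q)"
        then have "z \<in> Q" by simp
        then have "z \<in> {0<..<T} \<times> K" using K0 by (auto simp: Q_def)
        then show "(case z of (t, x) \<Rightarrow> nonlocal_ge \<mu> 1 (\<lambda>y. b (u (t, y))) x * sgn_part s (u (t, x) - k) * \<phi> (t, x)) =
          nonlocal_ge \<mu> 1 (\<lambda>y. b (u (fst z, y))) (snd z) * sgn_part s (u z - k) * flat_exp 0 (T' - fst z)"
          using \<phi>(3)[of z] by (simp add: case_prod_beta)
      qed
      also have "\<dots> \<le> 0" unfolding Q_def \<mu>_def
      proof (rule nonlocal_ge_sign[OF s c wm w(2) _ _ _ _ uw[unfolded S_def]])
        show "s * (w z - k) \<le> 0" if "z \<in> {0<..<T} \<times> (- \<Omega>)" for z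
        proof -
          have "w z = ubar z" using that w(1) unfolding extended_def by blast
          then show ?thesis using ub[OF that] by (simp add: algebra_simps)
        qed
        show "(\<lambda>t. flat_exp 0 (T' - t)) \<in> borel_measurable borel"
          by (rule smooth_borel_measurable[OF smooth_translate(2)[OF smooth_flat_exp]])
      qed (auto simp: flat_exp_def)
      finally show ?thesis .
    qed
    have "entropy_lhs_local T \<Omega> f u s k \<phi> \<le> 0" using ineq ge unfolding u0' lt by linarith
    moreover have "entropy_lhs_local T \<Omega> f u s k \<phi> - (LINT x|lebesgue_on \<Omega>. part s (u0 x - k) * \<phi> (0, x)) =
      - flux_int (slab T \<Omega>) (\<lambda>r. s *\<^sub>R f (s * r)) (\<lambda>z. s * w z) (\<lambda>_. s * k) \<phi>"
      by (rule entropy_lhs_local_eq_flux_int[OF \<Omega> T f wm w(2) _ u0 v0(1) w(3)[unfolded Q_def] s \<phi>(1)])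
        (rule w0)
    moreover have "flux_int (slab T \<Omega>) (\<lambda>r. s *\<^sub>R f (s * r)) (\<lambda>z. s * w z) (\<lambda>_. s * k) \<phi> =
      - (LINT z|lborel. indicator Q z * (part s (w z - k) * flat_exp 2 (T' - fst z)))"
    proof -
      have "indicator (slab T \<Omega>) z * (kflux (\<lambda>r. s *\<^sub>R f (s * r)) (s * w z) (s * k) \<bullet> switched (fst z) (nabla \<phi> z)) =
        - (indicator Q z * (part s (w z - k) * flat_exp 2 (T' - fst z)))" for z
      proof (cases "z \<in> Q")
        case True
        then have "nabla \<phi> z = (- flat_exp 2 (T' - fst z), 0)" using K0 by (intro \<phi>(4)) (auto simp: Q_def)
        moreover have "z \<in> slab T \<Omega>" using True by (auto simp: Q_def slab_def)
        ultimately show ?thesis using True unfolding kflux_signed[OF s] by (simp add: switched_def inner_prod_def)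
      next
        case False
        show ?thesis
        proof (cases "z \<in> slab T \<Omega>")
          case True
          then have "fst z \<le> 0" using False by (auto simp: Q_def slab_def)
          then have "\<bar>w z\<bar> \<le> M" using w0 v0(2) by simp
          from sk[OF this] have "kflux (\<lambda>r. s *\<^sub>R f (s * r)) (s * w z) (s * k) = 0"
            by (intro kflux_self_le) (simp add: algebra_simps)
          then show ?thesis using False by simp
        qed (use False in simp)
      qed
      then show ?thesis unfolding flux_int_def by simp
    qed
    ultimately have le0: "(LINT z|lborel. indicator Q z * (part s (w z - k) * flat_exp 2 (T' - fst z))) \<le> 0"
      unfolding u0' by linarith
    have fp: "0 \<le> flat_exp 2 t" for t by (simp add: flat_exp_def)
    have nn: "0 \<le> indicator Q z * (part s (w z - k) * flat_exp 2 (T' - fst z))" for z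
      using fp by (simp add: part_def)
    have int: "integrable lborel (\<lambda>z. indicator Q z * (part s (w z - k) * flat_exp 2 (T' - fst z)))"
    proof -
      have fm: "(\<lambda>t. flat_exp 2 (T' - t)) \<in> borel_measurable borel"
        by (rule smooth_borel_measurable[OF smooth_translate(2)[OF smooth_flat_exp]])
      have "bounded (flat_exp 2 ` {T' - T..T'})"
        by (intro compact_imp_bounded compact_continuous_image smooth_continuous_on smooth_flat_exp compact_Icc)
      then obtain B where B: "\<And>y. y \<in> flat_exp 2 ` {T' - T..T'} \<Longrightarrow> norm y \<le> B" unfolding bounded_iff by blast
      show ?thesis
      proof (rule integrable_bounded_support[OF _ Q_bounded, where B="(max C M + \<bar>k\<bar>) * \<bar>B\<bar>"])
        show "(\<lambda>z. indicator Q z * (part s (w z - k) * flat_exp 2 (T' - fst z))) \<in> borel_measurable borel"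
          unfolding part_def by (intro borel_measurable_times measurable_of_first[OF fm]) measurable
        fix z
        show "norm (indicator Q z * (part s (w z - k) * flat_exp 2 (T' - fst z))) \<le> (max C M + \<bar>k\<bar>) * \<bar>B\<bar>"
        proof (cases "z \<in> Q")
          case True
          then have "T' - fst z \<in> {T' - T..T'}" by (auto simp: Q_def)
          then have "\<bar>flat_exp 2 (T' - fst z)\<bar> \<le> \<bar>B\<bar>" using B[of "flat_exp 2 (T' - fst z)"] by force
          moreover have "\<bar>part s (w z - k)\<bar> \<le> max C M + \<bar>k\<bar>"
            using w(2)[of z] s by (auto simp: part_def)
          ultimately show ?thesis using True by (simp add: abs_mult mult_mono)
        next
          case False
          have "0 \<le> max C M + \<bar>k\<bar>" using M by auto
          then show ?thesis using False by simp
        qed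
      qed (simp add: Q_def)
    qed
    have "(LINT z|lborel. indicator Q z * (part s (w z - k) * flat_exp 2 (T' - fst z))) = 0"
      by (rule antisym[OF le0 Bochner_Integration.integral_nonneg]) (rule nn)
    then have "AE z in lborel. indicator Q z * (part s (w z - k) * flat_exp 2 (T' - fst z)) = 0"
      using integral_nonneg_eq_0_iff_AE[OF int] nn by simp
    then show ?thesis
    proof eventually_elim
      case (elim z)
      show ?case
      proof (intro impI)
        assume z: "z \<in> Q" "fst z < T'"
        then have "flat_exp 2 (T' - fst z) \<noteq> 0" by (simp add: flat_exp_def)
        then have "part s (w z - k) = 0" using elim z(1) by simp
        then have "s * w z \<le> s * k" by (simp add: part_def max_def algebra_simps split: if_splits)
        then show "s * w z \<le> M" using ss by (simp add: k_def mult.assoc[symmetric])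
      qed
    qed
  qed
  \<comment> \<open>The weight vanishes from \<open>T'\<close> on, so the bound is obtained before
    \<open>T'\<close> and then extended along a sequence tending to \<open>T\<close>.\<close>
  define T' where "T' n = T - 1 / real (Suc n)" for n
  have T': "T' n < T" for n by (simp add: T'_def)
  have "AE z in lborel. \<forall>n. z \<in> Q \<longrightarrow> fst z < T' n \<longrightarrow> 1 * w z \<le> M"
    "AE z in lborel. \<forall>n. z \<in> Q \<longrightarrow> fst z < T' n \<longrightarrow> - 1 * w z \<le> M"
    unfolding AE_all_countable using main[of 1, OF _ T'] main[of "-1", OF _ T'] by simp_all
  then show ?thesis using w(3) unfolding Q_def[symmetric]
  proof eventually_elim
    case (elim z)
    show ?case
    proof
      assume z: "z \<in> Q"
      then have "0 < T - fst z" by (auto simp: Q_def)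
      then obtain n where "1 / real (Suc n) < T - fst z" using reals_Archimedean[of "T - fst z"] by (auto simp: inverse_eq_divide)
      then have "fst z < T' n" by (simp add: T'_def)
      then show "\<bar>u z\<bar> \<le> M" using elim z by (auto simp: abs_le_iff)
    qed
  qed
qed

end

section \<open>Entropy inequalities with an error that vanishes with the nonlocal
  coefficient\<close>

context dirichlet_data
begin

text \<open>Constant continuation to negative times keeps the boundary datum continuous and bounded
  on the whole slab.\<close>

definition bdata :: "real \<times> 'a \<Rightarrow> real" where
  "bdata z = ubar (max (fst z) 0, snd z)"

lemma bdata_continuous: "continuous_on (slab T UNIV) bdata"
  unfolding bdata_def
  by (intro continuous_on_compose2[OF ubar(1)] continuous_intros) (use T in \<open>auto simp: slab_def\<close>)

lemma bdata_bound: "z \<in> slab T UNIV \<Longrightarrow> \<bar>bdata z\<bar> \<le> M"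
  unfolding bdata_def using T by (intro ubar(2)) (auto simp: slab_def)

lemma adm_test_exterior:
  assumes "adm_test T \<Omega> (\<lambda>z. s * bdata z) B R k \<phi>" "s \<in> {1, -1}" "z \<in> {0<..<T} \<times> (- \<Omega>)" "\<phi> z \<noteq> 0"
  shows "s * ubar z \<le> s * (s * k)"
proof -
  have "z \<in> slab T (- \<Omega>)" using assms(3) by (auto simp: slab_def)
  then have "s * bdata z \<le> k" using assms(1,4) unfolding adm_test_def by blast
  moreover have "bdata z = ubar z" using assms(3) by (cases z) (simp add: bdata_def)
  ultimately show ?thesis using assms(2) by auto
qed

text \<open>For admissible constants the boundary term is zero, so the entropy inequality holds in
  the required form with error 0.\<close>

lemma local_solution_asub:
  assumes sol: "local_entropy_solution T \<Omega> f uc ubar u0 u" and s: "s \<in> {1, -1}"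
    and w: "extended w" "\<And>z. \<bar>w z\<bar> \<le> C" "AE z in lborel. z \<in> {0<..<T} \<times> \<Omega> \<longrightarrow> u z = w z"
  shows "asub T \<Omega> (\<lambda>r. s *\<^sub>R f (s * r)) (\<lambda>z. s * bdata z) F (\<lambda>_ z. s * w z)"
  unfolding asub_def
proof (intro allI exI conjI impI)
  show "((\<lambda>_. 0) \<longlongrightarrow> 0) F" by simp
  fix B R k :: real and n :: nat and \<phi> assume adm: "adm_test T \<Omega> (\<lambda>z. s * bdata z) B R k \<phi>"
  have \<phi>: "test_on (slab T UNIV) \<phi>" "\<And>z. 0 \<le> \<phi> z" using adm unfolding adm_test_def by blast+
  have wm: "w \<in> borel_measurable borel" and w0: "\<And>z. fst z \<le> 0 \<Longrightarrow> w z = v0 (snd z)"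
    using w(1) unfolding extended_def by blast+
  have ss: "s * (s * k) = k" using s by auto
  have "entropy_rhs T \<Omega> f I ubar u0 s (s * k) \<phi> = (LINT x|lebesgue_on \<Omega>. part s (u0 x - s * k) * \<phi> (0, x))" for I
    by (rule entropy_rhs_eq_initial[OF \<Omega>(1)])
      (rule exterior_part_eq_0(2)[OF s], rule adm_test_exterior[OF adm s])
  moreover note test_on_slab_Cc_infty[OF \<phi>(1)]
  ultimately have "entropy_lhs_local T \<Omega> f u s (s * k) \<phi> \<le> (LINT x|lebesgue_on \<Omega>. part s (u0 x - s * k) * \<phi> (0, x))"
    using sol[unfolded local_entropy_solution_def, THEN conjunct2, rule_format, OF s, of \<phi> "s * k"] \<phi>(2) by simp
  then show "- flux_int (slab T \<Omega>) (\<lambda>r. s *\<^sub>R f (s * r)) (\<lambda>z. s * w z) (\<lambda>_. k) \<phi> \<le> 0"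
    using entropy_lhs_local_eq_flux_int[OF \<Omega> T f wm w(2) w0 u0 v0(1) w(3) s \<phi>(1), of "s * k"] by (simp add: ss)
qed

text \<open>With r = 1 both nonlocal terms carry the factor \<open>c n\<close>. What multiplies it
  is bounded in terms of \<open>B\<close>, \<open>R\<close> and \<open>C\<close>: long jumps by the
  sup norm, short jumps by the second differences of the test function. This is the uniformity that
  \<open>asub\<close> asks for.\<close>

lemma nonlocal_solution_asub:
  assumes sol: "\<And>n. nonlocal_entropy_solution T \<Omega> f b (scale_measure (ennreal (c n)) (frac_measure \<alpha>)) uc ubar u0 (u n)"
    and c: "\<And>n. 0 \<le> c n" "c \<longlonglongrightarrow> 0" and s: "s \<in> {1, -1}"
    and w: "\<And>n. extended (w n)" "\<And>n z. \<bar>w n z\<bar> \<le> C" "\<And>n. AE z in lborel. z \<in> {0<..<T} \<times> \<Omega> \<longrightarrow> u n z = w n z"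
  shows "asub T \<Omega> (\<lambda>r. s *\<^sub>R f (s * r)) (\<lambda>z. s * bdata z) sequentially (\<lambda>n z. s * w n z)"
  unfolding asub_def
proof (intro allI)
  fix B R :: real
  define Q where "Q = {0<..<T} \<times> \<Omega>"
  define S where "S = {0<..<T} \<times> (UNIV :: 'a set)"
  \<comment> \<open>Short jumps with r = 1 spread the support of the test function by at most
    1.\<close>
  define K where "K = {0<..<T} \<times> cball (0 :: 'a) (R + 1)"
  have Qm[measurable]: "Q \<in> sets borel" and Qb: "bounded Q" unfolding Q_def by (rule Q_borel Q_bounded)+
  have Sm: "S \<in> sets borel" and Km: "K \<in> sets borel" unfolding S_def K_def by (intro borel_Times; simp)+
  have Kb: "bounded K" unfolding K_def
    by (intro bounded_Times bounded_cball bounded_subset[OF bounded_closed_interval[of 0 T]]) auto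
  obtain P where P: "P \<ge> 0" "\<And>r. \<bar>r\<bar> \<le> max C B \<Longrightarrow> \<bar>b r\<bar> \<le> P"
  proof -
    have "bounded (b ` {- max C B..max C B})"
      by (intro compact_imp_bounded compact_continuous_image continuous_on_subset[OF b(1)]) auto
    then obtain P where P: "\<And>y. y \<in> b ` {- max C B..max C B} \<Longrightarrow> norm y \<le> P" unfolding bounded_iff by blast
    show thesis
    proof (rule that[of "max P 0"])
      fix r assume "\<bar>r\<bar> \<le> max C B"
      then have "r \<in> {- max C B..max C B}" by (simp add: abs_le_iff)
      then show "\<bar>b r\<bar> \<le> max P 0" using P[of "b r"] by simp
    qed simp
  qed
  define K1 where "K1 = frac_const DIM('a) \<alpha> * (LINT z|lborel. indicator {z :: 'a. 1 \<le> norm z} z * frac_weight \<alpha> z)"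
  define K2 where "K2 = frac_const DIM('a) \<alpha> * (LINT z|lborel. indicator (ball (0 :: 'a) 1) z * (frac_weight \<alpha> z * (norm z)\<^sup>2))"
  have K1: "0 \<le> K1" and K2: "0 \<le> K2"
    unfolding K1_def K2_def using frac_const_nonneg[OF \<alpha>(1), of "DIM('a)"]
    by (intro mult_nonneg_nonneg Bochner_Integration.integral_nonneg; simp add: frac_weight_nonneg)+
  define E where "E = 2 * P * K1 * B * measure lborel Q + 2 * P * (B * K2) * measure lborel K"
  show "\<exists>e. e \<longlonglongrightarrow> 0 \<and> (\<forall>n k \<phi>. \<bar>k\<bar> \<le> B \<longrightarrow> adm_test T \<Omega> (\<lambda>z. s * bdata z) B R k \<phi> \<longrightarrow>
      - flux_int (slab T \<Omega>) (\<lambda>r. s *\<^sub>R f (s * r)) (\<lambda>z. s * w n z) (\<lambda>_. k) \<phi> \<le> e n)"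
  proof (intro exI[of _ "\<lambda>n. c n * E"] conjI allI impI)
    show "(\<lambda>n. c n * E) \<longlonglongrightarrow> 0" using tendsto_mult_right[OF c(2), of E] by simp
    fix n k \<phi> assume k: "\<bar>k\<bar> \<le> B" and adm: "adm_test T \<Omega> (\<lambda>z. s * bdata z) B R k \<phi>"
    have B: "0 \<le> B" using k by linarith
    define \<mu> where "\<mu> = scale_measure (ennreal (c n)) (frac_measure \<alpha> :: 'a measure)"
    note sol' = sol[of n, unfolded nonlocal_entropy_solution_def, folded \<mu>_def]
    have \<phi>: "test_on (slab T UNIV) \<phi>" "\<And>z. 0 \<le> \<phi> z" "\<And>z. \<phi> z \<le> B" "\<And>z. \<phi> z \<noteq> 0 \<Longrightarrow> norm z \<le> R"
      "\<And>z h. \<bar>\<phi> (z + h) + \<phi> (z - h) - 2 * \<phi> z\<bar> \<le> B * (norm h)\<^sup>2"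
      using adm unfolding adm_test_def by blast+
    have wm: "w n \<in> borel_measurable borel" and w0: "\<And>z. fst z \<le> 0 \<Longrightarrow> w n z = v0 (snd z)"
      using w(1)[of n] unfolding extended_def by blast+
    have ss: "s * (s * k) = k" using s by auto
    have uw: "AE z in lborel. z \<in> S \<longrightarrow> u n z = w n z"
      unfolding S_def by (rule extended_eq_exterior[OF w(1) w(3)]) (use sol' in blast)
    note ext = exterior_part_eq_0[OF s, of \<phi> "s * k", OF adm_test_exterior[OF adm s]]
    define A1 where "A1 = (LINT (t, x)|lebesgue_on Q. nonlocal_ge \<mu> 1 (\<lambda>y. b (u n (t, y))) x * sgn_part s (u n (t, x) - s * k) * \<phi> (t, x))"
    define A2 where "A2 = (LINT (t, x)|lebesgue_on S. part s (b (u n (t, x)) - b (s * k)) * nonlocal_lt \<mu> 1 (\<lambda>y. \<phi> (t, y)) x)"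
    have "entropy_lhs_local T \<Omega> f (u n) s (s * k) \<phi> - A1 - A2 \<le> (LINT x|lebesgue_on \<Omega>. part s (u0 x - s * k) * \<phi> (0, x))"
    proof -
      have "entropy_rhs T \<Omega> f I ubar u0 s (s * k) \<phi> = (LINT x|lebesgue_on \<Omega>. part s (u0 x - s * k) * \<phi> (0, x))" for I
        by (rule entropy_rhs_eq_initial[OF \<Omega>(1)]) (rule ext(2))
      moreover note test_on_slab_Cc_infty[OF \<phi>(1)]
      ultimately show ?thesis
        using sol'[THEN conjunct2, THEN conjunct1, rule_format, OF s, of 1 \<phi> "s * k"] \<phi>(2) ext(1)
        unfolding Q_def S_def A1_def A2_def by simp
    qed
    moreover have "entropy_lhs_local T \<Omega> f (u n) s (s * k) \<phi> - (LINT x|lebesgue_on \<Omega>. part s (u0 x - s * k) * \<phi> (0, x)) =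
        - flux_int (slab T \<Omega>) (\<lambda>r. s *\<^sub>R f (s * r)) (\<lambda>z. s * w n z) (\<lambda>_. k) \<phi>"
      using entropy_lhs_local_eq_flux_int[OF \<Omega> T f wm w(2) w0 u0 v0(1) w(3) s \<phi>(1), of "s * k"] by (simp only: ss)
    moreover have "A1 \<le> c n * (2 * P * K1 * B * measure lborel Q)"
    proof -
      have "\<bar>A1\<bar> \<le> (c n * (2 * P * K1) * B) * measure lborel Q"
        unfolding A1_def
      proof (rule abs_integral_lebesgue_on_le[OF Qm Qm Qb])
        show "AE z in lborel. z \<in> Q \<longrightarrow> \<bar>case z of (t, x) \<Rightarrow> nonlocal_ge \<mu> 1 (\<lambda>y. b (u n (t, y))) x *
            sgn_part s (u n (t, x) - s * k) * \<phi> (t, x)\<bar> \<le> c n * (2 * P * K1) * B * indicator Q z"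
          using uw AE_slices[OF uw]
        proof eventually_elim
          case (elim z)
          show ?case
          proof
            assume z: "z \<in> Q"
            obtain t x where tx: "z = (t, x)" by (cases z)
            have t: "t \<in> {0<..<T}" using z by (simp add: tx Q_def)
            have wt: "(\<lambda>y. w n (t, y)) \<in> borel_measurable borel"
              by (rule measurable_compose[OF _ wm], rule borel_measurable_continuous_onI) (intro continuous_intros)
            then have bw: "(\<lambda>y. b (w n (t, y))) \<in> borel_measurable borel" by (rule measurable_compose) simp
            have uz: "u n (t, x) = w n (t, x)" using elim(1) t unfolding S_def tx by blast
            have sl: "AE y in lborel. b (u n (t, y)) = b (w n (t, y))"
              using elim(2) t by (auto simp: tx S_def)
            have "nonlocal_ge \<mu> 1 (\<lambda>y. b (u n (t, y))) x = nonlocal_ge \<mu> 1 (\<lambda>y. b (w n (t, y))) x"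
              unfolding \<mu>_def by (rule nonlocal_ge_cong[OF \<alpha>(1) c(1) bw _ sl]) (simp add: uz)
            also have "\<bar>\<dots>\<bar> \<le> c n * (2 * P * K1)"
              unfolding \<mu>_def K1_def
              by (rule nonlocal_ge_bound[OF \<alpha>(1) c(1) bw]) (rule P(2), rule order_trans[OF w(2)], simp)
            finally have 1: "\<bar>nonlocal_ge \<mu> 1 (\<lambda>y. b (u n (t, y))) x\<bar> \<le> c n * (2 * P * K1)" .
            have 2: "\<bar>sgn_part s (u n (t, x) - s * k)\<bar> \<le> 1" using s by (auto simp: sgn_part_def)
            have 3: "\<bar>\<phi> (t, x)\<bar> \<le> B" using \<phi>(2,3) by simp
            have 4: "0 \<le> c n * (2 * P * K1)" using c(1) P(1) K1 by simp
            have "\<bar>nonlocal_ge \<mu> 1 (\<lambda>y. b (u n (t, y))) x * sgn_part s (u n (t, x) - s * k) * \<phi> (t, x)\<bar>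
                \<le> (c n * (2 * P * K1)) * 1 * B"
              unfolding abs_mult by (intro mult_mono 1 2 3 mult_nonneg_nonneg 4) (use B in auto)
            then show "\<bar>case z of (t, x) \<Rightarrow> nonlocal_ge \<mu> 1 (\<lambda>y. b (u n (t, y))) x *
              sgn_part s (u n (t, x) - s * k) * \<phi> (t, x)\<bar> \<le> c n * (2 * P * K1) * B * indicator Q z"
              using z by (simp add: tx)
          qed
        qed
        show "0 \<le> c n * (2 * P * K1) * B" using c(1) P(1) K1 B by simp
      qed
      then show ?thesis by (simp add: mult_ac)
    qed
    moreover have "A2 \<le> c n * (2 * P * (B * K2) * measure lborel K)"
    proof -
      have "\<bar>A2\<bar> \<le> (2 * P * (c n * (B * K2))) * measure lborel K"
        unfolding A2_def
      proof (rule abs_integral_lebesgue_on_le[OF Sm Km Kb])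
        show "AE z in lborel. z \<in> S \<longrightarrow> \<bar>case z of (t, x) \<Rightarrow> part s (b (u n (t, x)) - b (s * k)) *
            nonlocal_lt \<mu> 1 (\<lambda>y. \<phi> (t, y)) x\<bar> \<le> 2 * P * (c n * (B * K2)) * indicator K z"
          using uw
        proof eventually_elim
          case (elim z)
          show ?case
          proof
            assume z: "z \<in> S"
            obtain t x where tx: "z = (t, x)" by (cases z)
            have uz: "u n (t, x) = w n (t, x)" using elim z unfolding tx by blast
            show "\<bar>case z of (t, x) \<Rightarrow> part s (b (u n (t, x)) - b (s * k)) * nonlocal_lt \<mu> 1 (\<lambda>y. \<phi> (t, y)) x\<bar>
                \<le> 2 * P * (c n * (B * K2)) * indicator K z"
            proof (cases "z \<in> K")
              case True
              have "\<bar>nonlocal_lt \<mu> 1 (\<lambda>y. \<phi> (t, y)) x\<bar> \<le> c n * (B * K2)"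
                unfolding \<mu>_def K2_def
              proof (rule nonlocal_lt_bound[OF \<alpha> c(1)])
                show "(\<lambda>y. \<phi> (t, y)) \<in> borel_measurable borel"
                  by (intro borel_measurable_continuous_onI continuous_on_compose2[OF smooth_continuous_on[OF test_on_smooth[OF \<phi>(1)], of UNIV]] continuous_intros) auto
                show "\<bar>\<phi> (t, y)\<bar> \<le> B" for y using \<phi>(2,3) by simp
                show "\<bar>\<phi> (t, x + h) + \<phi> (t, x - h) - 2 * \<phi> (t, x)\<bar> \<le> B * (norm h)\<^sup>2" for h
                  using \<phi>(5)[of "(t, x)" "(0, h)"] by simp
              qed
              moreover have "\<bar>part s (b (u n (t, x)) - b (s * k))\<bar> \<le> 2 * P"
              proof -
                have "\<bar>b (u n (t, x))\<bar> \<le> P" unfolding uz by (rule P(2)) (rule order_trans[OF w(2)], simp)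
                moreover have "\<bar>b (s * k)\<bar> \<le> P" by (rule P(2)) (use k s in auto)
                ultimately show ?thesis using s P(1) by (auto simp: part_def)
              qed
              ultimately have "\<bar>part s (b (u n (t, x)) - b (s * k)) * nonlocal_lt \<mu> 1 (\<lambda>y. \<phi> (t, y)) x\<bar> \<le> 2 * P * (c n * (B * K2))"
                unfolding abs_mult using P(1) by (intro mult_mono) auto
              then show ?thesis using True by (simp add: tx)
            next
              case False
              then have x: "R + 1 < norm x" using z by (simp add: K_def S_def tx)
              have out: "\<phi> (t, y) = 0" if "R < norm y" for y
                using \<phi>(4)[of "(t, y)"] norm_snd_le[of y t] that by fastforce
              have "nonlocal_lt \<mu> 1 (\<lambda>y. \<phi> (t, y)) x = 0"
              proof (rule nonlocal_lt_eq_0)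
                fix y :: 'a assume "norm y < 1"
                then have "R < norm (x + y)" using x norm_diff_ineq[of x y] by linarith
                then show "\<phi> (t, x + y) = \<phi> (t, x)" using x by (simp add: out)
              qed
              then show ?thesis using False by (simp add: tx)
            qed
          qed
        qed
        show "0 \<le> 2 * P * (c n * (B * K2))" using c(1) P(1) K2 B by simp
      qed
      then show ?thesis by (simp add: mult_ac)
    qed
    ultimately show "- flux_int (slab T \<Omega>) (\<lambda>r. s *\<^sub>R f (s * r)) (\<lambda>z. s * w n z) (\<lambda>_. k) \<phi> \<le> c n * E"
      unfolding E_def distrib_left by linarith
  qed
qed

end

section \<open>The vanishing nonlocal limit\<close>

lemma Ck_on_Lipschitz_on_ball:
  fixes \<gamma> :: "'a::euclidean_space \<Rightarrow> real"
  assumes "Ck_on 2 UNIV \<gamma>"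
  obtains L where "0 \<le> L" "\<And>x y. norm x \<le> R \<Longrightarrow> norm y \<le> R \<Longrightarrow> \<bar>\<gamma> x - \<gamma> y\<bar> \<le> L * norm (x - y)"
proof -
  obtain D where D: "\<And>x. (\<gamma> has_derivative D x) (at x)" "\<And>v. Ck_on 1 UNIV (\<lambda>x. D x v)"
  proof -
    have "Ck_on (Suc 1) UNIV \<gamma>" using assms by (simp only: numeral_2_eq_2 One_nat_def)
    then obtain D where "\<forall>x. (\<gamma> has_derivative D x) (at x)" "\<forall>v. Ck_on 1 UNIV (\<lambda>x. D x v)"
      unfolding Ck_on_Suc_UNIV by (elim exE conjE) (rule that)
    then have "(\<gamma> has_derivative D x) (at x)" "Ck_on 1 UNIV (\<lambda>x. D x v)" for x v by blast+
    then show thesis by (rule that[of D])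
  qed
  define h where "h x = (\<Sum>i\<in>Basis. norm (D x i))" for x
  have cD: "continuous_on UNIV (\<lambda>x. D x v)" for v using D(2)[of v] by (rule Ck_on_continuous)
  have "continuous_on UNIV h"
    unfolding h_def by (intro continuous_on_sum continuous_on_norm cD)
  then have "bounded (h ` cball 0 R)"
    using continuous_on_subset[of UNIV h "cball 0 R"] by (intro compact_imp_bounded compact_continuous_image compact_cball) auto
  then obtain L where L: "\<And>y. y \<in> h ` cball 0 R \<Longrightarrow> norm y \<le> L" unfolding bounded_iff by blast
  have on: "onorm (D x) \<le> max L 0" if "x \<in> cball 0 R" for x
  proof -
    have "onorm (D x) \<le> h x"
      unfolding h_def by (rule onorm_componentwise[OF has_derivative_bounded_linear[OF D(1)]])
    also have "h x \<le> max L 0" using L[of "h x"] that by auto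
    finally show ?thesis .
  qed
  show thesis
  proof (rule that[of "max L 0"])
    fix x y :: 'a assume "norm x \<le> R" "norm y \<le> R"
    then show "\<bar>\<gamma> x - \<gamma> y\<bar> \<le> max L 0 * norm (x - y)"
      using differentiable_bound[of "cball 0 R" \<gamma> D "max L 0" x y] on has_derivative_at_withinI[OF D(1)] by auto
  qed simp
qed

text \<open>The projection along \<open>\<nu>\<close> ignores multiples of \<open>\<nu>\<close>, so
  the height above the graph grows at unit rate in this direction. In the constant
  \<open>1 + 2 * L\<close> the factor 2 bounds the norm of the projection.\<close>

lemma C2_boundary_Lipschitz_chart:
  fixes \<Omega> :: "'a::euclidean_space set"
  assumes "C2_boundary \<Omega>" "x0 \<in> frontier \<Omega>"
  shows "\<exists>r \<nu> g L. Lipschitz_chart \<Omega> x0 r \<nu> g L"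
proof -
  obtain r \<nu> \<gamma> where r: "0 < r" and \<nu>: "norm \<nu> = 1" and \<gamma>: "Ck_on 2 UNIV (\<gamma> :: 'a \<Rightarrow> real)"
    and \<Omega>: "\<Omega> \<inter> ball x0 r = {x \<in> ball x0 r. \<gamma> (x - (x \<bullet> \<nu>) *\<^sub>R \<nu>) < x \<bullet> \<nu>}"
    using assms unfolding C2_boundary_def by blast
  define \<pi> where "\<pi> x = x - (x \<bullet> \<nu>) *\<^sub>R \<nu>" for x
  define g where "g x = x \<bullet> \<nu> - \<gamma> (\<pi> x)" for x
  have dot: "\<bar>x \<bullet> \<nu>\<bar> \<le> norm x" for x using Cauchy_Schwarz_ineq2[of x \<nu>] \<nu> by simp
  have \<pi>n: "norm (\<pi> x) \<le> 2 * norm x" for x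
    using norm_triangle_ineq4[of x "(x \<bullet> \<nu>) *\<^sub>R \<nu>"] dot[of x] \<nu> by (simp add: \<pi>_def)
  have \<pi>d: "\<pi> x - \<pi> y = \<pi> (x - y)" for x y by (simp add: \<pi>_def inner_diff_left scaleR_diff_left)
  obtain L where L: "0 \<le> L"
    "\<And>x y. norm x \<le> 2 * (norm x0 + r) \<Longrightarrow> norm y \<le> 2 * (norm x0 + r) \<Longrightarrow> \<bar>\<gamma> x - \<gamma> y\<bar> \<le> L * norm (x - y)"
    using Ck_on_Lipschitz_on_ball[OF \<gamma>] by blast
  have "Lipschitz_chart \<Omega> x0 r \<nu> g (1 + 2 * L)"
  proof unfold_locales
    show "continuous_on UNIV g"
      unfolding g_def \<pi>_def by (intro continuous_intros continuous_on_compose2[OF Ck_on_continuous[OF \<gamma>]]) auto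
    show "1 \<le> 1 + 2 * L" using L(1) by simp
    show "g (x + s *\<^sub>R \<nu>) = g x + s" for x s
    proof -
      have "\<nu> \<bullet> \<nu> = 1" using \<nu> by (simp add: dot_square_norm)
      then have "(x + s *\<^sub>R \<nu>) \<bullet> \<nu> = x \<bullet> \<nu> + s" by (simp add: inner_add_left)
      then show ?thesis by (simp add: g_def \<pi>_def scaleR_add_left)
    qed
    show "\<Omega> \<inter> ball x0 r = {x \<in> ball x0 r. 0 < g x}" unfolding \<Omega> g_def \<pi>_def by auto
    fix x y assume xy: "x \<in> ball x0 r" "y \<in> ball x0 r"
    have n: "norm (\<pi> z) \<le> 2 * (norm x0 + r)" if "z \<in> ball x0 r" for z
      using \<pi>n[of z] norm_triangle_sub[of z x0] that by (simp add: dist_norm norm_minus_commute)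
    have "\<bar>g x - g y\<bar> \<le> \<bar>(x - y) \<bullet> \<nu>\<bar> + \<bar>\<gamma> (\<pi> x) - \<gamma> (\<pi> y)\<bar>"
      unfolding g_def inner_diff_left by linarith
    also have "\<dots> \<le> norm (x - y) + L * norm (\<pi> (x - y))"
      using dot[of "x - y"] L(2)[OF n[OF xy(1)] n[OF xy(2)]] by (simp add: \<pi>d)
    also have "\<dots> \<le> norm (x - y) + L * (2 * norm (x - y))"
      using mult_left_mono[OF \<pi>n L(1)] by simp
    finally show "\<bar>g x - g y\<bar> \<le> (1 + 2 * L) * norm (x - y)" by (simp add: algebra_simps)
  qed (use r \<nu> in auto)
  then show ?thesis by blast
qed

text \<open>Inside \<open>S\<close> the set where a continuous function exceeds an essential bound
  is open and null, hence empty; the closure follows by continuity. It turns the essential bound of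
  the boundary datum into a pointwise one.\<close>

lemma continuous_AE_bound:
  fixes g :: "'e::euclidean_space \<Rightarrow> real"
  assumes g: "continuous_on (closure S) g" and S: "open S" and C: "AE x in lebesgue_on (closure S). norm (g x) \<le> C"
    and x: "x \<in> closure S"
  shows "\<bar>g x\<bar> \<le> C"
proof -
  have "\<bar>g y\<bar> \<le> C" if y: "y \<in> S" for y
  proof (rule ccontr)
    assume gy: "\<not> \<bar>g y\<bar> \<le> C"
    define U where "U = S \<inter> (\<lambda>y. \<bar>g y\<bar>) -` {C<..}"
    have "continuous_on S (\<lambda>y. \<bar>g y\<bar>)" using continuous_on_subset[OF g closure_subset] by (intro continuous_intros)
    then have "open U" unfolding U_def by (rule continuous_open_preimage[OF _ S]) simp
    moreover have "y \<in> U" using y gy by (simp add: U_def)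
    ultimately obtain e where e: "0 < e" "ball y e \<subseteq> U" unfolding open_contains_ball by blast
    have "AE x in lebesgue. x \<in> closure S \<longrightarrow> norm (g x) \<le> C"
      using C AE_restrict_space_iff[of "closure S" lebesgue] by simp
    then have "AE x in lebesgue. x \<notin> U"
      by eventually_elim (use closure_subset[of S] in \<open>auto simp: U_def\<close>)
    then have "negligible U"
      using completion.null_sets_iff_AE[of U lborel] by (simp add: negligible_iff_null_sets)
    then have "negligible (ball y e)" using e(2) by (rule negligible_subset)
    then show False using e(1) content_ball_pos[of e y] by (simp add: negligible_iff_measure)
  qed
  then show ?thesis using continuous_on_closure_norm_le[OF g _ x, of C] by simp
qed

lemma Lp_spaceI_bounded:
  assumes S: "S \<in> sets borel" "bounded S" and g: "g \<in> borel_measurable (lebesgue_on S)" and p: "0 \<le> p"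
    and C: "AE x in lborel. x \<in> S \<longrightarrow> \<bar>g x\<bar> \<le> C"
  shows "g \<in> Lp_space p S"
proof -
  have "S \<in> lmeasurable" using S by (intro bounded_set_imp_lmeasurable) auto
  then interpret finite_measure "lebesgue_on S" by (rule finite_measure_lebesgue_on)
  have AE: "AE x in lebesgue_on S. norm (\<bar>g x\<bar> powr p) \<le> C powr p"
  proof -
    have "AE x in lborel. x \<in> S \<longrightarrow> norm (\<bar>g x\<bar> powr p) \<le> C powr p"
      using C by eventually_elim (use p in \<open>auto intro: powr_mono2\<close>)
    then show ?thesis using AE_restrict_space_iff[of S lebesgue] S by (simp add: AE_completion_iff)
  qed
  have "integrable (lebesgue_on S) (\<lambda>x. \<bar>g x\<bar> powr p)"
    by (rule integrable_const_bound[OF AE]) (use g in measurable)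
  then show ?thesis unfolding Lp_space_def using g by simp
qed

text \<open>Interpolation with the uniform bound: the p-th power of |h| is at most C^(p-1) times
  |h|, so L^1 convergence suffices.\<close>

lemma Lp_norm_tendsto_0:
  fixes g h :: "nat \<Rightarrow> 'e::euclidean_space \<Rightarrow> real"
  assumes S: "S \<in> sets borel" "bounded S" and h: "\<And>n. h n \<in> borel_measurable borel" "\<And>n x. \<bar>h n x\<bar> \<le> C"
    and g: "\<And>n. AE x in lborel. x \<in> S \<longrightarrow> g n x = h n x" and p: "1 \<le> p"
    and lim: "(\<lambda>n. LINT x|lborel. indicator S x * \<bar>h n x\<bar>) \<longlonglongrightarrow> 0"
  shows "(\<lambda>n. Lp_norm p S (g n)) \<longlonglongrightarrow> 0"
proof -
  note [measurable] = S(1) h(1)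
  have C: "0 \<le> C" using order_trans[OF abs_ge_zero h(2)] .
  have i: "integrable lborel (\<lambda>x. indicator S x * \<bar>h n x\<bar>)" for n
    by (rule integrable_bounded_support[OF _ S(2), where B=C]) (use h(2) C in \<open>auto split: split_indicator\<close>)
  have ip: "integrable lborel (\<lambda>x. indicator S x * (\<bar>h n x\<bar> powr p))" for n
    by (rule integrable_bounded_support[OF _ S(2), where B="C powr p"])
      (use h(2) p in \<open>auto intro!: powr_mono2 split: split_indicator\<close>)
  have eq: "(LINT x|lebesgue_on S. \<bar>g n x\<bar> powr p) = (LINT x|lborel. indicator S x * (\<bar>h n x\<bar> powr p))" for n
  proof (rule integral_lebesgue_on_eq[OF S(1)])
    show "AE x in lborel. x \<in> S \<longrightarrow> \<bar>g n x\<bar> powr p = \<bar>h n x\<bar> powr p"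
      using g[of n] by eventually_elim simp
  qed measurable
  have le: "(LINT x|lborel. indicator S x * (\<bar>h n x\<bar> powr p)) \<le> C powr (p - 1) * (LINT x|lborel. indicator S x * \<bar>h n x\<bar>)" for n
  proof -
    have "(LINT x|lborel. indicator S x * (\<bar>h n x\<bar> powr p)) \<le> (LINT x|lborel. C powr (p - 1) * (indicator S x * \<bar>h n x\<bar>))"
    proof (rule integral_mono[OF ip integrable_mult_right[OF i]])
      fix x
      have "\<bar>h n x\<bar> powr p = \<bar>h n x\<bar> powr (p - 1) * \<bar>h n x\<bar>"
        using powr_add[of "\<bar>h n x\<bar>" "p - 1" 1] by simp
      also have "\<dots> \<le> C powr (p - 1) * \<bar>h n x\<bar>"
        using h(2)[of n x] p by (intro mult_right_mono powr_mono2) auto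
      finally show "indicator S x * (\<bar>h n x\<bar> powr p) \<le> C powr (p - 1) * (indicator S x * \<bar>h n x\<bar>)"
        by (simp split: split_indicator)
    qed
    then show ?thesis by simp
  qed
  have 0: "0 \<le> (LINT x|lborel. indicator S x * (\<bar>h n x\<bar> powr p))" for n
    by (intro Bochner_Integration.integral_nonneg) simp
  have "(\<lambda>n. LINT x|lborel. indicator S x * (\<bar>h n x\<bar> powr p)) \<longlonglongrightarrow> 0"
    by (rule tendsto_sandwich[OF _ _ tendsto_const, of _ _ _ "\<lambda>n. C powr (p - 1) * (LINT x|lborel. indicator S x * \<bar>h n x\<bar>)"])
      (use tendsto_mult_right_zero[OF lim, of "C powr (p - 1)"] le 0 in auto)
  then show ?thesis unfolding Lp_norm_def eq
    by (rule tendsto_zero_powrI[OF _ tendsto_const]) (use 0 p in auto)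
qed

theorem proposition2p10:
  fixes T \<alpha> p :: real
    and \<Omega> :: "'a::euclidean_space set"
    and f :: "real \<Rightarrow> 'a"
    and b :: "real \<Rightarrow> real"
    and uc ubar :: "real \<times> 'a \<Rightarrow> real"
    and u0 :: "'a \<Rightarrow> real"
    and un :: "nat \<Rightarrow> real \<times> 'a \<Rightarrow> real"
    and u :: "real \<times> 'a \<Rightarrow> real"
  assumes "T > 0"
    and "open \<Omega>" and "bounded \<Omega>" and "C2_boundary \<Omega>"
    and "W1inf_loc f"
    and "W1inf_loc b" and "mono b" and "\<exists>b'. weak_deriv b b' \<and> BV_loc b'"
    and "Ck_on 2 ({0<..<T} \<times> (- \<Omega>)) uc" and "Linf_on ({0<..<T} \<times> (- \<Omega>)) uc"
    and "Ck_on 2 ({0..T} \<times> UNIV) ubar" and "Linf_on ({0..T} \<times> UNIV) ubar"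
    and "\<forall>q\<in>{0<..<T} \<times> (- \<Omega>). ubar q = uc q"
    and "Linf_on \<Omega> u0"
    and "0 < \<alpha>" and "\<alpha> < 2"
    and "\<And>n. n \<ge> 1 \<Longrightarrow>
           nonlocal_entropy_solution T \<Omega> f b
             (scale_measure (ennreal (1 / real n)) (frac_measure \<alpha>)) uc ubar u0 (un n)"
    and "local_entropy_solution T \<Omega> f uc ubar u0 u"
    and "p \<ge> 1"
  shows "(\<forall>n\<ge>1. un n \<in> Lp_space p ({0<..<T} \<times> \<Omega>)) \<and> u \<in> Lp_space p ({0<..<T} \<times> \<Omega>) \<and>
         (\<lambda>n. Lp_norm p ({0<..<T} \<times> \<Omega>) (\<lambda>q. un n q - u q)) \<longlonglongrightarrow> 0"
proof -
  define Q where "Q = {0<..<T} \<times> \<Omega>"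
  note T = assms(1) and \<Omega> = assms(2,3) and sol = assms(17) and solu = assms(18) and p = assms(19)
  have Q: "Q \<in> sets borel" "bounded Q"
    unfolding Q_def using \<Omega> by (auto intro!: borel_Times bounded_Times bounded_subset[OF bounded_closed_interval[of 0 T]])
  have AEQ: "(AE z in lebesgue_on Q. P z) \<longleftrightarrow> (AE z in lborel. z \<in> Q \<longrightarrow> P z)" for P
    using AE_restrict_space_iff[of Q lebesgue] Q by (simp add: AE_completion_iff)
  have f: "continuous_on UNIV f" and b: "continuous_on UNIV b"
    using assms(5,6) by (simp_all add: W1inf_loc_def)
  have cl: "closure ({0<..<T} \<times> (UNIV :: 'a set)) = {0..T} \<times> UNIV" using T by (simp add: closure_Times)
  have ubarc: "continuous_on ({0..T} \<times> UNIV) ubar" using assms(11) by (rule Ck_on_continuous)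
  obtain C1 where "AE z in lebesgue_on ({0..T} \<times> UNIV). norm (ubar z) \<le> C1"
    using assms(12) unfolding Linf_on_def by blast
  then have C1: "\<bar>ubar z\<bar> \<le> C1" if "z \<in> {0..T} \<times> UNIV" for z
    using continuous_AE_bound[of "{0<..<T} \<times> UNIV" ubar C1 z] ubarc that unfolding cl by (simp add: open_Times)
  obtain C0 where C0: "AE x in lebesgue_on \<Omega>. norm (u0 x) \<le> C0" and u0m: "u0 \<in> borel_measurable (lebesgue_on \<Omega>)"
    using assms(14) unfolding Linf_on_def by blast
  \<comment> \<open>The common bound of the initial and boundary data, which
    \<open>maximum_principle\<close> passes on to every \<open>un\<close>.\<close>
  define M where "M = max 0 (max C0 C1)"
  have "AE x in lebesgue_on \<Omega>. \<bar>u0 x\<bar> \<le> M" using C0 by eventually_elim (auto simp: M_def)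
  moreover have "\<Omega> \<in> sets borel" "0 \<le> M" using \<Omega> by (auto simp: M_def)
  ultimately obtain v0 where v0: "v0 \<in> borel_measurable borel" "\<And>x. \<bar>v0 x\<bar> \<le> M" "AE x in lborel. x \<in> \<Omega> \<longrightarrow> u0 x = v0 x"
    using lebesgue_on_borel_representative[OF _ u0m] by blast
  have ubarM: "\<bar>ubar z\<bar> \<le> M" if "z \<in> {0..T} \<times> UNIV" for z using C1[OF that] by (simp add: M_def)
  have ucb: "uc z = ubar z" if "z \<in> {0<..<T} \<times> (- \<Omega>)" for z using assms(13) that by (metis (no_types))
  interpret dirichlet_data T \<alpha> M \<Omega> f b uc ubar u0 v0
    by unfold_locales (fact T \<Omega> f b assms(7,15,16) ubarc ubarM ucb v0)+
  obtain Cu where Cu: "AE z in lebesgue_on Q. norm (u z) \<le> Cu" and um: "u \<in> borel_measurable (lebesgue_on Q)"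
    using solu unfolding local_entropy_solution_def Linf_on_def Q_def by blast
  \<comment> \<open>\<open>u\<close> enters with an essential bound of its own; the maximum with
    \<open>M\<close> is a common bound for \<open>u\<close>, all \<open>un\<close> and the
    data.\<close>
  define C where "C = max M Cu"
  have uC: "AE z in lebesgue_on Q. \<bar>u z\<bar> \<le> C" using Cu by eventually_elim (auto simp: C_def)
  have MC: "M \<le> C" by (simp add: C_def)
  obtain w where w: "extended w" "\<And>z. \<bar>w z\<bar> \<le> C" "AE z in lborel. z \<in> Q \<longrightarrow> u z = w z"
    using ex_extended[OF um[unfolded Q_def] uC[unfolded Q_def] MC, folded Q_def] by blast
  have unm: "un n \<in> borel_measurable (lebesgue_on Q)" if "n \<ge> 1" for n
  proof -
    have "un n \<in> borel_measurable (lebesgue_on ({0<..<T} \<times> UNIV))"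
      using sol[OF that] unfolding nonlocal_entropy_solution_def Linf_on_def by blast
    then show ?thesis by (rule measurable_restrict_mono) (auto simp: Q_def)
  qed
  have unM: "AE z in lborel. z \<in> Q \<longrightarrow> \<bar>un n z\<bar> \<le> M" if "n \<ge> 1" for n
    unfolding Q_def by (rule maximum_principle[OF sol[OF that]]) simp
  \<comment> \<open>The hypothesis concerns indices from 1 on. Shifting by one gives a sequence over
    all naturals, with coefficients \<open>1 / real (Suc n)\<close>; \<open>LIMSEQ_imp_Suc\<close>
    undoes the shift at the end.\<close>
  have "\<exists>w'. extended w' \<and> (\<forall>z. \<bar>w' z\<bar> \<le> C) \<and> (AE z in lborel. z \<in> Q \<longrightarrow> un (Suc n) z = w' z)" for n
  proof -
    have "AE z in lebesgue_on Q. \<bar>un (Suc n) z\<bar> \<le> C"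
      unfolding AEQ using unM[of "Suc n"] MC by (auto elim!: eventually_mono)
    moreover have "un (Suc n) \<in> borel_measurable (lebesgue_on Q)" by (rule unm) simp
    ultimately obtain w' where "extended w'" "\<And>z. \<bar>w' z\<bar> \<le> C" "AE z in lborel. z \<in> Q \<longrightarrow> un (Suc n) z = w' z"
      using ex_extended[OF _ _ MC, of "un (Suc n)", folded Q_def] by blast
    then show ?thesis by blast
  qed
  then have "\<exists>W. \<forall>n. extended (W n) \<and> (\<forall>z. \<bar>W n z\<bar> \<le> C) \<and> (AE z in lborel. z \<in> Q \<longrightarrow> un (Suc n) z = W n z)"
    by (intro choice allI)
  then obtain W where "\<forall>n. extended (W n) \<and> (\<forall>z. \<bar>W n z\<bar> \<le> C) \<and> (AE z in lborel. z \<in> Q \<longrightarrow> un (Suc n) z = W n z)" ..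
  then have W: "\<And>n. extended (W n)" "\<And>n z. \<bar>W n z\<bar> \<le> C" "\<And>n. AE z in lborel. z \<in> Q \<longrightarrow> un (Suc n) z = W n z"
    by blast+
  have c: "0 \<le> 1 / real (Suc n)" "(\<lambda>n. 1 / real (Suc n)) \<longlonglongrightarrow> 0" for n
    using LIMSEQ_inverse_real_of_nat by (simp_all add: inverse_eq_divide)
  note subW = nonlocal_solution_asub[of "\<lambda>n. 1 / real (Suc n)" "\<lambda>n. un (Suc n)", OF sol c _ W(1,2) W(3)[unfolded Q_def]]
  note subw = local_solution_asub[OF solu _ w(1,2) w(3)[unfolded Q_def]]
  have lim: "(\<lambda>n. LINT z|lborel. indicator Q z * \<bar>W n z - w z\<bar>) \<longlonglongrightarrow> 0"
    unfolding Q_def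
  proof (rule L1_convergence[OF \<Omega> f _ W(2) _ w(2) _ _ _ _ T bdata_continuous])
    show "asub T \<Omega> f bdata sequentially W" "asub T \<Omega> (\<lambda>s. - f (- s)) (\<lambda>z. - bdata z) sequentially (\<lambda>n z. - W n z)"
      using subW[of 1] subW[of "-1"] by simp_all
    show "asub T \<Omega> f bdata sequentially (\<lambda>_. w)" "asub T \<Omega> (\<lambda>s. - f (- s)) (\<lambda>z. - bdata z) sequentially (\<lambda>_ z. - w z)"
      using subw[of 1 sequentially] subw[of "-1" sequentially] by simp_all
    show "\<bar>bdata z\<bar> \<le> C" if "z \<in> slab T UNIV" for z using bdata_bound[OF that] MC by simp
    show "W n z = w z" if "fst z \<le> 0" for n z
      using W(1)[of n] w(1) that unfolding extended_def by metis
    show "\<exists>r \<nu> g L. Lipschitz_chart \<Omega> x0 r \<nu> g L" if "x0 \<in> frontier \<Omega>" for x0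
      by (rule C2_boundary_Lipschitz_chart[OF assms(4) that])
  qed (use W(1) w(1) in \<open>simp_all add: extended_def\<close>)
  have "(\<lambda>n. Lp_norm p Q (\<lambda>q. un (Suc n) q - u q)) \<longlonglongrightarrow> 0"
  proof (rule Lp_norm_tendsto_0[OF Q _ _ _ p lim])
    show "(\<lambda>z. W n z - w z) \<in> borel_measurable borel" for n
      using W(1)[of n] w(1) unfolding extended_def by (intro borel_measurable_diff) blast+
    show "\<bar>W n z - w z\<bar> \<le> 2 * C" for n z using W(2)[of n z] w(2)[of z] by linarith
    show "AE z in lborel. z \<in> Q \<longrightarrow> un (Suc n) z - u z = W n z - w z" for n
      using W(3)[of n] w(3) by eventually_elim simp
  qed
  then have "(\<lambda>n. Lp_norm p Q (\<lambda>q. un n q - u q)) \<longlonglongrightarrow> 0" by (rule LIMSEQ_imp_Suc)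
  moreover have "un n \<in> Lp_space p Q" if "n \<ge> 1" for n
    using p by (intro Lp_spaceI_bounded[OF Q unm[OF that] _ unM[OF that]]) simp
  moreover have "u \<in> Lp_space p Q"
    using p uC unfolding AEQ by (intro Lp_spaceI_bounded[OF Q um]) auto
  ultimately show ?thesis unfolding Q_def by blast
qed

end
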